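(* Let $t\in\mathbb C$. The objects $\underline W^{\mathrm{old}}_{\mu,V}$, for $n\ge0$, $\mu\vdash n$ and $V$ a finite-dimensional complex representation of the centralizer of an element of cycle type $\mu$ in $S_n$, generate the entire center $\mathcal Z(\underline{\mathrm{Rep}}\,S_t)$ as a Karoubian tensor category.
   Context: $\mathcal Z(\mathcal C)$ is the monoidal (Drinfeld) center (objects $(Y,c)$ with half-braiding $c_V\colon Y\otimes V\to V\otimes Y$). "Generate as a Karoubian tensor category" means that the smallest full subcategory containing the given objects and closed under isomorphisms, duals, tensor products, finite direct sums and direct summands is everything. Deligne's category. $\underline{\mathrm{Rep}}\,S_t$ is the Karoubian envelope (finite direct sums and idempotent completion) of the $\mathbb C$-linear symmetric monoidal category with objects $X^{\otimes k}$, $k\ge0$, with $\mathrm{Hom}(X^{\otimes k},X^{\otimes l})$ having basis the set partitions of $\{1,\dots,k\}$ (upper points) and $\{1',\dots,l'\}$ (lower points) together; composition is stacking of diagrams with a factor $t^\ell$ for the $\ell$ components containing only middle points; tensor product is juxtaposition. For a partition $\pi$ define recursively $x_\pi=\pi-\sum_\tau x_\tau$, the sum over all partitions $\tau$ strictly coarser than $\pi$. Regard $g\in S_n$ as the partition with blocks $\{i,g(i)'\}$; then $g\mapsto x_g$ is an embedding $\mathbb CS_n\hookrightarrow\mathrm{End}(X^{\otimes n})$ (non-unital, with $x_{1}$ an idempotent), and it extends to $\mathbb CS_n\otimes M_k(\mathbb C)\hookrightarrow\mathrm{End}((X^{\otimes n})^{\oplus k})$. The objects $\underline W^{\mathrm{old}}_{\mu,V}$.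 Let $\sigma\in S_n$ have cycle type $\mu\vdash n$, $Z$ its centralizer in $S_n$, $\rho\colon Z\to GL_k(\mathbb C)$ the $k$-dimensional representation $V$, and $e_V=\frac1{|Z|}\sum_{g\in Z}g\otimes\rho(g)\in\mathbb CZ\otimes M_k(\mathbb C)$, an idempotent whose image is isomorphic to $V$. Let $e=\frac1{|Z|}\sum_{g\in Z}x_g\otimes\rho(g)$ be its image in $\mathrm{End}((X^{\otimes n})^{\oplus k})$ and $\mathrm{Im}\,e=((X^{\otimes n})^{\oplus k},e)$ in $\underline{\mathrm{Rep}}\,S_t$. Put $$d_1^{\sigma,V}=(e\otimes\mathrm{id}_X)\Big(1_{n+1}+\sum_{i=1}^n\big(E^i_{\sigma(i)}-E^i_i\big)\Big)\in\mathrm{End}(\mathrm{Im}\,e\otimes X),$$ where $1_{n+1}$ is the identity of $X^{\otimes(n+1)}$ and $E^i_j$ (acting diagonally on the $k$ copies) is the partition of $\{1,\dots,n+1,1',\dots,(n+1)'\}$ obtained from the blocks $\{l,l'\}$, $1\le l\le n$, by adding the point $n+1$ to the block containing $i$ and the point $(n+1)'$ to the block containing $j'$. With $\Psi$ the symmetric braiding of $\underline{\mathrm{Rep}}\,S_t$, the morphism $c_X=\Psi_{\mathrm{Im}\,e,X}\circ d_1^{\sigma,V}\colon\mathrm{Im}\,e\otimes X\to X\otimes\mathrm{Im}\,e$ extends uniquely to a half-braiding $c$ on $\mathrm{Im}\,e$, and $\underline W^{\mathrm{old}}_{\mu,V}:=(\mathrm{Im}\,e,c)$; its isomorphism class depends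 only on $\mu$ and the isomorphism class of $V$. *)

theory Defs
  imports
    "HOL-Library.Disjoint_Sets"
    "HOL-Library.FuncSet"
    "HOL-Library.Poly_Mapping"
    "HOL-Library.Multiset"
    "HOL-Combinatorics.Permutations"
    "HOL-Combinatorics.Orbits"
    "Jordan_Normal_Form.Matrix"
begin

section \<open>Strict monoidal categories\<close>

text \<open>
  Morphisms need not determine their source and target; they are always used relative to
  a hom-set. All monoidal categories below are strict (associators and unitors are identities).
\<close>

record ('o, 'm) smcat =
  objects :: "'o set"
  homs :: "'o \<Rightarrow> 'o \<Rightarrow> 'm set"
  ident :: "'o \<Rightarrow> 'm"
  comp_mor :: "'m \<Rightarrow> 'm \<Rightarrow> 'm"  \<comment> \<open>\<open>comp_mor C g f\<close> is \<open>g\<close> after \<open>f\<close>\<close>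
  tens_obj :: "'o \<Rightarrow> 'o \<Rightarrow> 'o"
  tens_mor :: "'m \<Rightarrow> 'm \<Rightarrow> 'm"
  unit_obj :: "'o"

record ('o, 'm) additive_smcat = "('o, 'm) smcat" +
  plus_mor :: "'m \<Rightarrow> 'm \<Rightarrow> 'm"
  zero_mor :: "'o \<Rightarrow> 'o \<Rightarrow> 'm"

definition is_iso :: "('o, 'm, 'z) smcat_scheme \<Rightarrow> 'o \<Rightarrow> 'o \<Rightarrow> 'm \<Rightarrow> bool" where
  "is_iso C A B f \<longleftrightarrow> f \<in> homs C A B \<and>
     (\<exists>g \<in> homs C B A. comp_mor C g f = ident C A \<and> comp_mor C f g = ident C B)"

definition isomorphic_objects :: "('o, 'm, 'z) smcat_scheme \<Rightarrow> 'o \<Rightarrow> 'o \<Rightarrow> bool" where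
  "isomorphic_objects C A B \<longleftrightarrow> (\<exists>f. is_iso C A B f)"

definition is_dual :: "('o, 'm, 'z) smcat_scheme \<Rightarrow> 'o \<Rightarrow> 'o \<Rightarrow> bool" where
  "is_dual C Y Y' \<longleftrightarrow>
     (\<exists>ev \<in> homs C (tens_obj C Y' Y) (unit_obj C).
      \<exists>coev \<in> homs C (unit_obj C) (tens_obj C Y Y').
        comp_mor C (tens_mor C (ident C Y) ev) (tens_mor C coev (ident C Y)) = ident C Y \<and>
        comp_mor C (tens_mor C ev (ident C Y')) (tens_mor C (ident C Y') coev) = ident C Y')"

definition is_zero_object :: "('o, 'm, 'z) additive_smcat_scheme \<Rightarrow> 'o \<Rightarrow> bool" where
  "is_zero_object C A \<longleftrightarrow> ident C A = zero_mor C A A"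

definition is_direct_sum :: "('o, 'm, 'z) additive_smcat_scheme \<Rightarrow> 'o \<Rightarrow> 'o \<Rightarrow> 'o \<Rightarrow> bool" where
  "is_direct_sum C A B S \<longleftrightarrow>
     (\<exists>i \<in> homs C A S. \<exists>j \<in> homs C B S. \<exists>p \<in> homs C S A. \<exists>q \<in> homs C S B.
        comp_mor C p i = ident C A \<and> comp_mor C q j = ident C B \<and>
        comp_mor C p j = zero_mor C B A \<and> comp_mor C q i = zero_mor C A B \<and>
        plus_mor C (comp_mor C i p) (comp_mor C j q) = ident C S)"

text \<open>
  A full subcategory is given by its objects. The rule \<open>dual\<close> uses duals on one side;
  in a braided category, such as a Drinfeld center, left and right duals agree.
\<close>

inductive_set karoubian_tensor_closure ::
  "('o, 'm, 'z) additive_smcat_scheme \<Rightarrow> 'o set \<Rightarrow> 'o set"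
  for C :: "('o, 'm, 'z) additive_smcat_scheme" and G :: "'o set" where
  gen: "A \<in> G \<Longrightarrow> A \<in> karoubian_tensor_closure C G"
| iso: "\<lbrakk>A \<in> karoubian_tensor_closure C G; B \<in> objects C; isomorphic_objects C A B\<rbrakk>
    \<Longrightarrow> B \<in> karoubian_tensor_closure C G"
| dual: "\<lbrakk>A \<in> karoubian_tensor_closure C G; B \<in> objects C; is_dual C A B\<rbrakk>
    \<Longrightarrow> B \<in> karoubian_tensor_closure C G"
| tensor: "\<lbrakk>A \<in> karoubian_tensor_closure C G; B \<in> karoubian_tensor_closure C G\<rbrakk>
    \<Longrightarrow> tens_obj C A B \<in> karoubian_tensor_closure C G"
| zero: "\<lbrakk>Z \<in> objects C; is_zero_object C Z\<rbrakk> \<Longrightarrow> Z \<in> karoubian_tensor_closure C G"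
| direct_sum: "\<lbrakk>A \<in> karoubian_tensor_closure C G; B \<in> karoubian_tensor_closure C G;
      S \<in> objects C; is_direct_sum C A B S\<rbrakk> \<Longrightarrow> S \<in> karoubian_tensor_closure C G"
| summand: "\<lbrakk>S \<in> karoubian_tensor_closure C G; A \<in> objects C; B \<in> objects C;
      is_direct_sum C A B S\<rbrakk> \<Longrightarrow> A \<in> karoubian_tensor_closure C G"

definition generates_as_karoubian_tensor_category ::
  "('o, 'm, 'z) additive_smcat_scheme \<Rightarrow> 'o set \<Rightarrow> bool" where
  "generates_as_karoubian_tensor_category C G \<longleftrightarrow>
     G \<subseteq> objects C \<and> karoubian_tensor_closure C G = objects C"

section \<open>The Drinfeld center\<close>

text \<open>
  Half-braidings are extensional, so that they are equal as soon as they agree on objects.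
  The condition at the unit object follows from invertibility and the tensor condition.
\<close>

definition half_braiding :: "('o, 'm, 'z) smcat_scheme \<Rightarrow> 'o \<Rightarrow> ('o \<Rightarrow> 'm) \<Rightarrow> bool" where
  "half_braiding C Y c \<longleftrightarrow>
     c \<in> extensional (objects C) \<and>
     (\<forall>V \<in> objects C. is_iso C (tens_obj C Y V) (tens_obj C V Y) (c V)) \<and>
     (\<forall>V \<in> objects C. \<forall>W \<in> objects C. \<forall>f \<in> homs C V W.
        comp_mor C (tens_mor C f (ident C Y)) (c V) =
        comp_mor C (c W) (tens_mor C (ident C Y) f)) \<and>
     (\<forall>V \<in> objects C. \<forall>W \<in> objects C.
        c (tens_obj C V W) =
        comp_mor C (tens_mor C (ident C V) (c W)) (tens_mor C (c V) (ident C W)))"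

definition drinfeld_center ::
  "('o, 'm) additive_smcat \<Rightarrow> ('o \<times> ('o \<Rightarrow> 'm), 'm) additive_smcat" where
  "drinfeld_center C = \<lparr>
     objects = {(Y, c). Y \<in> objects C \<and> half_braiding C Y c},
     homs = (\<lambda>(Y, c) (Y', c'). {f \<in> homs C Y Y'. \<forall>V \<in> objects C.
        comp_mor C (tens_mor C (ident C V) f) (c V) =
        comp_mor C (c' V) (tens_mor C f (ident C V))}),
     ident = (\<lambda>(Y, c). ident C Y),
     comp_mor = comp_mor C,
     tens_obj = (\<lambda>(Y, c) (Z, d). (tens_obj C Y Z,
        \<lambda>V \<in> objects C. comp_mor C (tens_mor C (c V) (ident C Z)) (tens_mor C (ident C Y) (d V)))),
     tens_mor = tens_mor C,
     unit_obj = (unit_obj C, \<lambda>V \<in> objects C. ident C V),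
     plus_mor = plus_mor C,
     zero_mor = (\<lambda>(Y, c) (Y', c'). zero_mor C Y Y')\<rparr>"

section \<open>Additive and Karoubi envelopes\<close>

text \<open>
  Objects of the additive envelope are finite lists of objects, read as formal direct sums;
  morphisms are matrices, with rows indexed by the target and columns by the source.
  Tensor products of lists are ordered lexicographically, which keeps the tensor product strict.
  Addition of morphisms in the input category is that of the type \<^typ>\<open>'m\<close>.
\<close>

definition additive_envelope ::
  "('o, 'm::ab_group_add) smcat \<Rightarrow> ('o list, 'm mat) additive_smcat" where
  "additive_envelope C = \<lparr>
     objects = lists (objects C),
     homs = (\<lambda>As Bs. {M \<in> carrier_mat (length Bs) (length As).
        \<forall>i < length Bs. \<forall>j < length As. M $$ (i, j) \<in> homs C (As ! j) (Bs ! i)}),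
     ident = (\<lambda>As. mat (length As) (length As)
        (\<lambda>(i, j). if i = j then ident C (As ! i) else 0)),
     comp_mor = (\<lambda>G F. mat (dim_row G) (dim_col F)
        (\<lambda>(i, j). \<Sum>k < dim_col G. comp_mor C (G $$ (i, k)) (F $$ (k, j)))),
     tens_obj = (\<lambda>As Bs. concat (map (\<lambda>A. map (tens_obj C A) Bs) As)),
     tens_mor = (\<lambda>F G. mat (dim_row F * dim_row G) (dim_col F * dim_col G)
        (\<lambda>(i, j). tens_mor C (F $$ (i div dim_row G, j div dim_col G))
                             (G $$ (i mod dim_row G, j mod dim_col G)))),
     unit_obj = [unit_obj C],
     plus_mor = (+),
     zero_mor = (\<lambda>As Bs. 0\<^sub>m (length Bs) (length As))\<rparr>"

definition karoubi_envelope ::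
  "('o, 'm) additive_smcat \<Rightarrow> ('o \<times> 'm, 'm) additive_smcat" where
  "karoubi_envelope C = \<lparr>
     objects = {(A, e). A \<in> objects C \<and> e \<in> homs C A A \<and> comp_mor C e e = e},
     homs = (\<lambda>(A, e) (B, f). {m \<in> homs C A B. comp_mor C f (comp_mor C m e) = m}),
     ident = (\<lambda>(A, e). e),
     comp_mor = comp_mor C,
     tens_obj = (\<lambda>(A, e) (B, f). (tens_obj C A B, tens_mor C e f)),
     tens_mor = tens_mor C,
     unit_obj = (unit_obj C, ident C (unit_obj C)),
     plus_mor = plus_mor C,
     zero_mor = (\<lambda>(A, e) (B, f). zero_mor C A B)\<rparr>"

section \<open>Deligne's category\<close>

text \<open>
  The upper points of a diagram are \<open>Inl 1, \<dots>, Inl k\<close> and the lower points (written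
  \<open>1', \<dots>, l'\<close> on paper) are \<open>Inr 1, \<dots>, Inr l\<close>. A diagram is the set of its blocks,
  and a morphism is a formal linear combination of diagrams.
\<close>

type_synonym diagram = "(nat + nat) set set"
type_synonym pmor = "diagram \<Rightarrow>\<^sub>0 complex"

definition points :: "nat \<Rightarrow> nat \<Rightarrow> (nat + nat) set" where
  "points k l = Inl ` {1..k} \<union> Inr ` {1..l}"

definition diagrams :: "nat \<Rightarrow> nat \<Rightarrow> diagram set" where
  "diagrams k l = {p. partition_on (points k l) p}"

abbreviation of_diagram :: "diagram \<Rightarrow> pmor" where
  "of_diagram p \<equiv> Poly_Mapping.single p 1"

definition scale :: "complex \<Rightarrow> pmor \<Rightarrow> pmor" where
  "scale a f = Poly_Mapping.map ((*) a) f"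

definition id_diagram :: "nat \<Rightarrow> diagram" where
  "id_diagram n = (\<lambda>i. {Inl i, Inr i}) ` {1..n}"

text \<open>
  Stacking \<open>p\<close> on top of \<open>q\<close> gives three layers of points: \<open>Inl i\<close> (upper points of \<open>p\<close>),
  \<open>Inr (Inl j)\<close> (middle points: lower points of \<open>p\<close> and upper points of \<open>q\<close>) and
  \<open>Inr (Inr m)\<close> (lower points of \<open>q\<close>).
\<close>

definition stack_blocks :: "diagram \<Rightarrow> diagram \<Rightarrow> (nat + (nat + nat)) set set" where
  "stack_blocks q p = (image (map_sum id Inl)) ` p \<union> (image Inr) ` q"

definition stack_components :: "diagram \<Rightarrow> diagram \<Rightarrow> (nat + (nat + nat)) set set" where
  "stack_components q p =
     \<Union> (stack_blocks q p) // {(x, y). \<exists>b \<in> stack_blocks q p. x \<in> b \<and> y \<in> b}\<^sup>+"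

definition diagram_comp :: "diagram \<Rightarrow> diagram \<Rightarrow> diagram" where
  "diagram_comp q p = (\<lambda>c. map_sum id Inr -` c) ` stack_components q p - {{}}"

definition middle_components :: "diagram \<Rightarrow> diagram \<Rightarrow> nat" where
  "middle_components q p = card {c \<in> stack_components q p. map_sum id Inr -` c = {}}"

definition pmor_comp :: "complex \<Rightarrow> pmor \<Rightarrow> pmor \<Rightarrow> pmor" where
  "pmor_comp t g f = (\<Sum>q \<in> Poly_Mapping.keys g. \<Sum>p \<in> Poly_Mapping.keys f.
     Poly_Mapping.single (diagram_comp q p)
       (Poly_Mapping.lookup g q * Poly_Mapping.lookup f p * t ^ middle_components q p))"

definition diagram_tensor :: "diagram \<Rightarrow> diagram \<Rightarrow> diagram" where
  "diagram_tensor p q = p \<union>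
     image (map_sum ((+) (card (Inl -` \<Union> p))) ((+) (card (Inr -` \<Union> p)))) ` q"

definition pmor_tensor :: "pmor \<Rightarrow> pmor \<Rightarrow> pmor" where
  "pmor_tensor f g = (\<Sum>p \<in> Poly_Mapping.keys f. \<Sum>q \<in> Poly_Mapping.keys g.
     Poly_Mapping.single (diagram_tensor p q)
       (Poly_Mapping.lookup f p * Poly_Mapping.lookup g q))"

text \<open>The natural number \<open>k\<close> stands for the object \<open>X\<^sup>\<otimes>\<^sup>k\<close>.\<close>

definition partition_category :: "complex \<Rightarrow> (nat, pmor) smcat" where
  "partition_category t = \<lparr>
     objects = UNIV,
     homs = (\<lambda>k l. {f. Poly_Mapping.keys f \<subseteq> diagrams k l}),
     ident = (\<lambda>n. of_diagram (id_diagram n)),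
     comp_mor = pmor_comp t,
     tens_obj = (+),
     tens_mor = pmor_tensor,
     unit_obj = 0\<rparr>"

definition Rep_S_add :: "complex \<Rightarrow> (nat list, pmor mat) additive_smcat" where
  "Rep_S_add t = additive_envelope (partition_category t)"

definition Rep_S :: "complex \<Rightarrow> (nat list \<times> pmor mat, pmor mat) additive_smcat" where
  "Rep_S t = karoubi_envelope (Rep_S_add t)"

definition X_obj :: "nat list \<times> pmor mat" where
  "X_obj = ([1], mat 1 1 (\<lambda>_. of_diagram (id_diagram 1)))"

definition swap_diagram :: "nat \<Rightarrow> nat \<Rightarrow> diagram" where
  "swap_diagram k l =
     (\<lambda>i. {Inl i, Inr (l + i)}) ` {1..k} \<union> (\<lambda>j. {Inl (k + j), Inr j}) ` {1..l}"

text \<open>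
  The summand \<open>A \<otimes> B\<close> of the source with \<open>A = As ! a\<close>, \<open>B = Bs ! b\<close> has index
  \<open>a * length Bs + b\<close>; the summand \<open>B \<otimes> A\<close> of the target has index \<open>b * length As + a\<close>.
\<close>

definition swap_mat :: "nat list \<Rightarrow> nat list \<Rightarrow> pmor mat" where
  "swap_mat As Bs = mat (length Bs * length As) (length As * length Bs)
     (\<lambda>(r, s). let a = s div length Bs; b = s mod length Bs in
        if r = b * length As + a then of_diagram (swap_diagram (As ! a) (Bs ! b)) else 0)"

definition symmetric_braiding ::
  "complex \<Rightarrow> nat list \<times> pmor mat \<Rightarrow> nat list \<times> pmor mat \<Rightarrow> pmor mat" where
  "symmetric_braiding t = (\<lambda>(As, e) (Bs, f).
     comp_mor (Rep_S_add t) (swap_mat As Bs) (tens_mor (Rep_S_add t) e f))"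

section \<open>The elements \<open>x\<^sub>\<pi>\<close>\<close>

lemma refines_card_less:
  assumes "refines A P Q" "P \<noteq> Q" "finite P"
  shows "card Q < card P"
proof -
  have P: "partition_on A P" and Q: "partition_on A Q"
    and sub: "\<forall>X\<in>P. \<exists>Y\<in>Q. X \<subseteq> Y"
    using assms(1) by (auto simp: refines_def)
  obtain h where h: "\<And>X. X \<in> P \<Longrightarrow> h X \<in> Q \<and> X \<subseteq> h X"
    using sub by metis
  have uniq: "Y = Y'" if "Y \<in> Q" "Y' \<in> Q" "z \<in> Y" "z \<in> Y'" for Y Y' z
    using Q that by (auto simp: partition_on_def disjoint_def)
  have surj: "h ` P = Q"
  proof
    show "h ` P \<subseteq> Q" using h by auto
    show "Q \<subseteq> h ` P"
    proof
      fix Y assume Y: "Y \<in> Q"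
      then obtain y where y: "y \<in> Y" using Q by (fastforce simp: partition_on_def)
      then have "y \<in> \<Union> P" using P Q Y by (auto simp: partition_on_def)
      then obtain X where X: "X \<in> P" "y \<in> X" by auto
      then have "h X = Y" using uniq h Y y by blast
      then show "Y \<in> h ` P" using X by auto
    qed
  qed
  have "card Q \<noteq> card P"
  proof
    assume "card Q = card P"
    then have inj: "inj_on h P" using surj assms(3) by (simp add: eq_card_imp_inj_on)
    have "h X = X" if X: "X \<in> P" for X
    proof
      show "X \<subseteq> h X" using h X by auto
      show "h X \<subseteq> X"
      proof
        fix z assume z: "z \<in> h X"
        then have "z \<in> \<Union> P" using h X P Q by (auto simp: partition_on_def)
        then obtain X' where X': "X' \<in> P" "z \<in> X'" by auto
        then have "h X' = h X" using uniq h X z by blast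
        then show "z \<in> X" using inj X X' by (auto dest: inj_onD)
      qed
    qed
    then show False using surj assms(2) by simp
  qed
  moreover have "card Q \<le> card P" using surj assms(3) card_image_le by blast
  ultimately show ?thesis by simp
qed

text \<open>The finiteness condition only serves termination; it holds for all diagrams in use.\<close>

function x_diagram :: "diagram \<Rightarrow> pmor" where
  "x_diagram p = of_diagram p -
     (\<Sum>q \<in> {q. finite p \<and> refines (\<Union> p) p q \<and> q \<noteq> p}. x_diagram q)"
  by auto
termination
  by (relation "measure card") (auto intro: refines_card_less)

declare x_diagram.simps [simp del]

section \<open>The objects \<open>W\<^sup>o\<^sup>l\<^sup>d\<close>\<close>

definition cycle_type :: "nat \<Rightarrow> (nat \<Rightarrow> nat) \<Rightarrow> nat multiset" where
  "cycle_type n \<sigma> = image_mset card (mset_set (orbit \<sigma> ` {1..n}))"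

definition is_number_partition :: "nat \<Rightarrow> nat multiset \<Rightarrow> bool" where
  "is_number_partition n \<mu> \<longleftrightarrow> 0 \<notin># \<mu> \<and> sum_mset \<mu> = n"

definition perm_centralizer :: "nat \<Rightarrow> (nat \<Rightarrow> nat) \<Rightarrow> (nat \<Rightarrow> nat) set" where
  "perm_centralizer n \<sigma> = {g. g permutes {1..n} \<and> g \<circ> \<sigma> = \<sigma> \<circ> g}"

text \<open>Invertibility of the matrices is automatic.\<close>

definition matrix_representation ::
  "(nat \<Rightarrow> nat) set \<Rightarrow> nat \<Rightarrow> ((nat \<Rightarrow> nat) \<Rightarrow> complex mat) \<Rightarrow> bool" where
  "matrix_representation Z k \<rho> \<longleftrightarrow>
     (\<forall>g \<in> Z. \<rho> g \<in> carrier_mat k k) \<and> \<rho> id = 1\<^sub>m k \<and>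
     (\<forall>g \<in> Z. \<forall>h \<in> Z. \<rho> (g \<circ> h) = \<rho> g * \<rho> h)"

definition perm_diagram :: "nat \<Rightarrow> (nat \<Rightarrow> nat) \<Rightarrow> diagram" where
  "perm_diagram n g = (\<lambda>i. {Inl i, Inr (g i)}) ` {1..n}"

definition old_idem ::
  "nat \<Rightarrow> (nat \<Rightarrow> nat) \<Rightarrow> nat \<Rightarrow> ((nat \<Rightarrow> nat) \<Rightarrow> complex mat) \<Rightarrow> pmor mat" where
  "old_idem n \<sigma> k \<rho> = (let Z = perm_centralizer n \<sigma> in
     mat k k (\<lambda>(a, b). scale (1 / of_nat (card Z))
       (\<Sum>g \<in> Z. scale (\<rho> g $$ (a, b)) (x_diagram (perm_diagram n g)))))"

definition old_image ::
  "nat \<Rightarrow> (nat \<Rightarrow> nat) \<Rightarrow> nat \<Rightarrow> ((nat \<Rightarrow> nat) \<Rightarrow> complex mat) \<Rightarrow> nat list \<times> pmor mat" where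
  "old_image n \<sigma> k \<rho> = (replicate k n, old_idem n \<sigma> k \<rho>)"

definition E_diagram :: "nat \<Rightarrow> nat \<Rightarrow> nat \<Rightarrow> diagram" where
  "E_diagram n i j = (\<lambda>l. {Inl l, Inr l} \<union> (if l = i then {Inl (n + 1)} else {})
     \<union> (if l = j then {Inr (n + 1)} else {})) ` {1..n}"

text \<open>The diagonal matrix below acts on \<open>(X\<^sup>\<otimes>\<^sup>n)\<^sup>\<oplus>\<^sup>k \<otimes> X = (X\<^sup>\<otimes>\<^sup>(\<^sup>n\<^sup>+\<^sup>1\<^sup>))\<^sup>\<oplus>\<^sup>k\<close>.\<close>

definition old_d1 ::
  "complex \<Rightarrow> nat \<Rightarrow> (nat \<Rightarrow> nat) \<Rightarrow> nat \<Rightarrow> ((nat \<Rightarrow> nat) \<Rightarrow> complex mat) \<Rightarrow> pmor mat" where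
  "old_d1 t n \<sigma> k \<rho> =
     comp_mor (Rep_S t) (tens_mor (Rep_S t) (old_idem n \<sigma> k \<rho>) (ident (Rep_S t) X_obj))
       (mat k k (\<lambda>(a, b). if a = b then
          of_diagram (id_diagram (n + 1)) +
          (\<Sum>i \<in> {1..n}. of_diagram (E_diagram n i (\<sigma> i)) - of_diagram (E_diagram n i i))
        else 0))"

definition old_half_braiding ::
  "complex \<Rightarrow> nat \<Rightarrow> (nat \<Rightarrow> nat) \<Rightarrow> nat \<Rightarrow> ((nat \<Rightarrow> nat) \<Rightarrow> complex mat) \<Rightarrow>
   nat list \<times> pmor mat \<Rightarrow> pmor mat" where
  "old_half_braiding t n \<sigma> k \<rho> = (THE c.
     half_braiding (Rep_S t) (old_image n \<sigma> k \<rho>) c \<and>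
     c X_obj = comp_mor (Rep_S t) (symmetric_braiding t (old_image n \<sigma> k \<rho>) X_obj)
                 (old_d1 t n \<sigma> k \<rho>))"

definition W_old ::
  "complex \<Rightarrow> nat \<Rightarrow> (nat \<Rightarrow> nat) \<Rightarrow> nat \<Rightarrow> ((nat \<Rightarrow> nat) \<Rightarrow> complex mat) \<Rightarrow>
   (nat list \<times> pmor mat) \<times> (nat list \<times> pmor mat \<Rightarrow> pmor mat)" where
  "W_old t n \<sigma> k \<rho> = (old_image n \<sigma> k \<rho>, old_half_braiding t n \<sigma> k \<rho>)"

end

theory Submission
  imports Defs
begin

text \<open>
  A morphism of Deligne's category is encoded faithfully by its kernel, a function on pairs of tuples of
  natural numbers that is invariant under all permutations of the natural numbers: a partition diagram becomes
  the condition that the entries agree along its blocks. Composition of kernels is integration with respect to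
  the finitely additive measure on the natural numbers in which points have mass 1 and the total mass is \<open>t\<close>.

  A half-braiding on \<open>Y\<close> is determined by its value at \<open>X\<close>, that is, by kernels \<open>pp i j\<close> on \<open>Y\<close> that are commuting
  idempotents and behave like the projections to the part of \<open>Y\<close> whose grading by a permutation sends \<open>i\<close> to \<open>j\<close>.
  Too many of these would be linearly independent if the gradings moved unboundedly many points, so they move at
  most \<open>r\<close> points for some \<open>r\<close>. For a derangement \<open>\<sigma>\<close> of \<open>r\<close> points, the part of \<open>Y\<close> graded by
  permutations of type \<open>\<sigma>\<close> is split off by an idempotent obtained by averaging, and it is a retract of the tensor
  product of the generator for \<open>\<sigma>\<close> and the trivial representation with \<open>Y\<close> made trivially braided. Trivially
  braided objects are summands of sums of tensor powers of the generator for \<open>n = 1\<close>. After all derangements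
  of \<open>r\<close> points have been split off, the gradings of the remaining summand move fewer than \<open>r\<close> points.
\<close>

section \<open>Finitely supported functions\<close>

text \<open>Every idempotent and every retraction is therefore written down as an explicit kernel.
  The denominators in these formulas are orders of centralizers; they count finite sets of distinct
  tuples, each of mass 1, so no condition on \<open>t\<close> arises.

  With only finitely many values, diagrams with more blocks than values could not be told apart.
  Infinitely many values make the encoding faithful for every diagram, at the price of an integral
  that is only finitely additive. Linearity and exchange of integrals hold for functions that are
  invariant under all permutations fixing some finite set, and this condition has to be carried
  through every computation.

  A projection that prescribes the grading at \<open>r\<close> points says nothing about the other
  points. It determines the grading only when no further point can be moved. Hence the bound on the
  number of moved points has to be known before anything is split off, and the induction descends
  from that bound.\<close>

class pset =
  fixes act :: "(nat \<Rightarrow> nat) \<Rightarrow> 'a \<Rightarrow> 'a" and atoms :: "'a \<Rightarrow> nat set"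
  assumes act_id: "act id x = x"
    and act_act: "act f (act g x) = act (f \<circ> g) x"
    and finite_atoms: "finite (atoms x)"
    and act_cong: "(\<And>y. y \<in> atoms x \<Longrightarrow> f y = g y) \<Longrightarrow> act f x = act g x"
begin

lemma act_fix: "(\<And>y. y \<in> atoms x \<Longrightarrow> f y = y) \<Longrightarrow> act f x = x"
  using act_cong[of x f id] by (simp add: act_id)

end

instantiation nat :: pset
begin
definition act_nat :: "(nat \<Rightarrow> nat) \<Rightarrow> nat \<Rightarrow> nat" where [simp]: "act_nat f x = f x"
definition atoms_nat :: "nat \<Rightarrow> nat set" where [simp]: "atoms_nat x = {x}"
instance by standard auto
end

instantiation prod :: (pset, pset) pset
begin
definition act_prod :: "(nat \<Rightarrow> nat) \<Rightarrow> 'a \<times> 'b \<Rightarrow> 'a \<times> 'b"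
  where "act_prod f x = (act f (fst x), act f (snd x))"
definition atoms_prod :: "'a \<times> 'b \<Rightarrow> nat set"
  where "atoms_prod x = atoms (fst x) \<union> atoms (snd x)"
instance
  by standard (auto simp: act_prod_def atoms_prod_def act_id act_act finite_atoms intro: act_cong)
end

lemma act_Pair [simp]: "act f (a, b) = (act f a, act f b)"
  by (simp add: act_prod_def)
lemma fst_act [simp]: "fst (act f x) = act f (fst x)"
  by (simp add: act_prod_def)
lemma snd_act [simp]: "snd (act f x) = act f (snd x)"
  by (simp add: act_prod_def)

instantiation list :: (pset) pset
begin
definition act_list :: "(nat \<Rightarrow> nat) \<Rightarrow> 'a list \<Rightarrow> 'a list" where [simp]: "act_list f x = map (act f) x"
definition atoms_list :: "'a list \<Rightarrow> nat set" where [simp]: "atoms_list x = (\<Union>y\<in>set x. atoms y)"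
instance
  by standard (auto simp: act_act finite_atoms intro!: map_idI act_id act_cong)
end

lemma act_list_nat: "act f (xs :: nat list) = map f xs"
  by (simp add: act_nat_def[abs_def])

text \<open>\<open>Pt s xs\<close> is a point with coordinates \<open>xs\<close> in the \<open>s\<close>-th summand of a formal direct sum.\<close>

datatype pt = Pt nat "nat list"

instantiation pt :: pset
begin
fun act_pt :: "(nat \<Rightarrow> nat) \<Rightarrow> pt \<Rightarrow> pt" where "act_pt f (Pt s xs) = Pt s (map f xs)"
fun atoms_pt :: "pt \<Rightarrow> nat set" where "atoms_pt (Pt s xs) = set xs"
instance
proof
  fix x :: pt and f g
  show "act id x = x" by (cases x) auto
  show "act f (act g x) = act (f \<circ> g) x" by (cases x) auto
  show "finite (atoms x)" by (cases x) auto
  show "(\<And>y. y \<in> atoms x \<Longrightarrow> f y = g y) \<Longrightarrow> act f x = act g x" by (cases x) auto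
qed
end

lemma act_inv_act: "bij \<pi> \<Longrightarrow> act (inv_into UNIV \<pi>) (act \<pi> x) = x"
  by (simp add: act_act bij_is_inj act_id)

lemma act_act_inv: "bij \<pi> \<Longrightarrow> act \<pi> (act (inv_into UNIV \<pi>) x) = x"
  by (simp add: act_act bij_is_surj surj_iff[THEN iffD1] act_id)

lemma act_eq_iff [simp]: "bij \<pi> \<Longrightarrow> act \<pi> x = act \<pi> y \<longleftrightarrow> x = y"
  using act_inv_act by metis

text \<open>Finite support in the sense of nominal sets. This class of functions is closed under the
  operations needed below and is the one on which the integral is linear and iterated integrals may
  be exchanged.\<close>

definition fs :: "('a::pset \<Rightarrow> complex) \<Rightarrow> bool" where
  "fs \<phi> \<longleftrightarrow> (\<exists>F. finite F \<and> (\<forall>\<pi>. bij \<pi> \<and> (\<forall>y\<in>F. \<pi> y = y) \<longrightarrow> (\<forall>x. \<phi> (act \<pi> x) = \<phi> x)))"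

text \<open>The corresponding condition for maps: equivariance for the permutations that fix some
  finite set. Substituting such maps into a finitely supported function keeps it finitely
  supported.\<close>

definition eqm :: "('a::pset \<Rightarrow> 'b::pset) \<Rightarrow> bool" where
  "eqm h \<longleftrightarrow> (\<exists>F. finite F \<and> (\<forall>\<pi>. bij \<pi> \<and> (\<forall>y\<in>F. \<pi> y = y) \<longrightarrow> (\<forall>x. h (act \<pi> x) = act \<pi> (h x))))"

lemma fs_op:
  assumes "fs f" "fs g" shows "fs (\<lambda>x. H (f x) (g x))"
proof -
  obtain F where F: "finite F" "\<And>\<pi> x. bij \<pi> \<Longrightarrow> (\<forall>y\<in>F. \<pi> y = y) \<Longrightarrow> f (act \<pi> x) = f x"
    using assms(1) by (auto simp: fs_def)
  obtain G where G: "finite G" "\<And>\<pi> x. bij \<pi> \<Longrightarrow> (\<forall>y\<in>G. \<pi> y = y) \<Longrightarrow> g (act \<pi> x) = g x"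
    using assms(2) by (auto simp: fs_def)
  show ?thesis
    unfolding fs_def by (intro exI[of _ "F \<union> G"]) (auto simp: F G)
qed

lemma fs_inv: "(\<And>\<pi> x. bij \<pi> \<Longrightarrow> \<phi> (act \<pi> x) = \<phi> x) \<Longrightarrow> fs \<phi>"
  unfolding fs_def by (intro exI[of _ "{}"]) auto

lemma fs_const: "fs (\<lambda>x. c)"
  by (rule fs_inv) simp

lemma fs_add: "fs f \<Longrightarrow> fs g \<Longrightarrow> fs (\<lambda>x. f x + g x)"
  by (rule fs_op)
lemma fs_diff: "fs f \<Longrightarrow> fs g \<Longrightarrow> fs (\<lambda>x. f x - g x)"
  by (rule fs_op)
lemma fs_mult: "fs f \<Longrightarrow> fs g \<Longrightarrow> fs (\<lambda>x. f x * g x)"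
  by (rule fs_op)

lemma fs_sum: "(\<And>i. i \<in> I \<Longrightarrow> fs (\<phi> i)) \<Longrightarrow> fs (\<lambda>x. \<Sum>i\<in>I. \<phi> i x)"
proof (induction I rule: infinite_finite_induct)
  case (insert x F)
  then show ?case by (simp add: fs_add)
qed (auto intro: fs_const)

lemma fs_eqm: "fs K \<Longrightarrow> eqm f \<Longrightarrow> fs (\<lambda>x. K (f x))"
proof -
  assume "fs K" "eqm f"
  then obtain F G where F: "finite F" "\<And>\<pi> x. bij \<pi> \<Longrightarrow> (\<forall>y\<in>F. \<pi> y = y) \<Longrightarrow> K (act \<pi> x) = K x"
    and G: "finite G" "\<And>\<pi> x. bij \<pi> \<Longrightarrow> (\<forall>y\<in>G. \<pi> y = y) \<Longrightarrow> f (act \<pi> x) = act \<pi> (f x)"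
    by (auto simp: fs_def eqm_def)
  show ?thesis
    unfolding fs_def by (intro exI[of _ "F \<union> G"]) (auto simp: F G)
qed

lemma eqm_const: "eqm (\<lambda>x. c)"
  unfolding eqm_def by (intro exI[of _ "atoms c"]) (auto simp: finite_atoms act_fix)
lemma eqm_id: "eqm (\<lambda>x. x)"
  unfolding eqm_def by (intro exI[of _ "{}"]) auto

lemma eqm_comp: assumes "\<And>\<pi> x. bij \<pi> \<Longrightarrow> h (act \<pi> x) = act \<pi> (h x)" "eqm f" shows "eqm (\<lambda>x. h (f x))"
  using assms unfolding eqm_def by metis

lemma eqm_o: "eqm f \<Longrightarrow> eqm g \<Longrightarrow> eqm (\<lambda>x. f (g x))"
proof -
  assume "eqm f" "eqm g"
  then obtain F G where F: "finite F" "\<And>\<pi> x. bij \<pi> \<Longrightarrow> (\<forall>y\<in>F. \<pi> y = y) \<Longrightarrow> f (act \<pi> x) = act \<pi> (f x)"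
    and G: "finite G" "\<And>\<pi> x. bij \<pi> \<Longrightarrow> (\<forall>y\<in>G. \<pi> y = y) \<Longrightarrow> g (act \<pi> x) = act \<pi> (g x)"
    by (auto simp: eqm_def)
  show ?thesis
    unfolding eqm_def by (intro exI[of _ "F \<union> G"]) (auto simp: F G)
qed

lemma eqm_fst: "eqm f \<Longrightarrow> eqm (\<lambda>x. fst (f x))"
  by (rule eqm_comp) auto
lemma eqm_snd: "eqm f \<Longrightarrow> eqm (\<lambda>x. snd (f x))"
  by (rule eqm_comp) auto

lemma eqm_Pair: "eqm f \<Longrightarrow> eqm g \<Longrightarrow> eqm (\<lambda>x. (f x, g x))"
proof -
  assume "eqm f" "eqm g"
  then obtain F G where F: "finite F" "\<And>\<pi> x. bij \<pi> \<Longrightarrow> (\<forall>y\<in>F. \<pi> y = y) \<Longrightarrow> f (act \<pi> x) = act \<pi> (f x)"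
    and G: "finite G" "\<And>\<pi> x. bij \<pi> \<Longrightarrow> (\<forall>y\<in>G. \<pi> y = y) \<Longrightarrow> g (act \<pi> x) = act \<pi> (g x)"
    by (auto simp: eqm_def)
  show ?thesis
    unfolding eqm_def by (intro exI[of _ "F \<union> G"]) (auto simp: F G)
qed

lemma eqm_op:
  assumes "\<And>\<pi> x y. bij \<pi> \<Longrightarrow> h (act \<pi> x) (act \<pi> y) = act \<pi> (h x y)" "eqm f" "eqm g"
  shows "eqm (\<lambda>x. h (f x) (g x))"
  using eqm_comp[of "case_prod h", OF _ eqm_Pair, OF _ assms(2,3)] assms(1) by auto

lemma eqm_Cons: "eqm f \<Longrightarrow> eqm g \<Longrightarrow> eqm (\<lambda>x. f x # g x)"
  by (rule eqm_op) auto
lemma eqm_append: "eqm f \<Longrightarrow> eqm g \<Longrightarrow> eqm (\<lambda>x. f x @ g x)"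
  by (rule eqm_op) auto
lemma eqm_Pt: "eqm f \<Longrightarrow> eqm (\<lambda>x. Pt s (f x))"
  by (rule eqm_comp) (auto simp: act_list_nat)

lemma fs_of_bool_eq: "eqm f \<Longrightarrow> eqm g \<Longrightarrow> fs (\<lambda>x. of_bool (f x = g x))"
proof -
  assume "eqm f" "eqm g"
  from fs_eqm[OF fs_inv eqm_Pair[OF this], of "\<lambda>z. of_bool (fst z = snd z)"] show ?thesis
    by auto
qed

lemma fs_if: "fs f \<Longrightarrow> fs g \<Longrightarrow> eqm h \<Longrightarrow> eqm k \<Longrightarrow> fs (\<lambda>x. if h x = k x then f x else g x)"
proof -
  assume "fs f" "fs g" "eqm h" "eqm k"
  then have "fs (\<lambda>x. of_bool (h x = k x) * f x + (1 - of_bool (h x = k x)) * g x)"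
    by (intro fs_add fs_mult fs_diff fs_const fs_of_bool_eq)
  moreover have "(\<lambda>x. of_bool (h x = k x) * f x + (1 - of_bool (h x = k x)) * g x) =
    (\<lambda>x. if h x = k x then f x else g x)" by auto
  ultimately show ?thesis by simp
qed

abbreviation fs2 :: "('a::pset \<Rightarrow> 'b::pset \<Rightarrow> complex) \<Rightarrow> bool" where
  "fs2 K \<equiv> fs (\<lambda>x. K (fst x) (snd x))"

lemma fs2D: "fs2 K \<Longrightarrow> eqm f \<Longrightarrow> eqm g \<Longrightarrow> fs (\<lambda>x. K (f x) (g x))"
  using fs_eqm[OF _ eqm_Pair, of "\<lambda>x. K (fst x) (snd x)" f g] by simp

lemmas fs_basic_intros = fs_const fs_add fs_diff fs_mult fs_sum fs_of_bool_eq fs_if eqm_fst eqm_snd eqm_Cons eqm_append eqm_Pt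
  eqm_id eqm_const

definition pts :: "nat list \<Rightarrow> pt set" where
  "pts As = {Pt s xs | s xs. s < length As \<and> length xs = As ! s}"

lemma Pt_in_pts [simp]: "Pt s xs \<in> pts As \<longleftrightarrow> s < length As \<and> length xs = As ! s"
  by (auto simp: pts_def)

lemma act_in_pts [simp]: "act \<pi> a \<in> pts As \<longleftrightarrow> a \<in> pts As"
  by (cases a) auto

section \<open>Integration with total mass t\<close>

locale deligne = fixes t :: complex
begin

text \<open>The integral of an almost constant function on the natural numbers, which have total mass \<open>t\<close>.\<close>

definition int1 :: "(nat \<Rightarrow> complex) \<Rightarrow> complex" where
  "int1 \<phi> = (let c = (THE c. finite {x. \<phi> x \<noteq> c}) in (\<Sum>x\<in>{x. \<phi> x \<noteq> c}. \<phi> x - c) + t * c)"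

text \<open>Two cofinite sets of natural numbers meet, so the generic value is unique. Any
  exceptional set may be used, because a point added to \<open>F\<close> takes mass 1 away from the
  complement, whose mass is \<open>t - of_nat (card F)\<close>.\<close>

lemma int1_eq:
  assumes "finite F" "\<And>x. x \<notin> F \<Longrightarrow> \<phi> x = c"
  shows "int1 \<phi> = sum \<phi> F + (t - of_nat (card F)) * c"
proof -
  have sub: "{x. \<phi> x \<noteq> c} \<subseteq> F" using assms(2) by auto
  then have fin: "finite {x. \<phi> x \<noteq> c}" using assms(1) finite_subset by blast
  have "(THE c. finite {x. \<phi> x \<noteq> c}) = c"
  proof (rule the_equality, rule fin)
    fix d assume "finite {x. \<phi> x \<noteq> d}"
    with fin have "finite ({x. \<phi> x \<noteq> c} \<union> {x. \<phi> x \<noteq> d})" by simp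
    then have "{x. \<phi> x \<noteq> c} \<union> {x. \<phi> x \<noteq> d} \<noteq> UNIV" by (metis infinite_UNIV_nat)
    then show "d = c" by auto
  qed
  then have "int1 \<phi> = (\<Sum>x\<in>{x. \<phi> x \<noteq> c}. \<phi> x - c) + t * c" by (simp add: int1_def)
  also have "(\<Sum>x\<in>{x. \<phi> x \<noteq> c}. \<phi> x - c) = (\<Sum>x\<in>F. \<phi> x - c)"
    by (rule sum.mono_neutral_left) (use assms sub in auto)
  finally show ?thesis by (simp add: sum_subtractf algebra_simps)
qed

lemma ex_bij_swap: "\<exists>\<pi>::nat\<Rightarrow>nat. bij \<pi> \<and> \<pi> x = y \<and> (\<forall>z. z \<noteq> x \<and> z \<noteq> y \<longrightarrow> \<pi> z = z)"
  by (intro exI[of _ "transpose x y"]) auto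

text \<open>The transposition of \<open>x\<close> and \<open>y\<close> fixes \<open>F\<close>
  pointwise.\<close>

lemma fs_nat_const:
  assumes "\<And>\<pi> x. bij \<pi> \<Longrightarrow> (\<forall>y\<in>F. \<pi> y = y) \<Longrightarrow> \<phi> (\<pi> x) = \<phi> (x::nat)" "x \<notin> F" "y \<notin> F"
  shows "\<phi> x = \<phi> y"
proof -
  obtain \<pi> :: "nat \<Rightarrow> nat" where "bij \<pi>" "\<pi> x = y" "\<forall>z. z \<noteq> x \<and> z \<noteq> y \<longrightarrow> \<pi> z = z"
    using ex_bij_swap by blast
  then show ?thesis using assms(1)[of \<pi> x] assms(2,3) by metis
qed

lemma int1_fs:
  assumes "finite F" "\<And>\<pi> x. bij \<pi> \<Longrightarrow> (\<forall>y\<in>F. \<pi> y = y) \<Longrightarrow> \<phi> (\<pi> x) = \<phi> x" "p \<notin> F"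
  shows "int1 \<phi> = sum \<phi> F + (t - of_nat (card F)) * \<phi> p"
proof (rule int1_eq[OF assms(1)])
  fix x assume "x \<notin> F"
  then show "\<phi> x = \<phi> p"
    by (intro fs_nat_const[of F \<phi> x p] assms(2,3)) auto
qed

lemma fs_ev:
  assumes "fs (\<phi>::nat\<Rightarrow>complex)"
  obtains F c where "finite F" "\<And>x. x \<notin> F \<Longrightarrow> \<phi> x = c"
proof -
  obtain F where F: "finite F" "\<And>\<pi> x. bij \<pi> \<Longrightarrow> (\<forall>y\<in>F. \<pi> y = y) \<Longrightarrow> \<phi> (\<pi> x) = \<phi> x"
    using assms by (auto simp: fs_def)
  obtain p where "p \<notin> F" using F(1) ex_new_if_finite infinite_UNIV_nat by blast
  then have "\<phi> x = \<phi> p" if "x \<notin> F" for x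
    by (intro fs_nat_const[of F \<phi> x p] F(2)) (use that in auto)
  then show thesis using F(1) that by blast
qed

lemma int1_add: "fs f \<Longrightarrow> fs g \<Longrightarrow> int1 (\<lambda>x. f x + g x) = int1 f + int1 g"
proof -
  assume "fs f" "fs g"
  then obtain F c G d where F: "finite F" "\<And>x. x \<notin> F \<Longrightarrow> f x = c" and G: "finite G" "\<And>x. x \<notin> G \<Longrightarrow> g x = d"
    by (metis fs_ev)
  have *: "int1 f = sum f (F \<union> G) + (t - of_nat (card (F \<union> G))) * c"
    "int1 g = sum g (F \<union> G) + (t - of_nat (card (F \<union> G))) * d"
    "int1 (\<lambda>x. f x + g x) = (\<Sum>x\<in>F \<union> G. f x + g x) + (t - of_nat (card (F \<union> G))) * (c + d)"
    by (rule int1_eq; use F G in auto)+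
  show ?thesis unfolding * by (simp add: sum.distrib algebra_simps)
qed

lemma int1_cmult: "fs f \<Longrightarrow> int1 (\<lambda>x. a * f x) = a * int1 f"
proof -
  assume "fs f"
  then obtain F c where F: "finite F" "\<And>x. x \<notin> F \<Longrightarrow> f x = c"
    by (metis fs_ev)
  have *: "int1 f = sum f F + (t - of_nat (card F)) * c"
    "int1 (\<lambda>x. a * f x) = (\<Sum>x\<in>F. a * f x) + (t - of_nat (card F)) * (a * c)"
    by (rule int1_eq; use F in auto)+
  show ?thesis unfolding * by (simp add: sum_distrib_left algebra_simps)
qed

lemma int1_bij: assumes "bij \<pi>" shows "int1 (\<lambda>x. \<phi> (\<pi> x)) = int1 \<phi>"
proof -
  have e: "{x. \<phi> (\<pi> x) \<noteq> c} = \<pi> -` {x. \<phi> x \<noteq> c}" for c by auto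
  have f: "finite (\<pi> -` S) = finite S" for S
    using assms finite_vimage_iff by blast
  have "(\<Sum>x\<in>\<pi> -` S. \<phi> (\<pi> x) - c) = (\<Sum>x\<in>S. \<phi> x - c)" for S c
    by (rule sum.reindex_bij_betw[of \<pi>])
       (use assms in \<open>auto simp: bij_betw_def inj_on_def bij_def surj_image_vimage_eq\<close>)
  then show ?thesis by (simp only: int1_def e f)
qed

lemma int1_delta: "int1 (\<lambda>x. if x = y then f x else 0) = f y"
  by (subst int1_eq[of "{y}" _ 0]) auto

text \<open>Invariance under the permutations fixing \<open>F\<close> reduces both iterated
  integrals to the values on \<open>F\<close>, at one generic point \<open>p\<close>, and at the
  pairs \<open>(p, p)\<close> and \<open>(p, q)\<close>. The two resulting expressions differ only
  in \<open>\<phi> p q\<close> against \<open>\<phi> q p\<close>, and the transposition of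
  \<open>p\<close> and \<open>q\<close> identifies these. The weight \<open>?w - 1\<close> is the
  mass of the complement of \<open>insert p F\<close>.\<close>

lemma int1_swap:
  assumes "fs2 \<phi>"
  shows "int1 (\<lambda>x. int1 (\<lambda>y. \<phi> x y)) = int1 (\<lambda>y. int1 (\<lambda>x. \<phi> x y))"
proof -
  obtain F where F: "finite F" "\<And>\<pi> x y. bij \<pi> \<Longrightarrow> (\<forall>y\<in>F. \<pi> y = y) \<Longrightarrow> \<phi> (\<pi> x) (\<pi> y) = \<phi> x y"
    using assms by (auto simp: fs_def)
  obtain p where p: "p \<notin> F" using F(1) ex_new_if_finite infinite_UNIV_nat by blast
  obtain q where q: "q \<notin> insert p F" using F(1) ex_new_if_finite infinite_UNIV_nat by (metis finite_insert)
  let ?w = "t - of_nat (card F)"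
  have main: "int1 (\<lambda>x. int1 (\<lambda>y. \<psi> x y)) =
    (\<Sum>x\<in>F. (\<Sum>y\<in>F. \<psi> x y) + ?w * \<psi> x p) + ?w * ((\<Sum>y\<in>F. \<psi> p y) + \<psi> p p + (?w - 1) * \<psi> p q)"
    if \<psi>: "\<And>\<pi> x y. bij \<pi> \<Longrightarrow> (\<forall>y\<in>F. \<pi> y = y) \<Longrightarrow> \<psi> (\<pi> x) (\<pi> y) = \<psi> x y" for \<psi>
  proof -
    have 1: "int1 (\<lambda>y. \<psi> x y) = (\<Sum>y\<in>F. \<psi> x y) + ?w * \<psi> x p" if "x \<in> F" for x
      by (rule int1_fs[OF F(1) _ p]) (metis \<psi> that)
    have "int1 (\<lambda>y. \<psi> p y) = (\<Sum>y\<in>insert p F. \<psi> p y) + (t - of_nat (card (insert p F))) * \<psi> p q"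
      by (rule int1_fs[OF _ _ q]) (use F(1) in \<open>simp, metis \<psi> insertCI\<close>)
    then have 2: "int1 (\<lambda>y. \<psi> p y) = (\<Sum>y\<in>F. \<psi> p y) + \<psi> p p + (?w - 1) * \<psi> p q"
      using F(1) p by (simp add: algebra_simps)
    have "int1 (\<lambda>x. int1 (\<lambda>y. \<psi> x y)) = (\<Sum>x\<in>F. int1 (\<lambda>y. \<psi> x y)) + ?w * int1 (\<lambda>y. \<psi> p y)"
    proof (rule int1_fs[OF F(1) _ p])
      fix \<pi> :: "nat \<Rightarrow> nat" and x assume \<pi>: "bij \<pi>" "\<forall>y\<in>F. \<pi> y = y"
      show "int1 (\<lambda>y. \<psi> (\<pi> x) y) = int1 (\<lambda>y. \<psi> x y)"
        using int1_bij[OF \<pi>(1), of "\<lambda>y. \<psi> (\<pi> x) y"] \<psi>[OF \<pi>] by simp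
    qed
    then show ?thesis using 1 2 by simp
  qed
  have pq: "\<phi> q p = \<phi> p q"
  proof -
    obtain \<pi> :: "nat \<Rightarrow> nat" where "bij \<pi>" "\<pi> p = q" "\<pi> q = p" "\<forall>y\<in>F. \<pi> y = y"
      using p q by (intro that[of "transpose p q"]) (auto simp: transpose_def)
    then show ?thesis using F(2)[of \<pi> p q] by simp
  qed
  have "int1 (\<lambda>x. int1 (\<lambda>y. \<phi> x y)) = (\<Sum>x\<in>F. (\<Sum>y\<in>F. \<phi> x y) + ?w * \<phi> x p) + ?w * ((\<Sum>y\<in>F. \<phi> p y) + \<phi> p p + (?w - 1) * \<phi> p q)"
    by (rule main) (rule F(2))
  also have "\<dots> = (\<Sum>x\<in>F. (\<Sum>y\<in>F. \<phi> y x) + ?w * \<phi> p x) + ?w * ((\<Sum>y\<in>F. \<phi> y p) + \<phi> p p + (?w - 1) * \<phi> q p)"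
    using pq sum.swap[of \<phi> F F]
    by (simp add: sum.distrib sum_subtractf sum_distrib_left algebra_simps)
  also have "\<dots> = int1 (\<lambda>y. int1 (\<lambda>x. \<phi> x y))"
    by (rule main[symmetric]) (rule F(2))
  finally show ?thesis .
qed

primrec intl :: "nat \<Rightarrow> (nat list \<Rightarrow> complex) \<Rightarrow> complex" where
  "intl 0 \<phi> = \<phi> []"
| "intl (Suc k) \<phi> = int1 (\<lambda>x. intl k (\<lambda>xs. \<phi> (x # xs)))"

lemma intl_cong: "(\<And>xs. length xs = k \<Longrightarrow> \<phi> xs = \<psi> xs) \<Longrightarrow> intl k \<phi> = intl k \<psi>"
proof (induction k arbitrary: \<phi> \<psi>)
  case (Suc k)
  have "intl k (\<lambda>xs. \<phi> (x # xs)) = intl k (\<lambda>xs. \<psi> (x # xs))" for x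
    by (rule Suc(1)) (simp add: Suc(2))
  then show ?case by simp
qed simp

lemma intl_act: "bij \<pi> \<Longrightarrow> intl k (\<lambda>xs. \<phi> (map \<pi> xs)) = intl k \<phi>"
proof (induction k arbitrary: \<phi>)
  case (Suc k)
  show ?case
    using Suc(1)[OF Suc(2), of "\<lambda>xs. \<phi> (\<pi> _ # xs)"]
      int1_bij[OF Suc(2), of "\<lambda>x. intl k (\<lambda>xs. \<phi> (x # xs))"] by simp
qed simp

text \<open>A permutation that fixes the support of \<open>\<phi>\<close> can be absorbed into the
  integration variables by \<open>intl_act\<close>, so integrating variables out creates no new
  support.\<close>

lemma fs_intl: "fs2 \<phi> \<Longrightarrow> fs (\<lambda>x. intl k (\<phi> x))"
proof -
  assume "fs2 \<phi>"
  then obtain F where F: "finite F" "\<And>\<pi> z. bij \<pi> \<Longrightarrow> (\<forall>y\<in>F. \<pi> y = y) \<Longrightarrow> \<phi> (act \<pi> (fst z)) (map \<pi> (snd z)) = \<phi> (fst z) (snd z)"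
    by (auto simp: fs_def act_nat_def[abs_def])
  have "intl k (\<phi> (act \<pi> x)) = intl k (\<phi> x)" if "bij \<pi>" "\<forall>y\<in>F. \<pi> y = y" for \<pi> x
    using intl_act[OF that(1), of k "\<phi> (act \<pi> x)"] F(2)[OF that, of "(x, _)"] by simp
  then show ?thesis using F(1) unfolding fs_def by blast
qed

lemma intl_add: "fs f \<Longrightarrow> fs g \<Longrightarrow> intl k (\<lambda>x. f x + g x) = intl k f + intl k g"
proof (induction k arbitrary: f g)
  case (Suc k)
  have "intl k (\<lambda>xs. f (x # xs) + g (x # xs)) = intl k (\<lambda>xs. f (x # xs)) + intl k (\<lambda>xs. g (x # xs))" for x
    by (intro Suc fs_eqm[OF Suc(2)] fs_eqm[OF Suc(3)] fs_basic_intros)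
  then show ?case
    by (auto intro!: int1_add fs_intl fs_eqm[OF Suc(2)] fs_eqm[OF Suc(3)] fs_basic_intros)
qed simp

lemma intl_cmult: "fs f \<Longrightarrow> intl k (\<lambda>x. a * f x) = a * intl k f"
proof (induction k arbitrary: f)
  case (Suc k)
  have "intl k (\<lambda>xs. a * f (x # xs)) = a * intl k (\<lambda>xs. f (x # xs))" for x
    by (intro Suc fs_eqm[OF Suc(2)] fs_basic_intros)
  then show ?case
    by (auto intro!: int1_cmult fs_intl fs_eqm[OF Suc(2)] fs_basic_intros)
qed simp

lemma int1_0 [simp]: "int1 (\<lambda>x. 0) = 0"
  by (subst int1_eq[of "{}" _ 0]) auto
lemma intl_0 [simp]: "intl k (\<lambda>x. 0) = 0"
  by (induction k) auto

lemma int1_intl_swap: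
  assumes "fs2 \<phi>"
  shows "int1 (\<lambda>x. intl k (\<lambda>ys. \<phi> x ys)) = intl k (\<lambda>ys. int1 (\<lambda>x. \<phi> x ys))"
  using assms
proof (induction k arbitrary: \<phi>)
  case (Suc k)
  have "int1 (\<lambda>x. int1 (\<lambda>y. intl k (\<lambda>ys. \<phi> x (y # ys)))) = int1 (\<lambda>y. int1 (\<lambda>x. intl k (\<lambda>ys. \<phi> x (y # ys))))"
    by (intro int1_swap fs_intl fs2D[OF Suc(2)] fs_basic_intros)
  also have "\<dots> = int1 (\<lambda>y. intl k (\<lambda>ys. int1 (\<lambda>x. \<phi> x (y # ys))))"
    by (intro arg_cong[where f = int1] ext Suc(1) fs2D[OF Suc(2)] fs_basic_intros)
  finally show ?case by simp
qed simp

lemma intl_swap: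
  assumes "fs2 \<phi>"
  shows "intl k (\<lambda>xs. intl l (\<lambda>ys. \<phi> xs ys)) = intl l (\<lambda>ys. intl k (\<lambda>xs. \<phi> xs ys))"
  using assms
proof (induction k arbitrary: \<phi>)
  case (Suc k)
  have "int1 (\<lambda>x. intl k (\<lambda>xs. intl l (\<lambda>ys. \<phi> (x # xs) ys))) = int1 (\<lambda>x. intl l (\<lambda>ys. intl k (\<lambda>xs. \<phi> (x # xs) ys)))"
    by (intro arg_cong[where f = int1] ext Suc(1) fs2D[OF Suc(2)] fs_basic_intros)
  also have "\<dots> = intl l (\<lambda>ys. int1 (\<lambda>x. intl k (\<lambda>xs. \<phi> (x # xs) ys)))"
    by (intro int1_intl_swap fs_intl fs2D[OF Suc(2)] fs_basic_intros)
  finally show ?case by simp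
qed simp

lemma intl_append: "intl (k + l) \<phi> = intl k (\<lambda>xs. intl l (\<lambda>ys. \<phi> (xs @ ys)))"
  by (induction k arbitrary: \<phi>) auto

lemma intl_delta: "intl k (\<lambda>xs. if xs = ys then f xs else 0) = (if length ys = k then f ys else 0)"
proof (induction k arbitrary: f ys)
  case (Suc k)
  show ?case
  proof (cases ys)
    case (Cons z zs)
    have "intl k (\<lambda>xs. if x # xs = ys then f (x # xs) else 0) =
      (if x = z then (if length zs = k then f (z # zs) else 0) else 0)" for x
      using Suc[of zs "\<lambda>xs. f (z # xs)"] by (cases "x = z") (auto simp: Cons)
    then show ?thesis
      using int1_delta[of z "\<lambda>x. if length zs = k then f (z # zs) else 0"] by (simp add: Cons)
  qed (simp)
qed auto

definition intp :: "nat list \<Rightarrow> (pt \<Rightarrow> complex) \<Rightarrow> complex" where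
  "intp As \<phi> = (\<Sum>s<length As. intl (As ! s) (\<lambda>xs. \<phi> (Pt s xs)))"

lemma intp_cong: "(\<And>a. a \<in> pts As \<Longrightarrow> \<phi> a = \<psi> a) \<Longrightarrow> intp As \<phi> = intp As \<psi>"
  unfolding intp_def by (intro sum.cong intl_cong) auto

lemma intp_act: "bij \<pi> \<Longrightarrow> intp As (\<lambda>a. \<phi> (act \<pi> a)) = intp As \<phi>"
  unfolding intp_def using intl_act[of \<pi> _ "\<lambda>xs. \<phi> (Pt _ xs)"] by simp

lemma fs_intp: assumes "fs2 \<phi>" shows "fs (\<lambda>x. intp As (\<phi> x))"
  unfolding intp_def by (intro fs_sum fs_intl fs2D[OF assms] fs_basic_intros)

lemma intp_add: assumes "fs f" "fs g" shows "intp As (\<lambda>x. f x + g x) = intp As f + intp As g"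
  unfolding intp_def sum.distrib[symmetric]
  by (intro sum.cong refl intl_add fs_eqm[OF assms(1)] fs_eqm[OF assms(2)] fs_basic_intros)

lemma intp_cmult: assumes "fs f" shows "intp As (\<lambda>x. a * f x) = a * intp As f"
  unfolding intp_def sum_distrib_left
  by (intro sum.cong refl intl_cmult fs_eqm[OF assms] fs_basic_intros)

lemma intp_multc: "fs f \<Longrightarrow> intp As (\<lambda>x. f x * a) = intp As f * a"
  using intp_cmult[of f As a] by (simp add: mult.commute)

lemma intp_diff: "fs f \<Longrightarrow> fs g \<Longrightarrow> intp As (\<lambda>x. f x - g x) = intp As f - intp As g"
  using intp_add[of f "\<lambda>x. (-1) * g x" As] intp_cmult[of g As "-1"]
    fs_mult[OF fs_const[of "-1"], of g] by simp

lemma intp_0 [simp]: "intp As (\<lambda>x. 0) = 0"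
  by (simp add: intp_def)

lemma intp_zero: "(\<And>a. a \<in> pts As \<Longrightarrow> \<phi> a = 0) \<Longrightarrow> intp As \<phi> = 0"
  using intp_cong[of As \<phi> "\<lambda>_. 0"] by simp

lemma intp_sum: "(\<And>i. i \<in> I \<Longrightarrow> fs (\<phi> i)) \<Longrightarrow> intp As (\<lambda>x. \<Sum>i\<in>I. \<phi> i x) = (\<Sum>i\<in>I. intp As (\<phi> i))"
  by (induction I rule: infinite_finite_induct) (auto simp: intp_add fs_sum)

lemma intl_sum: "(\<And>i. i \<in> I \<Longrightarrow> fs (\<phi> i)) \<Longrightarrow> intl k (\<lambda>x. \<Sum>i\<in>I. \<phi> i x) = (\<Sum>i\<in>I. intl k (\<phi> i))"
  by (induction I rule: infinite_finite_induct) (auto simp: intl_add fs_sum)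

lemma intp_swap:
  assumes "fs2 \<phi>"
  shows "intp As (\<lambda>a. intp Bs (\<lambda>b. \<phi> a b)) = intp Bs (\<lambda>b. intp As (\<lambda>a. \<phi> a b))"
proof -
  have "intp As (\<lambda>a. intp Bs (\<lambda>b. \<phi> a b)) =
    (\<Sum>s<length As. \<Sum>r<length Bs. intl (As ! s) (\<lambda>xs. intl (Bs ! r) (\<lambda>ys. \<phi> (Pt s xs) (Pt r ys))))"
    unfolding intp_def by (intro sum.cong refl intl_sum fs_intl fs2D[OF assms] fs_basic_intros)
  also have "\<dots> = (\<Sum>r<length Bs. \<Sum>s<length As. intl (Bs ! r) (\<lambda>ys. intl (As ! s) (\<lambda>xs. \<phi> (Pt s xs) (Pt r ys))))"
    by (subst sum.swap) (intro sum.cong refl intl_swap fs2D[OF assms] fs_basic_intros)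
  also have "\<dots> = intp Bs (\<lambda>b. intp As (\<lambda>a. \<phi> a b))"
    unfolding intp_def by (intro sum.cong refl intl_sum[symmetric] fs_intl fs2D[OF assms] fs_basic_intros)
  finally show ?thesis .
qed

lemma intp_intl_swap:
  assumes "fs2 \<phi>"
  shows "intp As (\<lambda>a. intl k (\<lambda>ys. \<phi> a ys)) = intl k (\<lambda>ys. intp As (\<lambda>a. \<phi> a ys))"
proof -
  have "intp As (\<lambda>a. intl k (\<lambda>ys. \<phi> a ys)) = (\<Sum>s<length As. intl k (\<lambda>ys. intl (As ! s) (\<lambda>xs. \<phi> (Pt s xs) ys)))"
    unfolding intp_def by (intro sum.cong refl intl_swap fs2D[OF assms] fs_basic_intros)
  also have "\<dots> = intl k (\<lambda>ys. intp As (\<lambda>a. \<phi> a ys))"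
    unfolding intp_def by (intro intl_sum[symmetric] fs_intl fs2D[OF assms] fs_basic_intros)
  finally show ?thesis .
qed

text \<open>Points have mass 1, so the equality kernel acts as the identity for composition by
  integration.\<close>

lemma intp_delta: "intp As (\<lambda>a. if a = b then f a else 0) = (if b \<in> pts As then f b else 0)"
proof (cases b)
  case (Pt r ys)
  have "intl (As ! s) (\<lambda>xs. if Pt s xs = b then f (Pt s xs) else 0) =
      (if s = r then (if length ys = As ! r then f b else 0) else 0)" for s
    using intl_delta[of "As ! s" ys "\<lambda>xs. f (Pt s xs)"] by (auto simp: Pt)
  then show ?thesis by (auto simp: intp_def Pt)
qed

text \<open>On a finite set the integral is an ordinary sum, and \<open>t\<close> does not enter.
  This evaluates the averages over the orbits of a centralizer.\<close>

lemma intp_finite: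
  assumes "finite S" "S \<subseteq> pts As" "\<And>a. a \<in> pts As \<Longrightarrow> a \<notin> S \<Longrightarrow> \<phi> a = 0"
  shows "intp As \<phi> = sum \<phi> S"
proof -
  have "intp As \<phi> = intp As (\<lambda>a. \<Sum>b\<in>S. if a = b then \<phi> b else 0)"
    by (rule intp_cong) (use assms in auto)
  also have "\<dots> = (\<Sum>b\<in>S. intp As (\<lambda>a. if a = b then \<phi> b else 0))"
    by (intro intp_sum fs_basic_intros)
  also have "\<dots> = sum \<phi> S"
    using assms(2) by (intro sum.cong) (auto simp: intp_delta[of _ _ "\<lambda>_. \<phi> _"])
  finally show ?thesis .
qed

end

section \<open>Partition diagrams as functions\<close>

text \<open>Points of diagrams are numbered from 1 and list positions from 0.\<close>

definition val :: "nat list \<Rightarrow> nat list \<Rightarrow> nat + nat \<Rightarrow> nat" where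
  "val xs ys = case_sum (\<lambda>i. xs ! (i - 1)) (\<lambda>j. ys ! (j - 1))"

lemma val_simps [simp]: "val xs ys (Inl i) = xs ! (i - 1)" "val xs ys (Inr i) = ys ! (i - 1)"
  by (simp_all add: val_def)

text \<open>The type of points is left open because the same condition is used for the three layers
  of a stacked diagram.\<close>

definition compat :: "'v set set \<Rightarrow> ('v \<Rightarrow> nat) \<Rightarrow> bool" where
  "compat P v \<longleftrightarrow> (\<forall>B\<in>P. \<forall>x\<in>B. \<forall>y\<in>B. v x = v y)"

definition pfun :: "nat \<Rightarrow> nat \<Rightarrow> diagram \<Rightarrow> nat list \<Rightarrow> nat list \<Rightarrow> complex" where
  "pfun k l p xs ys = of_bool (length xs = k \<and> length ys = l \<and> compat p (val xs ys))"

text \<open>The matrix entries of a morphism acting on functions on tuples of natural numbers.\<close>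

definition dk :: "nat \<Rightarrow> nat \<Rightarrow> pmor \<Rightarrow> nat list \<Rightarrow> nat list \<Rightarrow> complex" where
  "dk k l f xs ys = (\<Sum>p\<in>Poly_Mapping.keys f. Poly_Mapping.lookup f p * pfun k l p xs ys)"

lemma compat_cong: "(\<And>x. x \<in> \<Union> P \<Longrightarrow> v x = w x) \<Longrightarrow> compat P v \<longleftrightarrow> compat P w"
  unfolding compat_def by (metis UnionI)

lemma compat_Un: "compat (P \<union> Q) v \<longleftrightarrow> compat P v \<and> compat Q v"
  unfolding compat_def by auto

lemma compat_minus_empty: "compat (P - {{}}) v \<longleftrightarrow> compat P v"
proof
  assume c: "compat (P - {{}}) v"
  show "compat P v" unfolding compat_def
  proof (intro ballI)
    fix B x y assume "B \<in> P" "x \<in> B" "y \<in> B"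
    moreover from this have "B \<in> P - {{}}" by auto
    ultimately show "v x = v y" using c unfolding compat_def by blast
  qed
qed (auto simp: compat_def)

lemma compat_image: "compat ((`) f ` P) v \<longleftrightarrow> compat P (v \<circ> f)"
  unfolding compat_def by auto

lemma dk_superset:
  assumes "finite S" "Poly_Mapping.keys f \<subseteq> S"
  shows "dk k l f xs ys = (\<Sum>p\<in>S. Poly_Mapping.lookup f p * pfun k l p xs ys)"
  unfolding dk_def using assms by (intro sum.mono_neutral_left) (auto simp: in_keys_iff)

lemma dk_0 [simp]: "dk k l 0 xs ys = 0"
  by (simp add: dk_def)

lemma dk_add: "dk k l (f + g) xs ys = dk k l f xs ys + dk k l g xs ys"
proof -
  let ?S = "Poly_Mapping.keys f \<union> Poly_Mapping.keys g"
  have "Poly_Mapping.keys (f + g) \<subseteq> ?S" by (rule keys_add)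
  then show ?thesis
    by (simp add: dk_superset[of ?S] lookup_add distrib_right sum.distrib)
qed

lemma dk_diff: "dk k l (f - g) xs ys = dk k l f xs ys - dk k l g xs ys"
  using dk_add[of k l "f - g" g xs ys] by simp

lemma dk_sum: "dk k l (\<Sum>i\<in>I. f i) xs ys = (\<Sum>i\<in>I. dk k l (f i) xs ys)"
  by (induction I rule: infinite_finite_induct) (auto simp: dk_add)

lemma lookup_scale: "Poly_Mapping.lookup (scale a f) p = a * Poly_Mapping.lookup f p"
  unfolding scale_def by (simp add: Poly_Mapping.map.rep_eq when_def)

lemma keys_scale: "Poly_Mapping.keys (scale a f) \<subseteq> Poly_Mapping.keys f"
  by (auto simp: in_keys_iff lookup_scale)

lemma dk_scale: "dk k l (scale a f) xs ys = a * dk k l f xs ys"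
  by (subst dk_superset[OF _ keys_scale]) (auto simp: dk_def lookup_scale sum_distrib_left mult.assoc)

lemma dk_single: "dk k l (Poly_Mapping.single p a) xs ys = a * pfun k l p xs ys"
  by (subst dk_superset[of "{p}"]) auto

definition phom :: "nat \<Rightarrow> nat \<Rightarrow> pmor set" where
  "phom k l = {f. Poly_Mapping.keys f \<subseteq> diagrams k l}"

lemma phom_add: "f \<in> phom k l \<Longrightarrow> g \<in> phom k l \<Longrightarrow> f + g \<in> phom k l"
  unfolding phom_def mem_Collect_eq by (rule order_trans[OF keys_add]) simp
lemma phom_diff: "f \<in> phom k l \<Longrightarrow> g \<in> phom k l \<Longrightarrow> f - g \<in> phom k l"
  unfolding phom_def mem_Collect_eq by (rule order_trans[OF keys_diff]) simp
lemma phom_0: "0 \<in> phom k l"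
  by (simp add: phom_def)
lemma phom_sum: "(\<And>i. i \<in> I \<Longrightarrow> f i \<in> phom k l) \<Longrightarrow> (\<Sum>i\<in>I. f i) \<in> phom k l"
  by (induction I rule: infinite_finite_induct) (auto simp: phom_add phom_0)
lemma phom_scale: "f \<in> phom k l \<Longrightarrow> scale a f \<in> phom k l"
  unfolding phom_def mem_Collect_eq by (rule order_trans[OF keys_scale])
lemma phom_single: "p \<in> diagrams k l \<Longrightarrow> Poly_Mapping.single p a \<in> phom k l"
  unfolding phom_def by auto
lemma phomD: "f \<in> phom k l \<Longrightarrow> p \<in> Poly_Mapping.keys f \<Longrightarrow> p \<in> diagrams k l"
  unfolding phom_def by auto

lemma dk_length: "dk k l f xs ys \<noteq> 0 \<Longrightarrow> length xs = k \<and> length ys = l"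
  unfolding dk_def pfun_def by (auto intro: sum.neutral)

lemma Union_diagram: "p \<in> diagrams k l \<Longrightarrow> \<Union> p = points k l"
  by (auto simp: diagrams_def partition_on_def)

lemma finite_points: "finite (points k l)"
  by (simp add: points_def)

lemma finite_diagrams: "finite (diagrams k l)"
  unfolding diagrams_def by (rule finitely_many_partition_on) (rule finite_points)

lemma val_map: "length xs = k \<Longrightarrow> length ys = l \<Longrightarrow> x \<in> points k l \<Longrightarrow> val (map \<pi> xs) (map \<pi> ys) x = \<pi> (val xs ys x)"
  by (auto simp: points_def)

lemma pfun_act:
  assumes "inj \<pi>" "p \<in> diagrams k l"
  shows "pfun k l p (map \<pi> xs) (map \<pi> ys) = pfun k l p xs ys"
proof (cases "length xs = k \<and> length ys = l")
  case True
  then have "compat p (val (map \<pi> xs) (map \<pi> ys)) \<longleftrightarrow> compat p (\<lambda>x. \<pi> (val xs ys x))"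
    using Union_diagram[OF assms(2)] by (intro compat_cong) (auto simp: val_map)
  also have "\<dots> \<longleftrightarrow> compat p (val xs ys)"
    using assms(1) by (auto simp: compat_def inj_eq)
  finally show ?thesis by (simp add: pfun_def)
qed (auto simp: pfun_def)

lemma dk_act: "inj \<pi> \<Longrightarrow> f \<in> phom k l \<Longrightarrow> dk k l f (map \<pi> xs) (map \<pi> ys) = dk k l f xs ys"
  unfolding dk_def by (intro sum.cong refl) (simp add: pfun_act[OF _ phomD])

lemma fs2_pfun: "p \<in> diagrams k l \<Longrightarrow> fs2 (pfun k l p)"
  by (rule fs_inv) (simp add: act_nat_def[abs_def] pfun_act bij_is_inj)

text \<open>The level sets of the pair of tuples. By \<open>compat_iff_refines\<close> this is the
  coarsest diagram with which the pair is compatible.\<close>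

definition kerp :: "nat \<Rightarrow> nat \<Rightarrow> nat list \<Rightarrow> nat list \<Rightarrow> diagram" where
  "kerp k l xs ys = (\<lambda>c. {x \<in> points k l. val xs ys x = c}) ` val xs ys ` points k l"

lemma kerp_diagram: "kerp k l xs ys \<in> diagrams k l"
  unfolding diagrams_def kerp_def by (auto simp: partition_on_def disjoint_def)

lemma compat_iff_refines:
  assumes "p \<in> diagrams k l"
  shows "compat p (val xs ys) \<longleftrightarrow> refines (points k l) p (kerp k l xs ys)"
proof
  have p: "partition_on (points k l) p" using assms by (simp add: diagrams_def)
  assume c: "compat p (val xs ys)"
  have "\<exists>Y\<in>kerp k l xs ys. X \<subseteq> Y" if X: "X \<in> p" for X
  proof -
    obtain x where x: "x \<in> X" using p X by (metis partition_onD3 all_not_in_conv)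
    have sub: "X \<subseteq> points k l" using p X by (auto simp: partition_on_def)
    moreover have "val xs ys y = val xs ys x" if "y \<in> X" for y
      using c X x that unfolding compat_def by blast
    ultimately have "X \<subseteq> {y \<in> points k l. val xs ys y = val xs ys x}" by blast
    then show ?thesis using x sub by (auto simp: kerp_def)
  qed
  then show "refines (points k l) p (kerp k l xs ys)"
    using p kerp_diagram[of k l xs ys] by (auto simp: refines_def diagrams_def)
next
  assume "refines (points k l) p (kerp k l xs ys)"
  then have "\<exists>c. X \<subseteq> {x \<in> points k l. val xs ys x = c}" if "X \<in> p" for X
    using that by (auto simp: refines_def kerp_def)
  then show "compat p (val xs ys)" unfolding compat_def by blast
qed

lemma x_diagram_hom: "p \<in> diagrams k l \<Longrightarrow> x_diagram p \<in> phom k l"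
proof (induction p rule: x_diagram.induct)
  case (1 p)
  show ?case
    by (subst x_diagram.simps)
       (use 1 Union_diagram[OF 1(2)] in \<open>auto intro!: phom_diff phom_sum phom_single simp: refines_def diagrams_def\<close>)
qed

text \<open>Moebius inversion: \<open>pfun k l p\<close> is the sum, over all diagrams
  \<open>q\<close> equal to or coarser than \<open>p\<close>, of the indicators of
  \<open>kerp k l xs ys = q\<close>, and the recursion defining \<open>x_diagram\<close> inverts
  this sum.\<close>

lemma dk_x_diagram:
  assumes "p \<in> diagrams k l" "length xs = k" "length ys = l"
  shows "dk k l (x_diagram p) xs ys = of_bool (kerp k l xs ys = p)"
  using assms(1)
proof (induction p rule: x_diagram.induct)
  case (1 p)
  let ?K = "kerp k l xs ys" and ?S = "{q. finite p \<and> refines (\<Union> p) p q \<and> q \<noteq> p}"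
  have U: "\<Union> p = points k l" by (rule Union_diagram[OF 1(2)])
  have p: "partition_on (points k l) p" using 1(2) by (simp add: diagrams_def)
  have fp: "finite p" using p finite_points finite_elements by blast
  have sub: "?S \<subseteq> diagrams k l" by (auto simp: U refines_def diagrams_def)
  have "dk k l (x_diagram p) xs ys = pfun k l p xs ys - (\<Sum>q\<in>?S. dk k l (x_diagram q) xs ys)"
    by (subst x_diagram.simps) (simp add: dk_diff dk_sum dk_single)
  also have "(\<Sum>q\<in>?S. dk k l (x_diagram q) xs ys) = (\<Sum>q\<in>?S. of_bool (?K = q))"
  proof (rule sum.cong[OF refl])
    fix q assume q: "q \<in> ?S"
    with sub have "q \<in> diagrams k l" by blast
    with 1(1)[OF q] show "dk k l (x_diagram q) xs ys = of_bool (?K = q)" by simp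
  qed
  also have "\<dots> = of_bool (?K \<in> ?S)"
    using finite_subset[OF sub finite_diagrams] by (simp add: of_bool_def sum.delta')
  also have "pfun k l p xs ys = of_bool (refines (points k l) p ?K)"
    by (simp add: pfun_def assms(2,3) compat_iff_refines[OF 1(2)])
  also have "of_bool (refines (points k l) p ?K) - of_bool (?K \<in> ?S) = (of_bool (?K = p) :: complex)"
    using fp U refines_refl[OF p] by auto
  finally show ?case .
qed

text \<open>The blocks are labelled by distinct natural numbers. The supply of labels must be
  infinite if this is to work for diagrams of every size.\<close>

lemma kerp_surj:
  assumes "p \<in> diagrams k l"
  obtains xs ys where "length xs = k" "length ys = l" "kerp k l xs ys = p"
proof -
  have p: "partition_on (points k l) p" using assms by (simp add: diagrams_def)
  have fp: "finite p" using p finite_points finite_elements by blast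
  obtain h where h: "inj_on h p" "h ` p \<subseteq> (UNIV :: nat set)"
    using finite_imp_inj_to_nat_seg[OF fp] by blast
  define b where "b x = (THE B. B \<in> p \<and> x \<in> B)" for x
  have b: "B = b x" if "B \<in> p" "x \<in> B" for B x
  proof -
    have "C = B" if "C \<in> p" "x \<in> C" for C
      using that \<open>B \<in> p\<close> \<open>x \<in> B\<close> partition_onD2[OF p] unfolding disjoint_def by blast
    then show ?thesis unfolding b_def using that by (intro the_equality[symmetric]) blast+
  qed
  have bp: "b x \<in> p \<and> x \<in> b x" if "x \<in> points k l" for x
  proof -
    obtain B where "B \<in> p" "x \<in> B" using p \<open>x \<in> points k l\<close> by (auto simp: partition_on_def)
    then show ?thesis using b[OF \<open>B \<in> p\<close> \<open>x \<in> B\<close>] by simp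
  qed
  let ?xs = "map (\<lambda>i. h (b (Inl (Suc i)))) [0..<k]" and ?ys = "map (\<lambda>i. h (b (Inr (Suc i)))) [0..<l]"
  have v: "val ?xs ?ys x = h (b x)" if "x \<in> points k l" for x
    using that by (auto simp: points_def)
  have e: "{x \<in> points k l. val ?xs ?ys x = val ?xs ?ys y} = b y" if y: "y \<in> points k l" for y
  proof (intro Set.set_eqI iffI)
    fix x assume "x \<in> {x \<in> points k l. val ?xs ?ys x = val ?xs ?ys y}"
    then have "x \<in> points k l" "h (b x) = h (b y)" using v y by auto
    then show "x \<in> b y" using h(1) bp y by (metis inj_onD)
  next
    fix x assume x: "x \<in> b y"
    then have "x \<in> points k l" using bp[OF y] p by (auto simp: partition_on_def)
    moreover have "b x = b y" using b bp[OF y] x by metis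
    ultimately show "x \<in> {x \<in> points k l. val ?xs ?ys x = val ?xs ?ys y}" using v y by auto
  qed
  have "kerp k l ?xs ?ys = b ` points k l" unfolding kerp_def image_image using e by auto
  also have "\<dots> = p"
  proof
    show "b ` points k l \<subseteq> p" using bp by auto
    show "p \<subseteq> b ` points k l"
    proof
      fix B assume B: "B \<in> p"
      then obtain x where x: "x \<in> B" using p by (metis partition_onD3 all_not_in_conv)
      then have "x \<in> points k l" using p B by (auto simp: partition_on_def)
      then show "B \<in> b ` points k l" using b[OF B x] by blast
    qed
  qed
  finally show thesis by (intro that[of ?xs ?ys]) auto
qed

text \<open>Evaluate at a pair of tuples whose level sets form a diagram \<open>q\<close> of the
  support with the largest number of blocks. A diagram \<open>p\<close> contributes there only if it
  refines \<open>q\<close>; if \<open>p\<close> differs from \<open>q\<close> it has more blocks, so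
  only the coefficient of \<open>q\<close> survives.\<close>

lemma dk_faithful:
  assumes "f \<in> phom k l" "\<And>xs ys. length xs = k \<Longrightarrow> length ys = l \<Longrightarrow> dk k l f xs ys = 0"
  shows "f = 0"
proof (rule ccontr)
  assume "f \<noteq> 0"
  then have ne: "Poly_Mapping.keys f \<noteq> {}" by simp
  have "Max (card ` Poly_Mapping.keys f) \<in> card ` Poly_Mapping.keys f" by (rule Max_in) (use ne in auto)
  then obtain q where q: "q \<in> Poly_Mapping.keys f" "card q = Max (card ` Poly_Mapping.keys f)" by auto
  have max: "card p \<le> card q" if "p \<in> Poly_Mapping.keys f" for p
    unfolding q(2) by (rule Max_ge) (use that in auto)
  note q = q(1)
  obtain xs ys where xy: "length xs = k" "length ys = l" "kerp k l xs ys = q"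
    using kerp_surj phomD[OF assms(1) q] by blast
  have "pfun k l p xs ys = of_bool (p = q)" if p: "p \<in> Poly_Mapping.keys f" for p
  proof -
    have dp: "p \<in> diagrams k l" by (rule phomD[OF assms(1) p])
    have fp: "finite p" using dp finite_points finite_elements by (auto simp: diagrams_def)
    have "refines (points k l) p q \<longleftrightarrow> p = q"
      using refines_card_less[OF _ _ fp] max[OF p] refines_refl dp by (auto simp: diagrams_def not_less[symmetric])
    then show ?thesis using compat_iff_refines[OF dp, of xs ys] xy by (simp add: pfun_def)
  qed
  then have "dk k l f xs ys = (\<Sum>p\<in>Poly_Mapping.keys f. if p = q then Poly_Mapping.lookup f p else 0)"
    unfolding dk_def by (intro sum.cong) auto
  also have "\<dots> = Poly_Mapping.lookup f q" using q by simp
  finally show False using assms(2)[OF xy(1,2)] q by (simp add: in_keys_iff)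
qed

lemma dk_eqI:
  assumes "f \<in> phom k l" "g \<in> phom k l"
    "\<And>xs ys. length xs = k \<Longrightarrow> length ys = l \<Longrightarrow> dk k l f xs ys = dk k l g xs ys"
  shows "f = g"
  using dk_faithful[OF phom_diff[OF assms(1,2)]] assms(3) by (simp add: dk_diff)

lemma extend_to_bij:
  assumes "finite A" "inj_on f A"
  obtains \<pi> :: "nat \<Rightarrow> nat" where "bij \<pi>" "\<And>x. x \<in> A \<Longrightarrow> \<pi> x = f x"
proof -
  let ?U = "A \<union> f ` A"
  have fU: "finite ?U" using assms(1) by simp
  have "card (?U - A) = card (?U - f ` A)"
    using assms card_image[OF assms(2)] by (simp add: card_Diff_subset)
  then obtain g where g: "bij_betw g (?U - A) (?U - f ` A)"
    using fU by (metis finite_Diff finite_same_card_bij)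
  define \<pi> where "\<pi> x = (if x \<in> A then f x else if x \<in> ?U then g x else x)" for x
  have "bij_betw \<pi> A (f ` A)"
    using assms(2) by (auto simp: \<pi>_def bij_betw_def inj_on_def)
  moreover have "bij_betw \<pi> (?U - A) (?U - f ` A)"
    by (rule bij_betw_cong[THEN iffD1, OF _ g]) (auto simp: \<pi>_def)
  moreover have "bij_betw \<pi> (- ?U) (- ?U)"
    by (auto simp: \<pi>_def bij_betw_def inj_on_def)
  ultimately have "bij_betw \<pi> (A \<union> (?U - A) \<union> - ?U) (f ` A \<union> (?U - f ` A) \<union> - ?U)"
    by (intro bij_betw_combine) auto
  moreover have "A \<union> (?U - A) \<union> - ?U = UNIV" "f ` A \<union> (?U - f ` A) \<union> - ?U = UNIV" by auto
  ultimately show thesis using that[of \<pi>] by (auto simp: \<pi>_def)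
qed

text \<open>Equal level sets make the assignment of values to values well defined and injective on a
  finite set. Thus \<open>kerp\<close> classifies the orbits of pairs of tuples under permutations
  of the values.\<close>

lemma kerp_eq_bij:
  assumes "kerp k l xs ys = kerp k l xs' ys'" "length xs = k" "length ys = l" "length xs' = k" "length ys' = l"
  obtains \<pi> where "bij \<pi>" "map \<pi> xs = xs'" "map \<pi> ys = ys'"
proof -
  let ?v = "val xs ys" and ?v' = "val xs' ys'" and ?S = "points k l"
  have eq: "?v x = ?v y \<longleftrightarrow> ?v' x = ?v' y" if "x \<in> ?S" "y \<in> ?S" for x y
  proof -
    have in_ker: "(\<exists>B\<in>kerp k l us vs. x \<in> B \<and> y \<in> B) \<longleftrightarrow> val us vs x = val us vs y" for us vs
      using that by (auto simp: kerp_def)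
    show ?thesis using in_ker[of xs ys] in_ker[of xs' ys'] assms(1) by simp
  qed
  define g where "g c = ?v' (inv_into ?S ?v c)" for c
  have g: "g (?v x) = ?v' x" if "x \<in> ?S" for x
    unfolding g_def using eq that by (metis f_inv_into_f imageI inv_into_into)
  have "inj_on g (?v ` ?S)"
    by (rule inj_onI) (use g eq in auto)
  then obtain \<pi> where \<pi>: "bij \<pi>" "\<And>c. c \<in> ?v ` ?S \<Longrightarrow> \<pi> c = g c"
    using extend_to_bij[of "?v ` ?S" g] finite_points by blast
  have *: "\<pi> (?v x) = ?v' x" if "x \<in> ?S" for x using \<pi>(2) g that by auto
  have "map \<pi> xs = xs'"
    using *[of "Inl (Suc _)"] assms(2-) by (intro nth_equalityI) (auto simp: points_def image_iff)
  moreover have "map \<pi> ys = ys'"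
    using *[of "Inr (Suc _)"] assms(2-) by (intro nth_equalityI) (auto simp: points_def image_iff)
  ultimately show thesis using \<pi>(1) that by blast
qed

text \<open>The \<open>x_diagram\<close> have the indicators of the orbits as kernels, and there are
  finitely many orbits. The coefficient \<open>c q\<close> is the value of \<open>K\<close> at any
  representative of its orbit.\<close>

lemma dk_full:
  assumes "\<And>\<pi> xs ys. bij \<pi> \<Longrightarrow> K (map \<pi> xs) (map \<pi> ys) = K xs ys"
  obtains f where "f \<in> phom k l" "\<And>xs ys. length xs = k \<Longrightarrow> length ys = l \<Longrightarrow> dk k l f xs ys = K xs ys"
proof -
  define P where "P q z \<longleftrightarrow> length (fst z) = k \<and> length (snd z) = l \<and> kerp k l (fst z) (snd z) = q" for q z
  define c where "c q = (let z = (SOME z. P q z) in K (fst z) (snd z))" for q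
  have c: "c (kerp k l xs ys) = K xs ys" if len: "length xs = k" "length ys = l" for xs ys
  proof -
    define z where "z = (SOME z. P (kerp k l xs ys) z)"
    have "P (kerp k l xs ys) (xs, ys)" using that by (simp add: P_def)
    then have "P (kerp k l xs ys) z" unfolding z_def by (rule someI)
    then have z: "kerp k l xs ys = kerp k l (fst z) (snd z)" "length (fst z) = k" "length (snd z) = l"
      by (simp_all add: P_def)
    obtain \<pi> where "bij \<pi>" "map \<pi> xs = fst z" "map \<pi> ys = snd z"
      by (rule kerp_eq_bij[OF z(1) len z(2,3)])
    then show ?thesis using assms[of \<pi> xs ys] by (simp add: c_def z_def[symmetric])
  qed
  let ?f = "\<Sum>q\<in>diagrams k l. scale (c q) (x_diagram q)"
  have "dk k l ?f xs ys = K xs ys" if "length xs = k" "length ys = l" for xs ys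
  proof -
    have "dk k l ?f xs ys = (\<Sum>q\<in>diagrams k l. if q = kerp k l xs ys then c q else 0)"
      unfolding dk_sum dk_scale by (intro sum.cong) (auto simp: dk_x_diagram that)
    also have "\<dots> = K xs ys" using c[OF that] kerp_diagram finite_diagrams by simp
    finally show ?thesis .
  qed
  moreover have "?f \<in> phom k l" by (intro phom_sum phom_scale x_diagram_hom)
  ultimately show thesis using that by blast
qed

section \<open>Composition and tensor products of diagrams\<close>

text \<open>Assigns values to the listed points one at a time, in step with the recursion of
  \<open>intl\<close>, so that the middle points of a stacked diagram can be integrated out in
  succession.\<close>

primrec upd :: "('v \<Rightarrow> nat) \<Rightarrow> 'v list \<Rightarrow> nat list \<Rightarrow> 'v \<Rightarrow> nat" where
  "upd v [] ys = v"
| "upd v (m # ms) ys = upd (v(m := hd ys)) ms (tl ys)"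

lemma upd_notin: "x \<notin> set ms \<Longrightarrow> upd v ms ys x = v x"
  by (induction ms arbitrary: v ys) auto

lemma upd_nth: "distinct ms \<Longrightarrow> length ys = length ms \<Longrightarrow> i < length ms \<Longrightarrow> upd v ms ys (ms ! i) = ys ! i"
proof (induction ms arbitrary: v ys i)
  case (Cons m ms)
  then obtain y ys' where ys: "ys = y # ys'" by (cases ys) auto
  show ?case using Cons by (cases i) (auto simp: ys upd_notin)
qed simp

context deligne
begin

text \<open>The value at \<open>m\<close> is free if \<open>m\<close> is a block by itself, which
  contributes the total mass \<open>t\<close>. Otherwise it is forced to equal the value at another
  point of the same block, and a single point has mass 1.\<close>

lemma int1_compat:
  assumes "disjoint P" "m \<in> \<Union> P"
  shows "int1 (\<lambda>x. a * of_bool (compat P (v(m := x)))) =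
    a * ((if {m} \<in> P then t else 1) * of_bool (compat ((\<lambda>B. B - {m}) ` P - {{}}) v))"
proof -
  let ?R = "(\<lambda>B. B - {m}) ` P - {{}}"
  obtain B where B: "B \<in> P" "m \<in> B" using assms by auto
  have uniq: "C = B" if "C \<in> P" "m \<in> C" for C using assms(1) B that unfolding disjoint_def by blast
  have R: "compat ?R v \<longleftrightarrow> (\<forall>C\<in>P. \<forall>x\<in>C - {m}. \<forall>y\<in>C - {m}. v x = v y)"
    unfolding compat_minus_empty by (simp add: compat_def)
  show ?thesis
  proof (cases "B = {m}")
    case True
    have "compat P (v(m := x)) \<longleftrightarrow> compat ?R v" for x
      unfolding R unfolding compat_def
    proof (rule ball_cong[OF refl])
      fix C assume C: "C \<in> P"
      show "(\<forall>a\<in>C. \<forall>b\<in>C. (v(m := x)) a = (v(m := x)) b) \<longleftrightarrow> (\<forall>a\<in>C - {m}. \<forall>b\<in>C - {m}. v a = v b)"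
      proof (cases "m \<in> C")
        case True
        then have "C = {m}" using uniq[OF C] \<open>B = {m}\<close> by simp
        then show ?thesis by simp
      next
        case False
        then have "C - {m} = C" "\<And>a. a \<in> C \<Longrightarrow> (v(m := x)) a = v a" by auto
        then show ?thesis by simp
      qed
    qed
    then have "int1 (\<lambda>x. a * of_bool (compat P (v(m := x)))) = t * (a * of_bool (compat ?R v))"
      using int1_eq[of "{}" "\<lambda>_. a * of_bool (compat ?R v)"] by simp
    then show ?thesis using True B by simp
  next
    case False
    then obtain y where y: "y \<in> B" "y \<noteq> m" using B by auto
    have "compat P (v(m := x)) \<longleftrightarrow> compat ?R v \<and> x = v y" for x
    proof
      assume c: "compat P (v(m := x))"
      then have "x = v y" using B y unfolding compat_def by (metis fun_upd_other fun_upd_same)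
      moreover have "compat ?R v" unfolding R
      proof (intro ballI)
        fix C a b assume "C \<in> P" "a \<in> C - {m}" "b \<in> C - {m}"
        then have "(v(m := x)) a = (v(m := x)) b" using c unfolding compat_def by blast
        then show "v a = v b" using \<open>a \<in> C - {m}\<close> \<open>b \<in> C - {m}\<close> by simp
      qed
      ultimately show "compat ?R v \<and> x = v y" by simp
    next
      assume c: "compat ?R v \<and> x = v y"
      then have cR: "v a = v b" if "C \<in> P" "a \<in> C" "a \<noteq> m" "b \<in> C" "b \<noteq> m" for C a b
        using that unfolding R by blast
      show "compat P (v(m := x))" unfolding compat_def
      proof (intro ballI)
        fix C a b assume C: "C \<in> P" "a \<in> C" "b \<in> C"
        have 1: "(v(m := x)) a = v y" if "m \<in> C" "a \<in> C" for a
        proof (cases "a = m")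
          case False
          then show ?thesis using cR[OF B(1), of a y] uniq[OF C(1) that(1)] that(2) y by simp
        qed (use c in simp)
        show "(v(m := x)) a = (v(m := x)) b"
        proof (cases "m \<in> C")
          case True
          then show ?thesis using 1 C by metis
        next
          case False
          then have "a \<noteq> m" "b \<noteq> m" using C by auto
          then show ?thesis using cR[of C a b] C by simp
        qed
      qed
    qed
    then have "int1 (\<lambda>x. a * of_bool (compat P (v(m := x)))) = int1 (\<lambda>x. if x = v y then a * of_bool (compat ?R v) else 0)"
      by (intro arg_cong[where f = int1] ext) auto
    also have "\<dots> = a * of_bool (compat ?R v)" by (rule int1_delta)
    finally show ?thesis using False B(2) uniq[of "{m}"] by (cases "{m} \<in> P") simp_all
  qed
qed

text \<open>A block contained in \<open>ms\<close> yields one factor \<open>t\<close>, namely when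
  the last of its points is integrated out.\<close>

lemma intl_compat:
  assumes "disjoint P" "finite P" "{} \<notin> P" "distinct ms" "set ms \<subseteq> \<Union> P"
  shows "intl (length ms) (\<lambda>ys. of_bool (compat P (upd v ms ys))) =
    t ^ card {B \<in> P. B \<subseteq> set ms} * of_bool (compat ((\<lambda>B. B - set ms) ` P - {{}}) v)"
  using assms(4,5)
proof (induction ms arbitrary: v)
  case Nil
  have e: "{B \<in> P. B \<subseteq> set []} = {}" using assms(3) by auto
  show ?case unfolding e compat_minus_empty by simp
next
  case (Cons m ms)
  let ?P = "(\<lambda>B. B - set ms) ` P - {{}}" and ?S = "{B \<in> P. B \<subseteq> set ms}"
  have m: "m \<notin> set ms" "m \<in> \<Union> P" using Cons(2,3) by auto
  obtain B where B: "B \<in> P" "m \<in> B" using m by auto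
  have uniq: "C = B" if "C \<in> P" "m \<in> C" for C using assms(1) B that unfolding disjoint_def by blast
  have dis: "disjoint ?P" unfolding disjoint_def
  proof (intro ballI impI)
    fix X Y assume "X \<in> ?P" "Y \<in> ?P" "X \<noteq> Y"
    then obtain C D where CD: "C \<in> P" "D \<in> P" "X = C - set ms" "Y = D - set ms" "C \<noteq> D" by blast
    then have "C \<inter> D = {}" using assms(1) unfolding disjoint_def by blast
    then show "X \<inter> Y = {}" using CD by blast
  qed
  have mem: "m \<in> \<Union> ?P" using B m by auto
  have "intl (length (m # ms)) (\<lambda>ys. of_bool (compat P (upd v (m # ms) ys))) =
      int1 (\<lambda>x. t ^ card ?S * of_bool (compat ?P (v(m := x))))"
    using Cons by simp
  also have "\<dots> = t ^ card ?S * ((if {m} \<in> ?P then t else 1) * of_bool (compat ((\<lambda>B. B - {m}) ` ?P - {{}}) v))"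
    by (rule int1_compat[OF dis mem])
  also have "(\<lambda>B. B - {m}) ` ?P - {{}} = (\<lambda>B. B - set (m # ms)) ` P - {{}}"
  proof -
    have "(\<lambda>B. B - {m}) ` (Q - {{}}) - {{}} = (\<lambda>B. B - {m}) ` Q - {{}}" for Q by auto
    moreover have "C - set ms - {m} = C - set (m # ms)" for C by auto
    ultimately show ?thesis by (simp only: image_image)
  qed
  \<comment> \<open>The exponent grows exactly when \<open>m\<close> is all that \<open>ms\<close>
    leaves of its block.\<close>
  also have "t ^ card ?S * ((if {m} \<in> ?P then t else 1) * b) = t ^ card {B \<in> P. B \<subseteq> set (m # ms)} * b" for b
  proof (cases "{m} \<in> ?P")
    case True
    then obtain C where C: "C \<in> P" "C - set ms = {m}" by blast
    then have "C = B" using uniq by blast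
    with C have Bm: "B \<subseteq> set (m # ms)" by auto
    have "{B \<in> P. B \<subseteq> set (m # ms)} = insert B ?S"
    proof (intro Set.set_eqI iffI)
      fix D assume D: "D \<in> {B \<in> P. B \<subseteq> set (m # ms)}"
      then show "D \<in> insert B ?S" using uniq[of D] by (cases "m \<in> D") auto
    qed (use B Bm in auto)
    moreover have "B \<notin> ?S" using B m by auto
    ultimately have "card {B \<in> P. B \<subseteq> set (m # ms)} = Suc (card ?S)" using assms(2) by simp
    then show ?thesis using True by simp
  next
    case False
    have "{B \<in> P. B \<subseteq> set (m # ms)} = ?S"
    proof (intro Set.set_eqI iffI)
      fix C assume C: "C \<in> {B \<in> P. B \<subseteq> set (m # ms)}"
      show "C \<in> ?S"
      proof (cases "m \<in> C")
        case True
        then have "C - set ms = {m}" using C m by auto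
        then have "{m} \<in> ?P" using C by auto
        then show ?thesis using False by simp
      qed (use C in auto)
    qed auto
    then show ?thesis using False by simp
  qed
  finally show ?case .
qed

end

section \<open>Stacking diagrams is integration over the middle points\<close>

definition val3 :: "nat list \<Rightarrow> nat list \<Rightarrow> nat list \<Rightarrow> nat + (nat + nat) \<Rightarrow> nat" where
  "val3 xs ys zs = case_sum (\<lambda>i. xs ! (i - 1)) (val ys zs)"

lemma compat_stack_blocks:
  "compat (stack_blocks q p) (val3 xs ys zs) \<longleftrightarrow> compat p (val xs ys) \<and> compat q (val ys zs)"
proof -
  have "val3 xs ys zs \<circ> map_sum id Inl = val xs ys"
    by (auto simp: fun_eq_iff val3_def val_def split: sum.split)
  moreover have "val3 xs ys zs \<circ> Inr = val ys zs"
    by (auto simp: fun_eq_iff val3_def)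
  ultimately show ?thesis by (simp add: stack_blocks_def compat_Un compat_image)
qed

lemma stack_equiv:
  "equiv (\<Union> (stack_blocks q p)) ({(x, y). \<exists>b\<in>stack_blocks q p. x \<in> b \<and> y \<in> b}\<^sup>+)"
proof (rule equivI)
  let ?R = "{(x, y). \<exists>b\<in>stack_blocks q p. x \<in> b \<and> y \<in> b}"
  show "?R\<^sup>+ \<subseteq> \<Union> (stack_blocks q p) \<times> \<Union> (stack_blocks q p)"
    by (rule trancl_subset_Sigma) auto
  show "refl_on (\<Union> (stack_blocks q p)) (?R\<^sup>+)"
    by (rule refl_onI) auto
  show "sym (?R\<^sup>+)" by (rule sym_trancl) (auto simp: sym_def)
qed simp

lemma stack_components_partition: "partition_on (\<Union> (stack_blocks q p)) (stack_components q p)"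
  unfolding stack_components_def by (rule partition_on_quotient[OF stack_equiv])

text \<open>Equality along blocks propagates along chains of blocks, so passing to connected
  components does not change the condition.\<close>

lemma compat_stack_components: "compat (stack_components q p) v \<longleftrightarrow> compat (stack_blocks q p) v"
proof -
  let ?R = "{(x, y). \<exists>b\<in>stack_blocks q p. x \<in> b \<and> y \<in> b}"
  show ?thesis
  proof
    assume c: "compat (stack_blocks q p) v"
    have R: "v x = v y" if "(x, y) \<in> ?R" for x y
      using that c unfolding compat_def by blast
    have tr: "v x = v y" if "(x, y) \<in> ?R\<^sup>+" for x y
      using that
    proof induction
      case (step y z)
      then show ?case using R[of y z] by simp
    qed (rule R)
    show "compat (stack_components q p) v" unfolding compat_def
    proof (intro ballI)
      fix B x y assume "B \<in> stack_components q p" and xy: "x \<in> B" "y \<in> B"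
      then obtain z where z: "B = ?R\<^sup>+ `` {z}" unfolding stack_components_def quotient_def by blast
      have "(z, x) \<in> ?R\<^sup>+" "(z, y) \<in> ?R\<^sup>+" using xy unfolding z by (simp_all only: Image_singleton_iff)
      then show "v x = v y" using tr[of z x] tr[of z y] by simp
    qed
  next
    assume c: "compat (stack_components q p) v"
    show "compat (stack_blocks q p) v" unfolding compat_def
    proof (intro ballI)
      fix B x y assume B: "B \<in> stack_blocks q p" "x \<in> B" "y \<in> B"
      then have "?R\<^sup>+ `` {x} \<in> stack_components q p" unfolding stack_components_def by (blast intro: quotientI)
      moreover have "(x, x) \<in> ?R\<^sup>+" "(x, y) \<in> ?R\<^sup>+" using B by (blast intro: r_into_trancl)+
      then have "x \<in> ?R\<^sup>+ `` {x}" "y \<in> ?R\<^sup>+ `` {x}" by (simp_all only: Image_singleton_iff)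
      ultimately show "v x = v y" using c unfolding compat_def by blast
    qed
  qed
qed

lemma Union_stack_blocks:
  assumes "p \<in> diagrams k l" "q \<in> diagrams l m"
  shows "\<Union> (stack_blocks q p) = Inl ` {1..k} \<union> Inr ` Inl ` {1..l} \<union> Inr ` Inr ` {1..m}"
proof -
  have "\<Union> (stack_blocks q p) = map_sum id Inl ` \<Union> p \<union> Inr ` \<Union> q"
    unfolding stack_blocks_def by auto
  then show ?thesis unfolding Union_diagram[OF assms(1)] Union_diagram[OF assms(2)] points_def
    by (simp add: image_Un image_image Un_ac)
qed

lemma diagram_comp_diagram:
  assumes "p \<in> diagrams k l" "q \<in> diagrams l m"
  shows "diagram_comp q p \<in> diagrams k m"
proof -
  have "map_sum id Inr -` \<Union> (stack_blocks q p) = points k m"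
    unfolding Union_stack_blocks[OF assms] points_def
  proof (intro Set.set_eqI)
    fix x :: "nat + nat"
    show "x \<in> map_sum id Inr -` (Inl ` {1..k} \<union> Inr ` Inl ` {1..l} \<union> Inr ` Inr ` {1..m}) \<longleftrightarrow>
      x \<in> Inl ` {1..k} \<union> Inr ` {1..m}" by (cases x) auto
  qed
  then show ?thesis
    using partition_on_vimage[OF stack_components_partition[of q p], of "map_sum id Inr"]
    by (simp add: diagram_comp_def diagrams_def)
qed

context deligne
begin

text \<open>The middle points, listed in \<open>?ms\<close>, are integrated out of the connected
  components. Components made of middle points only give the factors \<open>t\<close>; what is left
  of the others, restricted to the outer points, is the composed diagram.\<close>

lemma pfun_comp:
  assumes p: "p \<in> diagrams k l" and q: "q \<in> diagrams l m" and len: "length xs = k" "length zs = m"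
  shows "intl l (\<lambda>ys. pfun k l p xs ys * pfun l m q ys zs) =
    t ^ middle_components q p * pfun k m (diagram_comp q p) xs zs"
proof -
  let ?C = "stack_components q p" and ?V = "\<Union> (stack_blocks q p)"
  let ?ms = "map (\<lambda>i. Inr (Inl (Suc i))) [0..<l] :: (nat + nat + nat) list"
  let ?v = "val3 xs [] zs"
  have V: "?V = Inl ` {1..k} \<union> Inr ` Inl ` {1..l} \<union> Inr ` Inr ` {1..m}" by (rule Union_stack_blocks[OF p q])
  have part: "partition_on ?V ?C" by (rule stack_components_partition)
  have fV: "finite ?V" unfolding V by simp
  have UC: "\<Union> ?C = ?V" using part by (simp add: partition_on_def)
  have ms: "set ?ms = Inr ` Inl ` {1..l}"
  proof -
    have "{1..l} = Suc ` {0..<l}" by (simp add: image_Suc_atLeastLessThan atLeastLessThanSuc_atLeastAtMost)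
    then show ?thesis by (simp only: image_image set_map set_upt)
  qed
  have eq: "upd ?v ?ms ys x = val3 xs ys zs x" if "length ys = l" "x \<in> ?V" for x ys
  proof (cases "x \<in> set ?ms")
    case True
    then obtain i where i: "i < l" "x = ?ms ! i" "x = Inr (Inl (Suc i))" by auto
    have "upd ?v ?ms ys x = ys ! i"
      unfolding i(2) by (rule upd_nth) (use i that in \<open>auto simp: distinct_map inj_on_def\<close>)
    then show ?thesis using i by (simp add: val3_def)
  next
    case False
    then show ?thesis using that(2) unfolding upd_notin[OF False] unfolding V ms by (auto simp: val3_def)
  qed
  have "intl l (\<lambda>ys. pfun k l p xs ys * pfun l m q ys zs) = intl l (\<lambda>ys. of_bool (compat ?C (upd ?v ?ms ys)))"
  proof (rule intl_cong)
    fix ys assume ys: "length (ys :: nat list) = l"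
    have "compat ?C (upd ?v ?ms ys) \<longleftrightarrow> compat ?C (val3 xs ys zs)"
      by (rule compat_cong) (use eq ys UC in auto)
    then show "pfun k l p xs ys * pfun l m q ys zs = of_bool (compat ?C (upd ?v ?ms ys))"
      unfolding compat_stack_components compat_stack_blocks pfun_def by (simp add: len ys)
  qed
  also have "\<dots> = t ^ card {B \<in> ?C. B \<subseteq> set ?ms} * of_bool (compat ((\<lambda>B. B - set ?ms) ` ?C - {{}}) ?v)"
  proof -
    have d: "distinct ?ms" by (simp add: distinct_map inj_on_def)
    have s: "set ?ms \<subseteq> \<Union> ?C" unfolding ms UC V by blast
    have l: "length ?ms = l" by simp
    show ?thesis
      using intl_compat[OF partition_onD2[OF part] finite_elements[OF fV part] partition_onD3[OF part] d s, of ?v]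
      unfolding l .
  qed
  also have "{B \<in> ?C. B \<subseteq> set ?ms} = {c \<in> ?C. map_sum id Inr -` c = {}}"
  proof (rule Collect_cong, rule conj_cong[OF refl])
    fix B assume "B \<in> ?C"
    then have sub: "B \<subseteq> ?V" using UC by auto
    show "B \<subseteq> set ?ms \<longleftrightarrow> map_sum id Inr -` B = {}"
    proof
      assume B: "B \<subseteq> set ?ms"
      show "map_sum id Inr -` B = {}"
      proof (rule equals0I)
        fix x assume "x \<in> map_sum id Inr -` B"
        then show False using B unfolding ms by (cases x) auto
      qed
    next
      assume e: "map_sum id Inr -` B = {}"
      show "B \<subseteq> set ?ms"
      proof
        fix x assume x: "x \<in> B"
        have "map_sum id Inr y \<notin> B" for y using e by auto
        from this[of "Inl _"] this[of "Inr _"] show "x \<in> set ?ms" using x sub unfolding V ms by auto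
      qed
    qed
  qed
  also have "compat ((\<lambda>B. B - set ?ms) ` ?C - {{}}) ?v \<longleftrightarrow> compat (diagram_comp q p) (val xs zs)"
  proof -
    have v: "?v (map_sum id Inr x) = val xs zs x" for x by (cases x) (auto simp: val3_def)
    have im: "\<exists>y. x = map_sum id Inr y" if "x \<in> ?V" "x \<notin> set ?ms" for x
    proof -
      have "x = map_sum id Inr (Inl a) \<or> x = map_sum id Inr (Inr b)" if "x = Inl a \<or> x = Inr (Inr b)" for a b
        using that by auto
      then show ?thesis using \<open>x \<in> ?V\<close> \<open>x \<notin> set ?ms\<close> unfolding V ms by blast
    qed
    have notin: "map_sum id Inr y \<notin> set ?ms" for y by (cases y) auto
    have "compat ((\<lambda>B. B - set ?ms) ` ?C - {{}}) ?v \<longleftrightarrow> (\<forall>B\<in>?C. \<forall>x\<in>B - set ?ms. \<forall>y\<in>B - set ?ms. ?v x = ?v y)"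
      unfolding compat_minus_empty by (simp add: compat_def)
    also have "\<dots> \<longleftrightarrow> (\<forall>B\<in>?C. \<forall>x\<in>map_sum id Inr -` B. \<forall>y\<in>map_sum id Inr -` B. val xs zs x = val xs zs y)"
    proof (rule ball_cong[OF refl])
      fix B assume "B \<in> ?C"
      then have e: "B - set ?ms = map_sum id Inr ` (map_sum id Inr -` B)" using UC im notin by blast
      show "(\<forall>x\<in>B - set ?ms. \<forall>y\<in>B - set ?ms. ?v x = ?v y) \<longleftrightarrow>
        (\<forall>x\<in>map_sum id Inr -` B. \<forall>y\<in>map_sum id Inr -` B. val xs zs x = val xs zs y)"
        unfolding e by (simp only: ball_simps v)
    qed
    also have "\<dots> \<longleftrightarrow> compat (diagram_comp q p) (val xs zs)"
      unfolding diagram_comp_def compat_minus_empty by (simp add: compat_def)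
    finally show ?thesis .
  qed
  finally show ?thesis by (simp only: middle_components_def pfun_def len simp_thms)
qed

lemma pmor_comp_hom: "f \<in> phom k l \<Longrightarrow> g \<in> phom l m \<Longrightarrow> pmor_comp t g f \<in> phom k m"
  unfolding pmor_comp_def by (intro phom_sum phom_single diagram_comp_diagram) (auto dest: phomD)

lemma dk_comp:
  assumes f: "f \<in> phom k l" and g: "g \<in> phom l m" and len: "length xs = k" "length zs = m"
  shows "dk k m (pmor_comp t g f) xs zs = intl l (\<lambda>ys. dk k l f xs ys * dk l m g ys zs)"
proof -
  have fs: "fs (\<lambda>ys. pfun k l p xs ys * pfun l m q ys zs)"
    if "p \<in> Poly_Mapping.keys f" "q \<in> Poly_Mapping.keys g" for p q
    using fs2D[OF fs2_pfun[OF phomD[OF f that(1)]], of "\<lambda>_. xs" "\<lambda>ys. ys"]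
      fs2D[OF fs2_pfun[OF phomD[OF g that(2)]], of "\<lambda>ys. ys" "\<lambda>_. zs"]
    by (intro fs_mult) (auto simp: eqm_id eqm_const)
  have "intl l (\<lambda>ys. dk k l f xs ys * dk l m g ys zs) =
    intl l (\<lambda>ys. \<Sum>q\<in>Poly_Mapping.keys g. \<Sum>p\<in>Poly_Mapping.keys f.
      (Poly_Mapping.lookup g q * Poly_Mapping.lookup f p) * (pfun k l p xs ys * pfun l m q ys zs))"
    unfolding dk_def sum_product by (subst sum.swap) (simp add: algebra_simps)
  also have "\<dots> = (\<Sum>q\<in>Poly_Mapping.keys g. \<Sum>p\<in>Poly_Mapping.keys f.
      (Poly_Mapping.lookup g q * Poly_Mapping.lookup f p) * intl l (\<lambda>ys. pfun k l p xs ys * pfun l m q ys zs))"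
    by (simp add: intl_sum intl_cmult fs fs_sum fs_mult fs_const)
  also have "\<dots> = dk k m (pmor_comp t g f) xs zs"
    unfolding pmor_comp_def dk_sum dk_single
    by (intro sum.cong refl) (auto simp: pfun_comp[OF phomD[OF f] phomD[OF g] len])
  finally show ?thesis by simp
qed

end

section \<open>Juxtaposition of diagrams multiplies kernels\<close>

lemma diagram_shift:
  assumes "p \<in> diagrams k l"
  shows "card (Inl -` \<Union> p) = k" "card (Inr -` \<Union> p) = l"
proof -
  have "Inl -` points k l = {1..k}" "Inr -` points k l = {1..l}" by (auto simp: points_def)
  then show "card (Inl -` \<Union> p) = k" "card (Inr -` \<Union> p) = l"
    unfolding Union_diagram[OF assms] by simp_all
qed

lemma diagram_tensor_diagram:
  assumes p: "p \<in> diagrams k l" and q: "q \<in> diagrams m n"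
  shows "diagram_tensor p q \<in> diagrams (k + m) (l + n)"
proof -
  let ?f = "map_sum ((+) k) ((+) l)"
  have inj: "inj ?f" by (intro sum.inj_map) auto
  have qd: "partition_on (points m n) q" and pd: "partition_on (points k l) p" using p q by (simp_all add: diagrams_def)
  have fp: "?f ` points m n \<inter> points k l = {}" by (auto simp: points_def)
  have un: "points k l \<union> ?f ` points m n = points (k + m) (l + n)"
  proof -
    have s: "{1..a} \<union> (+) a ` {1..b} = {1..a + b}" for a b :: nat
      unfolding image_add_atLeastAtMost by auto
    have "?f ` points m n = Inl ` (+) k ` {1..m} \<union> Inr ` (+) l ` {1..n}"
      unfolding points_def image_Un image_image map_sum.simps ..
    then have "points k l \<union> ?f ` points m n = Inl ` ({1..k} \<union> (+) k ` {1..m}) \<union> Inr ` ({1..l} \<union> (+) l ` {1..n})"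
      by (simp only: points_def[of k l] image_Un Un_ac)
    then show ?thesis by (simp only: s points_def)
  qed
  show ?thesis unfolding diagram_tensor_def diagram_shift[OF p] diagrams_def mem_Collect_eq
  proof (rule partition_onI)
    show "\<Union> (p \<union> (`) ?f ` q) = points (k + m) (l + n)"
      unfolding un[symmetric] partition_onD1[OF pd] partition_onD1[OF qd] by blast
  next
    show "{} \<notin> p \<union> (`) ?f ` q" using partition_onD3[OF pd] partition_onD3[OF qd] by blast
  next
    fix X Y assume XY: "X \<in> p \<union> (`) ?f ` q" "Y \<in> p \<union> (`) ?f ` q" "X \<noteq> Y"
    have mixed: "C \<inter> ?f ` D = {}" if "C \<in> p" "D \<in> q" for C D
      using fp that partition_onD1[OF pd] partition_onD1[OF qd] by blast
    have qq: "?f ` C \<inter> ?f ` D = {}" if "C \<in> q" "D \<in> q" "C \<noteq> D" for C D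
    proof -
      have "C \<inter> D = {}" using partition_onD2[OF qd] that unfolding disjoint_def by blast
      then show ?thesis using image_Int[OF inj, of C D] by simp
    qed
    have pp: "C \<inter> D = {}" if "C \<in> p" "D \<in> p" "C \<noteq> D" for C D
      using partition_onD2[OF pd] that unfolding disjoint_def by blast
    show "disjnt X Y" unfolding disjnt_def
    proof (cases "X \<in> p")
      case True
      show "X \<inter> Y = {}"
      proof (cases "Y \<in> p")
        case False
        then obtain D where "D \<in> q" "Y = ?f ` D" using XY by blast
        then show ?thesis using mixed[OF True] by simp
      qed (use pp True XY in blast)
    next
      case False
      then obtain C where C: "C \<in> q" "X = ?f ` C" using XY by blast
      show "X \<inter> Y = {}"
      proof (cases "Y \<in> p")
        case True
        then show ?thesis using mixed[OF True C(1)] C(2) by (simp add: Int_commute)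
      next
        case False
        then obtain D where "D \<in> q" "Y = ?f ` D" using XY by blast
        then show ?thesis using qq[of C D] C XY by blast
      qed
    qed
  qed
qed

lemma pfun_tensor:
  assumes p: "p \<in> diagrams k l" and q: "q \<in> diagrams m n"
    and len: "length xs = k" "length ys = l" "length xs' = m" "length ys' = n"
  shows "pfun (k + m) (l + n) (diagram_tensor p q) (xs @ xs') (ys @ ys') = pfun k l p xs ys * pfun m n q xs' ys'"
proof -
  have "compat p (val (xs @ xs') (ys @ ys')) \<longleftrightarrow> compat p (val xs ys)"
    by (rule compat_cong) (auto simp: Union_diagram[OF p] points_def nth_append len)
  moreover have "compat q (val (xs @ xs') (ys @ ys') \<circ> map_sum ((+) k) ((+) l)) \<longleftrightarrow> compat q (val xs' ys')"
    by (rule compat_cong) (auto simp: Union_diagram[OF q] points_def nth_append len)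
  ultimately show ?thesis
    unfolding pfun_def diagram_tensor_def diagram_shift[OF p] compat_Un compat_image by (simp add: len)
qed

lemma pmor_tensor_hom: "f \<in> phom k l \<Longrightarrow> g \<in> phom m n \<Longrightarrow> pmor_tensor f g \<in> phom (k + m) (l + n)"
  unfolding pmor_tensor_def by (intro phom_sum phom_single diagram_tensor_diagram) (auto dest: phomD)

lemma dk_tensor:
  assumes f: "f \<in> phom k l" and g: "g \<in> phom m n"
    and len: "length xs = k" "length ys = l" "length xs' = m" "length ys' = n"
  shows "dk (k + m) (l + n) (pmor_tensor f g) (xs @ xs') (ys @ ys') = dk k l f xs ys * dk m n g xs' ys'"
  unfolding pmor_tensor_def dk_sum dk_single
  by (simp add: dk_def sum_product)
     (intro sum.cong refl, simp add: pfun_tensor[OF phomD[OF f] phomD[OF g] len])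

lemma id_diagram: "id_diagram n \<in> diagrams n n"
  unfolding diagrams_def id_diagram_def by (auto simp: partition_on_def disjoint_def points_def)

lemma pfun_id: "pfun n n (id_diagram n) xs ys = of_bool (length xs = n \<and> xs = ys)"
proof -
  have "compat (id_diagram n) (val xs ys) \<longleftrightarrow> (\<forall>i\<in>{1..n}. xs ! (i - 1) = ys ! (i - 1))"
    by (simp add: compat_def id_diagram_def eq_commute[of "ys ! _"])
  also have "\<dots> \<longleftrightarrow> (\<forall>i<n. xs ! i = ys ! i)"
  proof (intro iffI allI impI ballI)
    fix i assume "\<forall>i\<in>{1..n}. xs ! (i - 1) = ys ! (i - 1)" "i < n"
    then show "xs ! i = ys ! i" by (auto dest!: bspec[of _ _ "Suc i"])
  qed auto
  finally show ?thesis unfolding pfun_def by (auto simp: list_eq_iff_nth_eq)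
qed

section \<open>Matrices of diagrams as kernels\<close>

abbreviation tl_obj :: "nat list \<Rightarrow> nat list \<Rightarrow> nat list" where
  "tl_obj As Bs \<equiv> concat (map (\<lambda>A. map ((+) A) Bs) As)"

definition ahom :: "nat list \<Rightarrow> nat list \<Rightarrow> pmor mat set" where
  "ahom As Bs = {M \<in> carrier_mat (length Bs) (length As).
     \<forall>i < length Bs. \<forall>j < length As. M $$ (i, j) \<in> phom (As ! j) (Bs ! i)}"

text \<open>The first argument is the source point, while matrices have their rows indexed by the
  target; hence the entry \<open>(r, s)\<close>.\<close>

fun kr :: "nat list \<Rightarrow> nat list \<Rightarrow> pmor mat \<Rightarrow> pt \<Rightarrow> pt \<Rightarrow> complex" where
  "kr As Bs M (Pt s xs) (Pt r ys) =
    (if s < length As \<and> r < length Bs then dk (As ! s) (Bs ! r) (M $$ (r, s)) xs ys else 0)"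

text \<open>By \<open>kr_kern\<close>, \<open>kr_eqI\<close> and \<open>kr_surj\<close> these are
  exactly the kernels of matrices, each of a unique one. From here on a morphism can be specified by
  writing down an invariant function.\<close>

definition kern :: "nat list \<Rightarrow> nat list \<Rightarrow> (pt \<Rightarrow> pt \<Rightarrow> complex) set" where
  "kern As Bs = {K. (\<forall>\<pi> a b. bij \<pi> \<longrightarrow> K (act \<pi> a) (act \<pi> b) = K a b) \<and>
     (\<forall>a b. K a b \<noteq> 0 \<longrightarrow> a \<in> pts As \<and> b \<in> pts Bs)}"

lemma kernI: "(\<And>\<pi> a b. bij \<pi> \<Longrightarrow> K (act \<pi> a) (act \<pi> b) = K a b) \<Longrightarrow>
    (\<And>a b. K a b \<noteq> 0 \<Longrightarrow> a \<in> pts As \<and> b \<in> pts Bs) \<Longrightarrow> K \<in> kern As Bs"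
  unfolding kern_def by blast

lemma kern_act: "K \<in> kern As Bs \<Longrightarrow> bij \<pi> \<Longrightarrow> K (act \<pi> a) (act \<pi> b) = K a b"
  unfolding kern_def by blast

lemma kern_supp: "K \<in> kern As Bs \<Longrightarrow> K a b \<noteq> 0 \<Longrightarrow> a \<in> pts As \<and> b \<in> pts Bs"
  unfolding kern_def by blast

lemma kern_0: "K \<in> kern As Bs \<Longrightarrow> \<not> (a \<in> pts As \<and> b \<in> pts Bs) \<Longrightarrow> K a b = 0"
  using kern_supp by blast

lemma fs2_kern: "K \<in> kern As Bs \<Longrightarrow> fs2 K"
  by (rule fs_inv) (simp add: kern_act)

lemma fs_kern: "K \<in> kern As Bs \<Longrightarrow> eqm f \<Longrightarrow> eqm g \<Longrightarrow> fs (\<lambda>x. K (f x) (g x))"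
  by (rule fs2D[OF fs2_kern])

lemma kr_kern: assumes "M \<in> ahom As Bs" shows "kr As Bs M \<in> kern As Bs"
proof (rule kernI)
  fix \<pi> :: "nat \<Rightarrow> nat" and a b assume "bij \<pi>"
  then show "kr As Bs M (act \<pi> a) (act \<pi> b) = kr As Bs M a b"
    using assms by (cases a; cases b) (auto simp: ahom_def dk_act bij_is_inj)
next
  fix a b assume "kr As Bs M a b \<noteq> 0"
  then show "a \<in> pts As \<and> b \<in> pts Bs"
    by (cases a; cases b) (auto dest: dk_length split: if_splits)
qed

lemma fs_kr: "M \<in> ahom As Bs \<Longrightarrow> eqm f \<Longrightarrow> eqm g \<Longrightarrow> fs (\<lambda>x. kr As Bs M (f x) (g x))"
  by (rule fs_kern[OF kr_kern])

lemma kr_eqI: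
  assumes M: "M \<in> ahom As Bs" and N: "N \<in> ahom As Bs"
    and eq: "\<And>a b. a \<in> pts As \<Longrightarrow> b \<in> pts Bs \<Longrightarrow> kr As Bs M a b = kr As Bs N a b"
  shows "M = N"
proof (rule eq_matI)
  fix r s assume "r < dim_row N" "s < dim_col N"
  then have rs: "r < length Bs" "s < length As" using N by (auto simp: ahom_def)
  show "M $$ (r, s) = N $$ (r, s)"
  proof (rule dk_eqI)
    show "M $$ (r, s) \<in> phom (As ! s) (Bs ! r)" "N $$ (r, s) \<in> phom (As ! s) (Bs ! r)"
      using M N rs by (auto simp: ahom_def)
    fix xs ys :: "nat list" assume "length xs = As ! s" "length ys = Bs ! r"
    then show "dk (As ! s) (Bs ! r) (M $$ (r, s)) xs ys = dk (As ! s) (Bs ! r) (N $$ (r, s)) xs ys"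
      using eq[of "Pt s xs" "Pt r ys"] rs by simp
  qed
qed (use M N in \<open>auto simp: ahom_def\<close>)

lemma kr_surj:
  assumes K: "K \<in> kern As Bs"
  obtains M where "M \<in> ahom As Bs" "kr As Bs M = K"
proof -
  have "\<exists>f. f \<in> phom (As ! s) (Bs ! r) \<and> (\<forall>xs ys. length xs = As ! s \<longrightarrow> length ys = Bs ! r \<longrightarrow>
    dk (As ! s) (Bs ! r) f xs ys = K (Pt s xs) (Pt r ys))" for s r
  proof -
    have inv: "K (Pt s (map \<pi> xs)) (Pt r (map \<pi> ys)) = K (Pt s xs) (Pt r ys)" if "bij \<pi>" for \<pi> xs ys
      using kern_act[OF K that, of "Pt s xs" "Pt r ys"] by simp
    show ?thesis
      by (rule dk_full[of "\<lambda>xs ys. K (Pt s xs) (Pt r ys)" "As ! s" "Bs ! r", OF inv]) auto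
  qed
  then obtain f where f: "\<And>s r. f s r \<in> phom (As ! s) (Bs ! r)" "\<And>s r xs ys. length xs = As ! s \<Longrightarrow> length ys = Bs ! r \<Longrightarrow>
    dk (As ! s) (Bs ! r) (f s r) xs ys = K (Pt s xs) (Pt r ys)"
    by metis
  define M where "M = mat (length Bs) (length As) (\<lambda>(r, s). f s r)"
  have M: "M \<in> ahom As Bs" using f(1) by (auto simp: ahom_def M_def)
  have "kr As Bs M a b = K a b" for a b
  proof (cases "a \<in> pts As \<and> b \<in> pts Bs")
    case True
    then show ?thesis using f(2) by (cases a; cases b) (auto simp: M_def)
  next
    case False
    then show ?thesis using kern_0[OF K] kern_0[OF kr_kern[OF M]] by metis
  qed
  then show thesis using that[OF M] by blast
qed

text \<open>The point of a tensor product made of two points; \<open>n\<close> is the number of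
  summands of the right factor, as required by the lexicographic order of summands.\<close>

definition pr :: "nat \<Rightarrow> pt \<Rightarrow> pt \<Rightarrow> pt" where
  "pr n a b = (case a of Pt s xs \<Rightarrow> case b of Pt r ys \<Rightarrow> Pt (s * n + r) (xs @ ys))"

lemma pr_Pt [simp]: "pr n (Pt s xs) (Pt r ys) = Pt (s * n + r) (xs @ ys)"
  by (simp add: pr_def)

lemma pr_act [simp]: "pr n (act \<pi> a) (act \<pi> b) = act \<pi> (pr n a b)"
  by (cases a; cases b) simp

lemma eqm_pr: "eqm f \<Longrightarrow> eqm g \<Longrightarrow> eqm (\<lambda>x. pr n (f x) (g x))"
  by (rule eqm_op) simp

lemmas fs_intros = fs_basic_intros eqm_pr

lemma length_tl_obj [simp]: "length (tl_obj As Bs) = length As * length Bs"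
  by (induction As) auto

lemma div_less_mult: "i < m * n \<Longrightarrow> i div n < m" for i m n :: nat
  by (simp add: less_mult_imp_div_less)

lemma idx_div [simp]: "r < n \<Longrightarrow> (s * n + r) div n = s" for s r n :: nat
  by (cases "n = 0") auto

lemma idx_less: "s < m \<Longrightarrow> r < n \<Longrightarrow> s * n + r < m * n" for s r m n :: nat
proof -
  assume "s < m" "r < n"
  then have "s * n + r < Suc s * n" "Suc s * n \<le> m * n" by (simp, intro mult_le_mono1, simp)
  then show ?thesis by simp
qed

lemma tl_obj_nth: "s < length As \<Longrightarrow> r < length Bs \<Longrightarrow> tl_obj As Bs ! (s * length Bs + r) = As ! s + Bs ! r"
proof (induction As arbitrary: s)
  case (Cons A As)
  then show ?case by (cases s) (auto simp: nth_append)
qed simp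

lemma pr_in_pts [simp]: "a \<in> pts As \<Longrightarrow> b \<in> pts Bs \<Longrightarrow> pr (length Bs) a b \<in> pts (tl_obj As Bs)"
  by (cases a; cases b) (simp add: idx_less tl_obj_nth del: length_concat)

lemma pts_tl_objE:
  assumes "c \<in> pts (tl_obj As Bs)"
  obtains a b where "a \<in> pts As" "b \<in> pts Bs" "c = pr (length Bs) a b"
proof (cases c)
  case (Pt i zs)
  let ?n = "length Bs" and ?s = "i div length Bs" and ?r = "i mod length Bs"
  have i: "i < length As * ?n" "length zs = tl_obj As Bs ! i" using assms by (auto simp: Pt simp del: length_concat)
  then have n: "?n > 0" by (cases ?n) auto
  have sr: "?s < length As" "?r < ?n" "?s * ?n + ?r = i" using i n by (auto simp: div_less_mult)
  then have l: "length zs = As ! ?s + Bs ! ?r" using tl_obj_nth[OF sr(1,2)] i by simp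
  show thesis
    by (rule that[of "Pt ?s (take (As ! ?s) zs)" "Pt ?r (drop (As ! ?s) zs)"]) (use sr l in \<open>auto simp: Pt\<close>)
qed

lemma pr_inj:
  assumes "a \<in> pts As" "b \<in> pts Bs" "a' \<in> pts As" "b' \<in> pts Bs" "pr (length Bs) a b = pr (length Bs) a' b'"
  shows "a = a' \<and> b = b'"
proof -
  obtain s xs r ys s' xs' r' ys' where P: "a = Pt s xs" "b = Pt r ys" "a' = Pt s' xs'" "b' = Pt r' ys'"
    by (metis pt.exhaust)
  let ?n = "length Bs"
  have e: "s * ?n + r = s' * ?n + r'" "xs @ ys = xs' @ ys'" and r: "r < ?n" "r' < ?n" using assms by (auto simp: P)
  have "?n > 0" using r by linarith
  then have "(s * ?n + r) div ?n = s" "(s * ?n + r) mod ?n = r" "(s' * ?n + r') div ?n = s'" "(s' * ?n + r') mod ?n = r'"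
    using r by auto
  then have "s = s'" "r = r'" using e by simp_all
  then show ?thesis using e assms by (auto simp: P)
qed

context deligne
begin

lemma intp_tl_obj:
  assumes "fs \<phi>"
  shows "intp (tl_obj As Bs) \<phi> = intp As (\<lambda>a. intp Bs (\<lambda>b. \<phi> (pr (length Bs) a b)))"
proof -
  let ?n = "length Bs" and ?g = "\<lambda>i. intl (tl_obj As Bs ! i) (\<lambda>zs. \<phi> (Pt i zs))"
  have "intp (tl_obj As Bs) \<phi> = sum ?g {..<length As * ?n}"
    unfolding intp_def by (simp only: length_tl_obj)
  also have "\<dots> = (\<Sum>s<length As. sum ?g {s * ?n..<s * ?n + ?n})"
    by (rule sum.nat_group[symmetric])
  also have "\<dots> = (\<Sum>s<length As. \<Sum>r<?n. ?g (s * ?n + r))"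
  proof (rule sum.cong[OF refl])
    fix s
    show "sum ?g {s * ?n..<s * ?n + ?n} = (\<Sum>r<?n. ?g (s * ?n + r))"
      using sum.shift_bounds_nat_ivl[of ?g 0 "s * ?n" ?n] by (simp add: lessThan_atLeast0 add.commute)
  qed
  also have "\<dots> = (\<Sum>s<length As. \<Sum>r<?n. intl (As ! s) (\<lambda>xs. intl (Bs ! r) (\<lambda>ys. \<phi> (Pt (s * ?n + r) (xs @ ys)))))"
    by (intro sum.cong refl) (simp add: tl_obj_nth intl_append)
  also have "\<dots> = (\<Sum>s<length As. intl (As ! s) (\<lambda>xs. \<Sum>r<?n. intl (Bs ! r) (\<lambda>ys. \<phi> (Pt (s * ?n + r) (xs @ ys)))))"
    by (intro sum.cong refl intl_sum[symmetric] fs_intl fs_eqm[OF assms] fs_intros)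
  finally show ?thesis unfolding intp_def by simp
qed

text \<open>Composition in diagrammatic order: the morphism with kernel \<open>K\<close> is applied
  first, in contrast to \<open>comp_mor\<close>.\<close>

definition kc :: "nat list \<Rightarrow> (pt \<Rightarrow> pt \<Rightarrow> complex) \<Rightarrow> (pt \<Rightarrow> pt \<Rightarrow> complex) \<Rightarrow> pt \<Rightarrow> pt \<Rightarrow> complex" where
  "kc Bs K L a c = intp Bs (\<lambda>b. K a b * L b c)"

lemma fs_kc: assumes "fs2 K" "fs2 L" "eqm f" "eqm g" shows "fs (\<lambda>x. kc Bs K L (f x) (g x))"
  unfolding kc_def
  by (intro fs_intp fs_mult fs2D[OF assms(1)] fs2D[OF assms(2)] eqm_o[OF assms(3)] eqm_o[OF assms(4)] fs_intros)

lemma kc_assoc: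
  assumes K: "fs2 K" and L: "fs2 L" and M: "fs2 M"
  shows "kc Cs (kc Bs K L) M a d = kc Bs K (kc Cs L M) a d"
proof -
  have "kc Cs (kc Bs K L) M a d = intp Cs (\<lambda>c. intp Bs (\<lambda>b. K a b * L b c * M c d))"
    unfolding kc_def
    by (intro intp_cong intp_multc[symmetric] fs_mult fs2D[OF K] fs2D[OF L] fs_intros)
  also have "\<dots> = intp Bs (\<lambda>b. intp Cs (\<lambda>c. K a b * L b c * M c d))"
    by (intro intp_swap fs_mult fs2D[OF K] fs2D[OF L] fs2D[OF M] fs_intros)
  also have "\<dots> = kc Bs K (kc Cs L M) a d"
    unfolding kc_def mult.assoc
    by (intro intp_cong intp_cmult fs_mult fs2D[OF L] fs2D[OF M] fs_intros)
  finally show ?thesis .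
qed

lemma kc_kern: assumes K: "K \<in> kern As Bs" and L: "L \<in> kern Bs Cs" shows "kc Bs K L \<in> kern As Cs"
proof (rule kernI)
  fix \<pi> :: "nat \<Rightarrow> nat" and a c assume \<pi>: "bij \<pi>"
  show "kc Bs K L (act \<pi> a) (act \<pi> c) = kc Bs K L a c"
    using intp_act[OF \<pi>, of Bs "\<lambda>b. K (act \<pi> a) b * L b (act \<pi> c)"]
    by (simp add: kc_def kern_act[OF K \<pi>] kern_act[OF L \<pi>])
next
  fix a c assume ne: "kc Bs K L a c \<noteq> 0"
  show "a \<in> pts As \<and> c \<in> pts Cs"
  proof (rule ccontr)
    assume "\<not> (a \<in> pts As \<and> c \<in> pts Cs)"
    then have "K a b * L b c = 0" for b using kern_supp[OF K, of a b] kern_supp[OF L, of b c] by auto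
    then have "kc Bs K L a c = intp Bs (\<lambda>b. 0)" unfolding kc_def by (intro intp_cong)
    then show False using ne by simp
  qed
qed

definition idk :: "nat list \<Rightarrow> pt \<Rightarrow> pt \<Rightarrow> complex" where
  "idk As a b = of_bool (a = b \<and> a \<in> pts As)"

lemma idk_kern: "idk As \<in> kern As As"
  by (rule kernI) (auto simp: idk_def)

lemma kc_idk_left: "K \<in> kern As Bs \<Longrightarrow> kc As (idk As) K = K"
proof (intro ext)
  fix a b assume K: "K \<in> kern As Bs"
  have "kc As (idk As) K a b = intp As (\<lambda>c. if c = a then K c b else 0)"
    unfolding kc_def by (rule intp_cong) (auto simp: idk_def)
  then show "kc As (idk As) K a b = K a b" using kern_0[OF K, of a b] by (simp add: intp_delta)
qed

lemma kc_idk_right: "K \<in> kern As Bs \<Longrightarrow> kc Bs K (idk Bs) = K"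
proof (intro ext)
  fix a b assume K: "K \<in> kern As Bs"
  have "kc Bs K (idk Bs) a b = intp Bs (\<lambda>c. if c = b then K a c else 0)"
    unfolding kc_def by (rule intp_cong) (auto simp: idk_def)
  then show "kc Bs K (idk Bs) a b = K a b" using kern_0[OF K, of a b] by (simp add: intp_delta)
qed

section \<open>The additive envelope\<close>

abbreviation "CA \<equiv> Rep_S_add t"

lemma CA_simps [simp]:
  "objects CA = UNIV" "homs CA As Bs = ahom As Bs" "tens_obj CA As Bs = tl_obj As Bs"
  "unit_obj CA = [0]" "plus_mor CA = (+)" "zero_mor CA As Bs = 0\<^sub>m (length Bs) (length As)"
  by (auto simp: Rep_S_add_def additive_envelope_def partition_category_def ahom_def phom_def)

lemma CA_comp: "comp_mor CA G F = mat (dim_row G) (dim_col F)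
        (\<lambda>(i, j). \<Sum>k < dim_col G. pmor_comp t (G $$ (i, k)) (F $$ (k, j)))"
  by (simp add: Rep_S_add_def additive_envelope_def partition_category_def cong: if_cong)

lemma CA_tens: "tens_mor CA F G = mat (dim_row F * dim_row G) (dim_col F * dim_col G)
        (\<lambda>(i, j). pmor_tensor (F $$ (i div dim_row G, j div dim_col G))
                             (G $$ (i mod dim_row G, j mod dim_col G)))"
  by (simp add: Rep_S_add_def additive_envelope_def partition_category_def cong: if_cong)

lemma CA_id: "ident CA As = mat (length As) (length As)
        (\<lambda>(i, j). if i = j then of_diagram (id_diagram (As ! i)) else 0)"
  by (simp add: Rep_S_add_def additive_envelope_def partition_category_def cong: if_cong)

lemma ahom_dim: "M \<in> ahom As Bs \<Longrightarrow> dim_row M = length Bs \<and> dim_col M = length As"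
  by (auto simp: ahom_def)

lemma ahom_entry: "M \<in> ahom As Bs \<Longrightarrow> r < length Bs \<Longrightarrow> s < length As \<Longrightarrow> M $$ (r, s) \<in> phom (As ! s) (Bs ! r)"
  by (auto simp: ahom_def)

lemma comp_ahom: assumes F: "F \<in> ahom As Bs" and G: "G \<in> ahom Bs Cs" shows "comp_mor CA G F \<in> ahom As Cs"
  unfolding CA_comp ahom_def using ahom_dim[OF F] ahom_dim[OF G]
  by (auto intro!: phom_sum pmor_comp_hom[OF ahom_entry[OF F] ahom_entry[OF G]])

lemma kr_comp:
  assumes F: "F \<in> ahom As Bs" and G: "G \<in> ahom Bs Cs"
  shows "kr As Cs (comp_mor CA G F) = kc Bs (kr As Bs F) (kr Bs Cs G)"
proof (intro ext)
  fix a c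
  show "kr As Cs (comp_mor CA G F) a c = kc Bs (kr As Bs F) (kr Bs Cs G) a c"
  proof (cases "a \<in> pts As \<and> c \<in> pts Cs")
    case True
    then obtain s xs q zs where P: "a = Pt s xs" "s < length As" "length xs = As ! s"
      "c = Pt q zs" "q < length Cs" "length zs = Cs ! q"
      by (auto simp: pts_def)
    have "kr As Cs (comp_mor CA G F) a c = (\<Sum>r<length Bs. dk (As ! s) (Cs ! q) (pmor_comp t (G $$ (q, r)) (F $$ (r, s))) xs zs)"
      using P ahom_dim[OF F] ahom_dim[OF G] by (simp add: CA_comp dk_sum)
    also have "\<dots> = (\<Sum>r<length Bs. intl (Bs ! r) (\<lambda>ys. dk (As ! s) (Bs ! r) (F $$ (r, s)) xs ys * dk (Bs ! r) (Cs ! q) (G $$ (q, r)) ys zs))"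
      using P by (intro sum.cong refl dk_comp ahom_entry[OF F] ahom_entry[OF G]) auto
    also have "\<dots> = kc Bs (kr As Bs F) (kr Bs Cs G) a c"
      unfolding kc_def intp_def using P by simp
    finally show ?thesis .
  next
    case False
    then show ?thesis using kern_0[OF kr_kern[OF comp_ahom[OF F G]]] kern_0[OF kc_kern[OF kr_kern[OF F] kr_kern[OF G]]] by metis
  qed
qed

lemma tens_ahom: assumes F: "F \<in> ahom As Bs" and G: "G \<in> ahom Cs Ds"
  shows "tens_mor CA F G \<in> ahom (tl_obj As Cs) (tl_obj Bs Ds)"
proof -
  have "pmor_tensor (F $$ (i div length Ds, j div length Cs)) (G $$ (i mod length Ds, j mod length Cs))
    \<in> phom (tl_obj As Cs ! j) (tl_obj Bs Ds ! i)"
    if "i < length Bs * length Ds" "j < length As * length Cs" for i j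
  proof -
    have "length Ds > 0" "length Cs > 0" using that by (cases "length Ds"; cases "length Cs"; simp)+
    then have ij: "i div length Ds < length Bs" "i mod length Ds < length Ds" "j div length Cs < length As" "j mod length Cs < length Cs"
      using that by (auto simp: div_less_mult)
    show ?thesis
      using pmor_tensor_hom[OF ahom_entry[OF F ij(1,3)] ahom_entry[OF G ij(2,4)]]
        tl_obj_nth[OF ij(3,4)] tl_obj_nth[OF ij(1,2)] by simp
  qed
  then show ?thesis
    unfolding CA_tens ahom_def using ahom_dim[OF F] ahom_dim[OF G] by (simp del: length_concat)
qed

lemma kr_tens:
  assumes F: "F \<in> ahom As Bs" and G: "G \<in> ahom Cs Ds"
    and p: "a \<in> pts As" "b \<in> pts Bs" "c \<in> pts Cs" "d \<in> pts Ds"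
  shows "kr (tl_obj As Cs) (tl_obj Bs Ds) (tens_mor CA F G) (pr (length Cs) a c) (pr (length Ds) b d) =
    kr As Bs F a b * kr Cs Ds G c d"
proof -
  obtain s xs where a: "a = Pt s xs" "s < length As" "length xs = As ! s" using p(1) by (auto simp: pts_def)
  obtain r ys where b: "b = Pt r ys" "r < length Bs" "length ys = Bs ! r" using p(2) by (auto simp: pts_def)
  obtain s' xs' where c: "c = Pt s' xs'" "s' < length Cs" "length xs' = Cs ! s'" using p(3) by (auto simp: pts_def)
  obtain r' ys' where d: "d = Pt r' ys'" "r' < length Ds" "length ys' = Ds ! r'" using p(4) by (auto simp: pts_def)
  have i: "s * length Cs + s' < length As * length Cs" "r * length Ds + r' < length Bs * length Ds"
    using a b c d by (auto intro: idx_less)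
  show ?thesis
    using i ahom_dim[OF F] ahom_dim[OF G] a b c d
      dk_tensor[OF ahom_entry[OF F b(2) a(2)] ahom_entry[OF G d(2) c(2)] a(3) b(3) c(3) d(3)]
    by (simp add: CA_tens tl_obj_nth del: length_concat)
qed

lemma id_ahom: "ident CA As \<in> ahom As As"
  by (auto simp: CA_id ahom_def phom_single phom_0 id_diagram)

lemma kr_id: "kr As As (ident CA As) = idk As"
proof (intro ext)
  fix a b show "kr As As (ident CA As) a b = idk As a b"
    by (cases a; cases b) (auto simp: CA_id idk_def dk_single pfun_id)
qed

lemma plus_ahom: "F \<in> ahom As Bs \<Longrightarrow> G \<in> ahom As Bs \<Longrightarrow> F + G \<in> ahom As Bs"
  by (auto simp: ahom_def intro!: phom_add)

lemma kr_plus: "F \<in> ahom As Bs \<Longrightarrow> G \<in> ahom As Bs \<Longrightarrow> kr As Bs (F + G) a b = kr As Bs F a b + kr As Bs G a b"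
  by (cases a; cases b) (auto simp: ahom_def dk_add)

lemma zero_ahom: "0\<^sub>m (length Bs) (length As) \<in> ahom As Bs"
  by (auto simp: ahom_def phom_0)

lemma kr_zero: "kr As Bs (0\<^sub>m (length Bs) (length As)) a b = 0"
  by (cases a; cases b) auto

lemma kr_tens_eqI:
  assumes "M \<in> ahom (tl_obj As Cs) (tl_obj Bs Ds)" "N \<in> ahom (tl_obj As Cs) (tl_obj Bs Ds)"
    and "\<And>a b c d. a \<in> pts As \<Longrightarrow> b \<in> pts Bs \<Longrightarrow> c \<in> pts Cs \<Longrightarrow> d \<in> pts Ds \<Longrightarrow>
      kr (tl_obj As Cs) (tl_obj Bs Ds) M (pr (length Cs) a c) (pr (length Ds) b d) =
      kr (tl_obj As Cs) (tl_obj Bs Ds) N (pr (length Cs) a c) (pr (length Ds) b d)"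
  shows "M = N"
proof (rule kr_eqI[OF assms(1,2)])
  fix x y assume "x \<in> pts (tl_obj As Cs)" "y \<in> pts (tl_obj Bs Ds)"
  then show "kr (tl_obj As Cs) (tl_obj Bs Ds) M x y = kr (tl_obj As Cs) (tl_obj Bs Ds) N x y"
    using assms(3) by (elim pts_tl_objE) simp
qed

lemma tl_obj_assoc: "tl_obj (tl_obj As Bs) Cs = tl_obj As (tl_obj Bs Cs)"
proof (induction As)
  case (Cons A As)
  have "tl_obj (map ((+) A) Bs) Cs = map ((+) A) (tl_obj Bs Cs)"
    by (induction Bs) (auto simp: add.assoc)
  then show ?case using Cons by simp
qed simp

lemma map_plus_0 [simp]: "map ((+) (0::nat)) xs = xs"
  by (simp add: map_idI)

lemma tl_obj_unit [simp]: "tl_obj [0] As = As" "tl_obj As [0] = As"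
  by (induction As) (auto simp: map_idI)

lemma pr_assoc: "pr (length Cs) (pr (length Bs) a b) c = pr (length (tl_obj Bs Cs)) a (pr (length Cs) b c)"
  by (cases a; cases b; cases c) (simp add: algebra_simps del: length_concat)

lemma CA_tens_id: "tens_mor CA (ident CA As) (ident CA Bs) = ident CA (tl_obj As Bs)"
proof (rule kr_tens_eqI)
  fix a b c d assume p: "a \<in> pts As" "b \<in> pts As" "c \<in> pts Bs" "d \<in> pts Bs"
  then show "kr (tl_obj As Bs) (tl_obj As Bs) (tens_mor CA (ident CA As) (ident CA Bs)) (pr (length Bs) a c) (pr (length Bs) b d) =
    kr (tl_obj As Bs) (tl_obj As Bs) (ident CA (tl_obj As Bs)) (pr (length Bs) a c) (pr (length Bs) b d)"
    unfolding kr_tens[OF id_ahom id_ahom p] kr_id idk_def using pr_inj[OF p(1,3,2,4)] by auto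
qed (intro tens_ahom id_ahom)+

text \<open>Kernels of tensor products are products of kernels, so the integral over the middle
  tensor product splits into a product of two integrals.\<close>

lemma CA_interchange:
  assumes F: "F \<in> ahom As Bs" and G: "G \<in> ahom Bs Cs" and F': "F' \<in> ahom As' Bs'" and G': "G' \<in> ahom Bs' Cs'"
  shows "comp_mor CA (tens_mor CA G G') (tens_mor CA F F') = tens_mor CA (comp_mor CA G F) (comp_mor CA G' F')"
proof (rule kr_tens_eqI)
  show "comp_mor CA (tens_mor CA G G') (tens_mor CA F F') \<in> ahom (tl_obj As As') (tl_obj Cs Cs')"
    by (intro comp_ahom[OF tens_ahom[OF F F'] tens_ahom[OF G G']])
  show "tens_mor CA (comp_mor CA G F) (comp_mor CA G' F') \<in> ahom (tl_obj As As') (tl_obj Cs Cs')"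
    by (intro tens_ahom comp_ahom[OF F G] comp_ahom[OF F' G'])
  fix a c a' c' assume p: "a \<in> pts As" "c \<in> pts Cs" "a' \<in> pts As'" "c' \<in> pts Cs'"
  let ?x = "pr (length As') a a'" and ?z = "pr (length Cs') c c'"
  have "kr (tl_obj As As') (tl_obj Cs Cs') (comp_mor CA (tens_mor CA G G') (tens_mor CA F F')) ?x ?z =
    intp (tl_obj Bs Bs') (\<lambda>y. kr (tl_obj As As') (tl_obj Bs Bs') (tens_mor CA F F') ?x y *
      kr (tl_obj Bs Bs') (tl_obj Cs Cs') (tens_mor CA G G') y ?z)"
    unfolding kr_comp[OF tens_ahom[OF F F'] tens_ahom[OF G G']] kc_def ..
  also have "\<dots> = intp Bs (\<lambda>b. intp Bs' (\<lambda>b'. kr (tl_obj As As') (tl_obj Bs Bs') (tens_mor CA F F') ?x (pr (length Bs') b b') *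
      kr (tl_obj Bs Bs') (tl_obj Cs Cs') (tens_mor CA G G') (pr (length Bs') b b') ?z))"
    by (intro intp_tl_obj fs_mult fs_kr[OF tens_ahom[OF F F']] fs_kr[OF tens_ahom[OF G G']] fs_intros)
  also have "\<dots> = intp Bs (\<lambda>b. intp Bs' (\<lambda>b'. (kr As Bs F a b * kr Bs Cs G b c) * (kr As' Bs' F' a' b' * kr Bs' Cs' G' b' c')))"
    by (intro intp_cong) (simp add: kr_tens[OF F F'] kr_tens[OF G G'] p mult_ac)
  also have "\<dots> = kc Bs (kr As Bs F) (kr Bs Cs G) a c * kc Bs' (kr As' Bs' F') (kr Bs' Cs' G') a' c'"
    unfolding kc_def
    by (subst intp_cmult, intro fs_mult fs_kr[OF F'] fs_kr[OF G'] fs_intros)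
       (rule intp_multc, intro fs_mult fs_kr[OF F] fs_kr[OF G] fs_intros)
  also have "\<dots> = kr (tl_obj As As') (tl_obj Cs Cs') (tens_mor CA (comp_mor CA G F) (comp_mor CA G' F')) ?x ?z"
    unfolding kr_tens[OF comp_ahom[OF F G] comp_ahom[OF F' G'] p] kr_comp[OF F G] kr_comp[OF F' G'] ..
  finally show "kr (tl_obj As As') (tl_obj Cs Cs') (comp_mor CA (tens_mor CA G G') (tens_mor CA F F')) ?x ?z =
    kr (tl_obj As As') (tl_obj Cs Cs') (tens_mor CA (comp_mor CA G F) (comp_mor CA G' F')) ?x ?z" .
qed

lemma CA_assoc:
  assumes F: "F \<in> ahom As Bs" and G: "G \<in> ahom Bs Cs" and H: "H \<in> ahom Cs Ds"
  shows "comp_mor CA H (comp_mor CA G F) = comp_mor CA (comp_mor CA H G) F"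
proof (rule kr_eqI)
  fix a d
  show "kr As Ds (comp_mor CA H (comp_mor CA G F)) a d = kr As Ds (comp_mor CA (comp_mor CA H G) F) a d"
    unfolding kr_comp[OF F comp_ahom[OF G H]] kr_comp[OF comp_ahom[OF F G] H] kr_comp[OF F G] kr_comp[OF G H]
    by (rule kc_assoc) (rule fs2_kern kr_kern F G H)+
qed (rule comp_ahom F G H)+

lemma CA_id_left: "F \<in> ahom As Bs \<Longrightarrow> comp_mor CA (ident CA Bs) F = F"
  by (rule kr_eqI) (auto simp: kr_comp[OF _ id_ahom] kr_id kc_idk_right[OF kr_kern] intro: comp_ahom id_ahom)

lemma CA_id_right: "F \<in> ahom As Bs \<Longrightarrow> comp_mor CA F (ident CA As) = F"
  by (rule kr_eqI) (auto simp: kr_comp[OF id_ahom] kr_id kc_idk_left[OF kr_kern] intro: comp_ahom id_ahom)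

lemma CA_tens_assoc:
  assumes F: "F \<in> ahom As As'" and G: "G \<in> ahom Bs Bs'" and H: "H \<in> ahom Cs Cs'"
  shows "tens_mor CA (tens_mor CA F G) H = tens_mor CA F (tens_mor CA G H)"
proof (rule kr_eqI)
  let ?S = "tl_obj (tl_obj As Bs) Cs" and ?T = "tl_obj (tl_obj As' Bs') Cs'"
  show "tens_mor CA (tens_mor CA F G) H \<in> ahom ?S ?T" by (intro tens_ahom F G H)
  show "tens_mor CA F (tens_mor CA G H) \<in> ahom ?S ?T"
    unfolding tl_obj_assoc by (intro tens_ahom F G H)
  fix x y assume "x \<in> pts ?S" "y \<in> pts ?T"
  then obtain a b c a' b' c' where p: "a \<in> pts As" "b \<in> pts Bs" "c \<in> pts Cs" "a' \<in> pts As'" "b' \<in> pts Bs'" "c' \<in> pts Cs'"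
    and x: "x = pr (length Cs) (pr (length Bs) a b) c" and y: "y = pr (length Cs') (pr (length Bs') a' b') c'"
    by (elim pts_tl_objE) blast
  have "kr ?S ?T (tens_mor CA (tens_mor CA F G) H) x y = kr As As' F a a' * kr Bs Bs' G b b' * kr Cs Cs' H c c'"
    unfolding x y using p by (simp add: kr_tens[OF tens_ahom[OF F G] H] kr_tens[OF F G] del: length_concat)
  also have "\<dots> = kr ?S ?T (tens_mor CA F (tens_mor CA G H)) x y"
    unfolding x y pr_assoc tl_obj_assoc kr_tens[OF F tens_ahom[OF G H] p(1,4) pr_in_pts[OF p(2,3)] pr_in_pts[OF p(5,6)]]
      kr_tens[OF G H p(2,5,3,6)] mult.assoc ..
  finally show "kr ?S ?T (tens_mor CA (tens_mor CA F G) H) x y = kr ?S ?T (tens_mor CA F (tens_mor CA G H)) x y" .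
qed

lemma pr_unit: "c \<in> pts [0] \<Longrightarrow> pr n c a = a" "c \<in> pts [0] \<Longrightarrow> pr (Suc 0) a c = a"
  by (cases c; cases a; simp)+

lemma idk_unit: "c \<in> pts [0] \<Longrightarrow> d \<in> pts [0] \<Longrightarrow> idk [0] c d = 1"
  by (cases c; cases d) (simp add: idk_def)

lemma CA_tens_unit:
  assumes F: "F \<in> ahom As Bs"
  shows "tens_mor CA (ident CA [0]) F = F" "tens_mor CA F (ident CA [0]) = F"
proof -
  have "Pt 0 [] \<in> pts [0]" by simp
  show "tens_mor CA (ident CA [0]) F = F"
  proof (rule kr_eqI)
    show "tens_mor CA (ident CA [0]) F \<in> ahom As Bs" using tens_ahom[OF id_ahom F, of "[0]"] by simp
    fix a b assume p: "a \<in> pts As" "b \<in> pts Bs"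
    show "kr As Bs (tens_mor CA (ident CA [0]) F) a b = kr As Bs F a b"
      using kr_tens[OF id_ahom F, of "Pt 0 []" "[0]" "Pt 0 []" a b] p
      by (simp add: pr_unit kr_id idk_unit)
  qed (rule F)
  show "tens_mor CA F (ident CA [0]) = F"
  proof (rule kr_eqI)
    show "tens_mor CA F (ident CA [0]) \<in> ahom As Bs" using tens_ahom[OF F id_ahom, of "[0]"] by simp
    fix a b assume p: "a \<in> pts As" "b \<in> pts Bs"
    show "kr As Bs (tens_mor CA F (ident CA [0])) a b = kr As Bs F a b"
      using kr_tens[OF F id_ahom, of a b "Pt 0 []" "[0]" "Pt 0 []"] p
      by (simp add: pr_unit kr_id idk_unit)
  qed (rule F)
qed

end

section \<open>Half-braidings in strict monoidal categories\<close>

text \<open>Stated for an abstract strict monoidal category because it is used twice: for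
  \<open>CA\<close>, to obtain the Karoubi envelope, and then for \<open>RS\<close>, whose
  half-braidings are studied.\<close>

locale smcat =
  fixes C :: "('o, 'm) additive_smcat"
  assumes id_in: "A \<in> objects C \<Longrightarrow> ident C A \<in> homs C A A"
    and comp_in: "f \<in> homs C A B \<Longrightarrow> g \<in> homs C B D \<Longrightarrow> A \<in> objects C \<Longrightarrow> B \<in> objects C \<Longrightarrow> D \<in> objects C \<Longrightarrow>
      comp_mor C g f \<in> homs C A D"
    and comp_assoc: "f \<in> homs C A B \<Longrightarrow> g \<in> homs C B D \<Longrightarrow> h \<in> homs C D E \<Longrightarrow>
      A \<in> objects C \<Longrightarrow> B \<in> objects C \<Longrightarrow> D \<in> objects C \<Longrightarrow> E \<in> objects C \<Longrightarrow>
      comp_mor C h (comp_mor C g f) = comp_mor C (comp_mor C h g) f"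
    and id_left: "f \<in> homs C A B \<Longrightarrow> A \<in> objects C \<Longrightarrow> B \<in> objects C \<Longrightarrow> comp_mor C (ident C B) f = f"
    and id_right: "f \<in> homs C A B \<Longrightarrow> A \<in> objects C \<Longrightarrow> B \<in> objects C \<Longrightarrow> comp_mor C f (ident C A) = f"
    and tobj: "A \<in> objects C \<Longrightarrow> B \<in> objects C \<Longrightarrow> tens_obj C A B \<in> objects C"
    and tmor: "f \<in> homs C A B \<Longrightarrow> g \<in> homs C A' B' \<Longrightarrow> A \<in> objects C \<Longrightarrow> B \<in> objects C \<Longrightarrow>
      A' \<in> objects C \<Longrightarrow> B' \<in> objects C \<Longrightarrow> tens_mor C f g \<in> homs C (tens_obj C A A') (tens_obj C B B')"
    and tobj_assoc: "A \<in> objects C \<Longrightarrow> B \<in> objects C \<Longrightarrow> D \<in> objects C \<Longrightarrow>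
      tens_obj C (tens_obj C A B) D = tens_obj C A (tens_obj C B D)"
    and tmor_assoc: "f \<in> homs C A A' \<Longrightarrow> g \<in> homs C B B' \<Longrightarrow> h \<in> homs C D D' \<Longrightarrow>
      A \<in> objects C \<Longrightarrow> A' \<in> objects C \<Longrightarrow> B \<in> objects C \<Longrightarrow> B' \<in> objects C \<Longrightarrow> D \<in> objects C \<Longrightarrow> D' \<in> objects C \<Longrightarrow>
      tens_mor C (tens_mor C f g) h = tens_mor C f (tens_mor C g h)"
    and unit_in: "unit_obj C \<in> objects C"
    and unit_tobj: "A \<in> objects C \<Longrightarrow> tens_obj C (unit_obj C) A = A" "A \<in> objects C \<Longrightarrow> tens_obj C A (unit_obj C) = A"
    and unit_tmor: "f \<in> homs C A B \<Longrightarrow> A \<in> objects C \<Longrightarrow> B \<in> objects C \<Longrightarrow> tens_mor C (ident C (unit_obj C)) f = f"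
      "f \<in> homs C A B \<Longrightarrow> A \<in> objects C \<Longrightarrow> B \<in> objects C \<Longrightarrow> tens_mor C f (ident C (unit_obj C)) = f"
    and tid: "A \<in> objects C \<Longrightarrow> B \<in> objects C \<Longrightarrow> tens_mor C (ident C A) (ident C B) = ident C (tens_obj C A B)"
    and interchange: "f \<in> homs C A B \<Longrightarrow> g \<in> homs C B D \<Longrightarrow> f' \<in> homs C A' B' \<Longrightarrow> g' \<in> homs C B' D' \<Longrightarrow>
      A \<in> objects C \<Longrightarrow> B \<in> objects C \<Longrightarrow> D \<in> objects C \<Longrightarrow> A' \<in> objects C \<Longrightarrow> B' \<in> objects C \<Longrightarrow> D' \<in> objects C \<Longrightarrow>
      comp_mor C (tens_mor C g g') (tens_mor C f f') = tens_mor C (comp_mor C g f) (comp_mor C g' f')"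
begin

abbreviation comp_syntax (infixr \<open>\<cdot>\<close> 70) where "g \<cdot> f \<equiv> comp_mor C g f"
abbreviation tens_syntax (infixr \<open>\<star>\<close> 75) where "f \<star> g \<equiv> tens_mor C f g"
abbreviation tobj_syntax (infixr \<open>\<box>\<close> 75) where "A \<box> B \<equiv> tens_obj C A B"
abbreviation id_syntax (\<open>\<I>\<close>) where "\<I> A \<equiv> ident C A"
abbreviation "Ob \<equiv> objects C"

lemma is_iso_comp:
  assumes "is_iso C A B f" "is_iso C B D g" and o: "A \<in> Ob" "B \<in> Ob" "D \<in> Ob"
  shows "is_iso C A D (g \<cdot> f)"
proof -
  obtain f' g' where f: "f \<in> homs C A B" "f' \<in> homs C B A" "f' \<cdot> f = \<I> A" "f \<cdot> f' = \<I> B"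
    and g: "g \<in> homs C B D" "g' \<in> homs C D B" "g' \<cdot> g = \<I> B" "g \<cdot> g' = \<I> D"
    using assms(1,2) by (auto simp: is_iso_def)
  have "(f' \<cdot> g') \<cdot> (g \<cdot> f) = f' \<cdot> ((g' \<cdot> g) \<cdot> f)"
    using comp_assoc[OF comp_in[OF f(1) g(1)] g(2) f(2)] comp_assoc[OF f(1) g(1) g(2)] f g o by simp
  then have 1: "(f' \<cdot> g') \<cdot> (g \<cdot> f) = \<I> A" using f g o by (simp add: id_left)
  have "(g \<cdot> f) \<cdot> (f' \<cdot> g') = g \<cdot> ((f \<cdot> f') \<cdot> g')"
    using comp_assoc[OF comp_in[OF g(2) f(2)] f(1) g(1)] comp_assoc[OF g(2) f(2) f(1)] f g o by simp
  then have 2: "(g \<cdot> f) \<cdot> (f' \<cdot> g') = \<I> D" using f g o by (simp add: id_left)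
  show ?thesis unfolding is_iso_def
    using 1 2 comp_in[OF f(1) g(1)] comp_in[OF g(2) f(2)] o by blast
qed

lemma is_iso_tens:
  assumes "is_iso C A B f" "is_iso C A' B' g" and o: "A \<in> Ob" "B \<in> Ob" "A' \<in> Ob" "B' \<in> Ob"
  shows "is_iso C (A \<box> A') (B \<box> B') (f \<star> g)"
proof -
  obtain f' g' where f: "f \<in> homs C A B" "f' \<in> homs C B A" "f' \<cdot> f = \<I> A" "f \<cdot> f' = \<I> B"
    and g: "g \<in> homs C A' B'" "g' \<in> homs C B' A'" "g' \<cdot> g = \<I> A'" "g \<cdot> g' = \<I> B'"
    using assms(1,2) by (auto simp: is_iso_def)
  have "(f' \<star> g') \<cdot> (f \<star> g) = \<I> (A \<box> A')" "(f \<star> g) \<cdot> (f' \<star> g') = \<I> (B \<box> B')"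
    using interchange[OF f(1,2) g(1,2)] interchange[OF f(2,1) g(2,1)] f g o by (simp_all add: tid)
  then show ?thesis unfolding is_iso_def using tmor[OF f(1) g(1)] tmor[OF f(2) g(2)] o by blast
qed

lemma is_iso_id: "A \<in> Ob \<Longrightarrow> is_iso C A A (\<I> A)"
  unfolding is_iso_def using id_in id_left by blast

lemma hb_iso: "half_braiding C Y c \<Longrightarrow> V \<in> Ob \<Longrightarrow> is_iso C (Y \<box> V) (V \<box> Y) (c V)"
  by (simp add: half_braiding_def)
lemma hb_in: "half_braiding C Y c \<Longrightarrow> V \<in> Ob \<Longrightarrow> c V \<in> homs C (Y \<box> V) (V \<box> Y)"
  by (simp add: half_braiding_def is_iso_def)
lemma hb_nat: "half_braiding C Y c \<Longrightarrow> V \<in> Ob \<Longrightarrow> W \<in> Ob \<Longrightarrow> f \<in> homs C V W \<Longrightarrow>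
    (f \<star> \<I> Y) \<cdot> c V = c W \<cdot> (\<I> Y \<star> f)"
  by (simp add: half_braiding_def)
lemma hb_tens: "half_braiding C Y c \<Longrightarrow> V \<in> Ob \<Longrightarrow> W \<in> Ob \<Longrightarrow>
    c (V \<box> W) = (\<I> V \<star> c W) \<cdot> (c V \<star> \<I> W)"
  by (simp add: half_braiding_def)

section \<open>Half-braidings on tensor products and on retracts\<close>

lemma half_braiding_tens:
  assumes c: "half_braiding C Y c" and d: "half_braiding C Z d" and Y: "Y \<in> Ob" and Z: "Z \<in> Ob"
  shows "half_braiding C (Y \<box> Z) (\<lambda>V\<in>Ob. (c V \<star> \<I> Z) \<cdot> (\<I> Y \<star> d V))"
proof -
  let ?e = "\<lambda>V. (c V \<star> \<I> Z) \<cdot> (\<I> Y \<star> d V)"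
  note o = Y Z tobj
  have c1: "c V \<star> \<I> Z \<in> homs C (Y \<box> V \<box> Z) (V \<box> Y \<box> Z)" if "V \<in> Ob" for V
    using tmor[OF hb_in[OF c that] id_in[OF Z]] that o by (simp add: tobj_assoc)
  have d1: "\<I> Y \<star> d V \<in> homs C (Y \<box> Z \<box> V) (Y \<box> V \<box> Z)" if "V \<in> Ob" for V
    using tmor[OF id_in[OF Y] hb_in[OF d that]] that o by simp
  have iso: "is_iso C ((Y \<box> Z) \<box> V) (V \<box> Y \<box> Z) (?e V)" if V: "V \<in> Ob" for V
  proof -
    have "is_iso C (Y \<box> Z \<box> V) (Y \<box> V \<box> Z) (\<I> Y \<star> d V)"
      by (rule is_iso_tens[OF is_iso_id hb_iso[OF d]]) (use V o in auto)
    moreover have "is_iso C ((Y \<box> V) \<box> Z) ((V \<box> Y) \<box> Z) (c V \<star> \<I> Z)"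
      by (rule is_iso_tens[OF hb_iso[OF c] is_iso_id]) (use V o in auto)
    ultimately have "is_iso C (Y \<box> Z \<box> V) (V \<box> Y \<box> Z) (?e V)"
      using V o by (intro is_iso_comp[of _ "Y \<box> V \<box> Z"]) (simp_all add: tobj_assoc)
    then show ?thesis using V o by (simp add: tobj_assoc)
  qed
  have nat: "(f \<star> \<I> (Y \<box> Z)) \<cdot> ?e V = ?e W \<cdot> (\<I> (Y \<box> Z) \<star> f)" if V: "V \<in> Ob" "W \<in> Ob" and f: "f \<in> homs C V W" for V W f
  proof -
    have f1: "f \<star> \<I> (Y \<box> Z) = (f \<star> \<I> Y) \<star> \<I> Z"
      using tmor_assoc[OF f id_in[OF Y] id_in[OF Z]] V o by (simp add: tid)
    have f1h: "f \<star> \<I> (Y \<box> Z) \<in> homs C (V \<box> Y \<box> Z) (W \<box> Y \<box> Z)"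
      by (rule tmor[OF f id_in]) (use V o in auto)
    have fm: "(\<I> Y \<star> f) \<star> \<I> Z = \<I> Y \<star> (f \<star> \<I> Z)"
      using tmor_assoc[OF id_in[OF Y] f id_in[OF Z]] V o by simp
    have fmh: "\<I> Y \<star> (f \<star> \<I> Z) \<in> homs C (Y \<box> V \<box> Z) (Y \<box> W \<box> Z)"
      by (intro tmor id_in f) (use V o in auto)
    have f2: "\<I> (Y \<box> Z) \<star> f = \<I> Y \<star> (\<I> Z \<star> f)"
      using tmor_assoc[OF id_in[OF Y] id_in[OF Z] f] V o by (simp add: tid)
    have f2h: "\<I> Y \<star> (\<I> Z \<star> f) \<in> homs C (Y \<box> Z \<box> V) (Y \<box> Z \<box> W)"
      by (intro tmor id_in f) (use V o in auto)
    have fY: "f \<star> \<I> Y \<in> homs C (V \<box> Y) (W \<box> Y)" "\<I> Y \<star> f \<in> homs C (Y \<box> V) (Y \<box> W)"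
      by (rule tmor[OF f id_in] tmor[OF id_in f]; use V o in simp)+
    have fZ: "f \<star> \<I> Z \<in> homs C (V \<box> Z) (W \<box> Z)" "\<I> Z \<star> f \<in> homs C (Z \<box> V) (Z \<box> W)"
      by (rule tmor[OF f id_in] tmor[OF id_in f]; use V o in simp)+
    have 1: "(f \<star> \<I> (Y \<box> Z)) \<cdot> (c V \<star> \<I> Z) = (c W \<star> \<I> Z) \<cdot> (\<I> Y \<star> (f \<star> \<I> Z))"
    proof -
      have "(f \<star> \<I> (Y \<box> Z)) \<cdot> (c V \<star> \<I> Z) = ((f \<star> \<I> Y) \<cdot> c V) \<star> (\<I> Z \<cdot> \<I> Z)"
        unfolding f1 by (rule interchange[OF hb_in[OF c] fY(1) id_in id_in]) (use V o in auto)
      also have "\<dots> = (c W \<cdot> (\<I> Y \<star> f)) \<star> (\<I> Z \<cdot> \<I> Z)"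
        using hb_nat[OF c V f] by simp
      also have "\<dots> = (c W \<star> \<I> Z) \<cdot> ((\<I> Y \<star> f) \<star> \<I> Z)"
        by (rule interchange[OF fY(2) hb_in[OF c] id_in id_in, symmetric]) (use V o in auto)
      finally show ?thesis unfolding fm .
    qed
    have 2: "(\<I> Y \<star> (f \<star> \<I> Z)) \<cdot> (\<I> Y \<star> d V) = (\<I> Y \<star> d W) \<cdot> (\<I> Y \<star> (\<I> Z \<star> f))"
    proof -
      have "(\<I> Y \<star> (f \<star> \<I> Z)) \<cdot> (\<I> Y \<star> d V) = (\<I> Y \<cdot> \<I> Y) \<star> ((f \<star> \<I> Z) \<cdot> d V)"
        by (rule interchange[OF id_in id_in hb_in[OF d] fZ(1)]) (use V o in auto)
      also have "\<dots> = (\<I> Y \<cdot> \<I> Y) \<star> (d W \<cdot> (\<I> Z \<star> f))" using hb_nat[OF d V f] by simp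
      also have "\<dots> = (\<I> Y \<star> d W) \<cdot> (\<I> Y \<star> (\<I> Z \<star> f))"
        by (rule interchange[OF id_in id_in fZ(2) hb_in[OF d], symmetric]) (use V o in auto)
      finally show ?thesis .
    qed
    have "(f \<star> \<I> (Y \<box> Z)) \<cdot> ?e V = ((f \<star> \<I> (Y \<box> Z)) \<cdot> (c V \<star> \<I> Z)) \<cdot> (\<I> Y \<star> d V)"
      by (rule comp_assoc[OF d1 c1 f1h]) (use V o in auto)
    also have "\<dots> = ((c W \<star> \<I> Z) \<cdot> (\<I> Y \<star> (f \<star> \<I> Z))) \<cdot> (\<I> Y \<star> d V)" unfolding 1 ..
    also have "\<dots> = (c W \<star> \<I> Z) \<cdot> ((\<I> Y \<star> (f \<star> \<I> Z)) \<cdot> (\<I> Y \<star> d V))"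
      by (rule comp_assoc[OF d1 fmh c1, symmetric]) (use V o in auto)
    also have "\<dots> = (c W \<star> \<I> Z) \<cdot> ((\<I> Y \<star> d W) \<cdot> (\<I> Y \<star> (\<I> Z \<star> f)))" unfolding 2 ..
    also have "\<dots> = ?e W \<cdot> (\<I> (Y \<box> Z) \<star> f)" unfolding f2
      by (rule comp_assoc[OF f2h d1 c1]) (use V o in auto)
    finally show ?thesis .
  qed
  have hex: "?e (V \<box> W) = (\<I> V \<star> ?e W) \<cdot> (?e V \<star> \<I> W)" if V: "V \<in> Ob" and W: "W \<in> Ob" for V W
  proof -
    have cV: "c V \<in> homs C (Y \<box> V) (V \<box> Y)" and cW: "c W \<in> homs C (Y \<box> W) (W \<box> Y)"
      and dV: "d V \<in> homs C (Z \<box> V) (V \<box> Z)" and dW: "d W \<in> homs C (Z \<box> W) (W \<box> Z)"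
      using hb_in[OF c] hb_in[OF d] V W by auto
    note i = id_in[OF V] id_in[OF W] id_in[OF Y] id_in[OF Z]
    let ?a = "\<I> Y \<star> d V \<star> \<I> W" and ?b = "\<I> (Y \<box> V) \<star> d W" and ?c = "c V \<star> \<I> (W \<box> Z)" and ?d = "\<I> V \<star> c W \<star> \<I> Z"
    let ?b' = "\<I> (V \<box> Y) \<star> d W" and ?c' = "c V \<star> \<I> (Z \<box> W)"
    have a: "?a \<in> homs C (Y \<box> Z \<box> V \<box> W) (Y \<box> V \<box> Z \<box> W)"
      using tmor[OF i(3) tmor[OF dV i(2)]] V W o by (simp add: tobj_assoc)
    have b: "?b \<in> homs C (Y \<box> V \<box> Z \<box> W) (Y \<box> V \<box> W \<box> Z)"
      using tmor[OF id_in dW, of "Y \<box> V"] V W o by (simp add: tobj_assoc)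
    have c': "?c \<in> homs C (Y \<box> V \<box> W \<box> Z) (V \<box> Y \<box> W \<box> Z)"
      using tmor[OF cV id_in, of "W \<box> Z"] V W o by (simp add: tobj_assoc)
    have d': "?d \<in> homs C (V \<box> Y \<box> W \<box> Z) (V \<box> W \<box> Y \<box> Z)"
      using tmor[OF i(1) tmor[OF cW i(4)]] V W o by (simp add: tobj_assoc)
    have b1: "?b' \<in> homs C (V \<box> Y \<box> Z \<box> W) (V \<box> Y \<box> W \<box> Z)"
      using tmor[OF id_in dW, of "V \<box> Y"] V W o by (simp add: tobj_assoc)
    have c1': "?c' \<in> homs C (Y \<box> V \<box> Z \<box> W) (V \<box> Y \<box> Z \<box> W)"
      using tmor[OF cV id_in, of "Z \<box> W"] V W o by (simp add: tobj_assoc)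
    \<comment> \<open>The braidings \<open>c V\<close> and \<open>d W\<close> act on different
      tensor factors and therefore commute. This is the only rearrangement that the hexagon of the
      tensor product needs.\<close>
    have bc: "?c \<cdot> ?b = ?b' \<cdot> ?c'"
    proof -
      have "?c \<cdot> ?b = (c V \<cdot> \<I> (Y \<box> V)) \<star> (\<I> (W \<box> Z) \<cdot> d W)"
        by (rule interchange[OF id_in cV dW id_in]) (use V W o in auto)
      also have "\<dots> = (\<I> (V \<box> Y) \<cdot> c V) \<star> (d W \<cdot> \<I> (Z \<box> W))"
        using id_left[OF cV] id_right[OF cV] id_left[OF dW] id_right[OF dW] V W o by simp
      also have "\<dots> = ?b' \<cdot> ?c'"
        by (rule interchange[OF cV id_in id_in dW, symmetric]) (use V W o in auto)
      finally show ?thesis .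
    qed
    have h: "d V \<star> \<I> W \<in> homs C (Z \<box> V \<box> W) (V \<box> Z \<box> W)" "\<I> V \<star> d W \<in> homs C (V \<box> Z \<box> W) (V \<box> W \<box> Z)"
      "c V \<star> \<I> W \<in> homs C (Y \<box> V \<box> W) (V \<box> Y \<box> W)" "\<I> V \<star> c W \<in> homs C (V \<box> Y \<box> W) (V \<box> W \<box> Y)"
      using tmor[OF dV i(2)] tmor[OF i(1) dW] tmor[OF cV i(2)] tmor[OF i(1) cW] V W o
      by (simp_all add: tobj_assoc)
    have "\<I> Y \<star> d (V \<box> W) = (\<I> Y \<star> (\<I> V \<star> d W)) \<cdot> (\<I> Y \<star> (d V \<star> \<I> W))"
    proof -
      have "(\<I> Y \<star> (\<I> V \<star> d W)) \<cdot> (\<I> Y \<star> (d V \<star> \<I> W)) = (\<I> Y \<cdot> \<I> Y) \<star> ((\<I> V \<star> d W) \<cdot> (d V \<star> \<I> W))"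
        by (rule interchange[OF i(3) i(3) h(1,2)]) (use V W o in auto)
      then show ?thesis using hb_tens[OF d V W] id_left[OF i(3)] Y by simp
    qed
    also have "\<I> Y \<star> (\<I> V \<star> d W) = ?b"
      using tmor_assoc[OF i(3) i(1) dW] V W o by (simp add: tid)
    finally have D: "\<I> Y \<star> d (V \<box> W) = ?b \<cdot> ?a" .
    have "c (V \<box> W) \<star> \<I> Z = ((\<I> V \<star> c W) \<star> \<I> Z) \<cdot> ((c V \<star> \<I> W) \<star> \<I> Z)"
    proof -
      have "((\<I> V \<star> c W) \<star> \<I> Z) \<cdot> ((c V \<star> \<I> W) \<star> \<I> Z) = ((\<I> V \<star> c W) \<cdot> (c V \<star> \<I> W)) \<star> (\<I> Z \<cdot> \<I> Z)"
        by (rule interchange[OF h(3,4) i(4) i(4)]) (use V W o in auto)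
      then show ?thesis using hb_tens[OF c V W] id_left[OF i(4)] Z by simp
    qed
    also have "(c V \<star> \<I> W) \<star> \<I> Z = ?c"
      using tmor_assoc[OF cV i(2) i(4)] V W o by (simp add: tid)
    also have "(\<I> V \<star> c W) \<star> \<I> Z = ?d"
      using tmor_assoc[OF i(1) cW i(4)] V W o by simp
    finally have C: "c (V \<box> W) \<star> \<I> Z = ?d \<cdot> ?c" .
    have eW: "\<I> V \<star> ?e W = ?d \<cdot> ?b'"
    proof -
      have "?d \<cdot> (\<I> V \<star> (\<I> Y \<star> d W)) = (\<I> V \<cdot> \<I> V) \<star> ((c W \<star> \<I> Z) \<cdot> (\<I> Y \<star> d W))"
        by (rule interchange[OF i(1) i(1) d1 c1]) (use V W o in auto)
      moreover have "\<I> V \<star> (\<I> Y \<star> d W) = ?b'"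
        using tmor_assoc[OF i(1) i(3) dW] V W o by (simp add: tid)
      ultimately show ?thesis using id_left[OF i(1)] V by simp
    qed
    have eV: "?e V \<star> \<I> W = ?c' \<cdot> ?a"
    proof -
      have "((c V \<star> \<I> Z) \<star> \<I> W) \<cdot> ((\<I> Y \<star> d V) \<star> \<I> W) = ((c V \<star> \<I> Z) \<cdot> (\<I> Y \<star> d V)) \<star> (\<I> W \<cdot> \<I> W)"
        by (rule interchange[OF d1 c1 i(2) i(2)]) (use V W o in auto)
      moreover have "(c V \<star> \<I> Z) \<star> \<I> W = ?c'"
        using tmor_assoc[OF cV i(4) i(2)] V W o by (simp add: tid)
      moreover have "(\<I> Y \<star> d V) \<star> \<I> W = ?a"
        using tmor_assoc[OF i(3) dV i(2)] V W o by simp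
      ultimately show ?thesis using id_left[OF i(2)] W by simp
    qed
    have q: "Y \<box> Z \<box> V \<box> W \<in> Ob" "Y \<box> V \<box> Z \<box> W \<in> Ob" "Y \<box> V \<box> W \<box> Z \<in> Ob" "V \<box> Y \<box> W \<box> Z \<in> Ob"
      "V \<box> W \<box> Y \<box> Z \<in> Ob" "V \<box> Y \<box> Z \<box> W \<in> Ob"
      using V W o by auto
    have "?e (V \<box> W) = (?d \<cdot> ?c) \<cdot> (?b \<cdot> ?a)" unfolding C D ..
    also have "\<dots> = ?d \<cdot> (?c \<cdot> (?b \<cdot> ?a))" by (rule comp_assoc[OF comp_in[OF a b] c' d', symmetric]) (use q in auto)
    also have "\<dots> = ?d \<cdot> ((?c \<cdot> ?b) \<cdot> ?a)" using comp_assoc[OF a b c'] q by simp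
    also have "\<dots> = ?d \<cdot> ((?b' \<cdot> ?c') \<cdot> ?a)" unfolding bc ..
    also have "\<dots> = ?d \<cdot> (?b' \<cdot> (?c' \<cdot> ?a))" using comp_assoc[OF a c1' b1] q by simp
    also have "\<dots> = (?d \<cdot> ?b') \<cdot> (?c' \<cdot> ?a)" by (rule comp_assoc[OF comp_in[OF a c1'] b1 d']) (use q in auto)
    also have "\<dots> = (\<I> V \<star> ?e W) \<cdot> (?e V \<star> \<I> W)" unfolding eW eV ..
    finally show ?thesis .
  qed
  show ?thesis
    unfolding half_braiding_def using iso nat hex o by simp
qed


text \<open>The half-braiding is compressed by \<open>i\<close> and \<open>p\<close>. Centrality of
  the idempotent \<open>i \<cdot> p\<close> lets \<open>i\<close> and \<open>p\<close> pass through
  the compressed braiding (\<open>absorb\<close> and \<open>absorb'\<close>), and the axioms follow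
  from these two relations. The inverse is the compression of the inverse of
  \<open>c V\<close>.\<close>

lemma half_braiding_retract:
  assumes c: "half_braiding C Y c" and Y: "Y \<in> Ob" and Y': "Y' \<in> Ob"
    and i: "i \<in> homs C Y' Y" and p: "p \<in> homs C Y Y'" and pi: "p \<cdot> i = \<I> Y'"
    and central: "\<And>V. V \<in> Ob \<Longrightarrow> (\<I> V \<star> (i \<cdot> p)) \<cdot> c V = c V \<cdot> ((i \<cdot> p) \<star> \<I> V)"
  shows "half_braiding C Y' (\<lambda>V\<in>Ob. (\<I> V \<star> p) \<cdot> (c V \<cdot> (i \<star> \<I> V)))"
    and "V \<in> Ob \<Longrightarrow> (\<I> V \<star> i) \<cdot> ((\<I> V \<star> p) \<cdot> (c V \<cdot> (i \<star> \<I> V))) = c V \<cdot> (i \<star> \<I> V)"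
    and "V \<in> Ob \<Longrightarrow> (\<I> V \<star> p) \<cdot> c V = ((\<I> V \<star> p) \<cdot> (c V \<cdot> (i \<star> \<I> V))) \<cdot> (p \<star> \<I> V)"
proof -
  let ?c = "\<lambda>V. (\<I> V \<star> p) \<cdot> (c V \<cdot> (i \<star> \<I> V))"
  let ?h = "i \<cdot> p"
  note o = Y Y' tobj
  have h: "?h \<in> homs C Y Y" by (rule comp_in[OF p i]) (use o in auto)
  have hi: "?h \<cdot> i = i" using comp_assoc[OF i p i] pi id_right[OF i] o by simp
  have ph: "p \<cdot> ?h = p" using comp_assoc[OF p i p] pi id_left[OF p] o by simp
  have iV: "i \<star> \<I> V \<in> homs C (Y' \<box> V) (Y \<box> V)" and Vi: "\<I> V \<star> i \<in> homs C (V \<box> Y') (V \<box> Y)"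
    and pV: "p \<star> \<I> V \<in> homs C (Y \<box> V) (Y' \<box> V)" and Vp: "\<I> V \<star> p \<in> homs C (V \<box> Y) (V \<box> Y')"
    and hV: "?h \<star> \<I> V \<in> homs C (Y \<box> V) (Y \<box> V)" and Vh: "\<I> V \<star> ?h \<in> homs C (V \<box> Y) (V \<box> Y)"
    if "V \<in> Ob" for V
    using tmor[OF i id_in] tmor[OF p id_in] tmor[OF h id_in] tmor[OF id_in i] tmor[OF id_in p] tmor[OF id_in h] that o by auto
  have cV: "c V \<in> homs C (Y \<box> V) (V \<box> Y)" if "V \<in> Ob" for V by (rule hb_in[OF c that])
  have ciV: "c V \<cdot> (i \<star> \<I> V) \<in> homs C (Y' \<box> V) (V \<box> Y)" if "V \<in> Ob" for V
    by (rule comp_in[OF iV cV]) (use that o in auto)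
  have c'V: "?c V \<in> homs C (Y' \<box> V) (V \<box> Y')" if "V \<in> Ob" for V
    by (rule comp_in[OF ciV Vp]) (use that o in auto)
  have hiV: "(?h \<star> \<I> V) \<cdot> (i \<star> \<I> V) = i \<star> \<I> V" if "V \<in> Ob" for V
    using interchange[OF i h id_in id_in] that o hi by (simp add: id_left[OF id_in])
  have Vph: "(\<I> V \<star> p) \<cdot> (\<I> V \<star> ?h) = \<I> V \<star> p" if "V \<in> Ob" for V
    using interchange[OF id_in id_in h p] that o ph by (simp add: id_left[OF id_in])
  have ipV: "(i \<star> \<I> V) \<cdot> (p \<star> \<I> V) = ?h \<star> \<I> V" if "V \<in> Ob" for V
    using interchange[OF p i id_in id_in] that o by (simp add: id_left[OF id_in])
  have Vip: "(\<I> V \<star> i) \<cdot> (\<I> V \<star> p) = \<I> V \<star> ?h" if "V \<in> Ob" for V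
    using interchange[OF id_in id_in p i] that o by (simp add: id_left[OF id_in])
  have piV: "(p \<star> \<I> V) \<cdot> (i \<star> \<I> V) = \<I> (Y' \<box> V)" if "V \<in> Ob" for V
    using interchange[OF i p id_in id_in] that o pi by (simp add: id_left[OF id_in] tid)
  have Vpi: "(\<I> V \<star> p) \<cdot> (\<I> V \<star> i) = \<I> (V \<box> Y')" if "V \<in> Ob" for V
    using interchange[OF id_in id_in i p] that o pi by (simp add: id_left[OF id_in] tid)
  have absorb: "(\<I> V \<star> i) \<cdot> ?c V = c V \<cdot> (i \<star> \<I> V)" if V: "V \<in> Ob" for V
  proof -
    have "(\<I> V \<star> i) \<cdot> ?c V = (\<I> V \<star> ?h) \<cdot> (c V \<cdot> (i \<star> \<I> V))"
      using comp_assoc[OF ciV Vp Vi] Vip V o by simp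
    also have "\<dots> = (c V \<cdot> (?h \<star> \<I> V)) \<cdot> (i \<star> \<I> V)"
      using comp_assoc[OF iV cV Vh] central V o by simp
    also have "\<dots> = c V \<cdot> (i \<star> \<I> V)"
      using comp_assoc[OF iV hV cV] hiV V o by simp
    finally show ?thesis .
  qed
  then show "V \<in> Ob \<Longrightarrow> (\<I> V \<star> i) \<cdot> ?c V = c V \<cdot> (i \<star> \<I> V)" by blast
  have absorb': "?c V \<cdot> (p \<star> \<I> V) = (\<I> V \<star> p) \<cdot> c V" if V: "V \<in> Ob" for V
  proof -
    have "?c V \<cdot> (p \<star> \<I> V) = (\<I> V \<star> p) \<cdot> ((c V \<cdot> (i \<star> \<I> V)) \<cdot> (p \<star> \<I> V))"
      by (rule comp_assoc[OF pV ciV Vp, symmetric]) (use V o in auto)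
    also have "(c V \<cdot> (i \<star> \<I> V)) \<cdot> (p \<star> \<I> V) = (\<I> V \<star> ?h) \<cdot> c V"
      using comp_assoc[OF pV iV cV] ipV central V o by simp
    also have "(\<I> V \<star> p) \<cdot> ((\<I> V \<star> ?h) \<cdot> c V) = (\<I> V \<star> p) \<cdot> c V"
      using comp_assoc[OF cV Vh Vp] Vph V o by simp
    finally show ?thesis .
  qed
  then show "V \<in> Ob \<Longrightarrow> (\<I> V \<star> p) \<cdot> c V = ?c V \<cdot> (p \<star> \<I> V)" by simp
  have iso: "is_iso C (Y' \<box> V) (V \<box> Y') (?c V)" if V: "V \<in> Ob" for V
  proof -
    obtain g where g: "g \<in> homs C (V \<box> Y) (Y \<box> V)" "g \<cdot> c V = \<I> (Y \<box> V)" "c V \<cdot> g = \<I> (V \<box> Y)"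
      using hb_iso[OF c V] by (auto simp: is_iso_def)
    let ?g = "(p \<star> \<I> V) \<cdot> (g \<cdot> (\<I> V \<star> i))"
    have gi: "g \<cdot> (\<I> V \<star> i) \<in> homs C (V \<box> Y') (Y \<box> V)" by (rule comp_in[OF Vi g(1)]) (use V o in auto)
    have g': "?g \<in> homs C (V \<box> Y') (Y' \<box> V)" by (rule comp_in[OF gi pV]) (use V o in auto)
    have "?c V \<cdot> ?g = (?c V \<cdot> (p \<star> \<I> V)) \<cdot> (g \<cdot> (\<I> V \<star> i))"
      by (rule comp_assoc[OF gi pV c'V]) (use V o in auto)
    also have "\<dots> = (\<I> V \<star> p) \<cdot> (c V \<cdot> (g \<cdot> (\<I> V \<star> i)))"
      unfolding absorb'[OF V] by (rule comp_assoc[OF gi cV Vp, symmetric]) (use V o in auto)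
    also have "c V \<cdot> (g \<cdot> (\<I> V \<star> i)) = \<I> V \<star> i"
      using comp_assoc[OF Vi g(1) cV] g id_left[OF Vi] V o by simp
    finally have 1: "?c V \<cdot> ?g = \<I> (V \<box> Y')" using Vpi V by simp
    have "?g \<cdot> ?c V = (p \<star> \<I> V) \<cdot> ((g \<cdot> (\<I> V \<star> i)) \<cdot> ?c V)"
      by (rule comp_assoc[OF c'V gi pV, symmetric]) (use V o in auto)
    also have "(g \<cdot> (\<I> V \<star> i)) \<cdot> ?c V = g \<cdot> (c V \<cdot> (i \<star> \<I> V))"
      using comp_assoc[OF c'V Vi g(1)] absorb V o by simp
    also have "\<dots> = i \<star> \<I> V"
      using comp_assoc[OF iV cV g(1)] g id_left[OF iV] V o by simp
    finally have 2: "?g \<cdot> ?c V = \<I> (Y' \<box> V)" using piV V by simp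
    show ?thesis unfolding is_iso_def using c'V[OF V] g' 1 2 by blast
  qed
  have nat: "(f \<star> \<I> Y') \<cdot> ?c V = ?c W \<cdot> (\<I> Y' \<star> f)" if V: "V \<in> Ob" "W \<in> Ob" and f: "f \<in> homs C V W" for V W f
  proof -
    have fY: "f \<star> \<I> Y \<in> homs C (V \<box> Y) (W \<box> Y)" "\<I> Y \<star> f \<in> homs C (Y \<box> V) (Y \<box> W)"
      and fY': "f \<star> \<I> Y' \<in> homs C (V \<box> Y') (W \<box> Y')" "\<I> Y' \<star> f \<in> homs C (Y' \<box> V) (Y' \<box> W)"
      using tmor[OF f id_in[OF Y]] tmor[OF id_in[OF Y] f] tmor[OF f id_in[OF Y']] tmor[OF id_in[OF Y'] f] V o by auto
    have 1: "(f \<star> \<I> Y') \<cdot> (\<I> V \<star> p) = (\<I> W \<star> p) \<cdot> (f \<star> \<I> Y)"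
      using interchange[OF id_in f p id_in] interchange[OF f id_in id_in p] V o f p
      by (simp add: id_left[OF f] id_right[OF f] id_left[OF p] id_right[OF p])
    have 2: "(\<I> Y \<star> f) \<cdot> (i \<star> \<I> V) = (i \<star> \<I> W) \<cdot> (\<I> Y' \<star> f)"
      using interchange[OF i id_in id_in f] interchange[OF id_in i f id_in] V o
      by (simp add: id_left[OF f] id_right[OF f] id_left[OF i] id_right[OF i])
    have "(f \<star> \<I> Y') \<cdot> ?c V = ((\<I> W \<star> p) \<cdot> (f \<star> \<I> Y)) \<cdot> (c V \<cdot> (i \<star> \<I> V))"
      unfolding 1[symmetric] by (rule comp_assoc[OF ciV Vp fY'(1)]) (use V o in auto)
    also have "\<dots> = (\<I> W \<star> p) \<cdot> (((f \<star> \<I> Y) \<cdot> c V) \<cdot> (i \<star> \<I> V))"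
      using comp_assoc[OF ciV fY(1) Vp] comp_assoc[OF iV cV fY(1)] V o by simp
    also have "\<dots> = (\<I> W \<star> p) \<cdot> (c W \<cdot> ((i \<star> \<I> W) \<cdot> (\<I> Y' \<star> f)))"
      unfolding hb_nat[OF c V f] 2[symmetric] using comp_assoc[OF iV fY(2) cV] V o by simp
    also have "\<dots> = (\<I> W \<star> p) \<cdot> ((c W \<cdot> (i \<star> \<I> W)) \<cdot> (\<I> Y' \<star> f))"
      using comp_assoc[OF fY'(2) iV cV] V o by simp
    also have "\<dots> = ?c W \<cdot> (\<I> Y' \<star> f)"
      by (rule comp_assoc[OF fY'(2) ciV Vp]) (use V o in auto)
    finally show ?thesis .
  qed
  have hex: "?c (V \<box> W) = (\<I> V \<star> ?c W) \<cdot> (?c V \<star> \<I> W)" if V: "V \<in> Ob" and W: "W \<in> Ob" for V W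
  proof -
    have VW: "V \<box> W \<in> Ob" using V W o by simp
    have q: "Y \<box> V \<box> W \<in> Ob" "Y' \<box> V \<box> W \<in> Ob" "V \<box> Y \<box> W \<in> Ob" "V \<box> Y' \<box> W \<in> Ob" "V \<box> W \<box> Y \<in> Ob" "V \<box> W \<box> Y' \<in> Ob"
      using V W o by auto
    note iv = id_in[OF V] and iw = id_in[OF W]
    have t1: "\<I> (V \<box> W) \<star> p = \<I> V \<star> \<I> W \<star> p" using tmor_assoc[OF iv iw p] V W o by (simp add: tid)
    have t2: "i \<star> \<I> (V \<box> W) = (i \<star> \<I> V) \<star> \<I> W" using tmor_assoc[OF i iv iw] V W o by (simp add: tid)
    have A: "\<I> V \<star> \<I> W \<star> p \<in> homs C (V \<box> W \<box> Y) (V \<box> W \<box> Y')" using tmor[OF iv Vp[OF W]] V W o by simp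
    have B: "\<I> V \<star> c W \<in> homs C (V \<box> Y \<box> W) (V \<box> W \<box> Y)" using tmor[OF iv cV[OF W]] V W o by simp
    have D: "c V \<star> \<I> W \<in> homs C (Y \<box> V \<box> W) (V \<box> Y \<box> W)" using tmor[OF cV[OF V] iw] V W o by (simp add: tobj_assoc)
    have E: "(i \<star> \<I> V) \<star> \<I> W \<in> homs C (Y' \<box> V \<box> W) (Y \<box> V \<box> W)" using tmor[OF iV[OF V] iw] V W o by (simp add: tobj_assoc)
    have F: "\<I> V \<star> (i \<star> \<I> W) \<in> homs C (V \<box> Y' \<box> W) (V \<box> Y \<box> W)" using tmor[OF iv iV[OF W]] V W o by simp
    have G: "?c V \<star> \<I> W \<in> homs C (Y' \<box> V \<box> W) (V \<box> Y' \<box> W)" using tmor[OF c'V[OF V] iw] V W o by (simp add: tobj_assoc)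
    have r: "\<I> V \<star> ?c W = (\<I> V \<star> \<I> W \<star> p) \<cdot> ((\<I> V \<star> c W) \<cdot> (\<I> V \<star> (i \<star> \<I> W)))"
    proof -
      have "(\<I> V \<star> c W) \<cdot> (\<I> V \<star> (i \<star> \<I> W)) = \<I> V \<star> (c W \<cdot> (i \<star> \<I> W))"
        using interchange[OF iv iv iV[OF W] cV[OF W]] V W o by (simp add: id_left[OF iv])
      then show ?thesis
        using interchange[OF iv iv ciV[OF W] Vp[OF W]] V W o by (simp add: id_left[OF iv])
    qed
    have l: "(\<I> V \<star> (i \<star> \<I> W)) \<cdot> (?c V \<star> \<I> W) = (c V \<star> \<I> W) \<cdot> ((i \<star> \<I> V) \<star> \<I> W)"
    proof -
      have "\<I> V \<star> (i \<star> \<I> W) = (\<I> V \<star> i) \<star> \<I> W" using tmor_assoc[OF iv i iw] V W o by simp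
      then have "(\<I> V \<star> (i \<star> \<I> W)) \<cdot> (?c V \<star> \<I> W) = ((\<I> V \<star> i) \<cdot> ?c V) \<star> (\<I> W \<cdot> \<I> W)"
        using interchange[OF c'V[OF V] Vi[OF V] iw iw] V W o by simp
      also have "\<dots> = (c V \<star> \<I> W) \<cdot> ((i \<star> \<I> V) \<star> \<I> W)"
        unfolding absorb[OF V] by (rule interchange[OF iV[OF V] cV[OF V] iw iw, symmetric]) (use V W o in auto)
      finally show ?thesis .
    qed
    have "?c (V \<box> W) = (\<I> V \<star> \<I> W \<star> p) \<cdot> (((\<I> V \<star> c W) \<cdot> (c V \<star> \<I> W)) \<cdot> ((i \<star> \<I> V) \<star> \<I> W))"
      unfolding t1 t2 hb_tens[OF c V W] ..
    also have "\<dots> = (\<I> V \<star> \<I> W \<star> p) \<cdot> ((\<I> V \<star> c W) \<cdot> ((\<I> V \<star> (i \<star> \<I> W)) \<cdot> (?c V \<star> \<I> W)))"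
      unfolding l using comp_assoc[OF E D B] q by simp
    also have "\<dots> = (\<I> V \<star> \<I> W \<star> p) \<cdot> (((\<I> V \<star> c W) \<cdot> (\<I> V \<star> (i \<star> \<I> W))) \<cdot> (?c V \<star> \<I> W))"
      using comp_assoc[OF G F B] q by simp
    also have "\<dots> = (\<I> V \<star> ?c W) \<cdot> (?c V \<star> \<I> W)"
      unfolding r by (rule comp_assoc[OF G comp_in[OF F B] A]) (use q in auto)
    finally show ?thesis .
  qed
  show "half_braiding C Y' (\<lambda>V\<in>Ob. ?c V)"
    unfolding half_braiding_def using iso nat hex o by simp
qed

section \<open>The Karoubi envelope\<close>

lemma karoubi_homs:
  "homs (karoubi_envelope C) X Y = {m \<in> homs C (fst X) (fst Y). snd Y \<cdot> (m \<cdot> snd X) = m}"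
  by (cases X; cases Y) (simp add: karoubi_envelope_def)

lemma karoubi_objects:
  "X \<in> objects (karoubi_envelope C) \<longleftrightarrow> fst X \<in> Ob \<and> snd X \<in> homs C (fst X) (fst X) \<and> snd X \<cdot> snd X = snd X"
  by (cases X) (simp add: karoubi_envelope_def)

lemma karoubi_simps [simp]:
  "ident (karoubi_envelope C) X = snd X" "comp_mor (karoubi_envelope C) = comp_mor C"
  "tens_obj (karoubi_envelope C) X Y = (fst X \<box> fst Y, snd X \<star> snd Y)" "tens_mor (karoubi_envelope C) = tens_mor C"
  "unit_obj (karoubi_envelope C) = (unit_obj C, \<I> (unit_obj C))"
  "plus_mor (karoubi_envelope C) = plus_mor C" "zero_mor (karoubi_envelope C) X Y = zero_mor C (fst X) (fst Y)"
  by (cases X; cases Y; simp add: karoubi_envelope_def)+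

lemma karoubi_homD:
  assumes "m \<in> homs (karoubi_envelope C) X Y" "X \<in> objects (karoubi_envelope C)" "Y \<in> objects (karoubi_envelope C)"
  shows "m \<in> homs C (fst X) (fst Y)" "snd Y \<cdot> m = m" "m \<cdot> snd X = m"
proof -
  have X: "fst X \<in> Ob" "snd X \<in> homs C (fst X) (fst X)" "snd X \<cdot> snd X = snd X"
    and Y: "fst Y \<in> Ob" "snd Y \<in> homs C (fst Y) (fst Y)" "snd Y \<cdot> snd Y = snd Y"
    and m: "m \<in> homs C (fst X) (fst Y)" "snd Y \<cdot> (m \<cdot> snd X) = m"
    using assms by (auto simp: karoubi_homs karoubi_objects)
  have mX: "m \<cdot> snd X \<in> homs C (fst X) (fst Y)" by (rule comp_in[OF X(2) m(1)]) (use X Y in auto)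
  show "m \<in> homs C (fst X) (fst Y)" by (rule m)
  show "snd Y \<cdot> m = m" using comp_assoc[OF mX Y(2) Y(2)] X Y m by simp
  have "(snd Y \<cdot> (m \<cdot> snd X)) \<cdot> snd X = snd Y \<cdot> ((m \<cdot> snd X) \<cdot> snd X)"
    by (rule comp_assoc[OF X(2) mX Y(2), symmetric]) (use X Y in auto)
  also have "(m \<cdot> snd X) \<cdot> snd X = m \<cdot> snd X" using comp_assoc[OF X(2) X(2) m(1)] X Y by simp
  finally show "m \<cdot> snd X = m" using m by simp
qed

lemma karoubi_homI: "m \<in> homs C (fst X) (fst Y) \<Longrightarrow> snd Y \<cdot> m = m \<Longrightarrow> m \<cdot> snd X = m \<Longrightarrow>
    m \<in> homs (karoubi_envelope C) X Y"
  by (simp add: karoubi_homs)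

lemma karoubi_smcat: "smcat (karoubi_envelope C)"
proof
  let ?K = "karoubi_envelope C"
  note O = karoubi_objects
  fix A B D E A' B' D' f g h f' g'
  show "A \<in> objects ?K \<Longrightarrow> ident ?K A \<in> homs ?K A A" by (rule karoubi_homI) (auto simp: O)
  { assume f: "f \<in> homs ?K A B" and g: "g \<in> homs ?K B D" and o: "A \<in> objects ?K" "B \<in> objects ?K" "D \<in> objects ?K"
    note F = karoubi_homD[OF f o(1,2)] and G = karoubi_homD[OF g o(2,3)]
    show "comp_mor ?K g f \<in> homs ?K A D"
      using comp_in[OF F(1) G(1)] comp_assoc[OF F(1) G(1), of "snd D"] comp_assoc[OF _ F(1) G(1), of "snd A"] F G o
      by (intro karoubi_homI) (auto simp: O)
    { assume h: "h \<in> homs ?K D E" and oE: "E \<in> objects ?K"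
      show "comp_mor ?K h (comp_mor ?K g f) = comp_mor ?K (comp_mor ?K h g) f"
        using comp_assoc[OF F(1) G(1) karoubi_homD(1)[OF h o(3) oE]] o oE by (simp add: O) }
    { assume f': "f' \<in> homs ?K A' B'" and g': "g' \<in> homs ?K B' D'" and o': "A' \<in> objects ?K" "B' \<in> objects ?K" "D' \<in> objects ?K"
      show "comp_mor ?K (tens_mor ?K g g') (tens_mor ?K f f') = tens_mor ?K (comp_mor ?K g f) (comp_mor ?K g' f')"
        using interchange[OF F(1) G(1) karoubi_homD(1)[OF f' o'(1,2)] karoubi_homD(1)[OF g' o'(2,3)]] o o' by (simp add: O) } }
  { assume f: "f \<in> homs ?K A B" and o: "A \<in> objects ?K" "B \<in> objects ?K"
    show "comp_mor ?K (ident ?K B) f = f" "comp_mor ?K f (ident ?K A) = f" using karoubi_homD[OF f o] by auto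
    show "tens_mor ?K (ident ?K (unit_obj ?K)) f = f" "tens_mor ?K f (ident ?K (unit_obj ?K)) = f"
      using unit_tmor[OF karoubi_homD(1)[OF f o]] o by (auto simp: O) }
  { assume o: "A \<in> objects ?K"
    show "tens_obj ?K (unit_obj ?K) A = A" "tens_obj ?K A (unit_obj ?K) = A"
      using o unit_tobj unit_tmor by (auto simp: O prod_eq_iff) }
  { assume o: "A \<in> objects ?K" "B \<in> objects ?K"
    show "tens_obj ?K A B \<in> objects ?K" using o tmor interchange by (auto simp: O tobj)
    show "tens_mor ?K (ident ?K A) (ident ?K B) = ident ?K (tens_obj ?K A B)" by simp
    { assume o': "D \<in> objects ?K"
      show "tens_obj ?K (tens_obj ?K A B) D = tens_obj ?K A (tens_obj ?K B D)"
        using o o' tobj_assoc tmor_assoc by (auto simp: O) } }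
  { assume f: "f \<in> homs ?K A B" and g: "g \<in> homs ?K A' B'" and o: "A \<in> objects ?K" "B \<in> objects ?K" "A' \<in> objects ?K" "B' \<in> objects ?K"
    note F = karoubi_homD[OF f o(1,2)] and G = karoubi_homD[OF g o(3,4)]
    show "tens_mor ?K f g \<in> homs ?K (tens_obj ?K A A') (tens_obj ?K B B')"
    proof (rule karoubi_homI)
      show "tens_mor ?K f g \<in> homs C (fst (tens_obj ?K A A')) (fst (tens_obj ?K B B'))"
        using tmor[OF F(1) G(1)] o by (simp add: O)
      show "snd (tens_obj ?K B B') \<cdot> tens_mor ?K f g = tens_mor ?K f g"
        using interchange[OF F(1) _ G(1), of "snd B" "fst B" "snd B'" "fst B'"] F G o by (simp add: O)
      show "tens_mor ?K f g \<cdot> snd (tens_obj ?K A A') = tens_mor ?K f g"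
        using interchange[OF _ F(1) _ G(1), of "snd A" "fst A" "snd A'" "fst A'"] F G o by (simp add: O)
    qed }
  show "unit_obj ?K \<in> objects ?K" using id_in[OF unit_in] id_left[OF id_in] unit_in by (simp add: O)
  { assume f: "f \<in> homs ?K A A'" and g: "g \<in> homs ?K B B'" and h: "h \<in> homs ?K D D'"
      and o: "A \<in> objects ?K" "A' \<in> objects ?K" "B \<in> objects ?K" "B' \<in> objects ?K" "D \<in> objects ?K" "D' \<in> objects ?K"
    show "tens_mor ?K (tens_mor ?K f g) h = tens_mor ?K f (tens_mor ?K g h)"
      using tmor_assoc[OF karoubi_homD(1)[OF f] karoubi_homD(1)[OF g] karoubi_homD(1)[OF h]] o by (simp add: O) }
qed

end

context deligne
begin

lemma CA_smcat: "smcat CA"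
  by unfold_locales
    (auto intro: id_ahom comp_ahom tens_ahom CA_id_left CA_id_right CA_assoc CA_tens_assoc CA_tens_unit CA_tens_id
      CA_interchange simp: tl_obj_assoc)

abbreviation "RS \<equiv> Rep_S t"

lemma RS_smcat: "smcat RS"
  unfolding Rep_S_def by (rule smcat.karoubi_smcat[OF CA_smcat])

lemma RS_objects: "(As, e) \<in> objects RS \<longleftrightarrow> e \<in> ahom As As \<and> comp_mor CA e e = e"
  unfolding Rep_S_def by (simp add: smcat.karoubi_objects[OF CA_smcat])

lemma RS_simps [simp]:
  "ident RS (As, e) = e" "comp_mor RS = comp_mor CA"
  "tens_obj RS (As, e) (Bs, f) = (tl_obj As Bs, tens_mor CA e f)" "tens_mor RS = tens_mor CA"
  "unit_obj RS = ([0], ident CA [0])" "plus_mor RS = (+)" "zero_mor RS (As, e) (Bs, f) = 0\<^sub>m (length Bs) (length As)"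
  unfolding Rep_S_def by (simp_all add: smcat.karoubi_simps[OF CA_smcat])

lemma RS_homD:
  assumes "m \<in> homs RS (As, e) (Bs, f)" "(As, e) \<in> objects RS" "(Bs, f) \<in> objects RS"
  shows "m \<in> ahom As Bs" "comp_mor CA f m = m" "comp_mor CA m e = m"
  using smcat.karoubi_homD[OF CA_smcat assms[unfolded Rep_S_def]] by simp_all

lemma RS_homI: "m \<in> ahom As Bs \<Longrightarrow> comp_mor CA f m = m \<Longrightarrow> comp_mor CA m e = m \<Longrightarrow> m \<in> homs RS (As, e) (Bs, f)"
  unfolding Rep_S_def by (rule smcat.karoubi_homI[OF CA_smcat]) simp_all

end

section \<open>Half-braidings as families of kernels\<close>

lemma fs4:
  assumes "\<And>\<pi> i j a b. bij \<pi> \<Longrightarrow> K (act \<pi> i) (act \<pi> j) (act \<pi> a) (act \<pi> b) = K i j a b"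
    "eqm f" "eqm g" "eqm h" "eqm k"
  shows "fs (\<lambda>x. K (f x) (g x) (h x) (k x))"
  using fs_eqm[OF fs_inv eqm_Pair[OF eqm_Pair[OF assms(2,3)] eqm_Pair[OF assms(4,5)]],
    of "\<lambda>z. K (fst (fst z)) (snd (fst z)) (fst (snd z)) (snd (snd z))"] assms(1) by simp

context deligne
begin

lemma intp_idk: "a \<in> pts As \<Longrightarrow> intp As (\<lambda>b. idk As a b * \<phi> b) = \<phi> a"
  "a \<in> pts As \<Longrightarrow> intp As (\<lambda>b. \<phi> b * idk As b a) = \<phi> a"
proof -
  assume a: "a \<in> pts As"
  have "intp As (\<lambda>b. idk As a b * \<phi> b) = intp As (\<lambda>b. if b = a then \<phi> b else 0)"
    "intp As (\<lambda>b. \<phi> b * idk As b a) = intp As (\<lambda>b. if b = a then \<phi> b else 0)"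
    by (rule intp_cong; auto simp: idk_def a)+
  then show "intp As (\<lambda>b. idk As a b * \<phi> b) = \<phi> a" "intp As (\<lambda>b. \<phi> b * idk As b a) = \<phi> a"
    using a by (simp_all add: intp_delta)
qed

lemma kr_comp_tens_pre:
  assumes F: "F \<in> ahom As Bs" and G: "G \<in> ahom Cs Ds" and M: "M \<in> ahom (tl_obj Bs Ds) Es"
    and p: "a \<in> pts As" "c \<in> pts Cs"
  shows "kr (tl_obj As Cs) Es (comp_mor CA M (tens_mor CA F G)) (pr (length Cs) a c) y =
    intp Bs (\<lambda>b. intp Ds (\<lambda>d. kr As Bs F a b * kr Cs Ds G c d * kr (tl_obj Bs Ds) Es M (pr (length Ds) b d) y))"
proof -
  have "kr (tl_obj As Cs) Es (comp_mor CA M (tens_mor CA F G)) (pr (length Cs) a c) y =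
    intp (tl_obj Bs Ds) (\<lambda>z. kr (tl_obj As Cs) (tl_obj Bs Ds) (tens_mor CA F G) (pr (length Cs) a c) z * kr (tl_obj Bs Ds) Es M z y)"
    unfolding kr_comp[OF tens_ahom[OF F G] M] kc_def ..
  also have "\<dots> = intp Bs (\<lambda>b. intp Ds (\<lambda>d. kr (tl_obj As Cs) (tl_obj Bs Ds) (tens_mor CA F G) (pr (length Cs) a c) (pr (length Ds) b d) *
      kr (tl_obj Bs Ds) Es M (pr (length Ds) b d) y))"
    by (intro intp_tl_obj fs_mult fs_kr[OF tens_ahom[OF F G]] fs_kr[OF M] fs_intros)
  finally show ?thesis
    by (simp add: kr_tens[OF F G] p cong: intp_cong)
qed

lemma kr_comp_tens_post:
  assumes F: "F \<in> ahom As Bs" and G: "G \<in> ahom Cs Ds" and M: "M \<in> ahom Es (tl_obj As Cs)"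
    and p: "b \<in> pts Bs" "d \<in> pts Ds"
  shows "kr Es (tl_obj Bs Ds) (comp_mor CA (tens_mor CA F G) M) x (pr (length Ds) b d) =
    intp As (\<lambda>a. intp Cs (\<lambda>c. kr Es (tl_obj As Cs) M x (pr (length Cs) a c) * kr As Bs F a b * kr Cs Ds G c d))"
proof -
  have "kr Es (tl_obj Bs Ds) (comp_mor CA (tens_mor CA F G) M) x (pr (length Ds) b d) =
    intp (tl_obj As Cs) (\<lambda>z. kr Es (tl_obj As Cs) M x z * kr (tl_obj As Cs) (tl_obj Bs Ds) (tens_mor CA F G) z (pr (length Ds) b d))"
    unfolding kr_comp[OF M tens_ahom[OF F G]] kc_def ..
  also have "\<dots> = intp As (\<lambda>a. intp Cs (\<lambda>c. kr Es (tl_obj As Cs) M x (pr (length Cs) a c) *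
      kr (tl_obj As Cs) (tl_obj Bs Ds) (tens_mor CA F G) (pr (length Cs) a c) (pr (length Ds) b d)))"
    by (intro intp_tl_obj fs_mult fs_kr[OF tens_ahom[OF F G]] fs_kr[OF M] fs_intros)
  finally show ?thesis
    by (simp add: kr_tens[OF F G] p mult.assoc cong: intp_cong)
qed

definition Xp :: "nat \<Rightarrow> nat list \<times> pmor mat" where "Xp k = ([k], ident CA [k])"

lemma Xp_object: "Xp k \<in> objects RS"
  unfolding Xp_def RS_objects by (simp add: id_ahom CA_id_left[OF id_ahom])

lemma Xp_tens: "tens_obj RS (Xp k) (Xp l) = Xp (k + l)"
  using CA_tens_id[of "[k]" "[l]"] by (simp add: Xp_def)

lemma X_obj_Xp: "X_obj = Xp 1"
  unfolding X_obj_def Xp_def CA_id by (auto intro!: eq_matI)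

end

locale center_object = deligne +
  fixes As :: "nat list" and e :: "pmor mat" and c :: "nat list \<times> pmor mat \<Rightarrow> pmor mat"
  assumes Y: "(As, e) \<in> objects RS" and hb: "half_braiding RS (As, e) c"
begin

abbreviation "n \<equiv> length As"
abbreviation "E \<equiv> kr As As e"

lemma e_hom: "e \<in> ahom As As" "comp_mor CA e e = e"
  using Y by (auto simp: RS_objects)

lemma E_kern: "E \<in> kern As As"
  by (rule kr_kern[OF e_hom(1)])

lemma E_idem: "kc As E E = E"
  using kr_comp[OF e_hom(1,1)] e_hom(2) by simp

text \<open>The kernel of the half-braiding with \<open>V\<close> as a function of the tensor
  factors: the source point is made of \<open>a\<close> and \<open>v\<close>, the target point of
  \<open>v'\<close> and \<open>b\<close>.\<close>

definition c4 :: "nat list \<times> pmor mat \<Rightarrow> pt \<Rightarrow> pt \<Rightarrow> pt \<Rightarrow> pt \<Rightarrow> complex" where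
  "c4 V a v v' b = kr (tl_obj As (fst V)) (tl_obj (fst V) As) (c V) (pr (length (fst V)) a v) (pr n v' b)"

lemma c_hom:
  assumes V: "(Bs, f) \<in> objects RS"
  shows "c (Bs, f) \<in> ahom (tl_obj As Bs) (tl_obj Bs As)"
    "comp_mor CA (tens_mor CA f e) (c (Bs, f)) = c (Bs, f)"
    "comp_mor CA (c (Bs, f)) (tens_mor CA e f) = c (Bs, f)"
proof -
  have "c (Bs, f) \<in> homs RS (tens_obj RS (As, e) (Bs, f)) (tens_obj RS (Bs, f) (As, e))"
    using smcat.hb_in[OF RS_smcat hb V] .
  moreover have "tens_obj RS (As, e) (Bs, f) \<in> objects RS" "tens_obj RS (Bs, f) (As, e) \<in> objects RS"
    using smcat.tobj[OF RS_smcat] Y V by blast+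
  ultimately show "c (Bs, f) \<in> ahom (tl_obj As Bs) (tl_obj Bs As)"
    "comp_mor CA (tens_mor CA f e) (c (Bs, f)) = c (Bs, f)"
    "comp_mor CA (c (Bs, f)) (tens_mor CA e f) = c (Bs, f)"
    using RS_homD[of "c (Bs, f)" "tl_obj As Bs" "tens_mor CA e f" "tl_obj Bs As" "tens_mor CA f e"] by simp_all
qed

lemma V_hom: "(Bs, f) \<in> objects RS \<Longrightarrow> f \<in> ahom Bs Bs" "(Bs, f) \<in> objects RS \<Longrightarrow> comp_mor CA f f = f"
  by (auto simp: RS_objects)

text \<open>Identities of the Karoubi envelope are idempotents, so the axioms for \<open>c\<close>
  come with \<open>e\<close> and \<open>f\<close> in the place of identities. Absorbing each of them
  separately makes it possible to compute with genuine identities, whose kernels are equality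
  kernels.\<close>

lemma c_absorb:
  assumes V: "(Bs, f) \<in> objects RS"
  shows "comp_mor CA (tens_mor CA f (ident CA As)) (c (Bs, f)) = c (Bs, f)"
    "comp_mor CA (tens_mor CA (ident CA Bs) e) (c (Bs, f)) = c (Bs, f)"
    "comp_mor CA (c (Bs, f)) (tens_mor CA e (ident CA Bs)) = c (Bs, f)"
    "comp_mor CA (c (Bs, f)) (tens_mor CA (ident CA As) f) = c (Bs, f)"
proof -
  note f = V_hom[OF V] and c = c_hom[OF V]
  have t: "tens_mor CA f e \<in> ahom (tl_obj Bs As) (tl_obj Bs As)" "tens_mor CA e f \<in> ahom (tl_obj As Bs) (tl_obj As Bs)"
    by (intro tens_ahom e_hom f)+
  have 1: "comp_mor CA (tens_mor CA f (ident CA As)) (tens_mor CA f e) = tens_mor CA f e"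
    "comp_mor CA (tens_mor CA (ident CA Bs) e) (tens_mor CA f e) = tens_mor CA f e"
    "comp_mor CA (tens_mor CA e f) (tens_mor CA e (ident CA Bs)) = tens_mor CA e f"
    "comp_mor CA (tens_mor CA e f) (tens_mor CA (ident CA As) f) = tens_mor CA e f"
    using CA_interchange[OF f(1) f(1) e_hom(1) id_ahom] CA_interchange[OF f(1) id_ahom e_hom(1) e_hom(1)]
      CA_interchange[OF e_hom(1) e_hom(1) id_ahom f(1)] CA_interchange[OF id_ahom e_hom(1) f(1) f(1)]
    by (simp_all add: f(2) e_hom(2) CA_id_left[OF f(1)] CA_id_left[OF e_hom(1)] CA_id_right[OF f(1)] CA_id_right[OF e_hom(1)])
  have i: "tens_mor CA f (ident CA As) \<in> ahom (tl_obj Bs As) (tl_obj Bs As)" "tens_mor CA (ident CA Bs) e \<in> ahom (tl_obj Bs As) (tl_obj Bs As)"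
    "tens_mor CA e (ident CA Bs) \<in> ahom (tl_obj As Bs) (tl_obj As Bs)" "tens_mor CA (ident CA As) f \<in> ahom (tl_obj As Bs) (tl_obj As Bs)"
    by (intro tens_ahom e_hom f id_ahom)+
  show "comp_mor CA (tens_mor CA f (ident CA As)) (c (Bs, f)) = c (Bs, f)"
    using CA_assoc[OF c(1) t(1) i(1)] c 1 by simp
  show "comp_mor CA (tens_mor CA (ident CA Bs) e) (c (Bs, f)) = c (Bs, f)"
    using CA_assoc[OF c(1) t(1) i(2)] c 1 by simp
  show "comp_mor CA (c (Bs, f)) (tens_mor CA e (ident CA Bs)) = c (Bs, f)"
    using CA_assoc[OF i(3) t(2) c(1)] c 1 by simp
  show "comp_mor CA (c (Bs, f)) (tens_mor CA (ident CA As) f) = c (Bs, f)"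
    using CA_assoc[OF i(4) t(2) c(1)] c 1 by simp
qed

lemma fs_c4:
  assumes V: "V \<in> objects RS" and q: "eqm w" "eqm x" "eqm y" "eqm z"
  shows "fs (\<lambda>u. c4 V (w u) (x u) (y u) (z u))"
proof -
  have "c V \<in> ahom (tl_obj As (fst V)) (tl_obj (fst V) As)" using c_hom(1)[of "fst V" "snd V"] V by simp
  then show ?thesis unfolding c4_def by (intro fs_kr eqm_pr q)
qed

lemma c4_act: "V \<in> objects RS \<Longrightarrow> bij \<pi> \<Longrightarrow> c4 V (act \<pi> a) (act \<pi> v) (act \<pi> v') (act \<pi> b) = c4 V a v v' b"
  using kern_act[OF kr_kern[OF c_hom(1)], of "fst V" "snd V"] by (simp add: c4_def)

lemma c4_absorb:
  assumes V: "(Bs, f) \<in> objects RS" and p: "a \<in> pts As" "v \<in> pts Bs" "v' \<in> pts Bs" "b \<in> pts As"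
  shows "intp Bs (\<lambda>w. c4 (Bs, f) a v w b * kr Bs Bs f w v') = c4 (Bs, f) a v v' b"
    "intp As (\<lambda>w. c4 (Bs, f) a v v' w * E w b) = c4 (Bs, f) a v v' b"
    "intp As (\<lambda>w. E a w * c4 (Bs, f) w v v' b) = c4 (Bs, f) a v v' b"
    "intp Bs (\<lambda>w. kr Bs Bs f v w * c4 (Bs, f) a w v' b) = c4 (Bs, f) a v v' b"
proof -
  note ch = c_hom(1)[OF V] and f = V_hom(1)[OF V]
  note pre = kr_comp_tens_pre[OF _ _ ch, where y = "pr n v' b", OF _ _ p(1,2)]
  note post = kr_comp_tens_post[OF _ _ ch, where x = "pr (length Bs) a v", OF _ _ p(3,4)]
  have d: "c4 (Bs, f) a v v' b = kr (tl_obj As Bs) (tl_obj Bs As) (c (Bs, f)) (pr (length Bs) a v) (pr n v' b)" for a v v' b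
    by (simp add: c4_def)
  show "intp Bs (\<lambda>w. c4 (Bs, f) a v w b * kr Bs Bs f w v') = c4 (Bs, f) a v v' b"
    using post[OF f id_ahom] p unfolding c_absorb(1)[OF V] kr_id intp_idk[OF p(4)] d[symmetric] by simp
  show "intp As (\<lambda>w. c4 (Bs, f) a v v' w * E w b) = c4 (Bs, f) a v v' b"
  proof -
    have "c4 (Bs, f) a v v' b = intp Bs (\<lambda>w. intp As (\<lambda>x. c4 (Bs, f) a v w x * idk Bs w v' * E x b))"
      using post[OF id_ahom e_hom(1)] unfolding c_absorb(2)[OF V] kr_id d[symmetric] .
    also have "\<dots> = intp Bs (\<lambda>w. intp As (\<lambda>x. c4 (Bs, f) a v w x * E x b) * idk Bs w v')"
      by (subst intp_multc[symmetric])
         (simp_all add: mult_ac fs_mult fs_c4[OF V] fs_kr[OF e_hom(1)] eqm_const eqm_id)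
    also have "\<dots> = intp As (\<lambda>x. c4 (Bs, f) a v v' x * E x b)" by (rule intp_idk(2)[OF p(3)])
    finally show ?thesis by simp
  qed
  show "intp As (\<lambda>w. E a w * c4 (Bs, f) w v v' b) = c4 (Bs, f) a v v' b"
  proof -
    have "c4 (Bs, f) a v v' b = intp As (\<lambda>x. intp Bs (\<lambda>w. E a x * idk Bs v w * c4 (Bs, f) x w v' b))"
      using pre[OF e_hom(1) id_ahom] unfolding c_absorb(3)[OF V] kr_id d[symmetric] .
    also have "\<dots> = intp As (\<lambda>x. intp Bs (\<lambda>w. idk Bs v w * (E a x * c4 (Bs, f) x w v' b)))"
      by (simp add: mult_ac)
    finally show ?thesis unfolding intp_idk[OF p(2)] by simp
  qed
  show "intp Bs (\<lambda>w. kr Bs Bs f v w * c4 (Bs, f) a w v' b) = c4 (Bs, f) a v v' b"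
  proof -
    have "c4 (Bs, f) a v v' b = intp As (\<lambda>x. intp Bs (\<lambda>w. idk As a x * kr Bs Bs f v w * c4 (Bs, f) x w v' b))"
      using pre[OF id_ahom f] unfolding c_absorb(4)[OF V] kr_id d[symmetric] .
    also have "\<dots> = intp As (\<lambda>x. idk As a x * intp Bs (\<lambda>w. kr Bs Bs f v w * c4 (Bs, f) x w v' b))"
      by (subst intp_cmult[symmetric])
         (simp_all add: mult_ac fs_mult fs_c4[OF V] fs_kr[OF f] eqm_const eqm_id)
    finally show ?thesis unfolding intp_idk[OF p(1)] by simp
  qed
qed

lemma c4_nat:
  assumes V: "(Bs, f) \<in> objects RS" and W: "(Cs, g) \<in> objects RS" and h: "h \<in> homs RS (Bs, f) (Cs, g)"
    and p: "a \<in> pts As" "v \<in> pts Bs" "w \<in> pts Cs" "b \<in> pts As"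
  shows "intp Bs (\<lambda>v'. c4 (Bs, f) a v v' b * kr Bs Cs h v' w) = intp Cs (\<lambda>w'. kr Bs Cs h v w' * c4 (Cs, g) a w' w b)"
proof -
  have hh: "h \<in> ahom Bs Cs" using RS_homD(1)[OF h V W] .
  have eq: "comp_mor CA (tens_mor CA h e) (c (Bs, f)) = comp_mor CA (c (Cs, g)) (tens_mor CA e h)"
    using smcat.hb_nat[OF RS_smcat hb V W h] by simp
  have t1: "tens_mor CA h e = comp_mor CA (tens_mor CA h (ident CA As)) (tens_mor CA (ident CA Bs) e)"
    using CA_interchange[OF id_ahom hh e_hom(1) id_ahom] by (simp add: CA_id_left[OF e_hom(1)] CA_id_right[OF hh])
  have t2: "tens_mor CA e h = comp_mor CA (tens_mor CA e (ident CA Cs)) (tens_mor CA (ident CA As) h)"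
    using CA_interchange[OF id_ahom e_hom(1) hh id_ahom] by (simp add: CA_id_left[OF hh] CA_id_right[OF e_hom(1)])
  \<comment> \<open>Naturality involves the identity \<open>e\<close> of \<open>(As, e)\<close>; on
    both sides this factor is absorbed by the half-braiding.\<close>
  have "comp_mor CA (tens_mor CA h (ident CA As)) (c (Bs, f)) = comp_mor CA (c (Cs, g)) (tens_mor CA (ident CA As) h)"
  proof -
    have "comp_mor CA (tens_mor CA h e) (c (Bs, f)) = comp_mor CA (tens_mor CA h (ident CA As)) (c (Bs, f))"
      unfolding t1 by (subst CA_assoc[OF c_hom(1)[OF V], symmetric])
        (rule tens_ahom id_ahom e_hom hh | simp add: c_absorb(2)[OF V])+
    moreover have "comp_mor CA (c (Cs, g)) (tens_mor CA e h) = comp_mor CA (c (Cs, g)) (tens_mor CA (ident CA As) h)"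
      unfolding t2 by (subst CA_assoc[OF _ _ c_hom(1)[OF W]])
        (rule tens_ahom id_ahom e_hom hh | simp add: c_absorb(3)[OF W])+
    ultimately show ?thesis using eq by simp
  qed
  then have "kr (tl_obj As Bs) (tl_obj Cs As) (comp_mor CA (tens_mor CA h (ident CA As)) (c (Bs, f))) (pr (length Bs) a v) (pr n w b) =
    kr (tl_obj As Bs) (tl_obj Cs As) (comp_mor CA (c (Cs, g)) (tens_mor CA (ident CA As) h)) (pr (length Bs) a v) (pr n w b)" by simp
  then have "intp Bs (\<lambda>v'. intp As (\<lambda>b'. c4 (Bs, f) a v v' b' * kr Bs Cs h v' w * idk As b' b)) =
     intp As (\<lambda>a'. intp Cs (\<lambda>w'. idk As a a' * kr Bs Cs h v w' * c4 (Cs, g) a' w' w b))"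
    unfolding kr_comp_tens_post[OF hh id_ahom c_hom(1)[OF V] p(3,4)] kr_comp_tens_pre[OF id_ahom hh c_hom(1)[OF W] p(1,2)] kr_id
    by (simp add: c4_def)
  also have "intp As (\<lambda>a'. intp Cs (\<lambda>w'. idk As a a' * kr Bs Cs h v w' * c4 (Cs, g) a' w' w b)) =
     intp As (\<lambda>a'. idk As a a' * intp Cs (\<lambda>w'. kr Bs Cs h v w' * c4 (Cs, g) a' w' w b))"
    by (subst intp_cmult[symmetric])
       (simp_all add: mult_ac fs_mult fs_c4[OF W] fs_kr[OF hh] eqm_const eqm_id)
  finally show ?thesis unfolding intp_idk[OF p(1)] intp_idk[OF p(4)] .
qed

text \<open>In the hexagon the identities of \<open>(Bs, f)\<close> and \<open>(Cs, g)\<close> are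
  idempotents. Once \<open>c_absorb\<close> has replaced them by genuine identities, the integrals
  over the intermediate points of \<open>Bs\<close> and \<open>Cs\<close> collapse and only the one
  over \<open>As\<close> remains.\<close>

lemma c4_tens:
  assumes V: "(Bs, f) \<in> objects RS" and W: "(Cs, g) \<in> objects RS"
    and p: "a \<in> pts As" "v \<in> pts Bs" "v' \<in> pts Bs" "w \<in> pts Cs" "w' \<in> pts Cs" "b \<in> pts As"
  shows "c4 (tens_obj RS (Bs, f) (Cs, g)) a (pr (length Cs) v w) (pr (length Cs) v' w') b =
    intp As (\<lambda>x. c4 (Bs, f) a v v' x * c4 (Cs, g) x w w' b)"
proof -
  note f = V_hom(1)[OF V] and g = V_hom(1)[OF W] and cV = c_hom(1)[OF V] and cW = c_hom(1)[OF W]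
  have i: "ident CA Bs \<in> ahom Bs Bs" "ident CA Cs \<in> ahom Cs Cs" by (rule id_ahom)+
  have t1: "tens_mor CA f (c (Cs, g)) = comp_mor CA (tens_mor CA (ident CA Bs) (c (Cs, g))) (tens_mor CA (tens_mor CA f (ident CA As)) (ident CA Cs))"
    using CA_interchange[OF f i(1) id_ahom cW] CA_tens_assoc[OF f id_ahom[of As] i(2)]
    by (simp add: CA_tens_id CA_id_left[OF f] CA_id_right[OF cW])
  let ?L = "tens_mor CA (ident CA Bs) (c (Cs, g))" and ?F = "tens_mor CA (tens_mor CA f (ident CA As)) (ident CA Cs)"
    and ?R = "tens_mor CA (c (Bs, f)) g" and ?R' = "tens_mor CA (c (Bs, f)) (ident CA Cs)"
  have L: "?L \<in> ahom (tl_obj Bs (tl_obj As Cs)) (tl_obj Bs (tl_obj Cs As))" by (intro tens_ahom i cW)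
  have R': "?R' \<in> ahom (tl_obj As (tl_obj Bs Cs)) (tl_obj Bs (tl_obj As Cs))"
    using tens_ahom[OF cV i(2)] unfolding tl_obj_assoc .
  have gW: "comp_mor CA ?L (tens_mor CA (ident CA (tl_obj Bs As)) g) = ?L"
    using CA_interchange[OF i(1) i(1) tens_ahom[OF id_ahom[of As] g] cW] CA_tens_assoc[OF i(1) id_ahom[of As] g]
    by (simp add: CA_id_left[OF i(1)] c_absorb(4)[OF W] flip: CA_tens_id)
  have gR2: "?R = comp_mor CA (tens_mor CA (ident CA (tl_obj Bs As)) g) ?R'"
    using CA_interchange[OF cV id_ahom i(2) g] by (simp add: CA_id_right[OF g] CA_id_left[OF cV])
  have gh: "tens_mor CA (ident CA (tl_obj Bs As)) g \<in> ahom (tl_obj Bs (tl_obj As Cs)) (tl_obj Bs (tl_obj As Cs))"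
    using tens_ahom[OF id_ahom g, of "tl_obj Bs As"] unfolding tl_obj_assoc .
  have Fh: "?F \<in> ahom (tl_obj Bs (tl_obj As Cs)) (tl_obj Bs (tl_obj As Cs))"
    using tens_ahom[OF tens_ahom[OF f id_ahom] i(2), of As] unfolding tl_obj_assoc .
  have FR: "comp_mor CA ?F ?R = ?R"
    using CA_interchange[OF cV tens_ahom[OF f id_ahom] g i(2)] by (simp add: c_absorb(1)[OF V] CA_id_left[OF g])
  have R: "?R \<in> ahom (tl_obj As (tl_obj Bs Cs)) (tl_obj Bs (tl_obj As Cs))"
    using tens_ahom[OF cV g] unfolding tl_obj_assoc .
  have "c (tens_obj RS (Bs, f) (Cs, g)) = comp_mor CA (tens_mor CA f (c (Cs, g))) ?R"
    using smcat.hb_tens[OF RS_smcat hb V W] by simp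
  also have "\<dots> = comp_mor CA ?L ?R"
    unfolding t1 using CA_assoc[OF R Fh L] FR by simp
  also have "\<dots> = comp_mor CA ?L ?R'" unfolding gR2 using CA_assoc[OF R' gh L] gW by simp
  finally have cc: "c (tens_obj RS (Bs, f) (Cs, g)) = comp_mor CA ?L ?R'" .
  have asc: "pr (length (tl_obj Bs Cs)) a (pr (length Cs) v w) = pr (length Cs) (pr (length Bs) a v) w"
    "pr n (pr (length Cs) v' w') b = pr (length (tl_obj Cs As)) v' (pr n w' b)"
    "pr (length (tl_obj As Cs)) v1 (pr (length Cs) x w1) = pr (length Cs) (pr n v1 x) w1" for v1 x w1
    by (simp_all only: pr_assoc)
  have R'v: "kr (tl_obj As (tl_obj Bs Cs)) (tl_obj Bs (tl_obj As Cs)) ?R' (pr (length Cs) (pr (length Bs) a v) w)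
      (pr (length (tl_obj As Cs)) v1 (pr (length Cs) x w1)) = c4 (Bs, f) a v v1 x * idk Cs w w1"
    if "v1 \<in> pts Bs" "x \<in> pts As" "w1 \<in> pts Cs" for v1 x w1
    using kr_tens[OF cV i(2), of "pr (length Bs) a v" "pr n v1 x" w w1] that p
    unfolding asc by (simp add: tl_obj_assoc kr_id c4_def del: length_concat)
  have "c4 (tens_obj RS (Bs, f) (Cs, g)) a (pr (length Cs) v w) (pr (length Cs) v' w') b =
     kr (tl_obj As (tl_obj Bs Cs)) (tl_obj Bs (tl_obj Cs As)) (comp_mor CA ?L ?R') (pr (length Cs) (pr (length Bs) a v) w)
       (pr (length (tl_obj Cs As)) v' (pr n w' b))"
    unfolding c4_def cc asc[symmetric] by (simp only: RS_simps fst_conv tl_obj_assoc)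
  also have "\<dots> = intp Bs (\<lambda>v1. intp (tl_obj As Cs) (\<lambda>z. kr (tl_obj As (tl_obj Bs Cs)) (tl_obj Bs (tl_obj As Cs)) ?R' (pr (length Cs) (pr (length Bs) a v) w)
      (pr (length (tl_obj As Cs)) v1 z) * idk Bs v1 v' * kr (tl_obj As Cs) (tl_obj Cs As) (c (Cs, g)) z (pr n w' b)))"
    using kr_comp_tens_post[OF i(1) cW R' p(3) pr_in_pts[OF p(5,6)]] unfolding kr_id .
  also have "\<dots> = intp Bs (\<lambda>v1. intp As (\<lambda>x. intp Cs (\<lambda>w1. kr (tl_obj As (tl_obj Bs Cs)) (tl_obj Bs (tl_obj As Cs)) ?R' (pr (length Cs) (pr (length Bs) a v) w)
      (pr (length (tl_obj As Cs)) v1 (pr (length Cs) x w1)) * idk Bs v1 v' * kr (tl_obj As Cs) (tl_obj Cs As) (c (Cs, g)) (pr (length Cs) x w1) (pr n w' b))))"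
    by (intro intp_cong intp_tl_obj fs_mult fs_kr[OF R'] fs_kr[OF cW] fs_kern[OF idk_kern] fs_intros)
  also have "\<dots> = intp Bs (\<lambda>v1. intp As (\<lambda>x. intp Cs (\<lambda>w1. idk Cs w w1 * (c4 (Bs, f) a v v1 x * idk Bs v1 v' * c4 (Cs, g) x w1 w' b))))"
    by (intro intp_cong) (simp only: R'v, simp add: c4_def mult_ac)
  also have "\<dots> = intp Bs (\<lambda>v1. intp As (\<lambda>x. c4 (Bs, f) a v v1 x * c4 (Cs, g) x w w' b) * idk Bs v1 v')"
    unfolding intp_idk[OF p(4)]
    by (subst intp_multc[symmetric]) (simp_all add: mult_ac fs_mult fs_c4[OF V] fs_c4[OF W] eqm_const eqm_id)
  also have "\<dots> = intp As (\<lambda>x. c4 (Bs, f) a v v' x * c4 (Cs, g) x w w' b)" by (rule intp_idk(2)[OF p(3)])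
  finally show ?thesis .
qed

text \<open>The kernel of the half-braiding with the \<open>k\<close>-th tensor power of X, where \<open>k\<close> is the length of \<open>I\<close>.\<close>

definition B :: "nat list \<Rightarrow> nat list \<Rightarrow> pt \<Rightarrow> pt \<Rightarrow> complex" where
  "B I J a b = (if a \<in> pts As \<and> b \<in> pts As \<and> length J = length I
     then c4 (Xp (length I)) a (Pt 0 I) (Pt 0 J) b else 0)"

abbreviation "pp i j \<equiv> B [i] [j]"

lemma B_act: "bij \<pi> \<Longrightarrow> B (act \<pi> I) (act \<pi> J) (act \<pi> a) (act \<pi> b) = B I J a b"
  using c4_act[OF Xp_object, of \<pi> "length I" a "Pt 0 I" "Pt 0 J" b]
  by (simp add: B_def act_nat_def[abs_def])

lemma fs_B: "eqm f \<Longrightarrow> eqm g \<Longrightarrow> eqm h \<Longrightarrow> eqm k \<Longrightarrow> fs (\<lambda>x. B (f x) (g x) (h x) (k x))"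
  by (rule fs4[where K = B, OF B_act])

lemma fs2_B: "fs2 (B I J)"
  by (intro fs_B fs_intros)

lemma B_supp: "B I J a b \<noteq> 0 \<Longrightarrow> a \<in> pts As \<and> b \<in> pts As"
  unfolding B_def by (auto split: if_splits)

lemma kc_0:
  assumes "\<not> (a \<in> pts As \<and> b \<in> pts As)" and K: "\<And>a b. K a b \<noteq> 0 \<Longrightarrow> a \<in> pts As \<and> b \<in> pts As"
    and L: "\<And>a b. L a b \<noteq> 0 \<Longrightarrow> a \<in> pts As \<and> b \<in> pts As"
  shows "kc As K L a b = 0"
  unfolding kc_def
proof (rule intp_zero)
  fix x
  show "K a x * L x b = 0" using assms(1) K[of a x] L[of x b] by (cases "K a x = 0"; cases "L x b = 0") auto
qed

lemma B_append:
  assumes l: "length J = length I" "length J' = length I'"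
  shows "B (I @ I') (J @ J') = kc As (B I J) (B I' J')"
proof (intro ext)
  fix a b
  show "B (I @ I') (J @ J') a b = kc As (B I J) (B I' J') a b"
  proof (cases "a \<in> pts As \<and> b \<in> pts As")
    case True
    let ?k = "length I" and ?l = "length I'"
    have t: "tens_obj RS ([?k], ident CA [?k]) ([?l], ident CA [?l]) = Xp (?k + ?l)"
      using Xp_tens[of ?k ?l] by (simp add: Xp_def)
    have "c4 (Xp (?k + ?l)) a (Pt 0 (I @ I')) (Pt 0 (J @ J')) b =
      intp As (\<lambda>x. c4 (Xp ?k) a (Pt 0 I) (Pt 0 J) x * c4 (Xp ?l) x (Pt 0 I') (Pt 0 J') b)"
      using c4_tens[OF Xp_object[of ?k, unfolded Xp_def] Xp_object[of ?l, unfolded Xp_def], of a "Pt 0 I" "Pt 0 J" "Pt 0 I'" "Pt 0 J'" b]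
        True l unfolding t by (simp add: Xp_def[symmetric])
    also have "\<dots> = kc As (B I J) (B I' J') a b"
      unfolding kc_def by (rule intp_cong) (use True l in \<open>simp add: B_def\<close>)
    finally show ?thesis using True l by (simp add: B_def)
  next
    case False
    then have "kc As (B I J) (B I' J') a b = 0" by (rule kc_0) (rule B_supp, assumption)+
    then show ?thesis using False by (auto simp: B_def)
  qed
qed

lemma B_Cons: "length J = length I \<Longrightarrow> B (i # I) (j # J) = kc As (pp i j) (B I J)"
  using B_append[of "[j]" "[i]" J I] by simp

lemma E_absorb: "kc As E (B I J) = B I J" "kc As (B I J) E = B I J"
proof -
  let ?V = "Xp (length I)"
  have V: "([length I], ident CA [length I]) \<in> objects RS" using Xp_object by (simp add: Xp_def)
  have "kc As E (B I J) a b = B I J a b \<and> kc As (B I J) E a b = B I J a b" for a b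
  proof (cases "a \<in> pts As \<and> b \<in> pts As \<and> length J = length I")
    case True
    then have p: "a \<in> pts As" "Pt 0 I \<in> pts [length I]" "Pt 0 J \<in> pts [length I]" "b \<in> pts As" by auto
    have "kc As E (B I J) a b = intp As (\<lambda>w. E a w * c4 ?V w (Pt 0 I) (Pt 0 J) b)"
      "kc As (B I J) E a b = intp As (\<lambda>w. c4 ?V a (Pt 0 I) (Pt 0 J) w * E w b)"
      unfolding kc_def by (rule intp_cong; use True in \<open>simp add: B_def\<close>)+
    then show ?thesis using c4_absorb(2,3)[OF V p] True by (simp add: Xp_def B_def)
  next
    case False
    show ?thesis
    proof (cases "a \<in> pts As \<and> b \<in> pts As")
      case True
      then have "B I J = (\<lambda>a b. 0)" using False by (auto simp: B_def fun_eq_iff)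
      then show ?thesis by (simp add: kc_def)
    next
      case False
      have "kc As E (B I J) a b = 0" "kc As (B I J) E a b = 0"
        by (rule kc_0[OF False]; use B_supp kern_supp[OF E_kern] in blast)+
      then show ?thesis using False by (auto simp: B_def)
    qed
  qed
  then show "kc As E (B I J) = B I J" "kc As (B I J) E = B I J" by auto
qed

text \<open>Every invariant function \<open>K\<close> on tuples is the kernel of a morphism between
  tensor powers of X, so naturality can be applied along it. The relations between the
  \<open>pp i j\<close> come from special choices of \<open>K\<close>.\<close>

lemma B_nat:
  assumes K: "\<And>\<pi> I J. bij \<pi> \<Longrightarrow> K (map \<pi> I) (map \<pi> J) = K I J"
    and l: "length I = k" "length J = l" and p: "a \<in> pts As" "b \<in> pts As"
  shows "intl k (\<lambda>J'. B I J' a b * K J' J) = intl l (\<lambda>I'. K I I' * B I' J a b)"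
proof -
  define L where "L x y = (case (x, y) of (Pt s xs, Pt r ys) \<Rightarrow>
    if s = 0 \<and> r = 0 \<and> length xs = k \<and> length ys = l then K xs ys else 0)" for x y
  have "L \<in> kern [k] [l]"
  proof (rule kernI)
    fix \<pi> :: "nat \<Rightarrow> nat" and a b assume "bij \<pi>"
    then show "L (act \<pi> a) (act \<pi> b) = L a b" by (cases a; cases b) (simp add: L_def K)
  next
    fix a b assume "L a b \<noteq> 0"
    then show "a \<in> pts [k] \<and> b \<in> pts [l]" by (cases a; cases b) (simp add: L_def split: if_splits)
  qed
  then obtain h where h: "h \<in> ahom [k] [l]" "kr [k] [l] h = L" by (rule kr_surj)
  have V: "([k], ident CA [k]) \<in> objects RS" "([l], ident CA [l]) \<in> objects RS" using Xp_object by (simp_all add: Xp_def)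
  have hh: "h \<in> homs RS ([k], ident CA [k]) ([l], ident CA [l])"
    by (rule RS_homI[OF h(1) CA_id_left[OF h(1)] CA_id_right[OF h(1)]])
  have "intp [k] (\<lambda>v'. c4 (Xp k) a (Pt 0 I) v' b * L v' (Pt 0 J)) = intp [l] (\<lambda>w'. L (Pt 0 I) w' * c4 (Xp l) a w' (Pt 0 J) b)"
    using c4_nat[OF V hh, of a "Pt 0 I" "Pt 0 J" b] p l unfolding h(2) by (simp add: Xp_def)
  then have "intl k (\<lambda>xs. c4 (Xp k) a (Pt 0 I) (Pt 0 xs) b * L (Pt 0 xs) (Pt 0 J)) =
     intl l (\<lambda>xs. L (Pt 0 I) (Pt 0 xs) * c4 (Xp l) a (Pt 0 xs) (Pt 0 J) b)"
    by (simp add: intp_def)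
  also have "intl k (\<lambda>xs. c4 (Xp k) a (Pt 0 I) (Pt 0 xs) b * L (Pt 0 xs) (Pt 0 J)) = intl k (\<lambda>J'. B I J' a b * K J' J)"
    by (rule intl_cong) (use l p in \<open>simp add: B_def L_def\<close>)
  also have "intl l (\<lambda>xs. L (Pt 0 I) (Pt 0 xs) * c4 (Xp l) a (Pt 0 xs) (Pt 0 J) b) = intl l (\<lambda>I'. K I I' * B I' J a b)"
    by (rule intl_cong) (use l p in \<open>simp add: B_def L_def\<close>)
  finally show ?thesis .
qed

lemma pp_eqI: "(\<And>a b. a \<in> pts As \<Longrightarrow> b \<in> pts As \<Longrightarrow> K a b = L a b) \<Longrightarrow>
   (\<And>a b. K a b \<noteq> 0 \<Longrightarrow> a \<in> pts As \<and> b \<in> pts As) \<Longrightarrow>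
   (\<And>a b. L a b \<noteq> 0 \<Longrightarrow> a \<in> pts As \<and> b \<in> pts As) \<Longrightarrow> K = L"
  by (intro ext) metis

lemma B_pair: "B [i, i'] [j, j'] = kc As (pp i j) (pp i' j')"
  by (rule B_Cons) simp

text \<open>Naturality along the multiplication of X, which sends a pair of equal points to that
  point: two different points cannot be sent to the same one.\<close>

lemma pp_target: "kc As (pp i k) (pp i' k) = (if i = i' then pp i k else (\<lambda>a b. 0))"
proof (rule pp_eqI)
  fix a b assume p: "a \<in> pts As" "b \<in> pts As"
  let ?K = "\<lambda>I J. of_bool (I = [hd J, hd J] \<and> length J = 1) :: complex"
  have K: "?K (map \<pi> I) (map \<pi> J) = ?K I J" if "bij \<pi>" for \<pi> I J
    using that by (cases J) (auto simp: inj_eq[OF bij_is_inj])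
  have "intl 2 (\<lambda>J'. B [i, i'] J' a b * ?K J' [k]) = intl 2 (\<lambda>J'. if J' = [k, k] then B [i, i'] J' a b else 0)"
    by (rule intl_cong) auto
  then have 1: "intl 2 (\<lambda>J'. B [i, i'] J' a b * ?K J' [k]) = B [i, i'] [k, k] a b" by (simp add: intl_delta)
  have "intl 1 (\<lambda>I'. ?K [i, i'] I' * B I' [k] a b) = intl 1 (\<lambda>I'. if I' = [i] then (of_bool (i = i') * B I' [k] a b) else 0)"
    by (rule intl_cong) (auto simp: length_Suc_conv)
  then have 2: "intl 1 (\<lambda>I'. ?K [i, i'] I' * B I' [k] a b) = of_bool (i = i') * pp i k a b"
    using intl_delta[of 1 "[i]" "\<lambda>I'. of_bool (i = i') * B I' [k] a b"] by simp
  show "kc As (pp i k) (pp i' k) a b = (if i = i' then pp i k else (\<lambda>a b. 0)) a b"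
    using B_nat[of ?K "[i, i']" 2 "[k]" 1, OF K _ _ p] 1 2 by (simp add: B_pair)
qed (auto simp: B_pair[symmetric] split: if_splits dest!: B_supp)

text \<open>Naturality along the comultiplication of X, which doubles a point: a point cannot be
  sent to two different ones.\<close>

lemma pp_source: "kc As (pp k j) (pp k j') = (if j = j' then pp k j else (\<lambda>a b. 0))"
proof (rule pp_eqI)
  fix a b assume p: "a \<in> pts As" "b \<in> pts As"
  let ?K = "\<lambda>J I. of_bool (I = [hd J, hd J] \<and> length J = 1) :: complex"
  have K: "?K (map \<pi> I) (map \<pi> J) = ?K I J" if "bij \<pi>" for \<pi> I J
    using that by (cases I) (auto simp: inj_eq[OF bij_is_inj])
  have "intl 2 (\<lambda>I'. ?K [k] I' * B I' [j, j'] a b) = intl 2 (\<lambda>I'. if I' = [k, k] then B I' [j, j'] a b else 0)"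
    by (rule intl_cong) auto
  then have 1: "intl 2 (\<lambda>I'. ?K [k] I' * B I' [j, j'] a b) = B [k, k] [j, j'] a b" by (simp add: intl_delta)
  have "intl 1 (\<lambda>J'. B [k] J' a b * ?K J' [j, j']) = intl 1 (\<lambda>J'. if J' = [j] then (of_bool (j = j') * B [k] J' a b) else 0)"
    by (rule intl_cong) (auto simp: length_Suc_conv)
  then have 2: "intl 1 (\<lambda>J'. B [k] J' a b * ?K J' [j, j']) = of_bool (j = j') * pp k j a b"
    using intl_delta[of 1 "[j]" "\<lambda>J'. of_bool (j = j') * B [k] J' a b"] by simp
  show "kc As (pp k j) (pp k j') a b = (if j = j' then pp k j else (\<lambda>a b. 0)) a b"
    using B_nat[of ?K "[k]" 1 "[j, j']" 2, OF K _ _ p] 1 2 by (simp add: B_pair)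
qed (auto simp: B_pair[symmetric] split: if_splits dest!: B_supp)

text \<open>Naturality along the flip of the two factors X.\<close>

lemma pp_commute: "kc As (pp i j) (pp i' j') = kc As (pp i' j') (pp i j)"
proof (rule pp_eqI)
  fix a b assume p: "a \<in> pts As" "b \<in> pts As"
  let ?K = "\<lambda>J I. of_bool (I = rev J) :: complex"
  have K: "?K (map \<pi> I) (map \<pi> J) = ?K I J" if "bij \<pi>" for \<pi> I J
    using inj_map_eq_map[OF bij_is_inj[OF that]] by (simp add: rev_map)
  have "intl 2 (\<lambda>I'. ?K [i, i'] I' * B I' [j', j] a b) = intl 2 (\<lambda>I'. if I' = [i', i] then B I' [j', j] a b else 0)"
    by (rule intl_cong) auto
  then have 1: "intl 2 (\<lambda>I'. ?K [i, i'] I' * B I' [j', j] a b) = B [i', i] [j', j] a b" by (simp add: intl_delta)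
  have "intl 2 (\<lambda>J'. B [i, i'] J' a b * ?K J' [j', j]) = intl 2 (\<lambda>J'. if J' = [j, j'] then B [i, i'] J' a b else 0)"
    by (rule intl_cong) (auto simp: numeral_2_eq_2 length_Suc_conv)
  then have 2: "intl 2 (\<lambda>J'. B [i, i'] J' a b * ?K J' [j', j]) = B [i, i'] [j, j'] a b" by (simp add: intl_delta)
  show "kc As (pp i j) (pp i' j') a b = kc As (pp i' j') (pp i j) a b"
    using B_nat[of ?K "[i, i']" 2 "[j', j]" 2, OF K _ _ p] 1 2 by (simp add: B_pair)
qed (auto simp: B_pair[symmetric] dest!: B_supp)

text \<open>The hexagon for two copies of the unit object shows that the braiding with the unit is
  idempotent. As an invertible idempotent it is the identity \<open>e\<close>.\<close>

lemma B_Nil: "B [] [] = E"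
proof (rule pp_eqI)
  let ?u = "([0], ident CA [0]) :: nat list \<times> pmor mat"
  have u: "?u \<in> objects RS" using Xp_object[of 0] by (simp add: Xp_def)
  have c1: "c ?u \<in> ahom As As" using c_hom(1)[OF u] by simp
  have c2: "comp_mor CA (c ?u) (c ?u) = c ?u"
    using smcat.hb_tens[OF RS_smcat hb u u] c1 CA_tens_unit[OF id_ahom[of "[0]"]] CA_tens_unit[OF c1] by simp
  have "is_iso RS (As, e) (As, e) (c ?u)"
    using smcat.hb_iso[OF RS_smcat hb u] CA_tens_unit[OF e_hom(1)] by simp
  then obtain g where g: "g \<in> homs RS (As, e) (As, e)" "comp_mor CA g (c ?u) = e" by (auto simp: is_iso_def)
  have gh: "g \<in> ahom As As" by (rule RS_homD(1)[OF g(1) Y Y])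
  have ec: "comp_mor CA e (c ?u) = c ?u" using c_hom(2)[OF u] CA_tens_unit[OF e_hom(1)] by simp
  have "c ?u = comp_mor CA (comp_mor CA g (c ?u)) (c ?u)" using ec g by simp
  also have "\<dots> = comp_mor CA g (comp_mor CA (c ?u) (c ?u))" by (rule CA_assoc[OF c1 c1 gh, symmetric])
  also have "\<dots> = e" using c2 g by simp
  finally have ce: "c ?u = e" .
  fix a b assume "a \<in> pts As" "b \<in> pts As"
  then show "B [] [] a b = E a b"
    using pr_unit(1)[of "Pt 0 []" n b] pr_unit(2)[of "Pt 0 []" a] ce by (simp add: B_def c4_def Xp_def)
qed (use B_supp kern_supp[OF E_kern] in blast)+

text \<open>Naturality along the morphism from X to the unit with constant kernel 1. For fixed
  \<open>i\<close> the orthogonal idempotents \<open>pp i j\<close> thus integrate to the identity: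
  every point is sent somewhere.\<close>

lemma pp_sum_target: "int1 (\<lambda>j. pp i j a b) = E a b"
proof (cases "a \<in> pts As \<and> b \<in> pts As")
  case True
  then show ?thesis
    using B_nat[of "\<lambda>I J. 1" "[i]" 1 "[]" 0 a b] by (simp add: B_Nil)
next
  case False
  then show ?thesis using kern_0[OF E_kern False] by (auto simp: B_def)
qed

text \<open>By naturality along the inclusions of the summands, the powers of X determine the half-braiding.\<close>

lemma c4_eq_B:
  assumes V: "(Bs, f) \<in> objects RS" and s: "s < length Bs" "length x = Bs ! s"
    and p: "a \<in> pts As" "v \<in> pts Bs" "b \<in> pts As"
  shows "c4 (Bs, f) a (Pt s x) v b = intl (Bs ! s) (\<lambda>x'. B x x' a b * kr Bs Bs f (Pt s x') v)"
proof -
  let ?k = "Bs ! s"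
  note f = V_hom[OF V]
  \<comment> \<open>The kernel of the inclusion of the \<open>s\<close>-th summand followed by
    \<open>f\<close>, a morphism from the tensor power of X with exponent \<open>?k\<close> to
    \<open>(Bs, f)\<close>.\<close>
  define L where "L y w = (case y of Pt r xs \<Rightarrow> if r = 0 then kr Bs Bs f (Pt s xs) w else 0)" for y w
  have "L \<in> kern [?k] Bs"
  proof (rule kernI)
    fix \<pi> :: "nat \<Rightarrow> nat" and a b assume "bij \<pi>"
    then show "L (act \<pi> a) (act \<pi> b) = L a b"
      using kern_act[OF kr_kern[OF f(1)], of \<pi> "Pt s _" b] by (cases a) (simp add: L_def)
  next
    fix a b assume "L a b \<noteq> 0"
    then show "a \<in> pts [?k] \<and> b \<in> pts Bs"
      using kern_supp[OF kr_kern[OF f(1)], of "Pt s _" b] by (cases a) (auto simp: L_def split: if_splits)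
  qed
  then obtain h where h: "h \<in> ahom [?k] Bs" "kr [?k] Bs h = L" by (rule kr_surj)
  have fL: "kc Bs L (kr Bs Bs f) = L"
  proof (intro ext)
    fix y w
    have "kc Bs (kr Bs Bs f) (kr Bs Bs f) u w = kr Bs Bs f u w" for u using kr_comp[OF f(1,1)] f(2) by simp
    then have "intp Bs (\<lambda>b. kr Bs Bs f u b * kr Bs Bs f b w) = kr Bs Bs f u w" for u
      unfolding kc_def .
    then show "kc Bs L (kr Bs Bs f) y w = L y w" by (cases y) (simp add: kc_def L_def)
  qed
  have V': "([?k], ident CA [?k]) \<in> objects RS" using Xp_object by (simp add: Xp_def)
  have fh: "comp_mor CA f h = h"
    by (rule kr_eqI[OF comp_ahom[OF h(1) f(1)] h(1)]) (simp add: kr_comp[OF h(1) f(1)] h(2) fL)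
  have hh: "h \<in> homs RS ([?k], ident CA [?k]) (Bs, f)"
    by (rule RS_homI[OF h(1) fh CA_id_right[OF h(1)]])
  have "intp [?k] (\<lambda>v'. c4 (Xp ?k) a (Pt 0 x) v' b * L v' v) = intp Bs (\<lambda>w'. L (Pt 0 x) w' * c4 (Bs, f) a w' v b)"
    using c4_nat[OF V' V hh, of a "Pt 0 x" v b] p s unfolding h(2) by (simp add: Xp_def)
  also have "\<dots> = intp Bs (\<lambda>w. kr Bs Bs f (Pt s x) w * c4 (Bs, f) a w v b)"
    by (simp only: L_def pt.case refl if_True)
  also have "\<dots> = c4 (Bs, f) a (Pt s x) v b"
    by (rule c4_absorb(4)[OF V p(1) _ p(2,3)]) (use s in simp)
  also have "intp [?k] (\<lambda>v'. c4 (Xp ?k) a (Pt 0 x) v' b * L v' v) = intl ?k (\<lambda>x'. B x x' a b * kr Bs Bs f (Pt s x') v)"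
  proof -
    have "intp [?k] (\<lambda>v'. c4 (Xp ?k) a (Pt 0 x) v' b * L v' v) = intl ?k (\<lambda>x'. c4 (Xp ?k) a (Pt 0 x) (Pt 0 x') b * L (Pt 0 x') v)"
      by (simp add: intp_def)
    also have "\<dots> = intl ?k (\<lambda>x'. B x x' a b * kr Bs Bs f (Pt s x') v)"
      by (rule intl_cong) (use s p in \<open>simp add: B_def L_def\<close>)
    finally show ?thesis .
  qed
  finally show ?thesis ..
qed

end

section \<open>The braiding with X decides which morphisms belong to the center\<close>

context deligne
begin

text \<open>Intertwining the braidings with X extends to tensor powers of X by the hexagon in the
  form \<open>B_Cons\<close>, and from there to every \<open>V\<close> by
  \<open>c4_eq_B\<close>.\<close>

lemma center_hom:
  assumes Y: "center_object t As e c" and Z: "center_object t Bs f d" and m: "m \<in> homs RS (As, e) (Bs, f)"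
    and comm: "\<And>i j. kc As (center_object.B t As c [i] [j]) (kr As Bs m) = kc Bs (kr As Bs m) (center_object.B t Bs d [i] [j])"
    and V: "V \<in> objects RS"
  shows "comp_mor RS (tens_mor RS (ident RS V) m) (c V) = comp_mor RS (d V) (tens_mor RS m (ident RS V))"
proof -
  interpret Y: center_object t As e c by (rule Y)
  interpret Z: center_object t Bs f d by (rule Z)
  let ?M = "kr As Bs m"
  have mh: "m \<in> ahom As Bs" "comp_mor CA f m = m" "comp_mor CA m e = m" using RS_homD[OF m Y.Y Z.Y] by auto
  have B: "kc As (Y.B I J) ?M = kc Bs ?M (Z.B I J)" if "length J = length I" for I J
    using that
  proof (induction I arbitrary: J)
    case Nil
    then show ?case
      using kr_comp[OF mh(1) Z.e_hom(1)] kr_comp[OF Y.e_hom(1) mh(1)] mh by (simp add: Y.B_Nil Z.B_Nil)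
  next
    case (Cons i I)
    then obtain j J' where J: "J = j # J'" "length J' = length I" by (cases J) auto
    have M: "fs2 ?M" by (rule fs2_kern[OF kr_kern[OF mh(1)]])
    have "kc As (Y.B (i # I) J) ?M = kc As (Y.B [i] [j]) (kc As (Y.B I J') ?M)"
      unfolding J(1) Y.B_Cons[OF J(2)] by (intro ext kc_assoc Y.fs2_B M)
    also have "\<dots> = kc As (Y.B [i] [j]) (kc Bs ?M (Z.B I J'))" unfolding Cons(1)[OF J(2)] ..
    also have "\<dots> = kc Bs (kc As (Y.B [i] [j]) ?M) (Z.B I J')" by (intro ext kc_assoc[symmetric] Y.fs2_B Z.fs2_B M)
    also have "\<dots> = kc Bs ?M (kc Bs (Z.B [i] [j]) (Z.B I J'))"
      unfolding comm by (intro ext kc_assoc Z.fs2_B M)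
    also have "\<dots> = kc Bs ?M (Z.B (i # I) J)" unfolding J(1) Z.B_Cons[OF J(2)] ..
    finally show ?case .
  qed
  obtain Cs g where Vg: "V = (Cs, g)" by (cases V)
  have V': "(Cs, g) \<in> objects RS" using V Vg by simp
  note g = Y.V_hom[OF V']
  have key: "intp As (\<lambda>x. Y.c4 V a v v' x * ?M x b) = intp Bs (\<lambda>x. ?M a x * Z.c4 V x v v' b)"
    if p: "a \<in> pts As" "v \<in> pts Cs" "v' \<in> pts Cs" "b \<in> pts Bs" for a v v' b
  proof -
    obtain s x where sx: "v = Pt s x" "s < length Cs" "length x = Cs ! s" using p(2) by (auto simp: pts_def)
    let ?G = "\<lambda>x'. kr Cs Cs g (Pt s x') v'" and ?k = "Cs ! s"
    have fG: "eqm h \<Longrightarrow> fs (\<lambda>z. ?G (h z))" for h :: "'z::pset \<Rightarrow> nat list" by (intro fs_kr[OF g(1)] fs_intros)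
    have "intp As (\<lambda>y. Y.c4 V a v v' y * ?M y b) = intp As (\<lambda>y. intl ?k (\<lambda>x'. Y.B x x' a y * ?G x') * ?M y b)"
      by (rule intp_cong) (simp add: Vg sx Y.c4_eq_B[OF V' sx(2,3) p(1,3)])
    also have "\<dots> = intp As (\<lambda>y. intl ?k (\<lambda>x'. ?M y b * (Y.B x x' a y * ?G x')))"
      by (subst mult.commute, subst intl_cmult[symmetric]) (intro fs_mult Y.fs_B fG fs_intros | simp)+
    also have "\<dots> = intl ?k (\<lambda>x'. intp As (\<lambda>y. ?M y b * (Y.B x x' a y * ?G x')))"
      by (rule intp_intl_swap) (intro fs_mult Y.fs_B fs_kr[OF mh(1)] fG fs_intros)
    also have "\<dots> = intl ?k (\<lambda>x'. kc As (Y.B x x') ?M a b * ?G x')"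
      unfolding kc_def
      by (subst intp_multc[symmetric]) (intro fs_mult Y.fs_B fs_kr[OF mh(1)] fs_intros | simp add: mult_ac)+
    also have "\<dots> = intl ?k (\<lambda>x'. kc Bs ?M (Z.B x x') a b * ?G x')"
      by (rule intl_cong) (simp add: B sx)
    also have "\<dots> = intl ?k (\<lambda>x'. intp Bs (\<lambda>y. ?M a y * (Z.B x x' y b * ?G x')))"
      unfolding kc_def
      by (subst intp_multc[symmetric]) (intro fs_mult Z.fs_B fs_kr[OF mh(1)] fs_intros | simp add: mult_ac)+
    also have "\<dots> = intp Bs (\<lambda>y. intl ?k (\<lambda>x'. ?M a y * (Z.B x x' y b * ?G x')))"
      by (rule intp_intl_swap[symmetric]) (intro fs_mult Z.fs_B fs_kr[OF mh(1)] fG fs_intros)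
    also have "\<dots> = intp Bs (\<lambda>y. ?M a y * intl ?k (\<lambda>x'. Z.B x x' y b * ?G x'))"
      by (subst intl_cmult[symmetric]) (intro fs_mult Z.fs_B fG fs_intros | simp)+
    also have "\<dots> = intp Bs (\<lambda>y. ?M a y * Z.c4 V y v v' b)"
      by (rule intp_cong) (simp add: Vg sx Z.c4_eq_B[OF V' sx(2,3) _ p(3,4)])
    finally show ?thesis .
  qed
  note cV = Y.c_hom(1)[OF V'] and dV = Z.c_hom(1)[OF V']
  have "comp_mor CA (tens_mor CA g m) (c (Cs, g)) = comp_mor CA (d (Cs, g)) (tens_mor CA m g)"
  proof -
    have t1: "tens_mor CA g m = comp_mor CA (tens_mor CA (ident CA Cs) m) (tens_mor CA g (ident CA As))"
      using CA_interchange[OF g(1) id_ahom id_ahom mh(1)] by (simp add: CA_id_left[OF g(1)] CA_id_right[OF mh(1)])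
    have t2: "tens_mor CA m g = comp_mor CA (tens_mor CA (ident CA Bs) g) (tens_mor CA m (ident CA Cs))"
      using CA_interchange[OF mh(1) id_ahom id_ahom g(1)] by (simp add: CA_id_left[OF mh(1)] CA_id_right[OF g(1)])
    have h: "tens_mor CA (ident CA Cs) m \<in> ahom (tl_obj Cs As) (tl_obj Cs Bs)" "tens_mor CA g (ident CA As) \<in> ahom (tl_obj Cs As) (tl_obj Cs As)"
      "tens_mor CA m (ident CA Cs) \<in> ahom (tl_obj As Cs) (tl_obj Bs Cs)" "tens_mor CA (ident CA Bs) g \<in> ahom (tl_obj Bs Cs) (tl_obj Bs Cs)"
      by (intro tens_ahom id_ahom g mh)+
    have "comp_mor CA (tens_mor CA g m) (c (Cs, g)) = comp_mor CA (tens_mor CA (ident CA Cs) m) (c (Cs, g))"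
      unfolding t1 using CA_assoc[OF cV h(2,1)] Y.c_absorb(1)[OF V'] by simp
    also have "\<dots> = comp_mor CA (d (Cs, g)) (tens_mor CA m (ident CA Cs))"
    proof (rule kr_tens_eqI)
      fix a b v w assume p: "a \<in> pts As" "b \<in> pts Cs" "v \<in> pts Cs" "w \<in> pts Bs"
      have "kr (tl_obj As Cs) (tl_obj Cs Bs) (comp_mor CA (tens_mor CA (ident CA Cs) m) (c (Cs, g))) (pr (length Cs) a v) (pr (length Bs) b w) =
         intp Cs (\<lambda>v'. intp As (\<lambda>x. Y.c4 V a v v' x * idk Cs v' b * ?M x w))"
        unfolding kr_comp_tens_post[OF id_ahom mh(1) cV p(2,4)] kr_id by (simp add: Y.c4_def Vg)
      also have "\<dots> = intp Cs (\<lambda>v'. intp As (\<lambda>x. Y.c4 V a v v' x * ?M x w) * idk Cs v' b)"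
        by (subst intp_multc[symmetric]) (intro fs_mult Y.fs_c4[OF V] fs_kr[OF mh(1)] fs_intros | simp add: mult_ac)+
      also have "\<dots> = intp As (\<lambda>x. Y.c4 V a v b x * ?M x w)" by (rule intp_idk(2)[OF p(2)])
      also have "\<dots> = intp Bs (\<lambda>x. ?M a x * Z.c4 V x v b w)" by (rule key[OF p(1,3,2,4)])
      also have "\<dots> = intp Bs (\<lambda>x. intp Cs (\<lambda>v'. idk Cs v v' * (?M a x * Z.c4 V x v' b w)))"
        unfolding intp_idk(1)[OF p(3)] ..
      also have "\<dots> = kr (tl_obj As Cs) (tl_obj Cs Bs) (comp_mor CA (d (Cs, g)) (tens_mor CA m (ident CA Cs))) (pr (length Cs) a v) (pr (length Bs) b w)"
        unfolding kr_comp_tens_pre[OF mh(1) id_ahom dV p(1,3)] kr_id by (simp add: Z.c4_def Vg mult_ac)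
      finally show "kr (tl_obj As Cs) (tl_obj Cs Bs) (comp_mor CA (tens_mor CA (ident CA Cs) m) (c (Cs, g))) (pr (length Cs) a v) (pr (length Bs) b w) =
        kr (tl_obj As Cs) (tl_obj Cs Bs) (comp_mor CA (d (Cs, g)) (tens_mor CA m (ident CA Cs))) (pr (length Cs) a v) (pr (length Bs) b w)" .
    qed (intro comp_ahom[OF cV h(1)] comp_ahom[OF h(3) dV])+
    also have "\<dots> = comp_mor CA (d (Cs, g)) (tens_mor CA m g)"
      unfolding t2 using CA_assoc[OF h(3,4) dV] Z.c_absorb(4)[OF V'] by simp
    finally show ?thesis .
  qed
  then show ?thesis by (simp add: Vg)
qed

end

section \<open>The center\<close>

context deligne
begin

lemma kr_pre_id:
  assumes F: "F \<in> ahom As Bs" and M: "M \<in> ahom (tl_obj Bs Ds) Es" and p: "a \<in> pts As" "d \<in> pts Ds"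
  shows "kr (tl_obj As Ds) Es (comp_mor CA M (tens_mor CA F (ident CA Ds))) (pr (length Ds) a d) y =
    intp Bs (\<lambda>b. kr As Bs F a b * kr (tl_obj Bs Ds) Es M (pr (length Ds) b d) y)"
proof -
  have "kr (tl_obj As Ds) Es (comp_mor CA M (tens_mor CA F (ident CA Ds))) (pr (length Ds) a d) y =
    intp Bs (\<lambda>b. intp Ds (\<lambda>c. idk Ds d c * (kr As Bs F a b * kr (tl_obj Bs Ds) Es M (pr (length Ds) b c) y)))"
    unfolding kr_comp_tens_pre[OF F id_ahom M p] kr_id by (simp add: mult_ac)
  then show ?thesis unfolding intp_idk[OF p(2)] .
qed

lemma kr_post_id:
  assumes G: "G \<in> ahom Cs Ds" and M: "M \<in> ahom Es (tl_obj As Cs)" and p: "a \<in> pts As" "d \<in> pts Ds"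
  shows "kr Es (tl_obj As Ds) (comp_mor CA (tens_mor CA (ident CA As) G) M) x (pr (length Ds) a d) =
    intp Cs (\<lambda>c. kr Es (tl_obj As Cs) M x (pr (length Cs) a c) * kr Cs Ds G c d)"
proof -
  have "kr Es (tl_obj As Ds) (comp_mor CA (tens_mor CA (ident CA As) G) M) x (pr (length Ds) a d) =
    intp As (\<lambda>b. intp Cs (\<lambda>c. kr Es (tl_obj As Cs) M x (pr (length Cs) b c) * kr Cs Ds G c d) * idk As b a)"
    unfolding kr_comp_tens_post[OF id_ahom G M p] kr_id
    by (subst intp_multc[symmetric]) (intro fs_mult fs_kr[OF M] fs_kr[OF G] fs_intros | simp add: mult_ac)+
  then show ?thesis unfolding intp_idk[OF p(1)] .
qed

abbreviation "ZC \<equiv> drinfeld_center RS"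

lemma ZC_objects: "((As, e), c) \<in> objects ZC \<longleftrightarrow> center_object t As e c"
  by (auto simp: drinfeld_center_def center_object_def)

lemma ZC_simps [simp]:
  "ident ZC ((As, e), c) = e" "comp_mor ZC = comp_mor CA"
  "unit_obj ZC = (unit_obj RS, \<lambda>V\<in>objects RS. ident RS V)" "plus_mor ZC = (+)"
  "zero_mor ZC ((As, e), c) ((Bs, f), d) = 0\<^sub>m (length Bs) (length As)"
  by (simp_all add: drinfeld_center_def)

lemma ZC_tens: "tens_obj ZC ((As, e), c) ((Bs, f), d) = ((tl_obj As Bs, tens_mor CA e f),
    \<lambda>V\<in>objects RS. comp_mor CA (tens_mor CA (c V) f) (tens_mor CA e (d V)))"
  by (simp add: drinfeld_center_def)

lemma ZC_tens_zob:
  assumes "center_object t As e c" "center_object t Bs f d"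
  shows "center_object t (tl_obj As Bs) (tens_mor CA e f) (\<lambda>V\<in>objects RS. comp_mor CA (tens_mor CA (c V) f) (tens_mor CA e (d V)))"
  using smcat.half_braiding_tens[OF RS_smcat, of "(As, e)" c "(Bs, f)" d] smcat.tobj[OF RS_smcat, of "(As, e)" "(Bs, f)"] assms
  by (simp add: center_object_def)

text \<open>Kernels of morphisms of the center; by \<open>center_hom\<close> only the half-braiding with X matters.\<close>

definition center_kernel :: "nat list \<Rightarrow> pmor mat \<Rightarrow> (nat list \<times> pmor mat \<Rightarrow> pmor mat) \<Rightarrow>
    nat list \<Rightarrow> pmor mat \<Rightarrow> (nat list \<times> pmor mat \<Rightarrow> pmor mat) \<Rightarrow> (pt \<Rightarrow> pt \<Rightarrow> complex) \<Rightarrow> bool" where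
  "center_kernel As e c Bs f d \<mu> \<longleftrightarrow> \<mu> \<in> kern As Bs \<and> kc As (kr As As e) \<mu> = \<mu> \<and> kc Bs \<mu> (kr Bs Bs f) = \<mu> \<and>
    (\<forall>i j. kc As (center_object.B t As c [i] [j]) \<mu> = kc Bs \<mu> (center_object.B t Bs d [i] [j]))"

lemma zh_mat:
  assumes Y: "center_object t As e c" and Z: "center_object t Bs f d" and \<mu>: "center_kernel As e c Bs f d \<mu>"
  obtains m where "m \<in> ahom As Bs" "kr As Bs m = \<mu>" "m \<in> homs RS (As, e) (Bs, f)" "m \<in> homs ZC ((As, e), c) ((Bs, f), d)"
proof -
  interpret Y: center_object t As e c by (rule Y)
  interpret Z: center_object t Bs f d by (rule Z)
  have k: "\<mu> \<in> kern As Bs" "kc As Y.E \<mu> = \<mu>" "kc Bs \<mu> Z.E = \<mu>" "\<And>i j. kc As (Y.B [i] [j]) \<mu> = kc Bs \<mu> (Z.B [i] [j])"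
    using \<mu> by (auto simp: center_kernel_def)
  obtain m where m: "m \<in> ahom As Bs" "kr As Bs m = \<mu>" by (rule kr_surj[OF k(1)])
  have "comp_mor CA f m = m"
    by (rule kr_eqI[OF comp_ahom[OF m(1) Z.e_hom(1)] m(1)]) (simp add: kr_comp[OF m(1) Z.e_hom(1)] m k)
  moreover have "comp_mor CA m e = m"
    by (rule kr_eqI[OF comp_ahom[OF Y.e_hom(1) m(1)] m(1)]) (simp add: kr_comp[OF Y.e_hom(1) m(1)] m k)
  ultimately have h: "m \<in> homs RS (As, e) (Bs, f)" by (intro RS_homI m)
  have "comp_mor RS (tens_mor RS (ident RS V) m) (c V) = comp_mor RS (d V) (tens_mor RS m (ident RS V))" if "V \<in> objects RS" for V
    by (rule center_hom[OF Y Z h _ that]) (simp add: m k)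
  then have "m \<in> homs ZC ((As, e), c) ((Bs, f), d)" using h by (simp add: drinfeld_center_def)
  then show thesis using that m h by blast
qed

text \<open>The identity \<open>e\<close> intertwines the two half-braidings at X, hence everywhere
  by \<open>center_hom\<close>. Outside the objects both are undefined by extensionality.\<close>

lemma hb_unique:
  assumes Y: "center_object t As e c" and Y': "center_object t As e d" and X: "c X_obj = d X_obj"
  shows "c = d"
proof
  interpret Y: center_object t As e c by (rule Y)
  interpret Y': center_object t As e d by (rule Y')
  fix V show "c V = d V"
  proof (cases "V \<in> objects RS")
    case True
    obtain Bs f where V: "V = (Bs, f)" by (cases V)
    have eh: "e \<in> homs RS (As, e) (As, e)" by (rule RS_homI) (use Y.e_hom in auto)
    have "Y.B [i] [j] = Y'.B [i] [j]" for i j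
      using X by (simp add: fun_eq_iff Y.B_def Y'.B_def Y.c4_def Y'.c4_def X_obj_Xp)
    then have "comp_mor RS (tens_mor RS (ident RS V) e) (c V) = comp_mor RS (d V) (tens_mor RS e (ident RS V))"
      by (intro center_hom[OF Y Y' eh _ True]) (simp add: Y'.E_absorb)
    then show ?thesis using Y.c_hom(2)[of Bs f] Y'.c_hom(3)[of Bs f] True by (simp add: V)
  next
    case False
    have "c \<in> extensional (objects RS)" "d \<in> extensional (objects RS)"
      using Y.hb Y'.hb by (simp_all only: half_braiding_def)
    then show ?thesis using extensional_arb[OF _ False] by metis
  qed
qed

section \<open>Splitting central idempotents and closure under retracts\<close>

lemma kc_diff_left: "fs2 K \<Longrightarrow> fs2 L \<Longrightarrow> fs2 M \<Longrightarrow> kc Bs (\<lambda>a b. K a b - L a b) M = (\<lambda>a b. kc Bs K M a b - kc Bs L M a b)"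
proof (intro ext)
  fix a c assume f: "fs2 K" "fs2 L" "fs2 M"
  have "kc Bs (\<lambda>a b. K a b - L a b) M a c = intp Bs (\<lambda>b. K a b * M b c - L a b * M b c)"
    unfolding kc_def by (simp add: left_diff_distrib)
  then show "kc Bs (\<lambda>a b. K a b - L a b) M a c = kc Bs K M a c - kc Bs L M a c"
    unfolding kc_def
    by (simp add: intp_diff fs_mult fs2D[OF f(1)] fs2D[OF f(2)] fs2D[OF f(3)] eqm_const eqm_id)
qed

lemma kc_diff_right: "fs2 K \<Longrightarrow> fs2 L \<Longrightarrow> fs2 M \<Longrightarrow> kc Bs M (\<lambda>a b. K a b - L a b) = (\<lambda>a b. kc Bs M K a b - kc Bs M L a b)"
proof (intro ext)
  fix a c assume f: "fs2 K" "fs2 L" "fs2 M"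
  have "kc Bs M (\<lambda>a b. K a b - L a b) a c = intp Bs (\<lambda>b. M a b * K b c - M a b * L b c)"
    unfolding kc_def by (simp add: right_diff_distrib)
  then show "kc Bs M (\<lambda>a b. K a b - L a b) a c = kc Bs M K a c - kc Bs M L a c"
    unfolding kc_def
    by (simp add: intp_diff fs_mult fs2D[OF f(1)] fs2D[OF f(2)] fs2D[OF f(3)] eqm_const eqm_id)
qed

text \<open>The image of a central idempotent carries the compressed half-braiding. Since
  \<open>\<eta>\<close> commutes with the \<open>pp i j\<close>, compressing these on both sides is
  the same as multiplying by \<open>\<eta>\<close> once.\<close>

lemma split_idem:
  assumes Y: "center_object t As e c" and \<eta>: "center_kernel As e c As e c \<eta>" and idem: "kc As \<eta> \<eta> = \<eta>"
  obtains h d where "center_object t As h d" "kr As As h = \<eta>" "\<And>i j. center_object.B t As d [i] [j] = kc As \<eta> (center_object.B t As c [i] [j])"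
    "center_kernel As h d As e c \<eta>" "center_kernel As e c As h d \<eta>"
proof -
  interpret Y: center_object t As e c by (rule Y)
  obtain h where h: "h \<in> ahom As As" "kr As As h = \<eta>" "h \<in> homs RS (As, e) (As, e)" "h \<in> homs ZC ((As, e), c) ((As, e), c)"
    by (rule zh_mat[OF Y Y \<eta>])
  have hh: "comp_mor CA h h = h"
    by (rule kr_eqI[OF comp_ahom[OF h(1,1)] h(1)]) (simp add: kr_comp[OF h(1,1)] h idem)
  have eh: "comp_mor CA e h = h" "comp_mor CA h e = h" using RS_homD[OF h(3) Y.Y Y.Y] by auto
  have o: "(As, h) \<in> objects RS" using h(1) hh by (simp add: RS_objects)
  have i: "h \<in> homs RS (As, h) (As, e)" and p: "h \<in> homs RS (As, e) (As, h)"
    by (intro RS_homI h hh eh)+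
  have cen: "comp_mor RS (tens_mor RS (ident RS V) (comp_mor RS h h)) (c V) = comp_mor RS (c V) (tens_mor RS (comp_mor RS h h) (ident RS V))"
    if "V \<in> objects RS" for V
    using h(4) that hh by (auto simp: drinfeld_center_def)
  let ?d = "\<lambda>V\<in>objects RS. comp_mor CA (tens_mor CA (ident RS V) h) (comp_mor CA (c V) (tens_mor CA h (ident RS V)))"
  have "half_braiding RS (As, h) ?d"
    using smcat.half_braiding_retract(1)[OF RS_smcat Y.hb Y.Y o i p _ cen] hh by simp
  then have Z: "center_object t As h ?d" using o by (simp add: center_object_def)
  interpret Z: center_object t As h ?d by (rule Z)
  have k: "\<eta> \<in> kern As As" "kc As Y.E \<eta> = \<eta>" "kc As \<eta> Y.E = \<eta>" "\<And>i j. kc As (Y.B [i] [j]) \<eta> = kc As \<eta> (Y.B [i] [j])"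
    using \<eta> by (auto simp: center_kernel_def)
  have f: "fs2 \<eta>" by (rule fs2_kern[OF k(1)])
  have B: "Z.B [i] [j] = kc As \<eta> (Y.B [i] [j])" for i j
  proof -
    have pt: "Z.B [i] [j] a b = kc As (kc As \<eta> (Y.B [i] [j])) \<eta> a b" if ab: "a \<in> pts As" "b \<in> pts As" for a b
    proof -
      let ?X = "([1], ident CA [1]) :: nat list \<times> pmor mat"
      have X: "?X \<in> objects RS" using Xp_object[of 1] by (simp add: Xp_def)
      note cX = Y.c_hom(1)[OF X]
      have hX: "tens_mor CA h (ident CA [1]) \<in> ahom (tl_obj As [1]) (tl_obj As [1])" by (intro tens_ahom h id_ahom)
      have v: "Pt 0 [i] \<in> pts [1]" "Pt 0 [j] \<in> pts [1]" by auto
      have "Z.B [i] [j] a b = kr (tl_obj As [1]) (tl_obj [1] As) (comp_mor CA (tens_mor CA (ident CA [1]) h) (comp_mor CA (c ?X) (tens_mor CA h (ident CA [1]))))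
          (pr (length [1::nat]) a (Pt 0 [i])) (pr (length As) (Pt 0 [j]) b)"
        using ab X by (simp add: Z.B_def Z.c4_def Xp_def)
      also have "\<dots> = intp As (\<lambda>y. intp As (\<lambda>x. \<eta> a x * Y.B [i] [j] x y) * \<eta> y b)"
        unfolding kr_post_id[OF h(1) comp_ahom[OF hX cX] v(2) ab(2)] kr_pre_id[OF h(1) cX ab(1) v(1)] h(2)
        by (rule intp_cong, rule arg_cong2[where f = "(*)"], rule intp_cong)
           (auto simp: Y.B_def Y.c4_def Xp_def)
      finally show ?thesis by (simp add: kc_def)
    qed
    have sup: "a \<in> pts As \<and> b \<in> pts As" if "kc As (kc As \<eta> (Y.B [i] [j])) \<eta> a b \<noteq> 0" for a b
    proof (rule ccontr)
      assume n: "\<not> (a \<in> pts As \<and> b \<in> pts As)"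
      have "x \<in> pts As \<and> y \<in> pts As" if "kc As \<eta> (Y.B [i] [j]) x y \<noteq> 0" for x y
      proof (rule ccontr)
        assume "\<not> (x \<in> pts As \<and> y \<in> pts As)"
        then have "kc As \<eta> (Y.B [i] [j]) x y = 0" by (rule Y.kc_0) (erule kern_supp[OF k(1)] Y.B_supp)+
        then show False using that by simp
      qed
      then have "kc As (kc As \<eta> (Y.B [i] [j])) \<eta> a b = 0"
        by (rule Y.kc_0[OF n _ kern_supp[OF k(1)]])
      then show False using that by simp
    qed
    have "Z.B [i] [j] = kc As (kc As \<eta> (Y.B [i] [j])) \<eta>"
      by (rule Y.pp_eqI[OF pt Z.B_supp sup])
    also have "\<dots> = kc As \<eta> (kc As (Y.B [i] [j]) \<eta>)" by (intro ext kc_assoc f Y.fs2_B)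
    also have "\<dots> = kc As (kc As \<eta> \<eta>) (Y.B [i] [j])" unfolding k(4) by (intro ext kc_assoc[symmetric] f Y.fs2_B)
    finally show ?thesis by (simp add: idem)
  qed
  have B1: "kc As (Z.B [i] [j]) \<eta> = kc As \<eta> (Y.B [i] [j])" for i j
  proof -
    have "kc As (Z.B [i] [j]) \<eta> = kc As \<eta> (kc As (Y.B [i] [j]) \<eta>)" unfolding B by (intro ext kc_assoc f Y.fs2_B)
    also have "\<dots> = kc As (kc As \<eta> \<eta>) (Y.B [i] [j])" unfolding k(4) by (intro ext kc_assoc[symmetric] f Y.fs2_B)
    finally show ?thesis by (simp add: idem)
  qed
  have B2: "kc As \<eta> (Z.B [i] [j]) = kc As (Y.B [i] [j]) \<eta>" for i j
  proof -
    have "kc As \<eta> (Z.B [i] [j]) = kc As (kc As \<eta> \<eta>) (Y.B [i] [j])" unfolding B by (intro ext kc_assoc[symmetric] f Y.fs2_B)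
    then show ?thesis by (simp add: idem k(4))
  qed
  show thesis
    by (rule that[OF Z h(2) B]) (use k idem B1 B2 in \<open>auto simp: center_kernel_def h(2)\<close>)
qed

lemma zh_complement:
  assumes Y: "center_object t As e c" and \<theta>: "center_kernel As e c As e c \<theta>" and idem: "kc As \<theta> \<theta> = \<theta>"
  defines "\<eta> \<equiv> (\<lambda>a b. kr As As e a b - \<theta> a b)"
  shows "center_kernel As e c As e c \<eta>" "kc As \<eta> \<eta> = \<eta>" "kc As \<eta> \<theta> = (\<lambda>a b. 0)" "kc As \<theta> \<eta> = (\<lambda>a b. 0)"
proof -
  interpret Y: center_object t As e c by (rule Y)
  have k: "\<theta> \<in> kern As As" "kc As Y.E \<theta> = \<theta>" "kc As \<theta> Y.E = \<theta>" "\<And>i j. kc As (Y.B [i] [j]) \<theta> = kc As \<theta> (Y.B [i] [j])"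
    using \<theta> by (auto simp: center_kernel_def)
  note f = fs2_kern[OF k(1)] fs2_kern[OF Y.E_kern]
  have kk: "\<eta> \<in> kern As As"
  proof (rule kernI)
    fix a b assume "\<eta> a b \<noteq> 0"
    then have "\<theta> a b \<noteq> 0 \<or> Y.E a b \<noteq> 0" by (auto simp: \<eta>_def)
    then show "a \<in> pts As \<and> b \<in> pts As" using kern_supp[OF k(1)] kern_supp[OF Y.E_kern] by blast
  qed (simp add: \<eta>_def kern_act[OF k(1)] kern_act[OF Y.E_kern])
  note d = kc_diff_left[OF f(2,1)] kc_diff_right[OF f(2,1)]
  show "kc As \<eta> \<theta> = (\<lambda>a b. 0)" unfolding \<eta>_def d(1)[OF f(1)] using k idem by simp
  show t\<eta>: "kc As \<theta> \<eta> = (\<lambda>a b. 0)" unfolding \<eta>_def d(2)[OF f(1)] using k idem by simp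
  have E\<eta>: "kc As Y.E \<eta> = \<eta>" unfolding \<eta>_def d(2)[OF f(2)] using k Y.E_idem by simp
  show "kc As \<eta> \<eta> = \<eta>"
    unfolding \<eta>_def d(1)[OF fs2_kern[OF kk, unfolded \<eta>_def]] using E\<eta> t\<eta> unfolding \<eta>_def by simp
  have "kc As \<eta> Y.E = \<eta>" unfolding \<eta>_def d(1)[OF f(2)] using k Y.E_idem by simp
  moreover have "kc As (Y.B [i] [j]) \<eta> = kc As \<eta> (Y.B [i] [j])" for i j
    unfolding \<eta>_def d(1)[OF Y.fs2_B] d(2)[OF Y.fs2_B] by (simp add: k Y.E_absorb)
  ultimately show "center_kernel As e c As e c \<eta>" using kk E\<eta> by (auto simp: center_kernel_def)
qed

lemma sum_from_split:
  assumes S: "center_object t Bs f d" and A: "center_object t As e c" and C: "center_object t Cs g b"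
    and i: "center_kernel As e c Bs f d \<mu>" and p: "center_kernel Bs f d As e c \<nu>" and j: "center_kernel Cs g b Bs f d \<mu>'" and q: "center_kernel Bs f d Cs g b \<nu>'"
    and e: "kc Bs \<mu> \<nu> = kr As As e" "kc Bs \<mu>' \<nu>' = kr Cs Cs g" "kc Bs \<mu>' \<nu> = (\<lambda>a b. 0)" "kc Bs \<mu> \<nu>' = (\<lambda>a b. 0)"
    and sum: "\<And>x y. kc As \<nu> \<mu> x y + kc Cs \<nu>' \<mu>' x y = kr Bs Bs f x y"
  shows "is_direct_sum ZC ((As, e), c) ((Cs, g), b) ((Bs, f), d)"
proof -
  obtain i where i: "i \<in> ahom As Bs" "kr As Bs i = \<mu>" "i \<in> homs ZC ((As, e), c) ((Bs, f), d)"
    using zh_mat[OF A S i] by metis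
  obtain p where p: "p \<in> ahom Bs As" "kr Bs As p = \<nu>" "p \<in> homs ZC ((Bs, f), d) ((As, e), c)"
    using zh_mat[OF S A p] by metis
  obtain j where j: "j \<in> ahom Cs Bs" "kr Cs Bs j = \<mu>'" "j \<in> homs ZC ((Cs, g), b) ((Bs, f), d)"
    using zh_mat[OF C S j] by metis
  obtain q where q: "q \<in> ahom Bs Cs" "kr Bs Cs q = \<nu>'" "q \<in> homs ZC ((Bs, f), d) ((Cs, g), b)"
    using zh_mat[OF S C q] by metis
  note ea = center_object.e_hom(1)[OF A] and es = center_object.e_hom(1)[OF S] and ec = center_object.e_hom(1)[OF C]
  have "comp_mor CA p i = e"
    by (rule kr_eqI[OF comp_ahom[OF i(1) p(1)] ea]) (simp add: kr_comp[OF i(1) p(1)] i p e)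
  moreover have "comp_mor CA q j = g"
    by (rule kr_eqI[OF comp_ahom[OF j(1) q(1)] ec]) (simp add: kr_comp[OF j(1) q(1)] j q e)
  moreover have "comp_mor CA p j = 0\<^sub>m (length As) (length Cs)"
    by (rule kr_eqI[OF comp_ahom[OF j(1) p(1)] zero_ahom]) (simp add: kr_comp[OF j(1) p(1)] j p e kr_zero)
  moreover have "comp_mor CA q i = 0\<^sub>m (length Cs) (length As)"
    by (rule kr_eqI[OF comp_ahom[OF i(1) q(1)] zero_ahom]) (simp add: kr_comp[OF i(1) q(1)] i q e kr_zero)
  moreover have "comp_mor CA i p + comp_mor CA j q = f"
    by (rule kr_eqI[OF plus_ahom[OF comp_ahom[OF p(1) i(1)] comp_ahom[OF q(1) j(1)]] es])
       (simp add: kr_plus[OF comp_ahom[OF p(1) i(1)] comp_ahom[OF q(1) j(1)]] kr_comp[OF p(1) i(1)] kr_comp[OF q(1) j(1)] i p j q sum)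
  ultimately show ?thesis
    unfolding is_direct_sum_def using i(3) p(3) j(3) q(3)
    by (intro bexI[of _ i] bexI[of _ j] bexI[of _ p] bexI[of _ q]) simp_all
qed

context
  fixes G :: "((nat list \<times> pmor mat) \<times> (nat list \<times> pmor mat \<Rightarrow> pmor mat)) set"
begin

abbreviation "cl \<equiv> karoubian_tensor_closure ZC G"

text \<open>The closure rule for summands asks for a complement. It is the image of the idempotent
  complementary to \<open>?\<theta>\<close>, the projection of the larger object onto the retract,
  and exists by \<open>split_idem\<close>.\<close>

lemma closure_retract:
  assumes Y: "center_object t As e c" and S: "center_object t Bs f d" and cl: "((Bs, f), d) \<in> cl"
    and i: "center_kernel As e c Bs f d \<mu>" and p: "center_kernel Bs f d As e c \<nu>" and pi: "kc Bs \<mu> \<nu> = kr As As e"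
  shows "((As, e), c) \<in> cl"
proof -
  interpret Y: center_object t As e c by (rule Y)
  interpret S: center_object t Bs f d by (rule S)
  have i': "\<mu> \<in> kern As Bs" "kc As Y.E \<mu> = \<mu>" "kc Bs \<mu> S.E = \<mu>" "\<And>i j. kc As (Y.B [i] [j]) \<mu> = kc Bs \<mu> (S.B [i] [j])"
    using i by (auto simp: center_kernel_def)
  have p': "\<nu> \<in> kern Bs As" "kc Bs S.E \<nu> = \<nu>" "kc As \<nu> Y.E = \<nu>" "\<And>i j. kc Bs (S.B [i] [j]) \<nu> = kc As \<nu> (Y.B [i] [j])"
    using p by (auto simp: center_kernel_def)
  note f = fs2_kern[OF i'(1)] fs2_kern[OF p'(1)] fs2_kern[OF S.E_kern] fs2_kern[OF Y.E_kern]
  let ?\<theta> = "kc As \<nu> \<mu>"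
  have f\<theta>: "fs2 ?\<theta>" by (rule fs_kc[OF f(2,1) eqm_fst[OF eqm_id] eqm_snd[OF eqm_id]])
  have a: "kc Bs \<mu> ?\<theta> = \<mu>"
  proof -
    have "kc Bs \<mu> ?\<theta> = kc As (kc Bs \<mu> \<nu>) \<mu>" by (intro ext kc_assoc[symmetric] f)
    then show ?thesis by (simp add: pi i')
  qed
  have b: "kc Bs ?\<theta> \<nu> = \<nu>"
  proof -
    have "kc Bs ?\<theta> \<nu> = kc As \<nu> (kc Bs \<mu> \<nu>)" by (intro ext kc_assoc f)
    then show ?thesis by (simp add: pi p')
  qed
  have th: "center_kernel Bs f d Bs f d ?\<theta>"
  proof -
    have "kc Bs S.E ?\<theta> = kc As (kc Bs S.E \<nu>) \<mu>" by (intro ext kc_assoc[symmetric] f)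
    then have "kc Bs S.E ?\<theta> = ?\<theta>" by (simp only: p'(2))
    moreover have "kc Bs ?\<theta> S.E = kc As \<nu> (kc Bs \<mu> S.E)" by (intro ext kc_assoc f)
    then have "kc Bs ?\<theta> S.E = ?\<theta>" by (simp only: i'(3))
    moreover have "kc Bs (S.B [i] [j]) ?\<theta> = kc Bs ?\<theta> (S.B [i] [j])" for i j
    proof -
      have "kc Bs (S.B [i] [j]) ?\<theta> = kc As (kc As \<nu> (Y.B [i] [j])) \<mu>"
        unfolding p'(4)[symmetric] by (intro ext kc_assoc[symmetric] S.fs2_B f)
      also have "\<dots> = kc As \<nu> (kc Bs \<mu> (S.B [i] [j]))"
        unfolding i'(4)[symmetric] by (intro ext kc_assoc Y.fs2_B f)
      also have "\<dots> = kc Bs ?\<theta> (S.B [i] [j])" by (intro ext kc_assoc[symmetric] S.fs2_B f)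
      finally show ?thesis .
    qed
    ultimately show ?thesis using kc_kern[OF p'(1) i'(1)] by (auto simp: center_kernel_def)
  qed
  have idem: "kc Bs ?\<theta> ?\<theta> = ?\<theta>"
  proof -
    have "kc Bs ?\<theta> ?\<theta> = kc As (kc Bs ?\<theta> \<nu>) \<mu>" by (intro ext kc_assoc[symmetric] f\<theta> f)
    then show ?thesis by (simp only: b)
  qed
  let ?\<eta> = "\<lambda>a b. S.E a b - ?\<theta> a b"
  note eta = zh_complement[OF S th idem]
  obtain h d' where h: "center_object t Bs h d'" "kr Bs Bs h = ?\<eta>" "center_kernel Bs h d' Bs f d ?\<eta>" "center_kernel Bs f d Bs h d' ?\<eta>"
    by (rule split_idem[OF S eta(1,2)]) (rule that)
  have ds: "is_direct_sum ZC ((As, e), c) ((Bs, h), d') ((Bs, f), d)"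
  proof (rule sum_from_split[OF S Y h(1) i p h(3,4) pi])
    show "kc Bs ?\<eta> ?\<eta> = kr Bs Bs h" using eta(2) h(2) by simp
    show "kc Bs ?\<eta> \<nu> = (\<lambda>a b. 0)"
      unfolding kc_diff_left[OF f(3) f\<theta> f(2)] b p'(2) by simp
    show "kc Bs \<mu> ?\<eta> = (\<lambda>a b. 0)"
      unfolding kc_diff_right[OF f(3) f\<theta> f(1)] a i'(3) by simp
    show "?\<theta> x y + kc Bs ?\<eta> ?\<eta> x y = S.E x y" for x y unfolding eta(2) by simp
  qed
  show ?thesis
    by (rule karoubian_tensor_closure.summand[OF cl _ _ ds]) (use Y h(1) in \<open>simp_all add: ZC_objects\<close>)
qed

end

lemma dec_ex:
  "\<exists>dec. \<forall>a\<in>pts As. \<forall>v\<in>pts Bs. dec (pr (length Bs) a v) = (a, v)"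
proof (intro exI[of _ "\<lambda>x. SOME z. fst z \<in> pts As \<and> snd z \<in> pts Bs \<and> x = pr (length Bs) (fst z) (snd z)"] ballI)
  fix a v assume p: "a \<in> pts As" "v \<in> pts Bs"
  show "(SOME z. fst z \<in> pts As \<and> snd z \<in> pts Bs \<and> pr (length Bs) a v = pr (length Bs) (fst z) (snd z)) = (a, v)"
  proof (rule some_equality)
    fix z assume "fst z \<in> pts As \<and> snd z \<in> pts Bs \<and> pr (length Bs) a v = pr (length Bs) (fst z) (snd z)"
    then show "z = (a, v)" using pr_inj[OF p, of "fst z" "snd z"] by (simp add: prod_eq_iff)
  qed (use p in simp)
qed

lemma kr4_surj:
  assumes Q: "\<And>\<pi> a v w b. bij \<pi> \<Longrightarrow> Q (act \<pi> a) (act \<pi> v) (act \<pi> w) (act \<pi> b) = Q a v w b"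
  obtains M where "M \<in> ahom (tl_obj As Bs) (tl_obj Cs Ds)"
    "\<And>a v w b. a \<in> pts As \<Longrightarrow> v \<in> pts Bs \<Longrightarrow> w \<in> pts Cs \<Longrightarrow> b \<in> pts Ds \<Longrightarrow>
      kr (tl_obj As Bs) (tl_obj Cs Ds) M (pr (length Bs) a v) (pr (length Ds) w b) = Q a v w b"
proof -
  obtain d1 where d1: "\<And>a v. a \<in> pts As \<Longrightarrow> v \<in> pts Bs \<Longrightarrow> d1 (pr (length Bs) a v) = (a, v)" using dec_ex by metis
  obtain d2 where d2: "\<And>a v. a \<in> pts Cs \<Longrightarrow> v \<in> pts Ds \<Longrightarrow> d2 (pr (length Ds) a v) = (a, v)" using dec_ex by metis
  define K where "K x y = (if x \<in> pts (tl_obj As Bs) \<and> y \<in> pts (tl_obj Cs Ds)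
     then Q (fst (d1 x)) (snd (d1 x)) (fst (d2 y)) (snd (d2 y)) else 0)" for x y
  have "K \<in> kern (tl_obj As Bs) (tl_obj Cs Ds)"
  proof (rule kernI)
    fix \<pi> :: "nat \<Rightarrow> nat" and x y assume \<pi>: "bij \<pi>"
    show "K (act \<pi> x) (act \<pi> y) = K x y"
    proof (cases "x \<in> pts (tl_obj As Bs) \<and> y \<in> pts (tl_obj Cs Ds)")
      case True
      then obtain a v w b where p: "a \<in> pts As" "v \<in> pts Bs" "x = pr (length Bs) a v" "w \<in> pts Cs" "b \<in> pts Ds" "y = pr (length Ds) w b"
        by (metis pts_tl_objE)
      have "d1 (act \<pi> x) = (act \<pi> a, act \<pi> v)" "d2 (act \<pi> y) = (act \<pi> w, act \<pi> b)"
        using d1[of "act \<pi> a" "act \<pi> v"] d2[of "act \<pi> w" "act \<pi> b"] p by simp_all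
      moreover have "d1 x = (a, v)" "d2 y = (w, b)" using d1 d2 p by simp_all
      ultimately show ?thesis using True Q[OF \<pi>] by (simp add: K_def)
    next
      case False
      then show ?thesis by (auto simp: K_def)
    qed
  qed (simp add: K_def split: if_splits)
  then obtain M where M: "M \<in> ahom (tl_obj As Bs) (tl_obj Cs Ds)" "kr (tl_obj As Bs) (tl_obj Cs Ds) M = K" by (rule kr_surj)
  show thesis by (rule that[OF M(1)]) (simp add: M(2) K_def d1 d2 del: length_concat)
qed

end

section \<open>Half-braidings given by permutations of the points\<close>

text \<open>In the model, \<open>\<tau> a\<close> is the group element by which the basis vector \<open>a\<close> is graded.\<close>

locale tau = deligne +
  fixes As :: "nat list" and e :: "pmor mat" and \<tau> :: "pt \<Rightarrow> nat \<Rightarrow> nat"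
  assumes Y: "(As, e) \<in> objects RS"
    and bij: "a \<in> pts As \<Longrightarrow> bij (\<tau> a)"
    and eqv: "bij \<pi> \<Longrightarrow> a \<in> pts As \<Longrightarrow> \<tau> (act \<pi> a) = \<pi> \<circ> \<tau> a \<circ> inv_into UNIV \<pi>"
    and pres: "kr As As e a b \<noteq> 0 \<Longrightarrow> \<tau> a = \<tau> b"
begin

abbreviation "n \<equiv> length As"
abbreviation "E \<equiv> kr As As e"

lemma e_hom: "e \<in> ahom As As" "comp_mor CA e e = e"
  using Y by (auto simp: RS_objects)

lemma E_kern: "E \<in> kern As As"
  by (rule kr_kern[OF e_hom(1)])

lemma E_idem: "intp As (\<lambda>x. E a x * E x b) = E a b"
  using kr_comp[OF e_hom(1,1)] e_hom(2) by (metis kc_def)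

text \<open>Passing a vector of degree \<open>\<tau> a\<close> over \<open>v\<close> turns
  \<open>v\<close> into its translate by \<open>\<tau> a\<close>. The additional kernel
  \<open>h\<close> is applied after the translation; it is the idempotent of \<open>V\<close> in the
  half-braiding, and a general \<open>h\<close> makes naturality a pair of composition rules,
  \<open>Tw_post\<close> and \<open>Tw_pre\<close>.\<close>

definition tq :: "(pt \<Rightarrow> pt \<Rightarrow> complex) \<Rightarrow> pt \<Rightarrow> pt \<Rightarrow> pt \<Rightarrow> pt \<Rightarrow> complex" where
  "tq h a v w b = E a b * h (act (\<tau> a) v) w"

lemma act_tau: "bij \<pi> \<Longrightarrow> a \<in> pts As \<Longrightarrow> act (\<tau> (act \<pi> a)) (act \<pi> v) = act \<pi> (act (\<tau> a) v)"
  by (simp add: eqv act_act comp_assoc bij_is_inj)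

lemma tq_act: "h \<in> kern Bs Cs \<Longrightarrow> bij \<pi> \<Longrightarrow> tq h (act \<pi> a) (act \<pi> v) (act \<pi> w) (act \<pi> b) = tq h a v w b"
  using kern_act[OF E_kern, of \<pi> a b] kern_0[OF E_kern, of a b]
  by (cases "a \<in> pts As") (simp_all add: tq_def act_tau kern_act)

definition Tw :: "nat list \<Rightarrow> nat list \<Rightarrow> pmor mat \<Rightarrow> pmor mat" where
  "Tw Bs Cs h = (SOME M. M \<in> ahom (tl_obj As Bs) (tl_obj Cs As) \<and> (\<forall>a\<in>pts As. \<forall>v\<in>pts Bs. \<forall>w\<in>pts Cs. \<forall>b\<in>pts As.
     kr (tl_obj As Bs) (tl_obj Cs As) M (pr (length Bs) a v) (pr n w b) = tq (kr Bs Cs h) a v w b))"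

lemma Tw:
  assumes h: "h \<in> ahom Bs Cs"
  shows "Tw Bs Cs h \<in> ahom (tl_obj As Bs) (tl_obj Cs As)"
    "a \<in> pts As \<Longrightarrow> v \<in> pts Bs \<Longrightarrow> w \<in> pts Cs \<Longrightarrow> b \<in> pts As \<Longrightarrow>
      kr (tl_obj As Bs) (tl_obj Cs As) (Tw Bs Cs h) (pr (length Bs) a v) (pr n w b) = tq (kr Bs Cs h) a v w b"
proof -
  have "\<exists>M. M \<in> ahom (tl_obj As Bs) (tl_obj Cs As) \<and> (\<forall>a\<in>pts As. \<forall>v\<in>pts Bs. \<forall>w\<in>pts Cs. \<forall>b\<in>pts As.
     kr (tl_obj As Bs) (tl_obj Cs As) M (pr (length Bs) a v) (pr n w b) = tq (kr Bs Cs h) a v w b)"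
  proof (rule kr4_surj[where Q = "tq (kr Bs Cs h)" and As = As and Bs = Bs and Cs = Cs and Ds = As])
    show "tq (kr Bs Cs h) (act \<pi> a) (act \<pi> v) (act \<pi> w) (act \<pi> b) = tq (kr Bs Cs h) a v w b" if "bij \<pi>" for \<pi> a v w b
      by (rule tq_act[OF kr_kern[OF h] that])
  qed blast
  from someI_ex[OF this, folded Tw_def]
  show "Tw Bs Cs h \<in> ahom (tl_obj As Bs) (tl_obj Cs As)"
    "a \<in> pts As \<Longrightarrow> v \<in> pts Bs \<Longrightarrow> w \<in> pts Cs \<Longrightarrow> b \<in> pts As \<Longrightarrow>
      kr (tl_obj As Bs) (tl_obj Cs As) (Tw Bs Cs h) (pr (length Bs) a v) (pr n w b) = tq (kr Bs Cs h) a v w b"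
    by blast+
qed

lemma Tw_post:
  assumes h: "h \<in> ahom Bs Cs" and g: "g \<in> ahom Cs Ds"
  shows "comp_mor CA (tens_mor CA g e) (Tw Bs Cs h) = Tw Bs Ds (comp_mor CA g h)"
proof (rule kr_tens_eqI)
  note gh = comp_ahom[OF h g]
  show "comp_mor CA (tens_mor CA g e) (Tw Bs Cs h) \<in> ahom (tl_obj As Bs) (tl_obj Ds As)"
    by (intro comp_ahom[OF Tw(1)[OF h]] tens_ahom g e_hom)
  show "Tw Bs Ds (comp_mor CA g h) \<in> ahom (tl_obj As Bs) (tl_obj Ds As)" by (rule Tw(1)[OF gh])
  fix a w v b assume p: "a \<in> pts As" "w \<in> pts Ds" "v \<in> pts Bs" "b \<in> pts As"
  have "kr (tl_obj As Bs) (tl_obj Ds As) (comp_mor CA (tens_mor CA g e) (Tw Bs Cs h)) (pr (length Bs) a v) (pr n w b) =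
    intp Cs (\<lambda>x. intp As (\<lambda>y. (kr Bs Cs h (act (\<tau> a) v) x * kr Cs Ds g x w) * (E a y * E y b)))"
    unfolding kr_comp_tens_post[OF g e_hom(1) Tw(1)[OF h] p(2,4)]
    by (intro intp_cong) (simp add: Tw(2)[OF h p(1,3)] tq_def mult_ac)
  also have "\<dots> = intp Cs (\<lambda>x. kr Bs Cs h (act (\<tau> a) v) x * kr Cs Ds g x w * E a b)"
    by (subst intp_cmult) (intro fs_mult fs_kr[OF e_hom(1)] fs_intros | simp add: E_idem)+
  also have "\<dots> = intp Cs (\<lambda>x. kr Bs Cs h (act (\<tau> a) v) x * kr Cs Ds g x w) * E a b"
    by (intro intp_multc fs_mult fs_kr[OF g] fs_kr[OF h] fs_intros)
  finally show "kr (tl_obj As Bs) (tl_obj Ds As) (comp_mor CA (tens_mor CA g e) (Tw Bs Cs h)) (pr (length Bs) a v) (pr n w b) =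
    kr (tl_obj As Bs) (tl_obj Ds As) (Tw Bs Ds (comp_mor CA g h)) (pr (length Bs) a v) (pr n w b)"
    unfolding Tw(2)[OF gh p(1,3,2,4)] tq_def kr_comp[OF h g] kc_def by simp
qed

text \<open>The morphism \<open>g\<close> is applied before the translation. Since its kernel is
  invariant and the integral is preserved by the bijection \<open>\<tau> a\<close>, the two may be
  exchanged. The twist occurs at an intermediate point \<open>x\<close>, and \<open>pres\<close>
  gives \<open>\<tau> x = \<tau> a\<close> wherever \<open>E a x\<close> is nonzero.\<close>

lemma Tw_pre:
  assumes h: "h \<in> ahom Cs Ds" and g: "g \<in> ahom Bs Cs"
  shows "comp_mor CA (Tw Cs Ds h) (tens_mor CA e g) = Tw Bs Ds (comp_mor CA h g)"
proof (rule kr_tens_eqI)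
  note gh = comp_ahom[OF g h]
  show "comp_mor CA (Tw Cs Ds h) (tens_mor CA e g) \<in> ahom (tl_obj As Bs) (tl_obj Ds As)"
    by (intro comp_ahom[OF _ Tw(1)[OF h]] tens_ahom g e_hom)
  show "Tw Bs Ds (comp_mor CA h g) \<in> ahom (tl_obj As Bs) (tl_obj Ds As)" by (rule Tw(1)[OF gh])
  fix a w v b assume p: "a \<in> pts As" "w \<in> pts Ds" "v \<in> pts Bs" "b \<in> pts As"
  have *: "intp Cs (\<lambda>y. kr Bs Cs g v y * kr Cs Ds h (act (\<tau> a) y) w) =
    intp Cs (\<lambda>y. kr Bs Cs g (act (\<tau> a) v) y * kr Cs Ds h y w)"
    using intp_act[OF bij[OF p(1)], of Cs "\<lambda>y. kr Bs Cs g (act (\<tau> a) v) y * kr Cs Ds h y w"]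
    by (simp add: kern_act[OF kr_kern[OF g] bij[OF p(1)]])
  have "kr (tl_obj As Bs) (tl_obj Ds As) (comp_mor CA (Tw Cs Ds h) (tens_mor CA e g)) (pr (length Bs) a v) (pr n w b) =
    intp As (\<lambda>x. intp Cs (\<lambda>y. (E a x * E x b) * (kr Bs Cs g v y * kr Cs Ds h (act (\<tau> a) y) w)))"
    unfolding kr_comp_tens_pre[OF e_hom(1) g Tw(1)[OF h] p(1,3)]
  proof (intro intp_cong)
    fix x y assume xy: "x \<in> pts As" "y \<in> pts Cs"
    show "E a x * kr Bs Cs g v y * kr (tl_obj As Cs) (tl_obj Ds As) (Tw Cs Ds h) (pr (length Cs) x y) (pr n w b) =
      (E a x * E x b) * (kr Bs Cs g v y * kr Cs Ds h (act (\<tau> a) y) w)"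
      unfolding Tw(2)[OF h xy p(2,4)] using pres[of a x] by (cases "E a x = 0") (auto simp: tq_def mult_ac)
  qed
  also have "\<dots> = intp As (\<lambda>x. E a x * E x b * intp Cs (\<lambda>y. kr Bs Cs g v y * kr Cs Ds h (act (\<tau> a) y) w))"
  proof (intro intp_cong intp_cmult)
    have "fs (\<lambda>y. kr Cs Ds h y (act (inv_into UNIV (\<tau> a)) w))" by (intro fs_kr[OF h] fs_intros)
    moreover have "kr Cs Ds h (act (\<tau> a) y) w = kr Cs Ds h y (act (inv_into UNIV (\<tau> a)) w)" for y
      using kern_act[OF kr_kern[OF h] bij[OF p(1)], of y "act (inv_into UNIV (\<tau> a)) w"] bij[OF p(1)]
      by (simp add: act_act_inv)
    ultimately show "fs (\<lambda>y. kr Bs Cs g v y * kr Cs Ds h (act (\<tau> a) y) w)"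
      by (auto intro!: fs_mult fs_kr[OF g] fs_intros)
  qed
  also have "\<dots> = E a b * intp Cs (\<lambda>y. kr Bs Cs g (act (\<tau> a) v) y * kr Cs Ds h y w)"
    unfolding * by (subst intp_multc) (intro fs_mult fs_kr[OF e_hom(1)] fs_intros | simp add: E_idem)+
  finally show "kr (tl_obj As Bs) (tl_obj Ds As) (comp_mor CA (Tw Cs Ds h) (tens_mor CA e g)) (pr (length Bs) a v) (pr n w b) =
    kr (tl_obj As Bs) (tl_obj Ds As) (Tw Bs Ds (comp_mor CA h g)) (pr (length Bs) a v) (pr n w b)"
    unfolding Tw(2)[OF gh p(1,3,2,4)] tq_def kr_comp[OF g h] kc_def by simp
qed

end

lemma (in deligne) RS_isoI:
  assumes A: "(As, e) \<in> objects RS" and B: "(Bs, f) \<in> objects RS" and m: "m \<in> homs RS (As, e) (Bs, f)"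
    and G: "G \<in> ahom Bs As" "comp_mor CA G m = e" "comp_mor CA m G = f"
  shows "is_iso RS (As, e) (Bs, f) m"
proof -
  note mh = RS_homD[OF m A B]
  have e: "e \<in> ahom As As" "comp_mor CA e e = e" and f: "f \<in> ahom Bs Bs" "comp_mor CA f f = f"
    using A B by (auto simp: RS_objects)
  let ?g = "comp_mor CA e (comp_mor CA G f)"
  have Gf: "comp_mor CA G f \<in> ahom Bs As" by (rule comp_ahom[OF f(1) G(1)])
  have gh: "?g \<in> homs RS (Bs, f) (As, e)"
  proof (rule RS_homI)
    show "?g \<in> ahom Bs As" by (rule comp_ahom[OF Gf e(1)])
    show "comp_mor CA e ?g = ?g" using CA_assoc[OF Gf e(1) e(1)] e by simp
    show "comp_mor CA ?g f = ?g" using CA_assoc[OF f(1) Gf e(1)] CA_assoc[OF f(1) f(1) G(1)] f by simp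
  qed
  have "comp_mor CA ?g m = e"
    using CA_assoc[OF mh(1) Gf e(1)] CA_assoc[OF mh(1) f(1) G(1)] mh G e by simp
  moreover have "comp_mor CA m ?g = f"
    using CA_assoc[OF Gf e(1) mh(1)] CA_assoc[OF f(1) G(1) mh(1)] mh G f by simp
  ultimately show ?thesis unfolding is_iso_def using m gh by auto
qed

context tau
begin

definition hbr :: "nat list \<times> pmor mat \<Rightarrow> pmor mat" where
  "hbr = (\<lambda>V\<in>objects RS. Tw (fst V) (fst V) (snd V))"

lemma kr_idem: "(Bs, f) \<in> objects RS \<Longrightarrow> intp Bs (\<lambda>x. kr Bs Bs f v x * kr Bs Bs f x w) = kr Bs Bs f v w"
  using fun_cong[OF fun_cong[OF kr_comp[of f Bs Bs f Bs], of v], of w] by (simp add: RS_objects kc_def)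

lemma kr_idem_tau: "(Bs, f) \<in> objects RS \<Longrightarrow> a \<in> pts As \<Longrightarrow>
    intp Bs (\<lambda>x. kr Bs Bs f v (act (\<tau> a) x) * kr Bs Bs f (act (\<tau> a) x) w) = kr Bs Bs f v w"
  using intp_act[OF bij, of a Bs "\<lambda>x. kr Bs Bs f v x * kr Bs Bs f x w"] kr_idem by simp

text \<open>By \<open>eqv\<close> the translation by \<open>\<tau> a\<close> commutes with every
  permutation fixing the atoms of \<open>a\<close>, so it has finite support.\<close>

lemma fs_tau:
  assumes "fs2 K" "eqm f" "eqm g" "\<And>\<pi> x y. bij \<pi> \<Longrightarrow> K (act \<pi> x) (act \<pi> y) = K x y" "a \<in> pts As"
  shows "fs (\<lambda>x. K (act (\<tau> a) (f x)) (g x))"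
proof -
  have "eqm (\<lambda>y. act (\<tau> a) y)"
  proof -
    have "act (\<tau> a) (act \<pi> y) = act \<pi> (act (\<tau> a) y)" if "bij \<pi>" "\<forall>x\<in>atoms a. \<pi> x = x" for \<pi> y
      using act_tau[OF that(1) assms(5)] act_fix[of a \<pi>] that by simp
    then show ?thesis unfolding eqm_def using finite_atoms by blast
  qed
  then show ?thesis using fs2D[OF assms(1) eqm_o assms(3)] assms(2) by blast
qed

lemma half_braiding: "half_braiding RS (As, e) hbr"
proof -
  have Fh: "f \<in> ahom Bs Bs" "comp_mor CA f f = f" if "(Bs, f) \<in> objects RS" for Bs f
    using that by (auto simp: RS_objects)
  have hv: "hbr (Bs, f) = Tw Bs Bs f" if "(Bs, f) \<in> objects RS" for Bs f
    using that by (simp add: hbr_def)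
  have ob: "(tl_obj As Bs, tens_mor CA e f) \<in> objects RS" "(tl_obj Bs As, tens_mor CA f e) \<in> objects RS"
    if "(Bs, f) \<in> objects RS" for Bs f
    using smcat.tobj[OF RS_smcat Y that] smcat.tobj[OF RS_smcat that Y] by simp_all
  have iso: "is_iso RS (tens_obj RS (As, e) V) (tens_obj RS V (As, e)) (hbr V)" if V: "V \<in> objects RS" for V
  proof -
    obtain Bs f where Vf: "V = (Bs, f)" by (cases V)
    have V': "(Bs, f) \<in> objects RS" using V Vf by simp
    note f = Fh[OF V']
    let ?F = "kr Bs Bs f" and ?T = "Tw Bs Bs f"
    have T: "?T \<in> homs RS (tl_obj As Bs, tens_mor CA e f) (tl_obj Bs As, tens_mor CA f e)"
      by (rule RS_homI[OF Tw(1)[OF f(1)]]) (simp_all add: Tw_post[OF f(1,1)] Tw_pre[OF f(1,1)] f(2))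
    \<comment> \<open>The inverse of the twist. The inverse permutation of \<open>\<tau> b\<close>
      is avoided by applying \<open>\<tau> b\<close> to the other argument of the invariant kernel
      \<open>?F\<close>.\<close>
    let ?Q = "\<lambda>w b a v. E b a * ?F w (act (\<tau> b) v)"
    have Q: "?Q (act \<pi> w) (act \<pi> b) (act \<pi> a) (act \<pi> v) = ?Q w b a v" if "bij \<pi>" for \<pi> w b a v
      using kern_act[OF E_kern that, of b a] kern_0[OF E_kern, of b a]
      by (cases "b \<in> pts As") (simp_all add: act_tau[OF that] kern_act[OF kr_kern[OF f(1)] that])
    obtain G where G: "G \<in> ahom (tl_obj Bs As) (tl_obj As Bs)" "\<And>w b a v. w \<in> pts Bs \<Longrightarrow> b \<in> pts As \<Longrightarrow> a \<in> pts As \<Longrightarrow> v \<in> pts Bs \<Longrightarrow>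
        kr (tl_obj Bs As) (tl_obj As Bs) G (pr n w b) (pr (length Bs) a v) = ?Q w b a v"
      by (rule kr4_surj[where Q = ?Q and As = Bs and Bs = As and Cs = As and Ds = Bs, OF Q]) (assumption, blast)
    have "comp_mor CA G ?T = tens_mor CA e f"
    proof (rule kr_tens_eqI)
      fix a a' v v' assume p: "a \<in> pts As" "a' \<in> pts As" "v \<in> pts Bs" "v' \<in> pts Bs"
      have "kr (tl_obj As Bs) (tl_obj As Bs) (comp_mor CA G ?T) (pr (length Bs) a v) (pr (length Bs) a' v') =
        intp Bs (\<lambda>w. intp As (\<lambda>b. kr (tl_obj As Bs) (tl_obj Bs As) ?T (pr (length Bs) a v) (pr n w b) *
           kr (tl_obj Bs As) (tl_obj As Bs) G (pr n w b) (pr (length Bs) a' v')))"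
        unfolding kr_comp[OF Tw(1)[OF f(1)] G(1)] kc_def
        by (intro intp_tl_obj fs_mult fs_kr[OF Tw(1)[OF f(1)]] fs_kr[OF G(1)] fs_intros)
      also have "\<dots> = intp Bs (\<lambda>w. intp As (\<lambda>b. (?F (act (\<tau> a) v) w * ?F w (act (\<tau> a) v')) * (E a b * E b a')))"
      proof (intro intp_cong)
        fix w b assume wb: "w \<in> pts Bs" "b \<in> pts As"
        show "kr (tl_obj As Bs) (tl_obj Bs As) ?T (pr (length Bs) a v) (pr n w b) *
           kr (tl_obj Bs As) (tl_obj As Bs) G (pr n w b) (pr (length Bs) a' v') =
           (?F (act (\<tau> a) v) w * ?F w (act (\<tau> a) v')) * (E a b * E b a')"
          unfolding Tw(2)[OF f(1) p(1,3) wb] G(2)[OF wb p(2,4)] using pres[of a b] by (cases "E a b = 0") (auto simp: tq_def)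
      qed
      also have "\<dots> = intp Bs (\<lambda>w. ?F (act (\<tau> a) v) w * ?F w (act (\<tau> a) v') * E a a')"
        by (subst intp_cmult) (intro fs_mult fs_kr[OF e_hom(1)] fs_intros | simp add: E_idem)+
      also have "\<dots> = ?F (act (\<tau> a) v) (act (\<tau> a) v') * E a a'"
        by (subst intp_multc) (intro fs_mult fs_kr[OF f(1)] fs_intros | simp add: kr_idem[OF V'])+
      also have "?F (act (\<tau> a) v) (act (\<tau> a) v') = ?F v v'" by (rule kern_act[OF kr_kern[OF f(1)] bij[OF p(1)]])
      finally show "kr (tl_obj As Bs) (tl_obj As Bs) (comp_mor CA G ?T) (pr (length Bs) a v) (pr (length Bs) a' v') =
        kr (tl_obj As Bs) (tl_obj As Bs) (tens_mor CA e f) (pr (length Bs) a v) (pr (length Bs) a' v')"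
        unfolding kr_tens[OF e_hom(1) f(1) p] by simp
    qed (intro comp_ahom[OF Tw(1)[OF f(1)] G(1)] tens_ahom e_hom f)+
    moreover have "comp_mor CA ?T G = tens_mor CA f e"
    proof (rule kr_tens_eqI)
      fix w w' b b' assume p: "w \<in> pts Bs" "w' \<in> pts Bs" "b \<in> pts As" "b' \<in> pts As"
      have "kr (tl_obj Bs As) (tl_obj Bs As) (comp_mor CA ?T G) (pr n w b) (pr n w' b') =
        intp As (\<lambda>a. intp Bs (\<lambda>v. kr (tl_obj Bs As) (tl_obj As Bs) G (pr n w b) (pr (length Bs) a v) *
           kr (tl_obj As Bs) (tl_obj Bs As) ?T (pr (length Bs) a v) (pr n w' b')))"
        unfolding kr_comp[OF G(1) Tw(1)[OF f(1)]] kc_def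
        by (intro intp_tl_obj fs_mult fs_kr[OF Tw(1)[OF f(1)]] fs_kr[OF G(1)] fs_intros)
      also have "\<dots> = intp As (\<lambda>a. intp Bs (\<lambda>v. (E b a * E a b') * (?F (act (\<tau> b) v) w' * ?F w (act (\<tau> b) v))))"
      proof (intro intp_cong)
        fix a v assume av: "a \<in> pts As" "v \<in> pts Bs"
        show "kr (tl_obj Bs As) (tl_obj As Bs) G (pr n w b) (pr (length Bs) a v) *
           kr (tl_obj As Bs) (tl_obj Bs As) ?T (pr (length Bs) a v) (pr n w' b') =
           (E b a * E a b') * (?F (act (\<tau> b) v) w' * ?F w (act (\<tau> b) v))"
          unfolding Tw(2)[OF f(1) av p(2,4)] G(2)[OF p(1,3) av] using pres[of b a] by (cases "E b a = 0") (auto simp: tq_def)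
      qed
      also have "\<dots> = intp As (\<lambda>a. (E b a * E a b') * ?F w w')"
      proof (intro intp_cong)
        fix a
        have "fs (\<lambda>v. ?F (act (\<tau> b) v) w' * ?F w (act (\<tau> b) v))"
          using fs_tau[OF fs2_kern[OF kr_kern[OF f(1)]] eqm_id eqm_const kern_act[OF kr_kern[OF f(1)]] p(3)]
            fs_tau[of "\<lambda>x y. ?F y x", OF fs_kr[OF f(1) eqm_snd[OF eqm_id] eqm_fst[OF eqm_id]] eqm_id eqm_const kern_act[OF kr_kern[OF f(1)]] p(3)]
          by (intro fs_mult) auto
        then show "intp Bs (\<lambda>v. (E b a * E a b') * (?F (act (\<tau> b) v) w' * ?F w (act (\<tau> b) v))) = (E b a * E a b') * ?F w w'"
          using kr_idem_tau[OF V' p(3), of w w'] by (simp add: intp_cmult mult.commute)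
      qed
      also have "\<dots> = E b b' * ?F w w'"
        by (subst intp_multc) (intro fs_mult fs_kr[OF e_hom(1)] fs_intros | simp add: E_idem)+
      finally show "kr (tl_obj Bs As) (tl_obj Bs As) (comp_mor CA ?T G) (pr n w b) (pr n w' b') =
        kr (tl_obj Bs As) (tl_obj Bs As) (tens_mor CA f e) (pr n w b) (pr n w' b')"
        unfolding kr_tens[OF f(1) e_hom(1) p] by simp
    qed (intro comp_ahom[OF G(1) Tw(1)[OF f(1)]] tens_ahom e_hom f)+
    ultimately have "is_iso RS (tl_obj As Bs, tens_mor CA e f) (tl_obj Bs As, tens_mor CA f e) ?T"
      by (intro RS_isoI[OF ob[OF V'] T G(1)])
    then show ?thesis by (simp add: Vf hv[OF V'])
  qed
  have nat: "comp_mor RS (tens_mor RS h (ident RS (As, e))) (hbr V) = comp_mor RS (hbr W) (tens_mor RS (ident RS (As, e)) h)"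
    if V: "V \<in> objects RS" and W: "W \<in> objects RS" and h: "h \<in> homs RS V W" for V W h
  proof -
    obtain Bs f Cs g where VW: "V = (Bs, f)" "W = (Cs, g)" by (cases V; cases W)
    have o: "(Bs, f) \<in> objects RS" "(Cs, g) \<in> objects RS" using V W VW by auto
    have hh: "h \<in> ahom Bs Cs" "comp_mor CA g h = h" "comp_mor CA h f = h" using RS_homD[of h Bs f Cs g] h o VW by auto
    show ?thesis
      using Tw_post[OF Fh(1)[OF o(1)] hh(1)] Tw_pre[OF Fh(1)[OF o(2)] hh(1)] hh by (simp add: VW hv o)
  qed
  have hex: "hbr (tens_obj RS V W) = comp_mor RS (tens_mor RS (ident RS V) (hbr W)) (tens_mor RS (hbr V) (ident RS W))"
    if V: "V \<in> objects RS" and W: "W \<in> objects RS" for V W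
  proof -
    obtain Bs f Cs g where VW: "V = (Bs, f)" "W = (Cs, g)" by (cases V; cases W)
    have o: "(Bs, f) \<in> objects RS" "(Cs, g) \<in> objects RS" using V W VW by auto
    note f = Fh[OF o(1)] and g = Fh[OF o(2)]
    let ?F = "kr Bs Bs f" and ?G = "kr Cs Cs g"
    have oo: "(tl_obj Bs Cs, tens_mor CA f g) \<in> objects RS" using smcat.tobj[OF RS_smcat o] by simp
    note fg = tens_ahom[OF f(1) g(1)]
    note TF = Tw(1)[OF f(1)] and TG = Tw(1)[OF g(1)]
    let ?M = "tens_mor CA (Tw Bs Bs f) g"
    have M: "?M \<in> ahom (tl_obj As (tl_obj Bs Cs)) (tl_obj Bs (tl_obj As Cs))"
      using tens_ahom[OF TF g(1)] unfolding tl_obj_assoc .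
    have L: "tens_mor CA f (Tw Cs Cs g) \<in> ahom (tl_obj Bs (tl_obj As Cs)) (tl_obj Bs (tl_obj Cs As))"
      by (intro tens_ahom f TG)
    have "Tw (tl_obj Bs Cs) (tl_obj Bs Cs) (tens_mor CA f g) = comp_mor CA (tens_mor CA f (Tw Cs Cs g)) ?M"
    proof (rule kr_eqI)
      show "Tw (tl_obj Bs Cs) (tl_obj Bs Cs) (tens_mor CA f g) \<in> ahom (tl_obj As (tl_obj Bs Cs)) (tl_obj Bs (tl_obj Cs As))"
        using Tw(1)[OF fg] by (simp only: tl_obj_assoc)
      show "comp_mor CA (tens_mor CA f (Tw Cs Cs g)) ?M \<in> ahom (tl_obj As (tl_obj Bs Cs)) (tl_obj Bs (tl_obj Cs As))"
        by (rule comp_ahom[OF M L])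
      fix x y assume "x \<in> pts (tl_obj As (tl_obj Bs Cs))" "y \<in> pts (tl_obj Bs (tl_obj Cs As))"
      then obtain a v w v' w' b where p: "a \<in> pts As" "v \<in> pts Bs" "w \<in> pts Cs" "v' \<in> pts Bs" "w' \<in> pts Cs" "b \<in> pts As"
        and x: "x = pr (length (tl_obj Bs Cs)) a (pr (length Cs) v w)" and y: "y = pr (length (tl_obj Cs As)) v' (pr n w' b)"
        by (elim pts_tl_objE) blast
      have y': "y = pr n (pr (length Cs) v' w') b" and x': "x = pr (length Cs) (pr (length Bs) a v) w"
        unfolding y x by (simp_all only: pr_assoc)
      have Mv: "kr (tl_obj As (tl_obj Bs Cs)) (tl_obj Bs (tl_obj As Cs)) ?M x (pr (length (tl_obj As Cs)) v1 (pr (length Cs) a1 w1)) =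
          E a a1 * ?F (act (\<tau> a) v) v1 * ?G w w1" if "v1 \<in> pts Bs" "a1 \<in> pts As" "w1 \<in> pts Cs" for v1 a1 w1
      proof -
        have "pr (length (tl_obj As Cs)) v1 (pr (length Cs) a1 w1) = pr (length Cs) (pr n v1 a1) w1" by (simp only: pr_assoc)
        then show ?thesis
          using kr_tens[OF TF g(1) pr_in_pts[OF p(1,2)] pr_in_pts[OF that(1,2)] p(3) that(3)] Tw(2)[OF f(1) p(1,2) that(1,2)]
          unfolding x' by (simp only: tl_obj_assoc tq_def)
      qed
      have fsG: "fs (\<lambda>w1. ?G w w1 * ?G (act (\<tau> a) w1) w')"
        by (rule fs_mult[OF fs_kr[OF g(1) eqm_const eqm_id]
          fs_tau[OF fs2_kern[OF kr_kern[OF g(1)]] eqm_id eqm_const kern_act[OF kr_kern[OF g(1)]] p(1)]])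
      have "kr (tl_obj As (tl_obj Bs Cs)) (tl_obj Bs (tl_obj Cs As)) (comp_mor CA (tens_mor CA f (Tw Cs Cs g)) ?M) x y =
        intp Bs (\<lambda>v1. intp (tl_obj As Cs) (\<lambda>z. kr (tl_obj As (tl_obj Bs Cs)) (tl_obj Bs (tl_obj As Cs)) ?M x (pr (length (tl_obj As Cs)) v1 z) *
           ?F v1 v' * kr (tl_obj As Cs) (tl_obj Cs As) (Tw Cs Cs g) z (pr n w' b)))"
        unfolding y by (rule kr_comp_tens_post[OF f(1) TG M p(4) pr_in_pts[OF p(5,6)]])
      also have "\<dots> = intp Bs (\<lambda>v1. intp As (\<lambda>a1. intp Cs (\<lambda>w1. kr (tl_obj As (tl_obj Bs Cs)) (tl_obj Bs (tl_obj As Cs)) ?M x (pr (length (tl_obj As Cs)) v1 (pr (length Cs) a1 w1)) *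
           ?F v1 v' * kr (tl_obj As Cs) (tl_obj Cs As) (Tw Cs Cs g) (pr (length Cs) a1 w1) (pr n w' b))))"
        by (intro intp_cong intp_tl_obj fs_mult fs_kr[OF M] fs_kr[OF TG] fs_intros)
      also have "\<dots> = intp Bs (\<lambda>v1. intp As (\<lambda>a1. intp Cs (\<lambda>w1. ((?F (act (\<tau> a) v) v1 * ?F v1 v') * (E a a1 * E a1 b)) * (?G w w1 * ?G (act (\<tau> a) w1) w'))))"
      proof (intro intp_cong)
        fix v1 a1 w1 assume q: "v1 \<in> pts Bs" "a1 \<in> pts As" "w1 \<in> pts Cs"
        show "kr (tl_obj As (tl_obj Bs Cs)) (tl_obj Bs (tl_obj As Cs)) ?M x (pr (length (tl_obj As Cs)) v1 (pr (length Cs) a1 w1)) *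
           ?F v1 v' * kr (tl_obj As Cs) (tl_obj Cs As) (Tw Cs Cs g) (pr (length Cs) a1 w1) (pr n w' b) =
           ((?F (act (\<tau> a) v) v1 * ?F v1 v') * (E a a1 * E a1 b)) * (?G w w1 * ?G (act (\<tau> a) w1) w')"
          unfolding Mv[OF q] Tw(2)[OF g(1) q(2,3) p(5,6)] using pres[of a a1] by (cases "E a a1 = 0") (auto simp: tq_def)
      qed
      also have "\<dots> = intp Bs (\<lambda>v1. intp As (\<lambda>a1. (?F (act (\<tau> a) v) v1 * ?F v1 v') * (E a a1 * E a1 b) * ?G (act (\<tau> a) w) w'))"
      proof (intro intp_cong)
        fix v1 a1
        have "intp Cs (\<lambda>w1. ?G w w1 * ?G (act (\<tau> a) w1) w') = ?G (act (\<tau> a) w) w'"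
          using kr_idem_tau[OF o(2) p(1), of "act (\<tau> a) w" w'] by (simp add: kern_act[OF kr_kern[OF g(1)] bij[OF p(1)]])
        then show "intp Cs (\<lambda>w1. ((?F (act (\<tau> a) v) v1 * ?F v1 v') * (E a a1 * E a1 b)) * (?G w w1 * ?G (act (\<tau> a) w1) w')) =
          (?F (act (\<tau> a) v) v1 * ?F v1 v') * (E a a1 * E a1 b) * ?G (act (\<tau> a) w) w'"
          by (simp add: intp_cmult[OF fsG])
      qed
      also have "\<dots> = intp Bs (\<lambda>v1. (?F (act (\<tau> a) v) v1 * ?F v1 v') * (E a b * ?G (act (\<tau> a) w) w'))"
        unfolding mult.assoc[of "?F (act (\<tau> a) v) _ * _"]
        by (subst intp_cmult, (intro fs_mult fs_kr[OF e_hom(1)] fs_intros)[1], subst intp_multc, (intro fs_mult fs_kr[OF e_hom(1)] fs_intros)[1])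
           (simp add: E_idem)
      also have "\<dots> = ?F (act (\<tau> a) v) v' * (E a b * ?G (act (\<tau> a) w) w')"
        by (subst intp_multc, (intro fs_mult fs_kr[OF f(1)] fs_intros)[1]) (simp add: kr_idem[OF o(1)])
      also have "\<dots> = kr (tl_obj As (tl_obj Bs Cs)) (tl_obj Bs (tl_obj Cs As)) (Tw (tl_obj Bs Cs) (tl_obj Bs Cs) (tens_mor CA f g)) x y"
      proof -
        have ap: "act (\<tau> a) (pr (length Cs) v w) = pr (length Cs) (act (\<tau> a) v) (act (\<tau> a) w)" by simp
        have "act (\<tau> a) v \<in> pts Bs" "act (\<tau> a) w \<in> pts Cs" using p by simp_all
        then have "kr (tl_obj Bs Cs) (tl_obj Bs Cs) (tens_mor CA f g) (act (\<tau> a) (pr (length Cs) v w)) (pr (length Cs) v' w') =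
          ?F (act (\<tau> a) v) v' * ?G (act (\<tau> a) w) w'"
          unfolding ap using p by (intro kr_tens[OF f(1) g(1)])
        then show ?thesis
          using Tw(2)[OF fg p(1) pr_in_pts[OF p(2,3)] pr_in_pts[OF p(4,5)] p(6)]
          unfolding x y' by (simp only: tl_obj_assoc tq_def mult_ac)
      qed
      finally show "kr (tl_obj As (tl_obj Bs Cs)) (tl_obj Bs (tl_obj Cs As)) (Tw (tl_obj Bs Cs) (tl_obj Bs Cs) (tens_mor CA f g)) x y =
         kr (tl_obj As (tl_obj Bs Cs)) (tl_obj Bs (tl_obj Cs As)) (comp_mor CA (tens_mor CA f (Tw Cs Cs g)) ?M) x y" by simp
    qed
    then show ?thesis by (simp add: VW hv o oo)
  qed
  show ?thesis
    unfolding half_braiding_def using iso nat hex by (simp add: hbr_def)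
qed

lemma center_object: "center_object t As e hbr"
  using Y half_braiding by (simp add: center_object_def)

lemma kr_hbr_X:
  assumes "a \<in> pts As" "b \<in> pts As"
  shows "kr (tl_obj As [1]) (tl_obj [1] As) (hbr X_obj) (pr 1 a (Pt 0 [i])) (pr n (Pt 0 [j]) b) = E a b * of_bool (\<tau> a i = j)"
  using Tw(2)[OF id_ahom, of a "Pt 0 [i]" "[1]" "Pt 0 [j]" b] assms Xp_object[of 1]
  by (simp add: hbr_def X_obj_Xp Xp_def tq_def kr_id idk_def)

lemma B_hbr: "center_object.B t As hbr [i] [j] a b = E a b * of_bool (\<tau> a i = j)"
proof (cases "a \<in> pts As \<and> b \<in> pts As")
  case True
  then show ?thesis using kr_hbr_X[of a b i j] by (simp add: center_object.B_def[OF center_object] center_object.c4_def[OF center_object] X_obj_Xp Xp_def)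
next
  case False
  then show ?thesis using kern_0[OF E_kern False] by (auto simp: center_object.B_def[OF center_object])
qed

end

section \<open>Trivially braided objects lie in the closure\<close>

context deligne
begin

lemma tau_id: "(As, e) \<in> objects RS \<Longrightarrow> tau t As e (\<lambda>_. id)"
  by unfold_locales (auto simp: fun_eq_iff bij_is_surj surj_f_inv_f)

text \<open>The half-braiding in which every vector has the identity permutation as its
  degree.\<close>

definition tr :: "nat list \<Rightarrow> pmor mat \<Rightarrow> nat list \<times> pmor mat \<Rightarrow> pmor mat" where
  "tr As e = tau.hbr t As e (\<lambda>_. id)"

lemma tr_zob: "(As, e) \<in> objects RS \<Longrightarrow> center_object t As e (tr As e)"
  unfolding tr_def by (rule tau.center_object[OF tau_id])

lemma tr_B: "(As, e) \<in> objects RS \<Longrightarrow> center_object.B t As (tr As e) [i] [j] a b = kr As As e a b * of_bool (i = j)"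
  unfolding tr_def by (simp add: tau.B_hbr[OF tau_id])

text \<open>Degrees multiply in a tensor product; as the right factor has trivial degree, the
  grading is that of the left factor. In the computation the intermediate point of X is forced to be
  \<open>i\<close>.\<close>

lemma B_tens_tr:
  assumes Y: "center_object t As e c" and Z: "center_object t Bs f d"
    and dB: "\<And>i j a b. center_object.B t Bs d [i] [j] a b = kr Bs Bs f a b * of_bool (i = j)"
    and p: "a \<in> pts As" "b \<in> pts As" "a' \<in> pts Bs" "b' \<in> pts Bs"
  shows "center_object.B t (tl_obj As Bs) (\<lambda>V\<in>objects RS. comp_mor CA (tens_mor CA (c V) f) (tens_mor CA e (d V))) [i] [j]
     (pr (length Bs) a a') (pr (length Bs) b b') = center_object.B t As c [i] [j] a b * kr Bs Bs f a' b'"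
proof -
  interpret Y: center_object t As e c by (rule Y)
  interpret Z: center_object t Bs f d by (rule Z)
  let ?d = "\<lambda>V\<in>objects RS. comp_mor CA (tens_mor CA (c V) f) (tens_mor CA e (d V))"
  interpret T: center_object t "tl_obj As Bs" "tens_mor CA e f" ?d by (rule ZC_tens_zob[OF Y Z])
  let ?X = "([1], ident CA [1]) :: nat list \<times> pmor mat"
  have X: "?X \<in> objects RS" using Xp_object[of 1] by (simp add: Xp_def)
  note cX = Y.c_hom(1)[OF X] and dX = Z.c_hom(1)[OF X]
  have ip: "Pt 0 [k] \<in> pts [1]" for k by simp
  have M: "tens_mor CA (c ?X) f \<in> ahom (tl_obj As (tl_obj [1] Bs)) (tl_obj [1] (tl_obj As Bs))"
    using tens_ahom[OF cX Z.e_hom(1)] by (simp only: tl_obj_assoc)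
  have cv: "kr (tl_obj As [1]) (tl_obj [1] As) (c ?X) (pr (length [1::nat]) x (Pt 0 [k])) (pr (length As) (Pt 0 [j]) y) = Y.B [k] [j] x y"
    if "x \<in> pts As" "y \<in> pts As" for x y k j
    using that by (simp add: Y.B_def Y.c4_def Xp_def)
  have dv: "kr (tl_obj Bs [1]) (tl_obj [1] Bs) (d ?X) (pr (length [1::nat]) x (Pt 0 [k])) (pr (length Bs) (Pt 0 [j]) y) = kr Bs Bs f x y * of_bool (k = j)"
    if "x \<in> pts Bs" "y \<in> pts Bs" for x y k j
    using that dB[of k j x y] by (simp add: Z.B_def Z.c4_def Xp_def)
  have "T.B [i] [j] (pr (length Bs) a a') (pr (length Bs) b b') =
    kr (tl_obj (tl_obj As Bs) [1]) (tl_obj [1] (tl_obj As Bs)) (comp_mor CA (tens_mor CA (c ?X) f) (tens_mor CA e (d ?X)))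
      (pr (length [1::nat]) (pr (length Bs) a a') (Pt 0 [i])) (pr (length (tl_obj As Bs)) (Pt 0 [j]) (pr (length Bs) b b'))"
    using X p pr_in_pts[OF p(1,3)] pr_in_pts[OF p(2,4)] by (simp add: T.B_def T.c4_def Xp_def del: length_concat)
  also have "\<dots> = kr (tl_obj As (tl_obj Bs [1])) (tl_obj [1] (tl_obj As Bs)) (comp_mor CA (tens_mor CA (c ?X) f) (tens_mor CA e (d ?X)))
      (pr (length (tl_obj Bs [1])) a (pr (length [1::nat]) a' (Pt 0 [i]))) (pr (length (tl_obj As Bs)) (Pt 0 [j]) (pr (length Bs) b b'))"
    by (simp only: tl_obj_assoc pr_assoc)
  also have "\<dots> = intp As (\<lambda>x. intp (tl_obj [1] Bs) (\<lambda>z. Y.E a x * kr (tl_obj Bs [1]) (tl_obj [1] Bs) (d ?X) (pr (length [1::nat]) a' (Pt 0 [i])) z *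
      kr (tl_obj As (tl_obj [1] Bs)) (tl_obj [1] (tl_obj As Bs)) (tens_mor CA (c ?X) f) (pr (length (tl_obj [1] Bs)) x z) (pr (length (tl_obj As Bs)) (Pt 0 [j]) (pr (length Bs) b b'))))"
    by (rule kr_comp_tens_pre[OF Y.e_hom(1) dX M p(1) pr_in_pts[OF p(3) ip]])
  also have "\<dots> = intp As (\<lambda>x. intp [1] (\<lambda>k. intp Bs (\<lambda>y. Y.E a x * kr (tl_obj Bs [1]) (tl_obj [1] Bs) (d ?X) (pr (length [1::nat]) a' (Pt 0 [i])) (pr (length Bs) k y) *
      kr (tl_obj As (tl_obj [1] Bs)) (tl_obj [1] (tl_obj As Bs)) (tens_mor CA (c ?X) f) (pr (length (tl_obj [1] Bs)) x (pr (length Bs) k y)) (pr (length (tl_obj As Bs)) (Pt 0 [j]) (pr (length Bs) b b')))))"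
    by (intro intp_cong intp_tl_obj fs_mult fs_kr[OF dX] fs_kr[OF M] fs_intros)
  also have "\<dots> = intp As (\<lambda>x. intp [1] (\<lambda>k. if k = Pt 0 [i] then Y.E a x * Y.B [i] [j] x b * kr Bs Bs f a' b' else 0))"
  proof (intro intp_cong)
    fix x k assume xk: "x \<in> pts As" "k \<in> pts [1]"
    then obtain l where l: "k = Pt 0 [l]" by (auto simp: pts_def length_Suc_conv)
    have v: "kr (tl_obj As (tl_obj [1] Bs)) (tl_obj [1] (tl_obj As Bs)) (tens_mor CA (c ?X) f) (pr (length (tl_obj [1] Bs)) x (pr (length Bs) k y))
        (pr (length (tl_obj As Bs)) (Pt 0 [j]) (pr (length Bs) b b')) = Y.B [l] [j] x b * kr Bs Bs f y b'" if "y \<in> pts Bs" for y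
      using kr_tens[OF cX Z.e_hom(1) pr_in_pts[OF xk(1) ip] pr_in_pts[OF ip p(2)] that p(4), of l j] cv[OF xk(1) p(2), of l j]
      by (simp only: tl_obj_assoc pr_assoc l)
    have "intp Bs (\<lambda>y. Y.E a x * kr (tl_obj Bs [1]) (tl_obj [1] Bs) (d ?X) (pr (length [1::nat]) a' (Pt 0 [i])) (pr (length Bs) k y) *
      kr (tl_obj As (tl_obj [1] Bs)) (tl_obj [1] (tl_obj As Bs)) (tens_mor CA (c ?X) f) (pr (length (tl_obj [1] Bs)) x (pr (length Bs) k y)) (pr (length (tl_obj As Bs)) (Pt 0 [j]) (pr (length Bs) b b'))) =
      intp Bs (\<lambda>y. (Y.E a x * Y.B [l] [j] x b * of_bool (i = l)) * (kr Bs Bs f a' y * kr Bs Bs f y b'))"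
    proof (rule intp_cong)
      fix y assume y: "y \<in> pts Bs"
      show "Y.E a x * kr (tl_obj Bs [1]) (tl_obj [1] Bs) (d ?X) (pr (length [1::nat]) a' (Pt 0 [i])) (pr (length Bs) k y) *
        kr (tl_obj As (tl_obj [1] Bs)) (tl_obj [1] (tl_obj As Bs)) (tens_mor CA (c ?X) f) (pr (length (tl_obj [1] Bs)) x (pr (length Bs) k y)) (pr (length (tl_obj As Bs)) (Pt 0 [j]) (pr (length Bs) b b')) =
        (Y.E a x * Y.B [l] [j] x b * of_bool (i = l)) * (kr Bs Bs f a' y * kr Bs Bs f y b')"
        unfolding v[OF y] unfolding l dv[OF p(3) y] by simp
    qed
    also have "\<dots> = (Y.E a x * Y.B [l] [j] x b * of_bool (i = l)) * kr Bs Bs f a' b'"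
      using Z.E_idem[unfolded kc_def fun_eq_iff]
      by (subst intp_cmult) (intro fs_mult fs_kr[OF Z.e_hom(1)] fs_intros | simp)+
    finally show "intp Bs (\<lambda>y. Y.E a x * kr (tl_obj Bs [1]) (tl_obj [1] Bs) (d ?X) (pr (length [1::nat]) a' (Pt 0 [i])) (pr (length Bs) k y) *
      kr (tl_obj As (tl_obj [1] Bs)) (tl_obj [1] (tl_obj As Bs)) (tens_mor CA (c ?X) f) (pr (length (tl_obj [1] Bs)) x (pr (length Bs) k y)) (pr (length (tl_obj As Bs)) (Pt 0 [j]) (pr (length Bs) b b'))) =
      (if k = Pt 0 [i] then Y.E a x * Y.B [i] [j] x b * kr Bs Bs f a' b' else 0)"
      by (auto simp: l)
  qed
  also have "\<dots> = intp As (\<lambda>x. Y.E a x * Y.B [i] [j] x b * kr Bs Bs f a' b')"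
    using ip[of i] by (simp add: intp_delta[where f = "\<lambda>_. _ * _ * _"])
  also have "\<dots> = kc As Y.E (Y.B [i] [j]) a b * kr Bs Bs f a' b'"
    unfolding kc_def by (intro intp_multc fs_mult fs_kr[OF Y.e_hom(1)] Y.fs_B fs_intros)
  finally show ?thesis unfolding Y.E_absorb .
qed

lemma zh_idem:
  assumes Y: "center_object t As e c" and Z: "center_object t As f d" and "kc As (kr As As e) (kr As As f) = kr As As e"
    and "\<And>i j. center_object.B t As c [i] [j] = kc As (kr As As e) (center_object.B t As d [i] [j])"
  shows "center_kernel As e c As f d (kr As As e)"
  unfolding center_kernel_def
proof (intro conjI allI)
  show "kc As (center_object.B t As c [i] [j]) (kr As As e) = kc As (kr As As e) (center_object.B t As d [i] [j])" for i j
    unfolding center_object.E_absorb(2)[OF Y] by (rule assms(4))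
qed (rule kr_kern[OF center_object.e_hom(1)[OF Y]] center_object.E_idem[OF Y] assms(3))+

context
  fixes G :: "((nat list \<times> pmor mat) \<times> (nat list \<times> pmor mat \<Rightarrow> pmor mat)) set"
  assumes X0: "(Xp 0, tr [0] (ident CA [0])) \<in> karoubian_tensor_closure ZC G"
    and X1: "(Xp 1, tr [1] (ident CA [1])) \<in> karoubian_tensor_closure ZC G"
begin

lemma obX: "([k], ident CA [k]) \<in> objects RS"
  using Xp_object[of k] by (simp add: Xp_def)

lemma obL: "(As, ident CA As) \<in> objects RS"
  by (simp add: RS_objects id_ahom CA_id_left[OF id_ahom])

text \<open>The tensor braiding and the trivial braiding have the same kernels with X, so the
  identity kernel is an isomorphism between the two objects in the center.\<close>

lemma Xk_closure: "(Xp k, tr [k] (ident CA [k])) \<in> cl G"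
proof (induction k)
  case 0
  show ?case by (rule X0)
next
  case (Suc k)
  let ?X = "([1], ident CA [1]) :: nat list \<times> pmor mat" and ?K = "([k], ident CA [k])"
  let ?c = "tr [1] (ident CA [1])" and ?d = "tr [k] (ident CA [k])"
  let ?t = "\<lambda>V\<in>objects RS. comp_mor CA (tens_mor CA (?c V) (ident CA [k])) (tens_mor CA (ident CA [1]) (?d V))"
  have t: "tens_obj ZC (?X, ?c) (?K, ?d) = (([Suc k], ident CA [Suc k]), ?t)"
    unfolding ZC_tens using CA_tens_id[of "[1]" "[k]"] by simp
  have Z: "center_object t [Suc k] (ident CA [Suc k]) ?t"
    using ZC_tens_zob[OF tr_zob[OF obX[of 1]] tr_zob[OF obX[of k]]] CA_tens_id[of "[1]" "[k]"] by simp
  have cl: "(([Suc k], ident CA [Suc k]), ?t) \<in> cl G"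
    using karoubian_tensor_closure.tensor[OF X1 Suc] unfolding Xp_def t .
  note Y = tr_zob[OF obX[of "Suc k"]]
  have B: "center_object.B t [Suc k] ?t [i] [j] = center_object.B t [Suc k] (tr [Suc k] (ident CA [Suc k])) [i] [j]" for i j
  proof (rule center_object.pp_eqI[OF Z _ center_object.B_supp[OF Z] center_object.B_supp[OF Y]])
    fix x y assume "x \<in> pts [Suc k]" "y \<in> pts [Suc k]"
    then have "x \<in> pts (tl_obj [1] [k])" "y \<in> pts (tl_obj [1] [k])" by simp_all
    then obtain a a' b b' where p: "a \<in> pts [1]" "b \<in> pts [1]" "a' \<in> pts [k]" "b' \<in> pts [k]"
      and xy: "x = pr (length [k]) a a'" "y = pr (length [k]) b b'"
      by (elim pts_tl_objE) blast
    have "center_object.B t [Suc k] ?t [i] [j] x y = (idk [1] a b * of_bool (i = j)) * idk [k] a' b'"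
      using B_tens_tr[OF tr_zob[OF obX] tr_zob[OF obX] tr_B[OF obX] p, of i j] unfolding xy
      by (simp add: tr_B[OF obX] kr_id)
    also have "\<dots> = idk [Suc k] x y * of_bool (i = j)"
      using kr_tens[OF id_ahom id_ahom p] CA_tens_id[of "[1]" "[k]"] unfolding xy by (simp add: kr_id)
    finally show "center_object.B t [Suc k] ?t [i] [j] x y = center_object.B t [Suc k] (tr [Suc k] (ident CA [Suc k])) [i] [j] x y"
      by (simp add: tr_B[OF obX] kr_id)
  qed
  note I = center_object.E_idem[OF Y]
  have 1: "center_kernel [Suc k] (ident CA [Suc k]) (tr [Suc k] (ident CA [Suc k])) [Suc k] (ident CA [Suc k]) ?t (kr [Suc k] [Suc k] (ident CA [Suc k]))"
    by (rule zh_idem[OF Y Z I]) (simp only: B center_object.E_absorb[OF Y])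
  have 2: "center_kernel [Suc k] (ident CA [Suc k]) ?t [Suc k] (ident CA [Suc k]) (tr [Suc k] (ident CA [Suc k])) (kr [Suc k] [Suc k] (ident CA [Suc k]))"
    by (rule zh_idem[OF Z Y I]) (simp only: B center_object.E_absorb[OF Y])
  show ?case unfolding Xp_def by (rule closure_retract[OF Y Z cl 1 2 I])
qed

lemma tr_list_closure: "((As, ident CA As), tr As (ident CA As)) \<in> cl G"
proof (induction As)
  case Nil
  show ?case
  proof (rule karoubian_tensor_closure.zero)
    show "(([], ident CA []), tr [] (ident CA [])) \<in> objects ZC" unfolding ZC_objects by (rule tr_zob[OF obL])
    show "is_zero_object ZC (([], ident CA []), tr [] (ident CA []))"
      by (auto simp: is_zero_object_def CA_id intro!: eq_matI)
  qed
next
  case (Cons A As)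
  note YA = tr_zob[OF obX[of A]] and YL = tr_zob[OF obL[of As]] and YS = tr_zob[OF obL[of "A # As"]]
  let ?eA = "ident CA [A]" and ?eL = "ident CA As" and ?eS = "ident CA (A # As)"
  \<comment> \<open>The inclusion of the remaining summands into \<open>A # As\<close> raises
    summand indices by one.\<close>
  define sh where "sh x = (case x of Pt s xs \<Rightarrow> Pt (Suc s) xs)" for x
  have sh_act: "act \<pi> (sh x) = sh (act \<pi> x)" for \<pi> x by (cases x) (simp add: sh_def)
  have sh_inj: "sh x = sh y \<longleftrightarrow> x = y" for x y by (cases x; cases y) (simp add: sh_def)
  have shp: "sh x \<in> pts (A # As) \<longleftrightarrow> x \<in> pts As" for x by (cases x) (simp add: sh_def)
  have Ap: "x \<in> pts [A] \<Longrightarrow> x \<in> pts (A # As)" for x by (cases x) simp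
  have disj: "x \<in> pts [A] \<Longrightarrow> x \<noteq> sh y" for x y by (cases x; cases y) (simp add: sh_def)
  have cov: "x \<in> pts (A # As) \<Longrightarrow> x \<in> pts [A] \<or> (\<exists>y\<in>pts As. x = sh y)" for x
  proof (cases x)
    case (Pt s xs)
    assume "x \<in> pts (A # As)"
    then show ?thesis
      by (cases s) (auto simp: Pt sh_def intro!: bexI[of _ "Pt (s - 1) xs"])
  qed
  let ?i = "idk [A]" and ?j = "\<lambda>x y. of_bool (x \<in> pts As \<and> y = sh x) :: complex" and ?q = "\<lambda>y x. of_bool (x \<in> pts As \<and> y = sh x) :: complex"
  have ki: "?i \<in> kern [A] (A # As)" "?i \<in> kern (A # As) [A]"
    using idk_kern[of "[A]"] Ap by (auto simp: kern_def)
  have kj: "?j \<in> kern As (A # As)" "?q \<in> kern (A # As) As"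
    by (intro kernI; auto simp: sh_act[symmetric] shp)+
  have di: "intp [A] (\<lambda>y. idk [A] x y * \<phi> y) = (if x \<in> pts [A] then \<phi> x else 0)" for x \<phi>
    by (cases "x \<in> pts [A]") (auto simp: intp_idk, simp add: idk_def)
  have di': "intp (A # As) (\<lambda>y. idk [A] x y * \<phi> y) = (if x \<in> pts [A] then \<phi> x else 0)" for x \<phi>
  proof -
    have "intp (A # As) (\<lambda>y. idk [A] x y * \<phi> y) = intp (A # As) (\<lambda>y. if y = x then of_bool (x \<in> pts [A]) * \<phi> y else 0)"
      by (rule intp_cong) (auto simp: idk_def)
    then show ?thesis using Ap[of x] by (simp add: intp_delta[where f = "\<lambda>y. _ * \<phi> y"])
  qed
  have dj: "intp (A # As) (\<lambda>y. ?j x y * \<phi> y) = (if x \<in> pts As then \<phi> (sh x) else 0)" for x \<phi>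
  proof -
    have "intp (A # As) (\<lambda>y. ?j x y * \<phi> y) = intp (A # As) (\<lambda>y. if y = sh x then of_bool (x \<in> pts As) * \<phi> y else 0)"
      by (rule intp_cong) auto
    then show ?thesis by (simp add: intp_delta[where f = "\<lambda>y. _ * \<phi> y"] shp)
  qed
  have dq: "intp As (\<lambda>x. ?q y x * \<phi> x) = (if y \<in> sh ` pts As then \<phi> (inv_into UNIV sh y) else 0)" for y \<phi>
  proof (cases "y \<in> sh ` pts As")
    case True
    then obtain z where z: "z \<in> pts As" "y = sh z" by auto
    have "inv_into UNIV sh (sh z) = z" by (rule inv_into_f_f) (auto simp: inj_on_def sh_inj)
    moreover have "intp As (\<lambda>x. ?q y x * \<phi> x) = intp As (\<lambda>x. if x = z then \<phi> x else 0)"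
      by (rule intp_cong) (auto simp: z sh_inj)
    ultimately show ?thesis using z by (simp add: intp_delta True)
  next
    case False
    then show ?thesis by (auto intro!: intp_zero)
  qed
  have comm: "kc Cs (\<lambda>a b. kr Cs Cs (ident CA Cs) a b * of_bool (i = j)) \<mu> = kc Ds \<mu> (\<lambda>a b. kr Ds Ds (ident CA Ds) a b * of_bool (i = j))"
    if "\<mu> \<in> kern Cs Ds" for Cs Ds \<mu> and i j :: nat
    using kc_idk_left[OF that] kc_idk_right[OF that] by (cases "i = j") (simp_all add: kr_id, simp add: kc_def fun_eq_iff)
  have center_kernel: "center_kernel Cs (ident CA Cs) (tr Cs (ident CA Cs)) Ds (ident CA Ds) (tr Ds (ident CA Ds)) \<mu>" if "\<mu> \<in> kern Cs Ds" for Cs Ds \<mu>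
  proof -
    have e: "center_object.B t Cs (tr Cs (ident CA Cs)) [i] [j] = (\<lambda>a b. kr Cs Cs (ident CA Cs) a b * of_bool (i = j))" for Cs i j
      by (intro ext tr_B obL)
    show ?thesis unfolding center_kernel_def e using that comm[OF that] kc_idk_left[OF that] kc_idk_right[OF that] by (auto simp: kr_id)
  qed
  have ds: "is_direct_sum ZC (([A], ?eA), tr [A] ?eA) ((As, ?eL), tr As ?eL) ((A # As, ?eS), tr (A # As) ?eS)"
  proof (rule sum_from_split[OF YS YA YL center_kernel[OF ki(1)] center_kernel[OF ki(2)] center_kernel[OF kj(1)] center_kernel[OF kj(2)]])
    show "kc (A # As) ?i ?i = kr [A] [A] ?eA"
      unfolding kc_def di' kr_id by (intro ext) (auto simp: idk_def)
    show "kc (A # As) ?j ?q = kr As As ?eL"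
      by (intro ext) (auto simp: kc_def dj kr_id idk_def sh_inj)
    show "kc (A # As) ?j ?i = (\<lambda>a b. 0)"
      by (intro ext) (auto simp: kc_def dj idk_def dest: disj)
    show "kc (A # As) ?i ?q = (\<lambda>a b. 0)"
      by (intro ext) (auto simp: kc_def di' dest: disj)
    fix x y
    have inv: "inv_into UNIV sh (sh z) = z" for z by (rule inv_into_f_f) (auto simp: inj_on_def sh_inj)
    show "kc [A] ?i ?i x y + kc As ?q ?j x y = kr (A # As) (A # As) ?eS x y"
      unfolding kc_def di dq kr_id
      using Ap[of x] cov[of x] disj[of x] by (auto simp: idk_def inv shp)
  qed
  show ?case
    by (rule karoubian_tensor_closure.direct_sum[OF Xk_closure[of A, unfolded Xp_def] Cons _ ds]) (use YS in \<open>simp add: ZC_objects\<close>)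
qed

text \<open>The idempotent \<open>e\<close> exhibits \<open>(As, e)\<close> as a retract of the full
  list \<open>As\<close>, and it commutes with trivial braidings.\<close>

lemma tr_closure:
  assumes o: "(As, e) \<in> objects RS"
  shows "((As, e), tr As e) \<in> cl G"
proof -
  note Y = tr_zob[OF o] and L = tr_zob[OF obL[of As]]
  have e: "e \<in> ahom As As" "comp_mor CA e e = e" using o by (auto simp: RS_objects)
  let ?E = "kr As As e"
  note k = kr_kern[OF e(1)]
  have EE: "kc As ?E ?E = ?E" by (rule center_object.E_idem[OF Y])
  have B: "center_object.B t As (tr As e) [i] [j] = (\<lambda>a b. ?E a b * of_bool (i = j))" for i j by (intro ext tr_B o)
  have BL: "center_object.B t As (tr As (ident CA As)) [i] [j] = (\<lambda>a b. idk As a b * of_bool (i = j))" for i j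
    unfolding kr_id[symmetric] by (intro ext tr_B obL)
  have c: "kc As (\<lambda>a b. ?E a b * of_bool (i = j)) ?E = kc As ?E (\<lambda>a b. idk As a b * of_bool (i = j))"
    "kc As (\<lambda>a b. idk As a b * of_bool (i = j)) ?E = kc As ?E (\<lambda>a b. ?E a b * of_bool (i = j))" for i j :: nat
    by (cases "i = j"; simp add: EE kc_idk_left[OF k] kc_idk_right[OF k]; simp add: kc_def fun_eq_iff)+
  have "center_kernel As e (tr As e) As (ident CA As) (tr As (ident CA As)) ?E"
    "center_kernel As (ident CA As) (tr As (ident CA As)) As e (tr As e) ?E"
    unfolding center_kernel_def B BL kr_id using k EE kc_idk_left[OF k] kc_idk_right[OF k] c by auto
  then show ?thesis by (rule closure_retract[OF Y L tr_list_closure _ _ EE])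
qed

end

end

section \<open>The generating objects\<close>

text \<open>The left action on positions: the entry at position \<open>i\<close> moves to position
  \<open>g i\<close>, hence the inverse of \<open>g\<close> in the formula.\<close>

definition relabel :: "nat \<Rightarrow> (nat \<Rightarrow> nat) \<Rightarrow> nat list \<Rightarrow> nat list" where
  "relabel n g xs = map (\<lambda>i. xs ! (inv_into UNIV g (Suc i) - 1)) [0..<n]"

lemma length_relabel [simp]: "length (relabel n g xs) = n"
  by (simp add: relabel_def)

lemma permutes_in: "g permutes {1..n} \<Longrightarrow> i \<in> {1..n} \<Longrightarrow> g i \<in> {1..n}" for n :: nat
  by (rule permutes_in_image[THEN iffD2])

lemma relabel_nth: "g permutes {1..n} \<Longrightarrow> i \<in> {1..n} \<Longrightarrow> relabel n g xs ! (g i - 1) = xs ! (i - 1)"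
proof -
  assume g: "g permutes {1..n}" and i: "i \<in> {1..n}"
  then have gi: "g i \<in> {1..n}" by (rule permutes_in)
  then have "g i - 1 < n" "Suc (g i - 1) = g i" by auto
  then show ?thesis using permutes_inverses(2)[OF g, of i] by (simp add: relabel_def)
qed

lemma relabel_unique:
  assumes g: "g permutes {1..n}" and len: "length ys = n"
  shows "(\<forall>i\<in>{1..n}. ys ! (g i - 1) = xs ! (i - 1)) \<longleftrightarrow> ys = relabel n g xs"
proof
  assume a: "\<forall>i\<in>{1..n}. ys ! (g i - 1) = xs ! (i - 1)"
  show "ys = relabel n g xs"
  proof (rule nth_equalityI)
    fix j assume j: "j < length ys"
    let ?i = "inv_into UNIV g (Suc j)"
    have "?i \<in> {1..n}" using permutes_in_image[OF permutes_inv[OF g], of "Suc j"] j len by simp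
    moreover have "g ?i = Suc j" by (rule permutes_inverses(1)[OF g])
    ultimately show "ys ! j = relabel n g xs ! j" using a j len by (force simp: relabel_def)
  qed (simp add: len)
next
  assume "ys = relabel n g xs"
  then show "\<forall>i\<in>{1..n}. ys ! (g i - 1) = xs ! (i - 1)" using relabel_nth[OF g] by simp
qed

lemma relabel_comp:
  assumes g: "g permutes {1..n}" and h: "h permutes {1..n}"
  shows "relabel n h (relabel n g xs) = relabel n (h \<circ> g) xs"
proof -
  have "relabel n h (relabel n g xs) ! ((h \<circ> g) i - 1) = xs ! (i - 1)" if "i \<in> {1..n}" for i
    using relabel_nth[OF h, of "g i"] relabel_nth[OF g that] that permutes_in_image[OF g] by simp
  then show ?thesis
    using relabel_unique[OF permutes_compose[OF g h], of "relabel n h (relabel n g xs)" xs] by simp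
qed

lemma set_relabel: "g permutes {1..n} \<Longrightarrow> length xs = n \<Longrightarrow> set (relabel n g xs) = set xs"
proof -
  assume g: "g permutes {1..n}" and l: "length xs = n"
  have "set (relabel n g xs) = (\<lambda>i. xs ! (inv_into UNIV g i - 1)) ` Suc ` {0..<n}"
    by (simp only: relabel_def set_map set_upt image_image)
  also have "Suc ` {0..<n} = {1..n}" by (simp add: image_Suc_atLeastLessThan atLeastLessThanSuc_atLeastAtMost)
  also have "(\<lambda>i. xs ! (inv_into UNIV g i - 1)) ` {1..n} = (\<lambda>i. xs ! (i - 1)) ` inv_into UNIV g ` {1..n}"
    by (simp add: image_image)
  also have "inv_into UNIV g ` {1..n} = {1..n}" by (rule permutes_image[OF permutes_inv[OF g]])
  also have "{1..n} = Suc ` {0..<n}" by (simp add: image_Suc_atLeastLessThan atLeastLessThanSuc_atLeastAtMost)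
  also have "(\<lambda>i. xs ! (i - 1)) ` Suc ` {0..<n} = set xs"
  proof -
    have "(\<lambda>i. xs ! (i - 1)) ` Suc ` {0..<n} = (!) xs ` set [0..<n]" by (simp only: image_image diff_Suc_1 set_upt)
    also have "\<dots> = set xs" unfolding set_map[symmetric] l[symmetric] map_nth ..
    finally show ?thesis .
  qed
  finally show ?thesis .
qed

lemma distinct_relabel: "g permutes {1..n} \<Longrightarrow> length xs = n \<Longrightarrow> distinct (relabel n g xs) = distinct xs"
proof -
  assume a: "g permutes {1..n}" "length xs = n"
  have "distinct zs \<longleftrightarrow> card (set zs) = length zs" for zs :: "nat list" using card_distinct distinct_card by blast
  then show ?thesis by (simp only: set_relabel[OF a] length_relabel a(2))
qed

lemma nth_ex: "x \<in> set xs \<Longrightarrow> \<exists>i\<in>{1..length xs}. xs ! (i - 1) = x"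
  by (metis One_nat_def Suc_leI atLeastAtMost_iff diff_Suc_1 in_set_conv_nth le_add1 plus_1_eq_Suc)

lemma nth_in_set: "i \<in> {1..length xs} \<Longrightarrow> xs ! (i - 1) \<in> set xs"
  by (rule nth_mem) auto

lemma nth_inj: "distinct xs \<Longrightarrow> i \<in> {1..length xs} \<Longrightarrow> j \<in> {1..length xs} \<Longrightarrow> xs ! (i - 1) = xs ! (j - 1) \<Longrightarrow> i = j"
proof -
  assume a: "distinct xs" "i \<in> {1..length xs}" "j \<in> {1..length xs}" "xs ! (i - 1) = xs ! (j - 1)"
  from a(2,3) have l: "i - 1 < length xs" "j - 1 < length xs" "1 \<le> i" "1 \<le> j" by auto
  have "i - 1 = j - 1" using nth_eq_iff_index_eq[OF a(1) l(1,2)] a(4) by blast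
  then show ?thesis using l(3,4) by linarith
qed

text \<open>The permutation of the natural numbers that acts on the entries of \<open>xs\<close> by permuting their positions by \<open>\<sigma>\<close>.\<close>

definition tperm :: "nat \<Rightarrow> (nat \<Rightarrow> nat) \<Rightarrow> nat list \<Rightarrow> nat \<Rightarrow> nat" where
  "tperm n \<sigma> xs x = (if distinct xs \<and> length xs = n \<and> x \<in> set xs
     then xs ! (\<sigma> (THE i. i \<in> {1..n} \<and> xs ! (i - 1) = x) - 1) else x)"

lemma tperm_nth: "distinct xs \<Longrightarrow> length xs = n \<Longrightarrow> i \<in> {1..n} \<Longrightarrow> tperm n \<sigma> xs (xs ! (i - 1)) = xs ! (\<sigma> i - 1)"
proof -
  assume a: "distinct xs" "length xs = n" "i \<in> {1..n}"
  have "(THE j. j \<in> {1..n} \<and> xs ! (j - 1) = xs ! (i - 1)) = i"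
  proof (rule the_equality)
    fix j assume "j \<in> {1..n} \<and> xs ! (j - 1) = xs ! (i - 1)"
    then show "j = i" using a nth_inj[OF a(1), of j i] by blast
  qed (use a in blast)
  then show ?thesis using a nth_in_set[of i xs] by (simp add: tperm_def)
qed

lemma tperm_notin: "x \<notin> set xs \<Longrightarrow> tperm n \<sigma> xs x = x"
  by (simp add: tperm_def)

lemma tperm_degenerate: "\<not> (distinct xs \<and> length xs = n) \<Longrightarrow> tperm n \<sigma> xs = id"
  by (auto simp: tperm_def fun_eq_iff)

lemma tperm_comp:
  assumes "\<tau> permutes {1..n}"
  shows "tperm n \<sigma> xs (tperm n \<tau> xs x) = tperm n (\<sigma> \<circ> \<tau>) xs x"
proof (cases "distinct xs \<and> length xs = n")
  case True
  show ?thesis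
  proof (cases "x \<in> set xs")
    case x: True
    then obtain i where i: "i \<in> {1..n}" "x = xs ! (i - 1)" using nth_ex[of x xs] True by auto
    from i(1) have ti: "\<tau> i \<in> {1..n}" by (rule permutes_in[OF assms])
    have d: "distinct xs" "length xs = n" using True by auto
    show ?thesis unfolding i(2) tperm_nth[OF d i(1)] tperm_nth[OF d ti] o_apply ..
  qed (simp add: tperm_notin)
qed (simp add: tperm_degenerate)

lemma tperm_id: "tperm n id xs = id"
proof
  fix x show "tperm n id xs x = id x"
    using nth_ex[of x xs] tperm_nth[of xs n _ id] tperm_notin[of x xs n id] tperm_degenerate[of xs n id]
    by (cases "distinct xs \<and> length xs = n"; cases "x \<in> set xs") (auto simp del: One_nat_def)
qed

lemma bij_tperm: "\<sigma> permutes {1..n} \<Longrightarrow> bij (tperm n \<sigma> xs)"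
proof -
  assume \<sigma>: "\<sigma> permutes {1..n}"
  have "inv_into UNIV \<sigma> \<circ> \<sigma> = id" "\<sigma> \<circ> inv_into UNIV \<sigma> = id" using permutes_inv_o[OF \<sigma>] by auto
  moreover have "tperm n (inv_into UNIV \<sigma>) xs \<circ> tperm n \<sigma> xs = tperm n (inv_into UNIV \<sigma> \<circ> \<sigma>) xs"
    "tperm n \<sigma> xs \<circ> tperm n (inv_into UNIV \<sigma>) xs = tperm n (\<sigma> \<circ> inv_into UNIV \<sigma>) xs"
    by (rule ext, simp only: o_apply tperm_comp[OF \<sigma>] tperm_comp[OF permutes_inv[OF \<sigma>]])+
  ultimately have "tperm n (inv_into UNIV \<sigma>) xs \<circ> tperm n \<sigma> xs = id" "tperm n \<sigma> xs \<circ> tperm n (inv_into UNIV \<sigma>) xs = id"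
    by (simp_all only: tperm_id)
  then show ?thesis by (rule o_bij)
qed

lemma tperm_eqv:
  assumes \<sigma>: "\<sigma> permutes {1..n}" and "bij \<pi>"
  shows "tperm n \<sigma> (map \<pi> xs) (\<pi> x) = \<pi> (tperm n \<sigma> xs x)"
proof (cases "distinct xs \<and> length xs = n")
  case True
  have inj: "inj \<pi>" using assms(2) by (rule bij_is_inj)
  then have d: "distinct (map \<pi> xs) \<and> length (map \<pi> xs) = n" using True by (simp add: distinct_map inj_on_def inj_def)
  show ?thesis
  proof (cases "x \<in> set xs")
    case x: True
    then obtain i where i: "i \<in> {1..n}" "x = xs ! (i - 1)" using nth_ex[of x xs] True by auto
    have "\<sigma> i \<in> {1..n}" by (rule permutes_in[OF \<sigma> i(1)])
    then have "i - 1 < length xs" "\<sigma> i - 1 < length xs" using i(1) True by auto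
    then have m: "map \<pi> xs ! (i - 1) = \<pi> (xs ! (i - 1))" "map \<pi> xs ! (\<sigma> i - 1) = \<pi> (xs ! (\<sigma> i - 1))"
      by (simp_all only: nth_map)
    have "tperm n \<sigma> (map \<pi> xs) (\<pi> x) = map \<pi> xs ! (\<sigma> i - 1)"
      unfolding i(2) m(1)[symmetric] by (rule tperm_nth[OF conjunct1[OF d] conjunct2[OF d] i(1)])
    also have "\<dots> = \<pi> (tperm n \<sigma> xs x)"
      unfolding i(2) m(2) tperm_nth[OF conjunct1[OF True] conjunct2[OF True] i(1)] ..
    finally show ?thesis .
  next
    case False
    then have "\<pi> x \<notin> set (map \<pi> xs)" using inj by (auto simp: inj_eq)
    then show ?thesis using False by (simp add: tperm_notin)
  qed
next
  case False
  have "\<not> (distinct (map \<pi> xs) \<and> length (map \<pi> xs) = n)"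
    using False by (auto simp: distinct_map)
  then show ?thesis using False by (simp add: tperm_degenerate)
qed

text \<open>Relabelling by \<open>g\<close> conjugates the permutation of positions by
  \<open>g\<close>, and here \<open>g\<close> commutes with \<open>\<sigma>\<close>. Consequently
  the idempotent of a generator preserves the grading.\<close>

lemma tperm_relabel:
  assumes \<sigma>: "\<sigma> permutes {1..n}" and g: "g \<in> perm_centralizer n \<sigma>" and len: "length xs = n"
  shows "tperm n \<sigma> (relabel n g xs) = tperm n \<sigma> xs"
proof
  fix x
  have gp: "g permutes {1..n}" and comm: "g (\<sigma> i) = \<sigma> (g i)" for i
    using g by (auto simp: perm_centralizer_def fun_eq_iff)
  show "tperm n \<sigma> (relabel n g xs) x = tperm n \<sigma> xs x"
  proof (cases "distinct xs \<and> x \<in> set xs")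
    case True
    then obtain i where i: "i \<in> {1..n}" "x = xs ! (i - 1)" using nth_ex[of x xs] len by auto
    then have gi: "g i \<in> {1..n}" "\<sigma> i \<in> {1..n}" using gp \<sigma> by (blast intro: permutes_in)+
    have d: "distinct (relabel n g xs)" using True distinct_relabel[OF gp len] by blast
    have "tperm n \<sigma> (relabel n g xs) x = relabel n g xs ! (\<sigma> (g i) - 1)"
      unfolding i(2) relabel_nth[OF gp i(1), of xs, symmetric] by (rule tperm_nth[OF d length_relabel gi(1)])
    also have "\<dots> = xs ! (\<sigma> i - 1)" unfolding comm[symmetric] by (rule relabel_nth[OF gp gi(2)])
    also have "\<dots> = tperm n \<sigma> xs x" unfolding i(2) tperm_nth[OF conjunct1[OF True] len i(1)] ..
    finally show ?thesis .
  next
    case False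
    then show ?thesis
      using tperm_notin[of x xs] tperm_notin[of x "relabel n g xs"] set_relabel[OF gp len] distinct_relabel[OF gp len]
        tperm_degenerate[of xs n] tperm_degenerate[of "relabel n g xs" n] by metis
  qed
qed

lemma perm_diagram: "g permutes {1..n} \<Longrightarrow> perm_diagram n g \<in> diagrams n n"
proof -
  assume g: "g permutes {1..n}"
  have im: "g ` {1..n} = {1..n}" by (rule permutes_image[OF g])
  have inj: "g i = g j \<longleftrightarrow> i = j" for i j using permutes_inj[OF g] by (simp add: inj_eq)
  have "\<Union> (perm_diagram n g) = Inl ` {1..n} \<union> Inr ` g ` {1..n}" by (auto simp: perm_diagram_def)
  then have "\<Union> (perm_diagram n g) = points n n" unfolding im points_def .
  moreover have "disjoint (perm_diagram n g)" by (auto simp: perm_diagram_def disjoint_def inj)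
  moreover have "{} \<notin> perm_diagram n g" by (auto simp: perm_diagram_def)
  ultimately show ?thesis by (simp add: diagrams_def partition_on_def)
qed

text \<open>Each block has only one upper point, which forces the entries of \<open>xs\<close> to be
  distinct. So the element \<open>x_diagram (perm_diagram n g)\<close> acts as \<open>g\<close> on
  distinct tuples and as zero on the others.\<close>

lemma kerp_perm_diagram:
  assumes g: "g permutes {1..n}" and len: "length xs = n" "length ys = n"
  shows "kerp n n xs ys = perm_diagram n g \<longleftrightarrow> distinct xs \<and> ys = relabel n g xs"
proof
  assume k: "kerp n n xs ys = perm_diagram n g"
  have "ys ! (g i - 1) = xs ! (i - 1)" if "i \<in> {1..n}" for i
  proof -
    have "{Inl i, Inr (g i)} \<in> kerp n n xs ys" unfolding k perm_diagram_def using that by blast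
    then obtain v where "{Inl i, Inr (g i)} = {x \<in> points n n. val xs ys x = v}" unfolding kerp_def by blast
    then have "val xs ys (Inl i) = v" "val xs ys (Inr (g i)) = v" by blast+
    then show ?thesis by simp
  qed
  then have "ys = relabel n g xs" using relabel_unique[OF g len(2)] by blast
  moreover have "distinct xs" unfolding distinct_conv_nth
  proof (intro allI impI notI)
    fix i j assume ij: "i < length xs" "j < length xs" "i \<noteq> j" "xs ! i = xs ! j"
    let ?S = "{x \<in> points n n. val xs ys x = xs ! i}"
    have m: "Inl (Suc i) \<in> ?S" "Inl (Suc j) \<in> ?S" using ij len by (auto simp: points_def)
    have "Inl (Suc i) \<in> points n n" using m by blast
    then have "?S \<in> kerp n n xs ys" unfolding kerp_def by (intro image_eqI[of _ _ "xs ! i"]) (auto simp: image_iff intro!: bexI[of _ "Inl (Suc i)"])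
    then obtain l where "?S = {Inl l, Inr (g l)}" unfolding k perm_diagram_def by blast
    then have "Suc i = l" "Suc j = l" using m by auto
    then show False using ij by simp
  qed
  ultimately show "distinct xs \<and> ys = relabel n g xs" by simp
next
  assume a: "distinct xs \<and> ys = relabel n g xs"
  have v: "val xs ys (Inr (g i)) = xs ! (i - 1)" if "i \<in> {1..n}" for i
    using relabel_nth[OF g that, of xs] a by simp
  have S: "{x \<in> points n n. val xs ys x = xs ! (i - 1)} = {Inl i, Inr (g i)}" if i: "i \<in> {1..n}" for i
  proof (intro Set.set_eqI iffI)
    fix x assume x: "x \<in> {x \<in> points n n. val xs ys x = xs ! (i - 1)}"
    show "x \<in> {Inl i, Inr (g i)}"
    proof (cases x)
      case (Inl j)
      then show ?thesis using x nth_inj[of xs j i] a i len by (auto simp: points_def)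
    next
      case (Inr j)
      let ?k = "inv_into UNIV g j"
      have "j \<in> {1..n}" using x Inr by (auto simp: points_def)
      then have k: "?k \<in> {1..n}" "g ?k = j" using permutes_in_image[OF permutes_inv[OF g]] permutes_inverses(1)[OF g] by auto
      then have "xs ! (?k - 1) = xs ! (i - 1)" using v[OF k(1)] x Inr by simp
      then have "?k = i" using nth_inj[of xs ?k i] k a i len by simp
      then show ?thesis using k Inr by simp
    qed
  next
    fix x assume "x \<in> {Inl i, Inr (g i)}"
    then show "x \<in> {x \<in> points n n. val xs ys x = xs ! (i - 1)}"
      using v[OF i] i permutes_in_image[OF g, of i] by (auto simp: points_def)
  qed
  have "kerp n n xs ys = (\<lambda>x. {y \<in> points n n. val xs ys y = val xs ys x}) ` points n n"
    unfolding kerp_def image_image ..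
  also have "\<dots> = (\<lambda>i. {y \<in> points n n. val xs ys y = val xs ys (Inl i)}) ` {1..n} \<union>
      (\<lambda>i. {y \<in> points n n. val xs ys y = val xs ys (Inr (g i))}) ` {1..n}"
  proof -
    have "points n n = Inl ` {1..n} \<union> Inr ` g ` {1..n}" unfolding permutes_image[OF g] points_def ..
    then show ?thesis by (simp only: image_Un image_image)
  qed
  also have "\<dots> = perm_diagram n g"
  proof -
    have "(\<lambda>i. {y \<in> points n n. val xs ys y = val xs ys (Inl i)}) ` {1..n} = (\<lambda>i. {Inl i, Inr (g i)}) ` {1..n}"
      by (rule image_cong[OF refl]) (simp add: S[symmetric] del: One_nat_def)
    moreover have "(\<lambda>i. {y \<in> points n n. val xs ys y = val xs ys (Inr (g i))}) ` {1..n} = (\<lambda>i. {Inl i, Inr (g i)}) ` {1..n}"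
      by (rule image_cong[OF refl]) (simp add: v S del: One_nat_def val_simps)
    ultimately show ?thesis by (simp add: perm_diagram_def)
  qed
  finally show "kerp n n xs ys = perm_diagram n g" .
qed

lemma cycle_type_partition:
  assumes "\<sigma> permutes {1..n}"
  shows "is_number_partition n (cycle_type n \<sigma>)"
proof -
  have perm: "permutation \<sigma>" using assms permutation_permutes by blast
  have self: "x \<in> orbit \<sigma> x" for x by (rule permutation_self_in_orbit[OF perm])
  have sub: "orbit \<sigma> x \<subseteq> {1..n}" if "x \<in> {1..n}" for x
    using permutes_orbit_subset[OF assms that] .
  have fin: "finite (orbit \<sigma> x)" if "x \<in> {1..n}" for x using sub[OF that] finite_subset by blast
  have eq: "orbit \<sigma> x = orbit \<sigma> y" if "z \<in> orbit \<sigma> x" "z \<in> orbit \<sigma> y" for x y z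
    using orbit_cyclic_eq3[OF cyclic_on_orbit'[OF perm] that(1)] orbit_cyclic_eq3[OF cyclic_on_orbit'[OF perm] that(2)] by simp
  have U: "\<Union> (orbit \<sigma> ` {1..n}) = {1..n}" using self sub by blast
  have "sum_mset (cycle_type n \<sigma>) = (\<Sum>C\<in>orbit \<sigma> ` {1..n}. card C)"
    by (simp add: cycle_type_def sum_unfold_sum_mset)
  also have "\<dots> = card (\<Union> (orbit \<sigma> ` {1..n}))"
  proof (rule card_Union_disjoint[symmetric])
    show "pairwise disjnt (orbit \<sigma> ` {1..n})"
    proof (rule pairwiseI)
      fix C D assume "C \<in> orbit \<sigma> ` {1..n}" "D \<in> orbit \<sigma> ` {1..n}" "C \<noteq> D"
      then obtain x y where "C = orbit \<sigma> x" "D = orbit \<sigma> y" "C \<noteq> D" by blast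
      then show "disjnt C D" unfolding disjnt_def using eq by blast
    qed
  qed (use fin in blast)
  finally have "sum_mset (cycle_type n \<sigma>) = n" unfolding U by simp
  moreover have "0 \<notin># cycle_type n \<sigma>"
  proof
    assume "0 \<in># cycle_type n \<sigma>"
    then obtain x where "x \<in> {1..n}" "card (orbit \<sigma> x) = 0" by (auto simp: cycle_type_def simp del: One_nat_def)
    then show False using fin[of x] self[of x] by auto
  qed
  ultimately show ?thesis by (simp add: is_number_partition_def)
qed

lemma E_diagram_diagram:
  assumes "i \<in> {1..n}" "j \<in> {1..n}"
  shows "E_diagram n i j \<in> diagrams (n + 1) (n + 1)"
proof -
  let ?B = "\<lambda>l. {Inl l, Inr l} \<union> (if l = i then {Inl (n + 1)} else {}) \<union> (if l = j then {Inr (n + 1)} else {}) :: (nat + nat) set"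
  have "\<Union> (?B ` {1..n}) = Inl ` {1..n} \<union> Inr ` {1..n} \<union> {Inl (n + 1), Inr (n + 1)}"
    using assms by (auto split: if_splits)
  also have "\<dots> = points (n + 1) (n + 1)"
  proof -
    have "{1..n + 1} = insert (n + 1) {1..n}" by auto
    then show ?thesis unfolding points_def by auto
  qed
  finally have "\<Union> (E_diagram n i j) = points (n + 1) (n + 1)" by (simp only: E_diagram_def)
  moreover have "?B l \<inter> ?B m = {}" if "l \<in> {1..n}" "m \<in> {1..n}" "l \<noteq> m" for l m
    using that by auto
  then have "disjoint (E_diagram n i j)"
    unfolding disjoint_def E_diagram_def by (intro ballI impI) blast
  moreover have "{} \<notin> E_diagram n i j" by (auto simp: E_diagram_def)
  ultimately show ?thesis by (simp add: diagrams_def partition_on_def)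
qed

lemma all_idx: "(\<forall>l\<in>{1..n}. P (l - 1)) \<longleftrightarrow> (\<forall>l<n. P l)" for n :: nat
proof (intro iffI allI impI ballI)
  fix l assume "\<forall>l\<in>{1..n}. P (l - 1)" "l < n"
  then show "P l" by (auto dest!: bspec[of _ _ "Suc l"])
qed auto

lemma pfun_E_diagram:
  assumes ij: "i \<in> {1..n}" "j \<in> {1..n}" and len: "length xs = n" "length ys = n"
  shows "pfun (n + 1) (n + 1) (E_diagram n i j) (xs @ [u]) (ys @ [w]) =
    of_bool (xs = ys \<and> u = xs ! (i - 1) \<and> w = xs ! (j - 1))"
proof -
  let ?v = "val (xs @ [u]) (ys @ [w])"
  have v: "?v (Inl l) = xs ! (l - 1)" "?v (Inr l) = ys ! (l - 1)" if "l \<in> {1..n}" for l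
    using that len by (auto simp: nth_append)
  have v': "?v (Inl (n + 1)) = u" "?v (Inr (n + 1)) = w" using len by (auto simp: nth_append)
  have "compat (E_diagram n i j) ?v \<longleftrightarrow> (\<forall>l\<in>{1..n}. xs ! (l - 1) = ys ! (l - 1) \<and>
      (l = i \<longrightarrow> u = xs ! (l - 1)) \<and> (l = j \<longrightarrow> w = xs ! (l - 1)))"
    unfolding compat_def E_diagram_def ball_simps
  proof (rule ball_cong[OF refl])
    fix l assume l: "l \<in> {1..n}"
    show "(\<forall>x\<in>{Inl l, Inr l} \<union> (if l = i then {Inl (n + 1)} else {}) \<union> (if l = j then {Inr (n + 1)} else {}).
      \<forall>y\<in>{Inl l, Inr l} \<union> (if l = i then {Inl (n + 1)} else {}) \<union> (if l = j then {Inr (n + 1)} else {}). ?v x = ?v y) \<longleftrightarrow>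
      xs ! (l - 1) = ys ! (l - 1) \<and> (l = i \<longrightarrow> u = xs ! (l - 1)) \<and> (l = j \<longrightarrow> w = xs ! (l - 1))"
      using v[OF l] v' by (auto simp del: val_simps One_nat_def)
  qed
  also have "\<dots> \<longleftrightarrow> (\<forall>l\<in>{1..n}. xs ! (l - 1) = ys ! (l - 1)) \<and> u = xs ! (i - 1) \<and> w = xs ! (j - 1)"
    using ij by blast
  also have "(\<forall>l\<in>{1..n}. xs ! (l - 1) = ys ! (l - 1)) \<longleftrightarrow> xs = ys"
    unfolding all_idx[where P = "\<lambda>l. xs ! l = ys ! l"] using len by (auto simp: list_eq_iff_nth_eq)
  finally show ?thesis by (simp add: pfun_def len)
qed

lemma swap_diagram_diagram: "swap_diagram k l \<in> diagrams (k + l) (l + k)"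
proof -
  have "\<Union> (swap_diagram k l) = Inl ` ({1..k} \<union> (+) k ` {1..l}) \<union> Inr ` ({1..l} \<union> (+) l ` {1..k})"
    by (auto simp: swap_diagram_def image_iff simp del: image_add_atLeastAtMost)
  also have "\<dots> = points (k + l) (l + k)"
  proof -
    have "{1..a} \<union> (+) a ` {1..b} = {1..a + b}" for a b :: nat
      unfolding image_add_atLeastAtMost by auto
    then show ?thesis by (simp only: points_def)
  qed
  finally have "\<Union> (swap_diagram k l) = points (k + l) (l + k)" .
  moreover have "disjoint (swap_diagram k l)" by (auto simp: swap_diagram_def disjoint_def)
  moreover have "{} \<notin> swap_diagram k l" by (auto simp: swap_diagram_def)
  ultimately show ?thesis by (simp add: diagrams_def partition_on_def)
qed

lemma pfun_swap:
  assumes len: "length xs = k" "length ys = k"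
  shows "pfun (k + 1) (1 + k) (swap_diagram k 1) (xs @ [u]) (w # ys) = of_bool (xs = ys \<and> u = w)"
proof -
  let ?v = "val (xs @ [u]) (w # ys)"
  have v: "?v (Inl l) = xs ! (l - 1)" "?v (Inr (1 + l)) = ys ! (l - 1)" if "l \<in> {1..k}" for l
    using that len by (auto simp: nth_append nth_Cons')
  have v': "?v (Inl (k + 1)) = u" "?v (Inr 1) = w" using len by (auto simp: nth_append)
  have "compat (swap_diagram k 1) ?v \<longleftrightarrow> (\<forall>l\<in>{1..k}. ?v (Inl l) = ?v (Inr (1 + l))) \<and> ?v (Inl (k + 1)) = ?v (Inr 1)"
    unfolding swap_diagram_def compat_Un unfolding compat_def by (auto simp del: val_simps)
  also have "\<dots> \<longleftrightarrow> (\<forall>l\<in>{1..k}. xs ! (l - 1) = ys ! (l - 1)) \<and> u = w"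
    unfolding v' using v by (simp del: val_simps One_nat_def)
  also have "(\<forall>l\<in>{1..k}. xs ! (l - 1) = ys ! (l - 1)) \<longleftrightarrow> xs = ys"
    unfolding all_idx[where P = "\<lambda>l. xs ! l = ys ! l"] using len by (auto simp: list_eq_iff_nth_eq)
  finally show ?thesis by (simp add: pfun_def len)
qed

section \<open>The generators as objects graded by permutations\<close>

locale wold = deligne +
  fixes n :: nat and \<sigma> :: "nat \<Rightarrow> nat" and k :: nat and \<rho> :: "(nat \<Rightarrow> nat) \<Rightarrow> complex mat"
  assumes \<sigma>: "\<sigma> permutes {1..n}" and rep: "matrix_representation (perm_centralizer n \<sigma>) k \<rho>"
begin

abbreviation "Z \<equiv> perm_centralizer n \<sigma>"
abbreviation "As \<equiv> replicate k n"
abbreviation "e \<equiv> old_idem n \<sigma> k \<rho>"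

lemma Z_perm: "g \<in> Z \<Longrightarrow> g permutes {1..n}"
  by (simp add: perm_centralizer_def)

lemma finite_Z: "finite Z"
  by (rule finite_subset[OF _ finite_permutations[of "{1..n}"]]) (auto simp: perm_centralizer_def)

lemma id_Z: "id \<in> Z"
  by (simp add: perm_centralizer_def permutes_id)

lemma card_Z: "card Z > 0"
  using finite_Z id_Z card_gt_0_iff by blast

lemma comp_Z: "g \<in> Z \<Longrightarrow> h \<in> Z \<Longrightarrow> h \<circ> g \<in> Z"
  by (auto simp: perm_centralizer_def permutes_compose fun_eq_iff)

lemma inv_Z: "g \<in> Z \<Longrightarrow> inv_into UNIV g \<in> Z"
proof -
  assume g: "g \<in> Z"
  note p = Z_perm[OF g]
  have "inv_into UNIV g (\<sigma> x) = \<sigma> (inv_into UNIV g x)" for x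
  proof -
    have "g (\<sigma> (inv_into UNIV g x)) = \<sigma> (g (inv_into UNIV g x))" using g by (auto simp: perm_centralizer_def fun_eq_iff)
    also have "\<dots> = \<sigma> x" by (simp add: permutes_inverses(1)[OF p])
    finally show ?thesis using permutes_inverses(2)[OF p] by metis
  qed
  then show ?thesis using permutes_inv[OF p] by (auto simp: perm_centralizer_def fun_eq_iff)
qed

lemma e_hom: "e \<in> ahom As As"
  unfolding ahom_def old_idem_def Let_def
  by (auto intro!: phom_scale phom_sum x_diagram_hom perm_diagram Z_perm)

text \<open>The restriction to distinct tuples is the effect of using \<open>x_diagram\<close> in
  place of the diagrams of the permutations.\<close>

lemma E_eq: "kr As As e (Pt s xs) (Pt r ys) = (if s < k \<and> r < k \<and> length xs = n \<and> distinct xs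
    then (\<Sum>g\<in>Z. 1 / of_nat (card Z) * \<rho> g $$ (r, s) * of_bool (ys = relabel n g xs)) else 0)"
proof (cases "s < k \<and> r < k \<and> length xs = n \<and> length ys = n")
  case True
  have "dk n n (x_diagram (perm_diagram n g)) xs ys = of_bool (distinct xs \<and> ys = relabel n g xs)" if "g \<in> Z" for g
    using dk_x_diagram[OF perm_diagram[OF Z_perm[OF that]], of xs ys] kerp_perm_diagram[OF Z_perm[OF that], of xs ys] True by simp
  then show ?thesis
    using True by (simp add: old_idem_def Let_def dk_scale dk_sum sum_distrib_left mult.assoc cong: sum.cong)
next
  case False
  have "kr As As e (Pt s xs) (Pt r ys) = 0"
    using kern_0[OF kr_kern[OF e_hom], of "Pt s xs" "Pt r ys"] False by auto
  moreover have "length ys \<noteq> n \<Longrightarrow> ys \<noteq> relabel n g xs" for g by auto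
  ultimately show ?thesis using False by auto
qed

lemma rho_comp: "g \<in> Z \<Longrightarrow> h \<in> Z \<Longrightarrow> q < k \<Longrightarrow> s < k \<Longrightarrow> (\<Sum>r<k. \<rho> g $$ (r, s) * \<rho> h $$ (q, r)) = \<rho> (h \<circ> g) $$ (q, s)"
proof -
  assume a: "g \<in> Z" "h \<in> Z" "q < k" "s < k"
  then have c: "\<rho> g \<in> carrier_mat k k" "\<rho> h \<in> carrier_mat k k" "\<rho> (h \<circ> g) = \<rho> h * \<rho> g"
    using rep by (auto simp: matrix_representation_def)
  show ?thesis using a c by (simp add: scalar_prod_def mult.commute lessThan_atLeast0)
qed

text \<open>The usual computation for a group average. The integral over the middle tuple picks, for
  each \<open>g\<close>, the single tuple \<open>relabel n g xs\<close> of mass 1, so it reduces to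
  sums over the centralizer.\<close>

lemma E_idem: "kc As (kr As As e) (kr As As e) = kr As As e"
proof (intro ext)
  fix a b
  obtain s xs q zs where P: "a = Pt s xs" "b = Pt q zs" by (cases a; cases b)
  let ?c = "1 / of_nat (card Z) :: complex" and ?E = "kr As As e"
  show "kc As ?E ?E a b = ?E a b"
  proof (cases "s < k \<and> q < k \<and> length xs = n \<and> distinct xs")
    case True
    have "kc As ?E ?E a b = (\<Sum>r<k. intl n (\<lambda>ys. ?E (Pt s xs) (Pt r ys) * ?E (Pt r ys) (Pt q zs)))"
      by (simp add: kc_def intp_def P)
    also have "\<dots> = (\<Sum>r<k. \<Sum>g\<in>Z. ?c * \<rho> g $$ (r, s) * ?E (Pt r (relabel n g xs)) (Pt q zs))"
    proof (rule sum.cong[OF refl])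
      fix r assume r: "r \<in> {..<k}"
      have "intl n (\<lambda>ys. ?E (Pt s xs) (Pt r ys) * ?E (Pt r ys) (Pt q zs)) =
        intl n (\<lambda>ys. \<Sum>g\<in>Z. if ys = relabel n g xs then ?c * \<rho> g $$ (r, s) * ?E (Pt r (relabel n g xs)) (Pt q zs) else 0)"
        by (rule intl_cong) (use True r in \<open>auto simp: E_eq[of s xs] sum_distrib_right simp del: kr.simps intro!: sum.cong\<close>)
      also have "\<dots> = (\<Sum>g\<in>Z. intl n (\<lambda>ys. if ys = relabel n g xs then ?c * \<rho> g $$ (r, s) * ?E (Pt r (relabel n g xs)) (Pt q zs) else 0))"
        by (intro intl_sum fs_intros)
      also have "\<dots> = (\<Sum>g\<in>Z. ?c * \<rho> g $$ (r, s) * ?E (Pt r (relabel n g xs)) (Pt q zs))"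
        by (intro sum.cong refl, subst intl_delta) simp
      finally show "intl n (\<lambda>ys. ?E (Pt s xs) (Pt r ys) * ?E (Pt r ys) (Pt q zs)) =
        (\<Sum>g\<in>Z. ?c * \<rho> g $$ (r, s) * ?E (Pt r (relabel n g xs)) (Pt q zs))" .
    qed
    also have "\<dots> = (\<Sum>r<k. \<Sum>g\<in>Z. \<Sum>h\<in>Z. ?c * ?c * (\<rho> g $$ (r, s) * \<rho> h $$ (q, r)) * of_bool (zs = relabel n (h \<circ> g) xs))"
    proof (intro sum.cong refl)
      fix r g assume r: "r \<in> {..<k}" and g: "g \<in> Z"
      show "?c * \<rho> g $$ (r, s) * ?E (Pt r (relabel n g xs)) (Pt q zs) =
        (\<Sum>h\<in>Z. ?c * ?c * (\<rho> g $$ (r, s) * \<rho> h $$ (q, r)) * of_bool (zs = relabel n (h \<circ> g) xs))"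
        unfolding E_eq using True r distinct_relabel[OF Z_perm[OF g], of xs]
        by (simp add: sum_distrib_left relabel_comp[OF Z_perm[OF g] Z_perm] mult_ac cong: sum.cong)
    qed
    also have "\<dots> = (\<Sum>g\<in>Z. \<Sum>h\<in>Z. \<Sum>r<k. ?c * ?c * (\<rho> g $$ (r, s) * \<rho> h $$ (q, r)) * of_bool (zs = relabel n (h \<circ> g) xs))"
      by (subst sum.swap, rule sum.cong[OF refl], rule sum.swap)
    also have "\<dots> = (\<Sum>g\<in>Z. \<Sum>h\<in>Z. ?c * ?c * \<rho> (h \<circ> g) $$ (q, s) * of_bool (zs = relabel n (h \<circ> g) xs))"
    proof (intro sum.cong refl)
      fix g h assume gh: "g \<in> Z" "h \<in> Z"
      have "(\<Sum>r<k. ?c * ?c * (\<rho> g $$ (r, s) * \<rho> h $$ (q, r)) * of_bool (zs = relabel n (h \<circ> g) xs)) =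
        ?c * ?c * (\<Sum>r<k. \<rho> g $$ (r, s) * \<rho> h $$ (q, r)) * of_bool (zs = relabel n (h \<circ> g) xs)"
        by (simp only: sum_distrib_left sum_distrib_right)
      then show "(\<Sum>r<k. ?c * ?c * (\<rho> g $$ (r, s) * \<rho> h $$ (q, r)) * of_bool (zs = relabel n (h \<circ> g) xs)) =
        ?c * ?c * \<rho> (h \<circ> g) $$ (q, s) * of_bool (zs = relabel n (h \<circ> g) xs)"
        using rho_comp[OF gh, of q s] True by simp
    qed
    \<comment> \<open>Right translation by \<open>g\<close> permutes the centralizer, so the inner
      sum does not depend on \<open>g\<close>; this produces the factor \<open>card Z\<close> that
      cancels one of the two denominators.\<close>
    also have "\<dots> = (\<Sum>g\<in>Z. \<Sum>h\<in>Z. ?c * ?c * \<rho> h $$ (q, s) * of_bool (zs = relabel n h xs))"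
    proof (rule sum.cong[OF refl])
      fix g assume g: "g \<in> Z"
      note gp = Z_perm[OF g]
      show "(\<Sum>h\<in>Z. ?c * ?c * \<rho> (h \<circ> g) $$ (q, s) * of_bool (zs = relabel n (h \<circ> g) xs)) =
        (\<Sum>h\<in>Z. ?c * ?c * \<rho> h $$ (q, s) * of_bool (zs = relabel n h xs))"
      proof (rule sum.reindex_bij_witness[where i = "\<lambda>h. h \<circ> inv_into UNIV g" and j = "\<lambda>h. h \<circ> g"])
        fix h
        show "(h \<circ> g) \<circ> inv_into UNIV g = h" "(h \<circ> inv_into UNIV g) \<circ> g = h"
          by (simp_all add: fun_eq_iff permutes_inverses[OF gp])
      qed (use g comp_Z inv_Z in auto)
    qed
    also have "\<dots> = ?E a b"
    proof -
      have "(\<Sum>g\<in>Z. \<Sum>h\<in>Z. ?c * ?c * \<rho> h $$ (q, s) * of_bool (zs = relabel n h xs)) =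
        (\<Sum>h\<in>Z. of_nat (card Z) * (?c * ?c * \<rho> h $$ (q, s) * of_bool (zs = relabel n h xs)))"
        by (simp only: sum_constant sum_distrib_left)
      also have "\<dots> = (\<Sum>h\<in>Z. ?c * \<rho> h $$ (q, s) * of_bool (zs = relabel n h xs))"
        using card_Z by (intro sum.cong) auto
      finally show ?thesis using True unfolding P E_eq by simp
    qed
    finally show ?thesis .
  next
    case False
    have "?E a b = 0" using False unfolding P E_eq by auto
    moreover have "?E a c * ?E c b = 0" for c
    proof (cases c)
      case (Pt r ys)
      have "q < k \<or> ?E c b = 0" "(s < k \<and> length xs = n \<and> distinct xs) \<or> ?E a c = 0"
        unfolding P Pt E_eq by auto
      then show ?thesis using False by auto
    qed
    ultimately show ?thesis by (simp only: kc_def intp_zero)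
  qed
qed

lemma object: "(As, e) \<in> objects RS"
proof -
  have "comp_mor CA e e = e"
    by (rule kr_eqI[OF comp_ahom[OF e_hom e_hom] e_hom]) (simp add: kr_comp[OF e_hom e_hom] E_idem)
  then show ?thesis using e_hom by (simp add: RS_objects)
qed

definition ta :: "pt \<Rightarrow> nat \<Rightarrow> nat" where
  "ta a = (case a of Pt s xs \<Rightarrow> tperm n \<sigma> xs)"

lemma tau: "tau t As e ta"
proof
  show "(As, e) \<in> objects RS" by (rule object)
  fix a b
  show "bij (ta a)" by (cases a) (simp add: ta_def bij_tperm[OF \<sigma>])
  show "ta (act \<pi> a) = \<pi> \<circ> ta a \<circ> inv_into UNIV \<pi>" if "bij \<pi>" for \<pi>
  proof
    fix x
    show "ta (act \<pi> a) x = (\<pi> \<circ> ta a \<circ> inv_into UNIV \<pi>) x"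
      using tperm_eqv[OF \<sigma> that, of _ "inv_into UNIV \<pi> x"] that
      by (cases a) (simp add: ta_def bij_is_surj surj_f_inv_f)
  qed
  show "ta a = ta b" if ne: "kr As As e a b \<noteq> 0"
  proof -
    obtain s xs r ys where P: "a = Pt s xs" "b = Pt r ys" by (cases a; cases b)
    have l: "length xs = n" using ne unfolding P E_eq by (auto split: if_splits)
    have "\<exists>g\<in>Z. ys = relabel n g xs"
    proof (rule ccontr)
      assume "\<not> (\<exists>g\<in>Z. ys = relabel n g xs)"
      then have "kr As As e a b = 0" unfolding P E_eq by (auto intro!: sum.neutral)
      then show False using ne by simp
    qed
    then show ?thesis using tperm_relabel[OF \<sigma> _ l] by (auto simp: ta_def P)
  qed
qed

lemma tl_rep: "tl_obj (replicate m l) [1] = replicate m (l + 1)"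
  by (induction m) auto

lemma tl_one: "tl_obj [1] Bs = map Suc Bs"
  by (induction Bs) auto

text \<open>On a distinct tuple the identity diagram keeps the extra coordinate \<open>u\<close>. If
  \<open>u\<close> is the \<open>i\<close>-th entry, the diagram with equal indices cancels this
  contribution and the one with indices \<open>i\<close> and \<open>\<sigma> i\<close> replaces
  \<open>u\<close> by the entry at \<open>\<sigma> i\<close>. The sum is therefore the translation
  by \<open>tperm n \<sigma> xs\<close>.\<close>

lemma hbr_X: "tau.hbr t As e ta X_obj = comp_mor RS (symmetric_braiding t (old_image n \<sigma> k \<rho>) X_obj) (old_d1 t n \<sigma> k \<rho>)"
proof -
  interpret T: tau t As e ta by (rule tau)
  let ?X = "tl_obj As [1]" and ?Y = "tl_obj [1] As" and ?i = "ident CA [1]"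
  let ?f = "of_diagram (id_diagram (n + 1)) + (\<Sum>i \<in> {1..n}. of_diagram (E_diagram n i (\<sigma> i)) - of_diagram (E_diagram n i i))"
  define D where "D = mat k k (\<lambda>(a, b). if a = b then ?f else 0)"
  have \<sigma>i: "\<sigma> i \<in> {1..n}" if "i \<in> {1..n}" for i by (rule permutes_in[OF \<sigma> that])
  have f: "?f \<in> phom (n + 1) (n + 1)"
    by (intro phom_add phom_sum phom_diff phom_single id_diagram E_diagram_diagram \<sigma>i)
  have D: "D \<in> ahom ?X ?X" unfolding tl_rep D_def ahom_def using f by (auto simp: phom_0)
  have S: "swap_mat As [1] \<in> ahom ?X ?Y"
    unfolding tl_rep tl_one unfolding ahom_def swap_mat_def
    using swap_diagram_diagram[of n 1] by (auto simp: Let_def phom_0 intro!: phom_single)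
  have iX: "ident RS X_obj = ?i" by (simp add: X_obj_Xp Xp_def)
  have ei: "tens_mor CA e ?i \<in> ahom ?X ?X" by (intro tens_ahom e_hom id_ahom)
  have d1: "old_d1 t n \<sigma> k \<rho> = comp_mor CA (tens_mor CA e ?i) D"
    unfolding old_d1_def iX D_def by simp
  let ?d = "comp_mor CA (tens_mor CA e ?i) D"
  have d: "?d \<in> ahom ?X ?X" by (rule comp_ahom[OF D ei])
  have "comp_mor RS (symmetric_braiding t (old_image n \<sigma> k \<rho>) X_obj) (old_d1 t n \<sigma> k \<rho>) =
    comp_mor CA (comp_mor CA (swap_mat As [1]) (tens_mor CA e ?i)) ?d"
    unfolding d1 by (simp add: symmetric_braiding_def old_image_def X_obj_Xp Xp_def)
  also have "\<dots> = comp_mor CA (swap_mat As [1]) (comp_mor CA (tens_mor CA e ?i) ?d)"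
    by (rule CA_assoc[OF d ei S, symmetric])
  \<comment> \<open>The idempotent \<open>e\<close> occurs in the symmetric braiding and again in
    \<open>old_d1\<close>; one occurrence is absorbed.\<close>
  also have "comp_mor CA (tens_mor CA e ?i) ?d = ?d"
    using CA_assoc[OF D ei ei] CA_interchange[OF e_hom e_hom id_ahom id_ahom] object CA_id_left[OF id_ahom]
    by (simp add: RS_objects)
  finally have rhs: "comp_mor RS (symmetric_braiding t (old_image n \<sigma> k \<rho>) X_obj) (old_d1 t n \<sigma> k \<rho>) =
    comp_mor CA (swap_mat As [1]) ?d" .
  have Dv: "kr ?X ?X D (Pt s (xs @ [u])) (Pt r (ys @ [w])) = of_bool (s = r \<and> xs = ys \<and> w = tperm n \<sigma> xs u)"
    if "s < k" "r < k" "length xs = n" "length ys = n" "distinct xs" for s r xs ys u w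
  proof -
    have "dk (n + 1) (n + 1) ?f (xs @ [u]) (ys @ [w]) = of_bool (xs @ [u] = ys @ [w]) +
      (\<Sum>i\<in>{1..n}. of_bool (xs = ys \<and> u = xs ! (i - 1) \<and> w = xs ! (\<sigma> i - 1)) - of_bool (xs = ys \<and> u = xs ! (i - 1) \<and> w = xs ! (i - 1)))"
    proof -
      have p: "pfun (n + 1) (n + 1) (E_diagram n i j) (xs @ [u]) (ys @ [w]) =
          of_bool (xs = ys \<and> u = xs ! (i - 1) \<and> w = xs ! (j - 1))" if "i \<in> {1..n}" "j \<in> {1..n}" for i j
        using pfun_E_diagram[OF that] \<open>length xs = n\<close> \<open>length ys = n\<close> by auto
      have "(\<Sum>i\<in>{1..n}. pfun (n + 1) (n + 1) (E_diagram n i (\<sigma> i)) (xs @ [u]) (ys @ [w]) - pfun (n + 1) (n + 1) (E_diagram n i i) (xs @ [u]) (ys @ [w])) =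
        (\<Sum>i\<in>{1..n}. of_bool (xs = ys \<and> u = xs ! (i - 1) \<and> w = xs ! (\<sigma> i - 1)) - of_bool (xs = ys \<and> u = xs ! (i - 1) \<and> w = xs ! (i - 1)))"
        by (rule sum.cong[OF refl]) (simp only: p \<sigma>i)
      then show ?thesis using that unfolding dk_add dk_sum dk_diff dk_single by (simp add: pfun_id)
    qed
    also have "\<dots> = of_bool (xs = ys \<and> w = tperm n \<sigma> xs u)"
    proof (cases "u \<in> set xs")
      case True
      then obtain l where l: "l \<in> {1..n}" "u = xs ! (l - 1)" using nth_ex[of u xs] \<open>length xs = n\<close> by metis
      have "(\<Sum>i\<in>{1..n}. of_bool (xs = ys \<and> u = xs ! (i - 1) \<and> w = xs ! (\<sigma> i - 1)) - of_bool (xs = ys \<and> u = xs ! (i - 1) \<and> w = xs ! (i - 1))) =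
        (\<Sum>i\<in>{1..n}. if i = l then of_bool (xs = ys \<and> w = xs ! (\<sigma> l - 1)) - of_bool (xs = ys \<and> w = xs ! (l - 1)) else 0 :: complex)"
        using nth_inj[OF that(5), of l] that l by (intro sum.cong refl) auto
      then show ?thesis using l tperm_nth[OF that(5,3) l(1), of \<sigma>] by auto
    next
      case False
      then have "u \<noteq> xs ! (i - 1)" if "i \<in> {1..n}" for i using nth_in_set[of i xs] that \<open>length xs = n\<close> by auto
      then show ?thesis using tperm_notin[OF False] by (auto intro!: sum.neutral)
    qed
    finally show ?thesis using that unfolding tl_rep by (simp add: D_def)
  qed
  show ?thesis unfolding rhs
  proof (rule kr_tens_eqI)
    show "T.hbr X_obj \<in> ahom ?X ?Y"
      using T.Tw(1)[OF id_ahom[of "[1]"]] Xp_object[of 1] by (simp add: T.hbr_def X_obj_Xp Xp_def)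
    show "comp_mor CA (swap_mat As [1]) ?d \<in> ahom ?X ?Y" by (rule comp_ahom[OF d S])
    fix a b c d' assume p: "a \<in> pts As" "b \<in> pts [1]" "c \<in> pts [1]" "d' \<in> pts As"
    obtain i j where ij: "c = Pt 0 [i]" "b = Pt 0 [j]" using p(2,3) by (auto simp: pts_def length_Suc_conv)
    obtain s xs where a: "a = Pt s xs" "s < k" "length xs = n" using p(1) by (auto simp: pts_def)
    obtain r ys where d': "d' = Pt r ys" "r < k" "length ys = n" using p(4) by (auto simp: pts_def)
    have Sv: "kr ?X ?Y (swap_mat As [1]) (pr 1 x (Pt 0 [l])) (pr (length As) b d') = of_bool (x = d' \<and> l = j)" if m: "x \<in> pts As" for x l
    proof -
      obtain q zs where x: "x = Pt q zs" "q < k" "length zs = n" using m by (auto simp: pts_def)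
      have "kr ?X ?Y (swap_mat As [1]) (pr 1 x (Pt 0 [l])) (pr (length As) b d') =
        (if q = r then pfun (n + 1) (1 + n) (swap_diagram n 1) (zs @ [l]) (j # ys) else 0)"
        using x d' unfolding ij tl_rep tl_one by (auto simp: swap_mat_def Let_def dk_single)
      then show ?thesis using pfun_swap[OF x(3) d'(3)] x d' by auto
    qed
    have dv: "kr ?X ?X ?d (pr 1 a c) (pr 1 x (Pt 0 [l])) = kr As As e a x * of_bool (ta a i = l)" if x: "x \<in> pts As" for x l
    proof -
      have l: "Pt 0 [l] \<in> pts [1]" by simp
      have "kr ?X ?X ?d (pr 1 a c) (pr (length [1::nat]) x (Pt 0 [l])) =
        intp As (\<lambda>y. intp [1] (\<lambda>w. kr ?X ?X D (pr 1 a c) (pr (length [1::nat]) y w) * kr As As e y x * idk [1] w (Pt 0 [l])))"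
        unfolding kr_comp_tens_post[OF e_hom id_ahom D x l] kr_id ..
      also have "\<dots> = intp As (\<lambda>y. kr ?X ?X D (pr 1 a c) (pr 1 y (Pt 0 [l])) * kr As As e y x)"
        unfolding intp_idk[OF l] by simp
      also have "\<dots> = intp As (\<lambda>y. if y = a then of_bool (ta a i = l) * kr As As e y x else 0)"
      proof (rule intp_cong)
        fix y assume "y \<in> pts As"
        then obtain q zs where y: "y = Pt q zs" "q < k" "length zs = n" by (auto simp: pts_def)
        show "kr ?X ?X D (pr 1 a c) (pr 1 y (Pt 0 [l])) * kr As As e y x = (if y = a then of_bool (ta a i = l) * kr As As e y x else 0)"
        \<comment> \<open>The idempotent comes after \<open>D\<close> and vanishes on tuples with a
          repetition, so only distinct \<open>zs\<close> matter. For these, \<open>D\<close>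
          vanishes unless \<open>xs = zs\<close>, which makes \<open>xs\<close> distinct as
          well.\<close>
        proof (cases "distinct zs")
          case True
          show ?thesis
          proof (cases "distinct xs")
            case True
            then show ?thesis using Dv[OF a(2) y(2) a(3) y(3), of i l] by (auto simp: a y ij ta_def simp del: kr.simps)
          next
            case False
            have "kr ?X ?X D (pr 1 a c) (pr 1 y (Pt 0 [l])) = 0"
            proof -
              have "xs \<noteq> zs" using False True by auto
              then have "pfun (n + 1) (n + 1) (E_diagram n u v) (xs @ [i]) (zs @ [l]) = 0"
                if "u \<in> {1..n}" "v \<in> {1..n}" for u v
                using pfun_E_diagram[OF that a(3) y(3)] by simp
              then have "dk (n + 1) (n + 1) ?f (xs @ [i]) (zs @ [l]) = 0"
                unfolding dk_add dk_sum dk_diff dk_single using a y \<open>xs \<noteq> zs\<close> \<sigma>i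
                by (simp add: pfun_id del: One_nat_def)
              then show ?thesis unfolding tl_rep using a y by (simp add: D_def ij)
            qed
            moreover have "y \<noteq> a" using False True by (auto simp: a y)
            ultimately show ?thesis by simp
          qed
        next
          case False
          then have "kr As As e y x = 0" by (cases x) (simp add: y E_eq del: kr.simps)
          then show ?thesis by (cases "y = a") simp_all
        qed
      qed
      also have "\<dots> = kr As As e a x * of_bool (ta a i = l)" using p(1) by (simp add: intp_delta)
      finally show ?thesis by simp
    qed
    have "kr ?X ?Y (comp_mor CA (swap_mat As [1]) ?d) (pr (length [1::nat]) a c) (pr (length As) b d') =
      intp ?X (\<lambda>z. kr ?X ?X ?d (pr 1 a c) z * kr ?X ?Y (swap_mat As [1]) z (pr (length As) b d'))"
      unfolding kr_comp[OF d S] kc_def by simp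
    also have "\<dots> = intp As (\<lambda>x. intp [1] (\<lambda>w. kr ?X ?X ?d (pr 1 a c) (pr (length [1::nat]) x w) * kr ?X ?Y (swap_mat As [1]) (pr (length [1::nat]) x w) (pr (length As) b d')))"
      by (intro intp_tl_obj fs_mult fs_kr[OF d] fs_kr[OF S] fs_intros)
    also have "\<dots> = intp As (\<lambda>x. intp [1] (\<lambda>w. if w = Pt 0 [j] then (if x = d' then kr As As e a d' * of_bool (ta a i = j) else 0) else 0))"
    proof (intro intp_cong)
      fix x w assume xw: "x \<in> pts As" "w \<in> pts [1]"
      then obtain l where l: "w = Pt 0 [l]" by (auto simp: pts_def length_Suc_conv)
      show "kr ?X ?X ?d (pr 1 a c) (pr (length [1::nat]) x w) * kr ?X ?Y (swap_mat As [1]) (pr (length [1::nat]) x w) (pr (length As) b d') =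
        (if w = Pt 0 [j] then (if x = d' then kr As As e a d' * of_bool (ta a i = j) else 0) else 0)"
        using dv[OF xw(1), of l] Sv[OF xw(1), of l] by (simp add: l)
    qed
    also have "\<dots> = kr As As e a d' * of_bool (ta a i = j)"
      using p by (simp add: intp_delta[where f = "\<lambda>_. if _ then _ else _"] intp_delta[where f = "\<lambda>_. kr As As e a d' * _"])
    also have "\<dots> = kr ?X ?Y (T.hbr X_obj) (pr (length [1::nat]) a c) (pr (length As) b d')"
      using T.kr_hbr_X[OF p(1,4), of i j] by (simp add: ij)
    finally show "kr ?X ?Y (T.hbr X_obj) (pr (length [1::nat]) a c) (pr (length As) b d') =
      kr ?X ?Y (comp_mor CA (swap_mat As [1]) ?d) (pr (length [1::nat]) a c) (pr (length As) b d')" by simp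
  qed
qed

text \<open>The definite description in \<open>old_half_braiding\<close> is resolved by
  \<open>hb_unique\<close>: the graded half-braiding has the prescribed value at X, and that value
  determines it.\<close>

lemma W_old_eq: "W_old t n \<sigma> k \<rho> = ((As, e), tau.hbr t As e ta)"
proof -
  interpret T: tau t As e ta by (rule tau)
  have "old_half_braiding t n \<sigma> k \<rho> = T.hbr"
    unfolding old_half_braiding_def
  proof (rule the_equality)
    show "half_braiding RS (old_image n \<sigma> k \<rho>) T.hbr \<and> T.hbr X_obj = comp_mor RS (symmetric_braiding t (old_image n \<sigma> k \<rho>) X_obj) (old_d1 t n \<sigma> k \<rho>)"
      using T.half_braiding hbr_X by (simp add: old_image_def)
    fix c assume c: "half_braiding RS (old_image n \<sigma> k \<rho>) c \<and> c X_obj = comp_mor RS (symmetric_braiding t (old_image n \<sigma> k \<rho>) X_obj) (old_d1 t n \<sigma> k \<rho>)"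
    then have "center_object t As e c" using object by (simp add: center_object_def old_image_def)
    then show "c = T.hbr" using hb_unique[OF _ T.center_object] c hbr_X by simp
  qed
  then show ?thesis by (simp add: W_old_def old_image_def)
qed

end

section \<open>Every central object moves boundedly many points\<close>

text \<open>Gaussian elimination for a homogeneous system with more unknowns than equations.\<close>

lemma linear_dependence:
  fixes f :: "'a \<Rightarrow> 'b \<Rightarrow> complex"
  assumes "finite T" "finite J" "card T < card J"
  shows "\<exists>u. (\<exists>j\<in>J. u j \<noteq> 0) \<and> (\<forall>x\<in>T. (\<Sum>j\<in>J. u j * f j x) = 0)"
  using assms
proof (induction T arbitrary: J f rule: finite_induct)
  case empty
  then obtain j where "j \<in> J" by fastforce
  then show ?case by (intro exI[of _ "\<lambda>_. 1"]) auto
next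
  case (insert x T)
  have card: "card T < card J" using insert.hyps insert.prems by simp
  show ?case
  proof (cases "\<forall>j\<in>J. f j x = 0")
    case True
    obtain u where u: "\<exists>j\<in>J. u j \<noteq> 0" "\<forall>x\<in>T. (\<Sum>j\<in>J. u j * f j x) = 0"
      using insert.IH[OF insert.prems(1) card, of f] by blast
    have "(\<Sum>j\<in>J. u j * f j x) = 0" using True by (intro sum.neutral) simp
    then show ?thesis using u by (intro exI[of _ u]) simp
  next
    case False
    then obtain p where p: "p \<in> J" "f p x \<noteq> 0" by blast
    \<comment> \<open>The equation at \<open>x\<close> is solved for the unknown with index
      \<open>p\<close> and substituted into the others. The coefficient \<open>- ?s\<close> below is
      the resulting value of that unknown.\<close>
    let ?g = "\<lambda>j y. f j y - f j x / f p x * f p y"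
    have "card T < card (J - {p})" using insert.hyps insert.prems p by simp
    then obtain u where u: "\<exists>j\<in>J - {p}. u j \<noteq> 0" "\<forall>y\<in>T. (\<Sum>j\<in>J - {p}. u j * ?g j y) = 0"
      using insert.IH[of "J - {p}" ?g] insert.prems(1) by auto
    let ?s = "\<Sum>j\<in>J - {p}. u j * (f j x / f p x)"
    let ?l = "\<lambda>j. if j = p then - ?s else u j"
    have "(\<Sum>j\<in>J. ?l j * f j y) = (\<Sum>j\<in>J - {p}. u j * ?g j y)" for y
    proof -
      have "(\<Sum>j\<in>J. ?l j * f j y) = - ?s * f p y + (\<Sum>j\<in>J - {p}. ?l j * f j y)"
        using sum.remove[OF insert.prems(1) p(1), of "\<lambda>j. ?l j * f j y"] by simp
      also have "(\<Sum>j\<in>J - {p}. ?l j * f j y) = (\<Sum>j\<in>J - {p}. u j * f j y)" by (rule sum.cong) auto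
      finally show ?thesis
        by (simp add: right_diff_distrib sum_subtractf sum_distrib_right mult.assoc)
    qed
    moreover have "?g j x = 0" for j using p by simp
    ultimately have 0: "\<forall>y\<in>insert x T. (\<Sum>j\<in>J. ?l j * f j y) = 0" using u(2) by simp
    have "\<exists>j\<in>J. ?l j \<noteq> 0" using u(1) by auto
    then show ?thesis using 0 by (rule_tac x = ?l in exI) (rule conjI)
  qed
qed

text \<open>Greedy choice. After \<open>(i, j)\<close> is chosen, the pairs with first entry
  \<open>i\<close> or \<open>j\<close> or second entry \<open>i\<close> have to go. By injectivity
  each condition excludes at most one pair, hence the factor 3.\<close>

lemma disjoint_pairs:
  assumes "finite \<phi>" "inj_on fst \<phi>" "inj_on snd \<phi>" "\<forall>(i, j)\<in>\<phi>. i \<noteq> j" "3 * r \<le> card (\<phi> :: (nat \<times> nat) set)"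
  shows "\<exists>\<psi>\<subseteq>\<phi>. card \<psi> = r \<and> fst ` \<psi> \<inter> snd ` \<psi> = {}"
  using assms
proof (induction r arbitrary: \<phi>)
  case 0
  then show ?case by (intro exI[of _ "{}"]) auto
next
  case (Suc r)
  have "\<phi> \<noteq> {}" using Suc.prems(5) by auto
  then obtain i j where p: "(i, j) \<in> \<phi>" by auto
  define \<chi> where "\<chi> = {q \<in> \<phi>. fst q = i \<or> fst q = j} \<union> {q \<in> \<phi>. snd q = i}"
  define \<phi>' where "\<phi>' = \<phi> - \<chi>"
  have one: "card {q \<in> \<phi>. h q = x} \<le> 1" if "inj_on h \<phi>" for h :: "nat \<times> nat \<Rightarrow> nat" and x
    using that Suc.prems(1) by (intro card_le_Suc0_iff_eq[THEN iffD2, folded One_nat_def]) (auto dest: inj_onD)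
  have \<chi>: "\<chi> = {q \<in> \<phi>. fst q = i} \<union> {q \<in> \<phi>. fst q = j} \<union> {q \<in> \<phi>. snd q = i}" unfolding \<chi>_def by auto
  have "card \<chi> \<le> card {q \<in> \<phi>. fst q = i} + card {q \<in> \<phi>. fst q = j} + card {q \<in> \<phi>. snd q = i}"
    unfolding \<chi>
    using card_Un_le[of "{q \<in> \<phi>. fst q = i} \<union> {q \<in> \<phi>. fst q = j}" "{q \<in> \<phi>. snd q = i}"]
      card_Un_le[of "{q \<in> \<phi>. fst q = i}" "{q \<in> \<phi>. fst q = j}"] by linarith
  then have "card \<chi> \<le> 3" using one[OF Suc.prems(2), of i] one[OF Suc.prems(2), of j] one[OF Suc.prems(3), of i] by linarith
  moreover have "card \<phi>' = card \<phi> - card \<chi>"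
    unfolding \<phi>'_def by (rule card_Diff_subset) (use Suc.prems(1) in \<open>auto simp: \<chi>_def\<close>)
  ultimately have "3 * r \<le> card \<phi>'" using Suc.prems(5) by simp
  moreover have "finite \<phi>'" "inj_on fst \<phi>'" "inj_on snd \<phi>'" "\<forall>(i, j)\<in>\<phi>'. i \<noteq> j"
    using Suc.prems by (auto simp: \<phi>'_def intro: inj_on_subset)
  ultimately obtain \<psi> where \<psi>: "\<psi> \<subseteq> \<phi>'" "card \<psi> = r" "fst ` \<psi> \<inter> snd ` \<psi> = {}" using Suc.IH by blast
  have n: "fst q \<noteq> i" "fst q \<noteq> j" "snd q \<noteq> i" if "q \<in> \<psi>" for q
    using that \<psi>(1) by (auto simp: \<phi>'_def \<chi>_def)
  have "(i, j) \<notin> \<psi>" using n by fastforce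
  moreover have "finite \<psi>" using \<psi>(1) \<open>finite \<phi>'\<close> finite_subset by blast
  ultimately have "card (insert (i, j) \<psi>) = Suc r" using \<psi>(2) by simp
  moreover have "fst ` insert (i, j) \<psi> \<inter> snd ` insert (i, j) \<psi> = {}"
    using \<psi>(3) n p Suc.prems(4) by (auto; metis fst_conv snd_conv)
  moreover have "insert (i, j) \<psi> \<subseteq> \<phi>" using p \<psi>(1) by (auto simp: \<phi>'_def)
  ultimately show ?case by blast
qed

context center_object
begin

text \<open>\<open>Q ps\<close> projects to the part of the object whose grading sends \<open>i\<close> to \<open>j\<close> for all pairs \<open>(i, j)\<close> in \<open>ps\<close>.\<close>

definition Q :: "(nat \<times> nat) list \<Rightarrow> pt \<Rightarrow> pt \<Rightarrow> complex" where
  "Q ps = B (map fst ps) (map snd ps)"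

lemma kcA: "fs2 K \<Longrightarrow> fs2 L \<Longrightarrow> fs2 M \<Longrightarrow> kc As (kc As K L) M = kc As K (kc As L M)"
  by (intro ext kc_assoc)

lemma Q_Nil: "Q [] = E"
  by (simp add: Q_def B_Nil)

lemma Q_Cons: "Q (p # ps) = kc As (pp (fst p) (snd p)) (Q ps)"
  using B_Cons[of "map snd ps" "map fst ps" "fst p" "snd p"] by (simp add: Q_def)

lemma Q_append: "Q (ps @ qs) = kc As (Q ps) (Q qs)"
  by (simp add: Q_def B_append)

lemma fs2_Q: "fs2 (Q ps)"
  unfolding Q_def by (rule fs2_B)

lemma Q_supp: "Q ps a b \<noteq> 0 \<Longrightarrow> a \<in> pts As \<and> b \<in> pts As"
  unfolding Q_def by (rule B_supp)

lemma Q_act: "bij \<pi> \<Longrightarrow> Q (map (map_prod \<pi> \<pi>) ps) (act \<pi> a) (act \<pi> b) = Q ps a b"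
  using B_act[of \<pi> "map fst ps" "map snd ps" a b] by (simp add: Q_def act_list_nat comp_def)

lemma E_Q: "kc As E (Q ps) = Q ps" "kc As (Q ps) E = Q ps"
  unfolding Q_def by (rule E_absorb)+

lemma kc_zero: "kc As K (\<lambda>a b. 0) = (\<lambda>a b. 0)" "kc As (\<lambda>a b. 0) K = (\<lambda>a b. 0)"
  by (simp_all add: kc_def fun_eq_iff)

lemma pp_Q_commute: "kc As (pp i j) (Q ps) = kc As (Q ps) (pp i j)"
proof (induction ps)
  case Nil
  then show ?case by (simp add: Q_Nil E_absorb)
next
  case (Cons p ps)
  let ?p = "pp (fst p) (snd p)"
  have "kc As (pp i j) (Q (p # ps)) = kc As (kc As (pp i j) ?p) (Q ps)"
    unfolding Q_Cons by (rule kcA[OF fs2_B fs2_B fs2_Q, symmetric])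
  also have "\<dots> = kc As ?p (kc As (pp i j) (Q ps))"
    unfolding pp_commute[of i j] by (rule kcA[OF fs2_B fs2_B fs2_Q])
  also have "\<dots> = kc As (Q (p # ps)) (pp i j)"
    unfolding Cons Q_Cons by (rule kcA[OF fs2_B fs2_Q fs2_B, symmetric])
  finally show ?case .
qed

lemma pp_Q_absorb: "p \<in> set ps \<Longrightarrow> kc As (pp (fst p) (snd p)) (Q ps) = Q ps"
proof (induction ps)
  case (Cons q ps)
  let ?p = "pp (fst p) (snd p)" and ?q = "pp (fst q) (snd q)"
  have *: "kc As ?p (Q (q # ps)) = kc As (kc As ?p ?q) (Q ps)"
    unfolding Q_Cons by (rule kcA[OF fs2_B fs2_B fs2_Q, symmetric])
  show ?case
  proof (cases "p = q")
    case True
    then show ?thesis unfolding * by (simp add: pp_target Q_Cons)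
  next
    case False
    have "kc As (kc As ?p ?q) (Q ps) = kc As ?q (kc As ?p (Q ps))"
      unfolding pp_commute[of "fst p" "snd p"] by (rule kcA[OF fs2_B fs2_B fs2_Q])
    then show ?thesis unfolding * using Cons False by (simp add: Q_Cons)
  qed
qed simp

lemma Q_subset: "set qs \<subseteq> set ps \<Longrightarrow> kc As (Q qs) (Q ps) = Q ps"
proof (induction qs)
  case Nil
  then show ?case by (simp add: Q_Nil E_Q)
next
  case (Cons q qs)
  have "kc As (Q (q # qs)) (Q ps) = kc As (pp (fst q) (snd q)) (kc As (Q qs) (Q ps))"
    unfolding Q_Cons by (rule kcA[OF fs2_B fs2_Q fs2_Q])
  then show ?case using Cons pp_Q_absorb[of q ps] by simp
qed

lemma Q_commute: "kc As (Q ps) (Q qs) = kc As (Q qs) (Q ps)"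
proof (induction ps)
  case Nil
  then show ?case by (simp add: Q_Nil E_Q)
next
  case (Cons p ps)
  let ?p = "pp (fst p) (snd p)"
  have "kc As (Q (p # ps)) (Q qs) = kc As ?p (kc As (Q qs) (Q ps))"
    unfolding Q_Cons Cons[symmetric] by (rule kcA[OF fs2_B fs2_Q fs2_Q])
  also have "\<dots> = kc As (kc As (Q qs) ?p) (Q ps)"
    unfolding pp_Q_commute[symmetric] by (rule kcA[OF fs2_B fs2_Q fs2_Q, symmetric])
  also have "\<dots> = kc As (Q qs) (Q (p # ps))"
    unfolding Q_Cons by (rule kcA[OF fs2_Q fs2_B fs2_Q])
  finally show ?case .
qed

lemma Q_set_cong: "set ps = set qs \<Longrightarrow> Q ps = Q qs"
  using Q_subset[of ps qs] Q_subset[of qs ps] Q_commute[of ps qs] by simp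

lemma Q_0_mono: "Q qs = (\<lambda>a b. 0) \<Longrightarrow> set qs \<subseteq> set ps \<Longrightarrow> Q ps = (\<lambda>a b. 0)"
  using Q_subset[of qs ps] by (simp add: kc_zero)

text \<open>A degree is a well-defined and injective map, by \<open>pp_source\<close> and
  \<open>pp_target\<close>.\<close>

lemma Q_conflict:
  assumes "(i, j) \<in> set ps" "(i', j') \<in> set ps" "(i = i') \<noteq> (j = j')"
  shows "Q ps = (\<lambda>a b. 0)"
proof (rule Q_0_mono)
  have "kc As (pp i j) (pp i' j') = (\<lambda>a b. 0)"
    using assms(3) pp_target[of i j i'] pp_source[of i j j'] by (cases "i = i'") auto
  then show "Q [(i, j), (i', j')] = (\<lambda>a b. 0)" by (simp add: Q_Cons Q_Nil E_absorb)
  show "set [(i, j), (i', j')] \<subseteq> set ps" using assms by simp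
qed

text \<open>The idempotents \<open>pp i j\<close> integrate to the identity over \<open>j\<close>.
  If every \<open>j\<close> different from \<open>i\<close> contributes zero after multiplication
  with \<open>Q ps\<close>, the integral reduces to the point \<open>j = i\<close>.\<close>

lemma Q_pull:
  assumes "\<And>j. j \<noteq> i \<Longrightarrow> Q ((i, j) # ps) = (\<lambda>a b. 0)"
  shows "Q ((i, i) # ps) = Q ps"
proof (intro ext)
  fix a b
  have Qc: "kc As (Q ps) (pp i j) = Q ((i, j) # ps)" for j by (simp add: Q_Cons pp_Q_commute)
  have "int1 (\<lambda>j. Q ps a x * pp i j x b) = Q ps a x * E x b" for x
    unfolding pp_sum_target[of i x b, symmetric]
    by (rule int1_cmult[OF fs_B[OF eqm_const eqm_Cons[OF eqm_id eqm_const] eqm_const eqm_const]])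
  then have "Q ps a b = intp As (\<lambda>x. int1 (\<lambda>j. Q ps a x * pp i j x b))"
    using fun_cong[OF fun_cong[OF E_Q(2)[of ps], of a], of b] by (simp only: kc_def)
  also have "\<dots> = int1 (\<lambda>j. intp As (\<lambda>x. Q ps a x * pp i j x b))"
  proof -
    have "fs2 (\<lambda>x ys. Q ps a x * B [i] ys x b)"
      by (intro fs_mult fs2D[OF fs2_Q] fs_B eqm_const eqm_fst eqm_snd eqm_id)
    from intp_intl_swap[OF this, of As 1] show ?thesis by simp
  qed
  also have "\<dots> = int1 (\<lambda>j. if j = i then Q ((i, i) # ps) a b else 0)"
    using Qc assms by (intro arg_cong[where f = int1] ext) (auto simp: kc_def fun_eq_iff)
  also have "\<dots> = Q ((i, i) # ps) a b" by (rule int1_delta)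
  finally show "Q ((i, i) # ps) a b = Q ps a b" ..
qed

text \<open>No vector is moved by its grading at \<open>r\<close> or more points.\<close>

definition moves_less :: "nat \<Rightarrow> bool" where
  "moves_less r \<longleftrightarrow> (\<forall>ps. length ps = r \<and> distinct (map fst ps) \<and> (\<forall>(i, j)\<in>set ps. i \<noteq> j) \<longrightarrow> Q ps = (\<lambda>a b. 0))"

lemma moves_lessD:
  "moves_less r \<Longrightarrow> length ps = r \<Longrightarrow> distinct (map fst ps) \<Longrightarrow> (\<And>i j. (i, j) \<in> set ps \<Longrightarrow> i \<noteq> j) \<Longrightarrow> Q ps = (\<lambda>a b. 0)"
  unfolding moves_less_def by blast

text \<open>For fixed \<open>I\<close> the nonzero kernels \<open>B I J\<close> would be orthogonal idempotents, hence linearly independent.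
  For \<open>J\<close> with entries below \<open>R\<close> there are about \<open>R ^ length J\<close> of them, but they live in a space whose dimension
  grows only like \<open>R ^ (2 * m)\<close>, where \<open>m\<close> bounds the length of the points.\<close>

lemma disjoint_zero:
  assumes m: "\<forall>k\<in>set As. k \<le> m" and r: "r = 2 * m + 1"
    and IJ: "length I = r" "length J = r" "distinct (I @ J)"
  shows "B I J = (\<lambda>a b. 0)"
proof (rule ccontr)
  assume nz: "B I J \<noteq> (\<lambda>a b. 0)"
  \<comment> \<open>All sequences of \<open>2 * r\<close> distinct numbers lie in one orbit, so
    invariance spreads nonvanishing from \<open>I @ J\<close> to each of them.\<close>
  have all_nz: "B I' J' \<noteq> (\<lambda>a b. 0)" if IJ': "length I' = r" "length J' = r" "distinct (I' @ J')" for I' J'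
  proof
    assume 0: "B I' J' = (\<lambda>a b. 0)"
    define f where "f x = (I @ J) ! (THE k. k < 2 * r \<and> (I' @ J') ! k = x)" for x
    have f: "f ((I' @ J') ! k) = (I @ J) ! k" if "k < 2 * r" for k
    proof -
      have "(THE l. l < 2 * r \<and> (I' @ J') ! l = (I' @ J') ! k) = k"
        by (rule the_equality) (use that IJ' nth_eq_iff_index_eq[OF IJ'(3)] in auto)
      then show ?thesis by (simp only: f_def)
    qed
    have "inj_on f (set (I' @ J'))"
    proof (rule inj_onI)
      fix x y assume "x \<in> set (I' @ J')" "y \<in> set (I' @ J')" and eq: "f x = f y"
      then obtain k l where kl: "k < 2 * r" "x = (I' @ J') ! k" "l < 2 * r" "y = (I' @ J') ! l"
        using IJ' unfolding in_set_conv_nth by (metis length_append mult_2)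
      then have "k = l" using eq f[of k] f[of l] nth_eq_iff_index_eq[OF IJ(3), of k l] IJ by auto
      then show "x = y" using kl by simp
    qed
    then obtain \<pi> :: "nat \<Rightarrow> nat" where \<pi>: "bij \<pi>" "\<And>x. x \<in> set (I' @ J') \<Longrightarrow> \<pi> x = f x"
      using extend_to_bij[OF finite_set, of f "I' @ J'"] by blast
    have "map \<pi> (I' @ J') = I @ J"
    proof (rule nth_equalityI)
      fix k assume "k < length (map \<pi> (I' @ J'))"
      then have k: "k < 2 * r" "k < length (I' @ J')" using IJ' by auto
      show "map \<pi> (I' @ J') ! k = (I @ J) ! k" using \<pi>(2)[OF nth_mem[OF k(2)]] f[OF k(1)] nth_map[OF k(2), of \<pi>] by simp
    qed (use IJ IJ' in simp)
    then have "map \<pi> I' = I" "map \<pi> J' = J" using IJ IJ' by auto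
    then have "B I J a b = 0" for a b
      using B_act[OF \<pi>(1), of I' J' "act (inv_into UNIV \<pi>) a" "act (inv_into UNIV \<pi>) b"] 0
        by (simp add: act_act_inv[OF \<pi>(1)] act_list_nat del: act_list_def)
    then show False using nz by (simp add: fun_eq_iff)
  qed
  define D where "D = length As"
  \<comment> \<open>Each entry of \<open>J\<close> will range over \<open>x\<close> values, which
    gives \<open>x ^ r\<close> tuples with \<open>r = 2 * m + 1\<close>. The choice ensures
    \<open>R + 2 * m \<le> (r + 1) * x\<close> and \<open>D * D * (r + 1) ^ (2 * m) < x\<close>, so
    that these tuples outnumber the pairs of points in \<open>T0\<close>.\<close>
  define x where "x = (D * D) * (r + 1) ^ (2 * m) + 2 * m + r + 1"
  define R where "R = r + r * x"
  define I0 where "I0 = [0..<r]"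
  define L where "L = {xs. set xs \<subseteq> {..<x} \<and> length xs = r}"
  \<comment> \<open>The \<open>s\<close>-th entry is taken from an interval of length
    \<open>x\<close> of its own, above \<open>r\<close>. Hence the entries are distinct and avoid
    \<open>I0\<close>, and \<open>xs\<close> can be recovered by division with remainder.\<close>
  define Jf where "Jf xs = map (\<lambda>s. r + s * x + xs ! s) [0..<r]" for xs :: "nat list"
  have x0: "x > 0" unfolding x_def by simp
  have nx: "xs ! s < x" if "xs \<in> L" "s < r" for xs s
  proof -
    have "xs ! s \<in> set xs" using that by (simp add: L_def)
    then show ?thesis using that(1) unfolding L_def by blast
  qed
  have JfR: "set (Jf xs) \<subseteq> {r..<R}" if "xs \<in> L" for xs
  proof
    fix y assume "y \<in> set (Jf xs)"
    then obtain s where s: "s < r" "y = r + s * x + xs ! s" by (auto simp: Jf_def)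
    have "xs ! s < x" by (rule nx[OF that s(1)])
    moreover have "s * x + x \<le> r * x" using s(1) mult_le_mono1[of "Suc s" r x] by simp
    ultimately show "y \<in> {r..<R}" using s by (simp add: R_def)
  qed
  have Jnth: "(Jf xs ! s - r) div x = s" "(Jf xs ! s - r) mod x = xs ! s" if "xs \<in> L" "s < r" for xs s
  proof -
    have "xs ! s < x" by (rule nx[OF that])
    then show "(Jf xs ! s - r) div x = s" "(Jf xs ! s - r) mod x = xs ! s" using that x0 by (simp_all add: Jf_def)
  qed
  have Jd: "distinct (I0 @ Jf xs)" "length (Jf xs) = r" if "xs \<in> L" for xs
  proof -
    show l: "length (Jf xs) = r" by (simp add: Jf_def)
    have "distinct (Jf xs)" unfolding distinct_conv_nth l
      using Jnth(1)[OF that] by metis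
    then show "distinct (I0 @ Jf xs)" using JfR[OF that] by (auto simp: I0_def)
  qed
  have Jinj: "xs = ys" if "xs \<in> L" "ys \<in> L" "Jf xs = Jf ys" for xs ys
  proof (rule nth_equalityI)
    show "length xs = length ys" using that by (simp add: L_def)
    fix s assume "s < length xs"
    then have "s < r" using that by (simp add: L_def)
    then show "xs ! s = ys ! s" using Jnth(2)[of xs s] Jnth(2)[of ys s] that by simp
  qed
  have finL: "finite L" and cardL: "card L = x ^ r" unfolding L_def using finite_lists_length_eq[of "{..<x}"] card_lists_length_eq[of "{..<x}"] by auto
  \<comment> \<open>The points with coordinates below \<open>R + 2 * m\<close>. Tuples are padded to
    length \<open>m\<close> to make them easy to count; the \<open>2 * m\<close> extra values leave
    room for the coordinates of two points.\<close>
  define T0 where "T0 = (\<lambda>(s, zs). Pt s (take (As ! s) zs)) ` ({..<D} \<times> {zs. set zs \<subseteq> {..<R + 2 * m} \<and> length zs = m})"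
  have cardZ: "card {zs. set zs \<subseteq> {..<R + 2 * m} \<and> length zs = m} = (R + 2 * m) ^ m" and
    finZ: "finite {zs. set zs \<subseteq> {..<R + 2 * m} \<and> length zs = m}"
    using finite_lists_length_eq[of "{..<R + 2 * m}"] card_lists_length_eq[of "{..<R + 2 * m}"] by auto
  have finT0: "finite T0" unfolding T0_def using finZ by simp
  have "card T0 \<le> D * (R + 2 * m) ^ m"
    unfolding T0_def using card_image_le[of "{..<D} \<times> {zs. set zs \<subseteq> {..<R + 2 * m} \<and> length zs = m}"] finZ
    by (simp add: card_cartesian_product cardZ)
  then have "card (T0 \<times> T0) \<le> (D * (R + 2 * m) ^ m) * (D * (R + 2 * m) ^ m)"
    unfolding card_cartesian_product by (rule mult_le_mono) fact
  also have "\<dots> = D * D * (R + 2 * m) ^ (2 * m)" by (simp add: mult_2 power_add)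
  also have "\<dots> \<le> D * D * ((r + 1) * x) ^ (2 * m)"
    by (intro mult_le_mono2 power_mono) (auto simp: R_def x_def)
  also have "\<dots> = (D * D * (r + 1) ^ (2 * m)) * x ^ (2 * m)"
    unfolding power_mult_distrib by (simp only: mult.assoc)
  also have "\<dots> < x * x ^ (2 * m)" using x0 by (intro mult_strict_right_mono) (auto simp: x_def)
  also have "\<dots> = card L" unfolding cardL r by simp
  finally have less: "card (T0 \<times> T0) < card L" .
  obtain u where u: "\<exists>xs\<in>L. u xs \<noteq> 0" "\<forall>p\<in>T0 \<times> T0. (\<Sum>xs\<in>L. u xs * B I0 (Jf xs) (fst p) (snd p)) = 0"
    using linear_dependence[OF finite_cartesian_product[OF finT0 finT0] finL less, of "\<lambda>xs p. B I0 (Jf xs) (fst p) (snd p)"] by blast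
  have inT0: "a \<in> T0" if "a \<in> pts As" "atoms a \<subseteq> {..<R + 2 * m}" for a
  proof (cases a)
    case (Pt s zs)
    then have s: "s < D" "length zs = As ! s" "As ! s \<le> m" using that m by (auto simp: D_def)
    show ?thesis
    proof (cases "m = 0")
      case True
      then show ?thesis using Pt s unfolding T0_def by force
    next
      case False
      let ?z = "zs @ replicate (m - As ! s) 0"
      have "set ?z \<subseteq> {..<R + 2 * m} \<and> length ?z = m" using that(2) Pt s False by auto
      then show ?thesis unfolding T0_def using s Pt by (intro image_eqI[of _ _ "(s, ?z)"]) auto
    qed
  qed
  have sum0: "(\<Sum>xs\<in>L. u xs * B I0 (Jf xs) a b) = 0" for a b
  proof (cases "a \<in> pts As \<and> b \<in> pts As")
    case False
    then have "B I0 (Jf xs) a b = 0" for xs using B_supp by blast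
    then show ?thesis by simp
  next
    case True
    \<comment> \<open>A pair of points has at most \<open>2 * m\<close> coordinates that are
      \<open>R\<close> or more. A permutation fixing all numbers below \<open>R\<close>, and with
      them all entries of \<open>I0\<close> and \<open>Jf xs\<close>, moves these into the next
      \<open>2 * m\<close> numbers. So a linear relation on the finite set
      \<open>T0 \<times> T0\<close> holds everywhere.\<close>
    define U where "U = (atoms a \<union> atoms b) - {..<R}"
    have at: "finite (atoms c) \<and> card (atoms c) \<le> m" if "c \<in> pts As" for c
    proof (cases c)
      case (Pt s zs)
      then have "length zs \<le> m" using that m by auto
      then show ?thesis using Pt card_length[of zs] by simp
    qed
    then have fU: "finite U" using True by (simp add: U_def)
    have "card U \<le> card (atoms a \<union> atoms b)" unfolding U_def by (rule card_mono) (use at True in auto)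
    also have "\<dots> \<le> card {R..<R + 2 * m}" using at[of a] at[of b] True card_Un_le[of "atoms a" "atoms b"] by simp
    finally obtain f where f: "f ` U \<subseteq> {R..<R + 2 * m}" "inj_on f U"
      using card_le_inj[OF fU, of "{R..<R + 2 * m}"] by blast
    let ?f = "\<lambda>y. if y < R then y else f y"
    have "inj_on ?f ({..<R} \<union> U)"
      using f by (intro inj_onI) (force simp: U_def inj_on_def split: if_splits)
    then obtain \<pi> :: "nat \<Rightarrow> nat" where \<pi>: "bij \<pi>" "\<And>y. y \<in> {..<R} \<union> U \<Longrightarrow> \<pi> y = ?f y"
      using extend_to_bij[of "{..<R} \<union> U" ?f] fU by blast
    have fixed: "\<pi> y = y" if "y < R" for y using \<pi>(2)[of y] that by simp
    have bound: "\<pi> y < R + 2 * m" if "y \<in> atoms a \<union> atoms b" for y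
    proof (cases "y < R")
      case False
      then have "y \<in> U" "\<pi> y = f y" using that \<pi>(2)[of y] by (auto simp: U_def)
      then show ?thesis using f(1) by auto
    qed (simp add: fixed)
    have atm: "atoms (act \<pi> c) = \<pi> ` atoms c" for c :: pt by (cases c) simp
    have "act \<pi> a \<in> T0" "act \<pi> b \<in> T0" by (rule inT0; use bound True in \<open>auto simp: atm\<close>)+
    then have in_T: "(act \<pi> a, act \<pi> b) \<in> T0 \<times> T0" by blast
    have "B I0 (Jf xs) (act \<pi> a) (act \<pi> b) = B I0 (Jf xs) a b" if "xs \<in> L" for xs
    proof -
      have "map \<pi> I0 = I0" "map \<pi> (Jf xs) = Jf xs"
        using fixed JfR[OF that] by (auto intro!: map_idI simp: I0_def R_def subset_iff)
      then show ?thesis using B_act[OF \<pi>(1), of I0 "Jf xs" a b] by (simp add: act_list_nat del: act_list_def)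
    qed
    then have "(\<Sum>xs\<in>L. u xs * B I0 (Jf xs) (act \<pi> a) (act \<pi> b)) = (\<Sum>xs\<in>L. u xs * B I0 (Jf xs) a b)"
      by (intro sum.cong) auto
    then show ?thesis using u(2) in_T by fastforce
  qed
  obtain ys where ys: "ys \<in> L" "u ys \<noteq> 0" using u(1) by blast
  have BQ: "B I0 (Jf xs) = Q (zip I0 (Jf xs))" if "xs \<in> L" for xs using Jd(2)[OF that] by (simp add: Q_def I0_def)
  \<comment> \<open>Different tuples \<open>J\<close> send the same point \<open>s\<close> of
    \<open>I0\<close> to different points, which is a conflict.\<close>
  have orth: "kc As (B I0 (Jf ys)) (B I0 (Jf xs)) = (if xs = ys then B I0 (Jf ys) else (\<lambda>a b. 0))" if xs: "xs \<in> L" for xs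
  proof (cases "xs = ys")
    case True
    then show ?thesis using Q_subset[of "zip I0 (Jf ys)" "zip I0 (Jf ys)"] ys by (simp add: BQ)
  next
    case False
    then obtain s where s: "s < r" "Jf xs ! s \<noteq> Jf ys ! s"
      using Jinj[OF xs ys(1)] Jd(2)[OF xs] Jd(2)[OF ys(1)] nth_equalityI[of "Jf xs" "Jf ys"] by metis
    have "(s, Jf zs ! s) \<in> set (zip I0 (Jf zs))" if "zs \<in> L" for zs
      using s Jd(2)[OF that] by (auto simp: set_zip I0_def intro!: exI[of _ s])
    then have "Q (zip I0 (Jf ys) @ zip I0 (Jf xs)) = (\<lambda>a b. 0)"
      using s(2) xs ys(1) by (intro Q_conflict[of s "Jf ys ! s" _ s "Jf xs ! s"]) auto
    then show ?thesis using False xs ys by (simp add: Q_append BQ)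
  qed
  have "B I0 (Jf ys) a b = 0" for a b
  proof -
    \<comment> \<open>Multiplying the linear relation by one of the orthogonal idempotents isolates
      its coefficient.\<close>
    have "0 = kc As (B I0 (Jf ys)) (\<lambda>a b. \<Sum>xs\<in>L. u xs * B I0 (Jf xs) a b) a b" unfolding sum0 by (simp add: kc_zero)
    also have "\<dots> = intp As (\<lambda>z. \<Sum>xs\<in>L. u xs * (B I0 (Jf ys) a z * B I0 (Jf xs) z b))"
      by (simp add: kc_def sum_distrib_left mult_ac)
    also have "\<dots> = (\<Sum>xs\<in>L. intp As (\<lambda>z. u xs * (B I0 (Jf ys) a z * B I0 (Jf xs) z b)))"
      by (intro intp_sum fs_mult fs_B fs_intros)
    also have "\<dots> = (\<Sum>xs\<in>L. u xs * kc As (B I0 (Jf ys)) (B I0 (Jf xs)) a b)"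
      unfolding kc_def by (intro sum.cong refl intp_cmult fs_mult fs_B fs_intros)
    also have "\<dots> = (\<Sum>xs\<in>L. if xs = ys then u ys * B I0 (Jf ys) a b else 0)"
      by (intro sum.cong refl) (simp add: orth)
    also have "\<dots> = u ys * B I0 (Jf ys) a b" using finL ys(1) by simp
    finally show ?thesis using ys(2) by simp
  qed
  then show False using all_nz[of I0 "Jf ys"] Jd[OF ys(1)] by (simp add: fun_eq_iff I0_def)
qed

text \<open>Among \<open>3 * r\<close> moved points with distinct images there are \<open>r\<close>
  whose sources and targets are disjoint, and for these \<open>disjoint_zero\<close> applies.
  Coinciding images are excluded by \<open>Q_conflict\<close>.\<close>

lemma ex_moves_less: "\<exists>r. moves_less r"
proof -
  define m where "m = Max (insert 0 (set As))"
  have m: "\<forall>k\<in>set As. k \<le> m" by (simp add: m_def)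
  define r where "r = 2 * m + 1"
  have "moves_less (3 * r)" unfolding moves_less_def
  proof (intro allI impI)
    fix ps :: "(nat \<times> nat) list"
    assume ps: "length ps = 3 * r \<and> distinct (map fst ps) \<and> (\<forall>(i, j)\<in>set ps. i \<noteq> j)"
    show "Q ps = (\<lambda>a b. 0)"
    proof (cases "inj_on snd (set ps)")
      case False
      then obtain p q where "p \<in> set ps" "q \<in> set ps" "snd p = snd q" "p \<noteq> q" by (auto simp: inj_on_def)
      then show ?thesis using Q_conflict[of "fst p" "snd p" ps "fst q" "snd q"] by (simp add: prod_eq_iff) (metis prod.collapse)
    next
      case True
      have "card (set ps) = 3 * r" "inj_on fst (set ps)" using ps by (auto simp: distinct_map distinct_card)
      then obtain \<psi> where \<psi>: "\<psi> \<subseteq> set ps" "card \<psi> = r" "fst ` \<psi> \<inter> snd ` \<psi> = {}"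
        using disjoint_pairs[of "set ps" r] True ps by auto
      have inj: "inj_on fst \<psi>" "inj_on snd \<psi>" using \<psi>(1) True \<open>inj_on fst (set ps)\<close> inj_on_subset by blast+
      obtain qs where qs: "set qs = \<psi>" "distinct qs" using finite_distinct_list[of \<psi>] \<psi>(1) finite_subset by blast
      then have "length qs = r" using \<psi>(2) distinct_card by fastforce
      moreover have "distinct (map fst qs @ map snd qs)" using qs inj \<psi>(3) by (simp add: distinct_map)
      ultimately have "Q qs = (\<lambda>a b. 0)" unfolding Q_def by (intro disjoint_zero[OF m r_def]) auto
      then show ?thesis by (rule Q_0_mono) (use qs \<psi> in simp)
    qed
  qed
  then show ?thesis by blast
qed

end

section \<open>Splitting off the part graded by one permutation type\<close>

lemma relabel_ex:
  assumes "distinct xs" "length xs = n" "distinct ys" "set ys = set xs"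
  obtains g where "g permutes {1..n}" "ys = relabel n g xs"
proof -
  have ly: "length ys = n" using assms distinct_card[of xs] distinct_card[of ys] by simp
  have "\<forall>i\<in>{1..n}. \<exists>j\<in>{1..n}. ys ! (j - 1) = xs ! (i - 1)"
  proof
    fix i assume "i \<in> {1..n}"
    then have "xs ! (i - 1) \<in> set ys" using nth_in_set[of i xs] assms by simp
    then show "\<exists>j\<in>{1..n}. ys ! (j - 1) = xs ! (i - 1)" using nth_ex[of "xs ! (i - 1)" ys] ly by simp
  qed
  then obtain g0 where g0: "\<And>i. i \<in> {1..n} \<Longrightarrow> g0 i \<in> {1..n} \<and> ys ! (g0 i - 1) = xs ! (i - 1)" by metis
  define g where "g i = (if i \<in> {1..n} then g0 i else i)" for i
  have g: "g i \<in> {1..n} \<and> ys ! (g i - 1) = xs ! (i - 1)" if "i \<in> {1..n}" for i using g0[OF that] that by (simp only: g_def if_True)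
  have "inj_on g {1..n}"
  proof (rule inj_onI)
    fix i j assume "i \<in> {1..n}" "j \<in> {1..n}" "g i = g j"
    then show "i = j" using g[of i] g[of j] nth_inj[OF assms(1), of i j] assms(2) by metis
  qed
  moreover have "g ` {1..n} \<subseteq> {1..n}" using g by blast
  ultimately have "bij_betw g {1..n} {1..n}" by (simp add: bij_betw_def endo_inj_surj)
  then have perm: "g permutes {1..n}" by (rule bij_imp_permutes) (simp only: g_def if_False)
  then have "ys = relabel n g xs" using relabel_unique[OF perm ly, of xs] g by blast
  with perm show ?thesis by (rule that)
qed

text \<open>The requirement that the degree permute the entries of \<open>xs\<close> as
  \<open>\<sigma>\<close> permutes their positions.\<close>

definition perm_pairs :: "nat \<Rightarrow> (nat \<Rightarrow> nat) \<Rightarrow> nat list \<Rightarrow> (nat \<times> nat) list" where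
  "perm_pairs r \<sigma> xs = map (\<lambda>x. (x, tperm r \<sigma> xs x)) xs"

lemma perm_pairs_simps: "map fst (perm_pairs r \<sigma> xs) = xs" "length (perm_pairs r \<sigma> xs) = length xs"
  "set (perm_pairs r \<sigma> xs) = (\<lambda>x. (x, tperm r \<sigma> xs x)) ` set xs"
  by (simp_all add: perm_pairs_def comp_def)

context deligne
begin

lemma supp_eqI:
  assumes "\<And>a b. a \<in> pts As \<Longrightarrow> b \<in> pts Bs \<Longrightarrow> K a b = L a b"
    and "\<And>a b. \<not> (a \<in> pts As \<and> b \<in> pts Bs) \<Longrightarrow> K a b = 0" "\<And>a b. \<not> (a \<in> pts As \<and> b \<in> pts Bs) \<Longrightarrow> L a b = 0"
  shows "K = L"
  using assms by (intro ext) metis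

lemma kc_supp:
  assumes "\<And>a b. \<not> (a \<in> pts As \<and> b \<in> pts Bs) \<Longrightarrow> K a b = 0" "\<And>a b. \<not> (a \<in> pts Bs \<and> b \<in> pts Cs) \<Longrightarrow> L a b = 0"
    and "\<not> (a \<in> pts As \<and> b \<in> pts Cs)"
  shows "kc Bs K L a b = 0"
  unfolding kc_def by (rule intp_zero) (metis assms mult_eq_0_iff)

end

text \<open>The derangement moves all \<open>r\<close> points of a distinct tuple, and by
  \<open>moves\<close> no further point can be moved. So prescribing the degree on the tuple
  determines it on all natural numbers; see \<open>pp_P\<close>.\<close>

locale grade = center_object +
  fixes r :: nat and \<sigma> :: "nat \<Rightarrow> nat"
  assumes \<sigma>: "\<sigma> permutes {1..r}" and derangement: "i \<in> {1..r} \<Longrightarrow> \<sigma> i \<noteq> i"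
    and moves: "moves_less (Suc r)"

sublocale grade \<subseteq> W: wold t r \<sigma> 1 "\<lambda>_. 1\<^sub>m 1"
  by unfold_locales (rule \<sigma>, simp add: matrix_representation_def)

context grade
begin

abbreviation "eW \<equiv> old_idem r \<sigma> 1 (\<lambda>_. 1\<^sub>m 1)"
definition "EW = kr [r] [r] eW"
abbreviation "N \<equiv> of_nat (card W.Z) :: complex"

lemma N0: "N \<noteq> 0"
  using W.card_Z by simp

lemma W_tau: "tau t [r] eW W.ta"
  using W.tau by simp

lemma EW_kern: "EW \<in> kern [r] [r]"
  unfolding EW_def using W.e_hom by (intro kr_kern) simp

text \<open>The orbits of the centralizer on distinct tuples. Related tuples describe the same
  permutation of the natural numbers, by \<open>rel_eq\<close>.\<close>

definition rel :: "pt \<Rightarrow> pt \<Rightarrow> bool" where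
  "rel v w \<longleftrightarrow> (\<exists>xs. \<exists>g\<in>W.Z. v = Pt 0 xs \<and> w = Pt 0 (relabel r g xs) \<and> length xs = r \<and> distinct xs)"

lemma relabel_inj:
  assumes "g \<in> W.Z" "h \<in> W.Z" "distinct xs" "length xs = r" "relabel r g xs = relabel r h xs"
  shows "g = h"
proof
  fix i
  note p = W.Z_perm[OF assms(1)] W.Z_perm[OF assms(2)]
  show "g i = h i"
  proof (cases "i \<in> {1..r}")
    case True
    have "relabel r g xs ! (g i - 1) = relabel r g xs ! (h i - 1)"
      using relabel_nth[OF p(1) True, of xs] relabel_nth[OF p(2) True, of xs] assms(5) by simp
    then show ?thesis
      using nth_inj[of "relabel r g xs" "g i" "h i"] permutes_in[OF p(1) True] permutes_in[OF p(2) True]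
        distinct_relabel[OF p(1) assms(4)] assms(3) by simp
  next
    case False
    then show ?thesis using permutes_not_in[OF p(1)] permutes_not_in[OF p(2)] by simp
  qed
qed

text \<open>For the trivial representation every summand in \<open>W.E_eq\<close> has the same
  weight, and since the centralizer acts freely on distinct tuples at most one summand is
  nonzero.\<close>

lemma EW_eq: "EW v w = (if rel v w then 1 / N else 0)"
proof (cases "\<exists>xs ys. v = Pt 0 xs \<and> w = Pt 0 ys \<and> length xs = r \<and> distinct xs")
  case True
  then obtain xs ys where vw: "v = Pt 0 xs" "w = Pt 0 ys" "length xs = r" "distinct xs" by blast
  have "EW v w = (\<Sum>g\<in>W.Z. 1 / N * of_bool (ys = relabel r g xs))"
    using W.E_eq[of 0 xs 0 ys] vw by (simp add: EW_def del: kr.simps)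
  also have "\<dots> = (if rel v w then 1 / N else 0)"
  proof (cases "rel v w")
    case True
    then obtain g where g: "g \<in> W.Z" "ys = relabel r g xs" by (auto simp: rel_def vw)
    have "(\<Sum>h\<in>W.Z. 1 / N * of_bool (ys = relabel r h xs)) = (\<Sum>h\<in>W.Z. if h = g then 1 / N else 0)"
      by (rule sum.cong[OF refl]) (use g relabel_inj[OF g(1) _ vw(4,3)] in auto)
    then show ?thesis using True g W.finite_Z by simp
  next
    case False
    then have "\<forall>g\<in>W.Z. ys \<noteq> relabel r g xs" by (auto simp: rel_def vw)
    then show ?thesis using False by simp
  qed
  finally show ?thesis .
next
  case False
  obtain s xs q ys where vw: "v = Pt s xs" "w = Pt q ys" by (cases v; cases w)
  have "EW v w = 0" using W.E_eq[of s xs q ys] False vw by (auto simp: EW_def simp del: kr.simps)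
  moreover have "\<not> rel v w" using False by (auto simp: rel_def)
  ultimately show ?thesis by simp
qed

lemma rel_sym: "rel v w \<Longrightarrow> rel w v"
proof -
  assume "rel v w"
  then obtain xs g where g: "g \<in> W.Z" "v = Pt 0 xs" "w = Pt 0 (relabel r g xs)" "length xs = r" "distinct xs"
    by (auto simp: rel_def)
  note p = W.Z_perm[OF g(1)]
  have "relabel r (inv_into UNIV g) (relabel r g xs) = relabel r id xs"
    unfolding relabel_comp[OF p permutes_inv[OF p]] by (simp add: permutes_inv_o[OF p])
  also have "\<dots> = xs" using relabel_unique[of id r xs xs] g(4) by (simp add: permutes_id)
  finally show "rel w v" unfolding rel_def using g W.inv_Z[OF g(1)] distinct_relabel[OF p g(4)]
    by (intro exI[of _ "relabel r g xs"] bexI[of _ "inv_into UNIV g"]) auto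
qed

lemma EW_sym: "EW v w = EW w v"
  unfolding EW_eq using rel_sym by auto

text \<open>The orbit has as many points as the centralizer has elements, each of mass 1 and weight
  \<open>1 / N\<close>. The result does not depend on \<open>t\<close>.\<close>

lemma EW_total:
  assumes "length xs = r" "distinct xs"
  shows "intp [r] (EW (Pt 0 xs)) = 1"
proof -
  let ?S = "(\<lambda>g. Pt 0 (relabel r g xs)) ` W.Z"
  have inj: "inj_on (\<lambda>g. Pt 0 (relabel r g xs)) W.Z"
    using relabel_inj[OF _ _ assms(2,1)] by (intro inj_onI) simp
  have rel: "rel (Pt 0 xs) w \<longleftrightarrow> w \<in> ?S" for w using assms by (auto simp: rel_def)
  have "intp [r] (EW (Pt 0 xs)) = sum (EW (Pt 0 xs)) ?S"
    by (rule intp_finite) (auto simp: W.finite_Z EW_eq rel simp del: kr.simps)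
  also have "\<dots> = (\<Sum>w\<in>?S. 1 / N)" by (rule sum.cong[OF refl]) (simp add: EW_eq rel del: kr.simps)
  also have "\<dots> = 1" using N0 by (simp add: card_image[OF inj])
  finally show ?thesis .
qed

text \<open>The part of the object graded by the permutation \<open>W.ta v\<close>.\<close>

definition P :: "pt \<Rightarrow> pt \<Rightarrow> pt \<Rightarrow> complex" where
  "P v = (case v of Pt s xs \<Rightarrow> if s = 0 \<and> length xs = r \<and> distinct xs then Q (perm_pairs r \<sigma> xs) else (\<lambda>a b. 0))"

lemma P_cases:
  obtains (good) xs where "v = Pt 0 xs" "length xs = r" "distinct xs" "P v = Q (perm_pairs r \<sigma> xs)"
  | (bad) "P v = (\<lambda>a b. 0)" "\<And>w. \<not> rel v w"
  by (cases v) (force simp: P_def rel_def split: if_splits)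

lemma fs2_P: "fs2 (P v)"
  by (cases v rule: P_cases) (auto simp: fs2_Q fs_const)

lemma P_supp: "\<not> (a \<in> pts As \<and> b \<in> pts As) \<Longrightarrow> P v a b = 0"
  using Q_supp by (cases v rule: P_cases) auto

lemma P_act:
  assumes \<pi>: "bij \<pi>"
  shows "P (act \<pi> v) (act \<pi> a) (act \<pi> b) = P v a b"
proof (cases v)
  case (Pt s xs)
  have "perm_pairs r \<sigma> (map \<pi> xs) = map (map_prod \<pi> \<pi>) (perm_pairs r \<sigma> xs)"
    by (simp add: perm_pairs_def tperm_eqv[OF \<sigma> \<pi>])
  moreover have "distinct (map \<pi> xs) = distinct xs" using inj_on_subset[OF bij_is_inj[OF \<pi>] subset_UNIV] by (simp add: distinct_map)
  ultimately show ?thesis using Pt Q_act[OF \<pi>] by (simp add: P_def)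
qed

lemma fs_P: "eqm f \<Longrightarrow> eqm g \<Longrightarrow> eqm h \<Longrightarrow> fs (\<lambda>x. P (f x) (g x) (h x))"
  using fs_eqm[OF fs_inv eqm_Pair[OF eqm_Pair], of "\<lambda>x. P (fst (fst x)) (snd (fst x)) (snd x)" f g h] P_act by simp

lemma E_P: "kc As E (P v) = P v" "kc As (P v) E = P v"
  by (cases v rule: P_cases; simp add: E_Q kc_zero)+

lemma pp_P_commute: "kc As (pp i j) (P v) = kc As (P v) (pp i j)"
  by (cases v rule: P_cases) (simp_all add: pp_Q_commute kc_zero)

lemma P_idem: "kc As (P v) (P v) = P v"
  by (cases v rule: P_cases) (simp_all add: Q_subset kc_zero)

lemma tperm_moves:
  assumes "length xs = r" "distinct xs" "x \<in> set xs"
  shows "tperm r \<sigma> xs x \<noteq> x" "tperm r \<sigma> xs x \<in> set xs"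
proof -
  obtain i where i: "i \<in> {1..r}" "x = xs ! (i - 1)" using nth_ex[OF assms(3)] assms(1) by auto
  have \<sigma>i: "\<sigma> i \<in> {1..r}" by (rule permutes_in[OF \<sigma> i(1)])
  have eq: "tperm r \<sigma> xs x = xs ! (\<sigma> i - 1)" unfolding i(2) by (rule tperm_nth[OF assms(2,1) i(1)])
  show "tperm r \<sigma> xs x \<noteq> x"
    unfolding eq using nth_inj[OF assms(2), of "\<sigma> i" i] derangement[OF i(1)] i \<sigma>i assms(1) by metis
  show "tperm r \<sigma> xs x \<in> set xs" unfolding eq using nth_in_set[of "\<sigma> i" xs] \<sigma>i assms(1) by simp
qed

text \<open>The degree would move the \<open>r\<close> entries of \<open>xs\<close> and the point
  \<open>i\<close>.\<close>

lemma Q_extra: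
  assumes "length xs = r" "distinct xs" "i \<notin> set xs" "i \<noteq> j"
  shows "Q ((i, j) # perm_pairs r \<sigma> xs) = (\<lambda>a b. 0)"
proof (rule moves_lessD[OF moves])
  fix i' j' assume "(i', j') \<in> set ((i, j) # perm_pairs r \<sigma> xs)"
  then consider "i' = i" "j' = j" | "i' \<in> set xs" "j' = tperm r \<sigma> xs i'" by (auto simp: perm_pairs_simps)
  then show "i' \<noteq> j'" by cases (use assms(4) tperm_moves(1)[OF assms(1,2)] in metis)+
qed (use assms in \<open>simp_all add: perm_pairs_simps\<close>)

text \<open>At an entry of the tuple the condition \<open>i\<close> to \<open>j\<close> is either
  one of those imposed by \<open>P w\<close> or in conflict with one. At any other point
  \<open>Q_extra\<close> excludes every \<open>j\<close> different from \<open>i\<close>, and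
  \<open>Q_pull\<close> then shows that \<open>i\<close> is fixed.\<close>

lemma pp_P: "kc As (pp i j) (P w) = (if W.ta w i = j then P w else (\<lambda>a b. 0))"
proof (cases w rule: P_cases)
  case bad
  then show ?thesis by (simp add: kc_zero)
next
  case (good xs)
  let ?ps = "perm_pairs r \<sigma> xs"
  have ta: "W.ta w = tperm r \<sigma> xs" using good by (simp add: W.ta_def)
  have Qc: "kc As (pp i j) (P w) = Q ((i, j) # ?ps)" unfolding Q_Cons good(4) by simp
  show ?thesis
  proof (cases "i \<in> set xs")
    case True
    then have m: "(i, tperm r \<sigma> xs i) \<in> set ?ps" by (simp add: perm_pairs_simps)
    show ?thesis
    proof (cases "tperm r \<sigma> xs i = j")
      case True
      then show ?thesis using pp_Q_absorb[OF m] unfolding ta good(4) by simp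
    next
      case False
      then show ?thesis using m unfolding Qc ta by (simp add: Q_conflict[of i j _ i "tperm r \<sigma> xs i"])
    qed
  next
    case False
    have "W.ta w i = i" unfolding ta using False by (rule tperm_notin)
    moreover have "Q ((i, i) # ?ps) = Q ?ps" by (rule Q_pull) (simp add: Q_extra[OF good(2,3) False])
    ultimately show ?thesis unfolding Qc using Q_extra[OF good(2,3) False] good(4) by auto
  qed
qed

lemma rel_eq: "rel v w \<Longrightarrow> P v = P w \<and> W.ta v = W.ta w"
proof -
  assume "rel v w"
  then obtain xs g where g: "g \<in> W.Z" "v = Pt 0 xs" "w = Pt 0 (relabel r g xs)" "length xs = r" "distinct xs"
    by (auto simp: rel_def)
  note p = W.Z_perm[OF g(1)]
  have t: "tperm r \<sigma> (relabel r g xs) = tperm r \<sigma> xs" by (rule tperm_relabel[OF \<sigma> g(1,4)])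
  have "Q (perm_pairs r \<sigma> (relabel r g xs)) = Q (perm_pairs r \<sigma> xs)"
    by (rule Q_set_cong) (simp add: perm_pairs_simps t set_relabel[OF p g(4)])
  then show ?thesis using g distinct_relabel[OF p g(4)] t by (simp add: P_def W.ta_def)
qed

text \<open>For unrelated tuples the product vanishes. If one tuple has an entry outside the other,
  an additional point would be moved. If both have the same entries, they are relabellings of each
  other by some \<open>g\<close>; were the two permutations of these entries equal, \<open>g\<close>
  would commute with \<open>\<sigma>\<close> and the tuples would be related, so the conditions
  conflict at some entry.\<close>

lemma P_P: "kc As (P v) (P w) = (\<lambda>a b. N * EW v w * P v a b)"
proof (cases "rel v w")
  case True
  then show ?thesis using rel_eq[OF True] P_idem[of v] N0 by (simp add: EW_eq)
next
  case False
  have "kc As (P v) (P w) = (\<lambda>a b. 0)"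
  proof (cases v rule: P_cases)
    case bad
    then show ?thesis by (simp add: kc_zero)
  next
    case v: (good xs)
    show ?thesis
    proof (cases w rule: P_cases)
      case bad
      then show ?thesis by (simp add: kc_zero)
    next
      case w: (good ys)
      let ?px = "perm_pairs r \<sigma> xs" and ?py = "perm_pairs r \<sigma> ys"
      have "Q (?px @ ?py) = (\<lambda>a b. 0)"
      proof (cases "set ys \<subseteq> set xs")
        case False
        then obtain y where y: "y \<in> set ys" "y \<notin> set xs" by blast
        have "tperm r \<sigma> ys y \<noteq> y" by (rule tperm_moves(1)[OF w(2,3) y(1)])
        then have "Q ((y, tperm r \<sigma> ys y) # ?px) = (\<lambda>a b. 0)" using Q_extra[OF v(2,3) y(2)] by metis
        then show ?thesis by (rule Q_0_mono) (use y in \<open>auto simp: perm_pairs_simps\<close>)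
      next
        case sub: True
        have "card (set ys) = card (set xs)" using distinct_card[OF v(3)] distinct_card[OF w(3)] v(2) w(2) by simp
        then have seteq: "set ys = set xs" using card_subset_eq[OF finite_set sub] by blast
        obtain g where g: "g permutes {1..r}" "ys = relabel r g xs" using relabel_ex[OF v(3,2) w(3) seteq] .
        have "\<exists>x\<in>set xs. tperm r \<sigma> xs x \<noteq> tperm r \<sigma> ys x"
        proof (rule ccontr)
          assume "\<not> (\<exists>x\<in>set xs. tperm r \<sigma> xs x \<noteq> tperm r \<sigma> ys x)"
          then have eq: "tperm r \<sigma> xs x = tperm r \<sigma> ys x" if "x \<in> set xs" for x using that by blast
          have "g (\<sigma> i) = \<sigma> (g i)" for i
          proof (cases "i \<in> {1..r}")
            case True
            have in1: "g i \<in> {1..r}" "\<sigma> i \<in> {1..r}" using permutes_in[OF g(1) True] permutes_in[OF \<sigma> True] by auto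
            have in2: "\<sigma> (g i) \<in> {1..r}" "g (\<sigma> i) \<in> {1..r}" using permutes_in[OF \<sigma> in1(1)] permutes_in[OF g(1) in1(2)] by auto
            have "ys ! (\<sigma> (g i) - 1) = tperm r \<sigma> ys (ys ! (g i - 1))" by (rule tperm_nth[OF w(3,2) in1(1), symmetric])
            also have "ys ! (g i - 1) = xs ! (i - 1)" unfolding g(2) by (rule relabel_nth[OF g(1) True])
            also have "tperm r \<sigma> ys (xs ! (i - 1)) = tperm r \<sigma> xs (xs ! (i - 1))"
              using eq nth_in_set[of i xs] True v(2) by simp
            also have "\<dots> = xs ! (\<sigma> i - 1)" by (rule tperm_nth[OF v(3,2) True])
            also have "\<dots> = ys ! (g (\<sigma> i) - 1)" unfolding g(2) by (rule relabel_nth[OF g(1) in1(2), symmetric])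
            finally show ?thesis using nth_inj[OF w(3), of "\<sigma> (g i)" "g (\<sigma> i)"] in2 w(2) by simp
          next
            case False
            then show ?thesis using permutes_not_in[OF g(1) False] permutes_not_in[OF \<sigma> False] by simp
          qed
          then have "g \<in> W.Z" using g(1) by (simp add: perm_centralizer_def fun_eq_iff)
          then show False using \<open>\<not> rel v w\<close> v w g(2) by (auto simp: rel_def)
        qed
        then obtain x where "x \<in> set xs" "tperm r \<sigma> xs x \<noteq> tperm r \<sigma> ys x" by blast
        then show ?thesis using seteq
          by (intro Q_conflict[of x "tperm r \<sigma> xs x" _ x "tperm r \<sigma> ys x"]) (auto simp: perm_pairs_simps)
      qed
      then show ?thesis unfolding v(4) w(4) Q_append .
    qed
  qed
  then show ?thesis using False by (simp add: EW_eq)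
qed

text \<open>\<open>P\<close> is constant on the orbits of the centralizer, and \<open>EW\<close> is
  a probability weight on the orbit. If \<open>v\<close> is not a distinct tuple of length
  \<open>r\<close>, both sides vanish.\<close>

lemma int_EW: "intp [r] (\<lambda>w. EW v w * P w a b) = P v a b" "intp [r] (\<lambda>w. EW w v * P w a b) = P v a b"
proof -
  have "intp [r] (\<lambda>w. EW v w * P w a b) = intp [r] (\<lambda>w. EW v w * P v a b)"
    by (rule intp_cong) (use rel_eq in \<open>auto simp: EW_eq simp del: kr.simps\<close>)
  also have "\<dots> = intp [r] (EW v) * P v a b"
    by (intro intp_multc fs_kern[OF EW_kern] fs_intros)
  also have "\<dots> = P v a b"
    by (cases v rule: P_cases) (simp_all add: EW_total)
  finally show "intp [r] (\<lambda>w. EW v w * P w a b) = P v a b" .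
  then show "intp [r] (\<lambda>w. EW w v * P w a b) = P v a b" using EW_sym by simp
qed

text \<open>The regularized sum of the projections to all degrees of type \<open>\<sigma>\<close>:
  each such permutation is described by exactly one orbit of \<open>N\<close> tuples, and the factor
  \<open>1 / N\<close> counts it once.\<close>

definition \<theta> :: "pt \<Rightarrow> pt \<Rightarrow> complex" where
  "\<theta> a b = 1 / N * intp [r] (\<lambda>v. P v a b)"

lemma theta_kern: "\<theta> \<in> kern As As"
proof (rule kernI)
  fix \<pi> a b assume "bij (\<pi> :: nat \<Rightarrow> nat)"
  then show "\<theta> (act \<pi> a) (act \<pi> b) = \<theta> a b"
    using intp_act[of \<pi> "[r]" "\<lambda>v. P v (act \<pi> a) (act \<pi> b)"] P_act[of \<pi>] by (simp add: \<theta>_def)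
next
  fix a b assume ne: "\<theta> a b \<noteq> 0"
  have "\<not> (\<forall>v. P v a b = 0)"
  proof
    assume "\<forall>v. P v a b = 0"
    then have "\<theta> a b = 0" by (simp add: \<theta>_def)
    with ne show False ..
  qed
  then show "a \<in> pts As \<and> b \<in> pts As" using P_supp[of a b] by blast
qed

lemma kc_theta:
  assumes L: "fs2 L"
  shows "kc As L \<theta> a b = 1 / N * intp [r] (\<lambda>w. kc As L (P w) a b)"
    "kc As \<theta> L a b = 1 / N * intp [r] (\<lambda>w. kc As (P w) L a b)"
proof -
  have fP: "fs (\<lambda>w. P w x y)" for x y by (intro fs_P fs_intros)
  have f1: "fs2 (\<lambda>x w. L a x * P w x b)" and f2: "fs2 (\<lambda>x w. P w a x * L x b)"
    by (intro fs_mult fs_P fs2D[OF L] fs_intros)+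
  have g1: "fs (\<lambda>x. intp [r] (\<lambda>w. L a x * P w x b))" by (rule fs_intp[OF f1])
  have g2: "fs (\<lambda>x. intp [r] (\<lambda>w. P w a x * L x b))" by (rule fs_intp[OF f2])
  have "kc As L \<theta> a b = intp As (\<lambda>x. 1 / N * intp [r] (\<lambda>w. L a x * P w x b))"
    unfolding kc_def \<theta>_def by (simp add: intp_cmult[OF fP] mult_ac)
  then show "kc As L \<theta> a b = 1 / N * intp [r] (\<lambda>w. kc As L (P w) a b)"
    unfolding intp_cmult[OF g1] intp_swap[OF f1] kc_def .
  have "kc As \<theta> L a b = intp As (\<lambda>x. 1 / N * intp [r] (\<lambda>w. P w a x * L x b))"
    unfolding kc_def \<theta>_def by (simp only: intp_multc[OF fP] mult.assoc)
  then show "kc As \<theta> L a b = 1 / N * intp [r] (\<lambda>w. kc As (P w) L a b)"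
    unfolding intp_cmult[OF g2] intp_swap[OF f2] kc_def .
qed

text \<open>By \<open>P_P\<close> only the orbit of \<open>v\<close> contributes to the integral,
  with factor \<open>N\<close> and weight \<open>EW\<close>; \<open>int_EW\<close> evaluates what
  remains.\<close>

lemma P_theta: "kc As (P v) \<theta> = P v" "kc As \<theta> (P v) = P v"
proof -
  have f: "fs (\<lambda>w. EW v w * P w a b)" "fs (\<lambda>w. EW v w)" for a b
    by (intro fs_mult fs_kern[OF EW_kern] fs_P fs_intros)+
  have 1: "kc As (P v) (P w) = (\<lambda>a b. N * (EW v w * P w a b))" for w
    unfolding P_P using rel_eq[of v w] by (auto simp: EW_eq simp del: kr.simps)
  have 2: "kc As (P w) (P v) = (\<lambda>a b. N * (EW v w * P w a b))" for w
    unfolding P_P EW_sym[of v] by (simp add: mult_ac del: kr.simps)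
  show "kc As (P v) \<theta> = P v" "kc As \<theta> (P v) = P v"
    unfolding fun_eq_iff kc_theta[OF fs2_P] 1 2 intp_cmult[OF f(1)] int_EW using N0 by simp_all
qed

lemma theta_idem: "kc As \<theta> \<theta> = \<theta>"
  unfolding fun_eq_iff kc_theta[OF fs2_kern[OF theta_kern]] P_theta by (simp add: \<theta>_def)

lemma theta_zh: "center_kernel As e c As e c \<theta>"
  unfolding center_kernel_def
proof (intro conjI allI)
  show "kc As E \<theta> = \<theta>" "kc As \<theta> E = \<theta>"
    unfolding fun_eq_iff kc_theta[OF fs2_kern[OF E_kern]] E_P by (simp_all add: \<theta>_def)
  show "kc As (pp i j) \<theta> = kc As \<theta> (pp i j)" for i j
    unfolding fun_eq_iff kc_theta[OF fs2_B] pp_P_commute by simp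
qed (rule theta_kern)

section \<open>The part of type \<open>\<sigma>\<close> as a retract of a tensor product with the
  generator\<close>

abbreviation "Bs \<equiv> tl_obj [r] As"
abbreviation "f \<equiv> tens_mor CA eW e"
abbreviation "dS \<equiv> \<lambda>V\<in>objects RS. comp_mor CA (tens_mor CA (tau.hbr t [r] eW W.ta V) e) (tens_mor CA eW (tr As e V))"

lemma S_zob: "center_object t Bs f dS"
  by (rule ZC_tens_zob[OF tau.center_object[OF W_tau] tr_zob[OF Y]])

lemma f_kern: "kr Bs Bs f \<in> kern Bs Bs"
  using W.e_hom by (intro kr_kern tens_ahom e_hom(1)) simp

lemma kr_f: "v \<in> pts [r] \<Longrightarrow> w \<in> pts [r] \<Longrightarrow> a \<in> pts As \<Longrightarrow> b \<in> pts As \<Longrightarrow>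
    kr Bs Bs f (pr n v a) (pr n w b) = EW v w * E a b"
  unfolding EW_def by (rule kr_tens) (use W.e_hom e_hom(1) in simp_all)

lemma S_B: "v \<in> pts [r] \<Longrightarrow> w \<in> pts [r] \<Longrightarrow> a \<in> pts As \<Longrightarrow> b \<in> pts As \<Longrightarrow>
    center_object.B t Bs dS [i] [j] (pr n v a) (pr n w b) = (EW v w * of_bool (W.ta v i = j)) * E a b"
  unfolding EW_def tau.B_hbr[OF W_tau, symmetric] by (rule B_tens_tr[OF tau.center_object[OF W_tau] tr_zob[OF Y] tr_B[OF Y]])

text \<open>An inverse of \<open>pr\<close> on the points of \<open>Bs\<close>. Since
  \<open>[r]\<close> has a single summand, the summand index of a product point is that of its right
  factor.\<close>

definition dec :: "pt \<Rightarrow> pt \<times> pt" where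
  "dec z = (case z of Pt s zs \<Rightarrow> (Pt 0 (take r zs), Pt s (drop r zs)))"

lemma dec_pr: "v \<in> pts [r] \<Longrightarrow> dec (pr n v a) = (v, a)"
  by (cases v; cases a) (simp add: dec_def)

lemma dec_act: "dec (act \<pi> z) = (act \<pi> (fst (dec z)), act \<pi> (snd (dec z)))"
  by (cases z) (simp add: dec_def take_map drop_map)

text \<open>The two morphisms between the image of \<open>\<theta>\<close> and the tensor product of the generator with a trivially braided object.\<close>

definition \<mu> :: "pt \<Rightarrow> pt \<Rightarrow> complex" where
  "\<mu> a z = (if z \<in> pts Bs then 1 / N * P (fst (dec z)) a (snd (dec z)) else 0)"

definition \<nu> :: "pt \<Rightarrow> pt \<Rightarrow> complex" where
  "\<nu> z b = (if z \<in> pts Bs then P (fst (dec z)) (snd (dec z)) b else 0)"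

lemma mu_pr: "v \<in> pts [r] \<Longrightarrow> y \<in> pts As \<Longrightarrow> \<mu> a (pr n v y) = 1 / N * P v a y"
  unfolding \<mu>_def using pr_in_pts[of v "[r]" y As] by (simp add: dec_pr del: concat.simps)

lemma nu_pr: "v \<in> pts [r] \<Longrightarrow> y \<in> pts As \<Longrightarrow> \<nu> (pr n v y) b = P v y b"
  unfolding \<nu>_def using pr_in_pts[of v "[r]" y As] by (simp add: dec_pr del: concat.simps)

lemma mu_kern: "\<mu> \<in> kern As Bs"
proof (rule kernI)
  show "\<mu> (act \<pi> a) (act \<pi> z) = \<mu> a z" if "bij \<pi>" for \<pi> a z
    unfolding \<mu>_def dec_act fst_conv snd_conv P_act[OF that] act_in_pts ..
  show "a \<in> pts As \<and> z \<in> pts Bs" if "\<mu> a z \<noteq> 0" for a z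
    using that P_supp[of a "snd (dec z)" "fst (dec z)"] unfolding \<mu>_def by (auto split: if_splits)
qed

lemma nu_kern: "\<nu> \<in> kern Bs As"
proof (rule kernI)
  show "\<nu> (act \<pi> z) (act \<pi> b) = \<nu> z b" if "bij \<pi>" for \<pi> b z
    unfolding \<nu>_def dec_act fst_conv snd_conv P_act[OF that] act_in_pts ..
  show "z \<in> pts Bs \<and> b \<in> pts As" if "\<nu> z b \<noteq> 0" for b z
    using that P_supp[of "snd (dec z)" b "fst (dec z)"] unfolding \<nu>_def by (auto split: if_splits)
qed

lemma kc_Bs:
  assumes "fs2 K" "fs2 L"
  shows "kc Bs K L a b = intp [r] (\<lambda>v. intp As (\<lambda>y. K a (pr n v y) * L (pr n v y) b))"
  unfolding kc_def by (rule intp_tl_obj) (intro fs_mult fs2D[OF assms(1)] fs2D[OF assms(2)] fs_intros)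

lemma pts_BsE:
  assumes "z \<in> pts Bs"
  obtains v y where "v \<in> pts [r]" "y \<in> pts As" "z = pr n v y"
  by (rule pts_tl_objE[OF assms])

text \<open>Both the idempotent of the tensor product and its braiding are of the form \<open>(EW v w * s) * E x y\<close>.\<close>

lemma mu_post:
  assumes H: "fs2 K" "\<And>v x. v \<in> pts [r] \<Longrightarrow> x \<in> pts As \<Longrightarrow> K (pr n v x) (pr n w y) = (EW v w * s) * E x y"
    and p: "w \<in> pts [r]" "y \<in> pts As"
  shows "kc Bs \<mu> K a (pr n w y) = s * \<mu> a (pr n w y)"
proof -
  have "kc Bs \<mu> K a (pr n w y) = intp [r] (\<lambda>v. intp As (\<lambda>x. (1 / N * P v a x) * ((EW v w * s) * E x y)))"
    unfolding kc_Bs[OF fs2_kern[OF mu_kern] H(1)] by (intro intp_cong) (simp only: mu_pr H(2))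
  also have "\<dots> = intp [r] (\<lambda>v. (s / N) * (EW v w * P v a y))"
  proof (rule intp_cong)
    fix v
    have "intp As (\<lambda>x. (1 / N * P v a x) * ((EW v w * s) * E x y)) = intp As (\<lambda>x. (s / N * EW v w) * (P v a x * E x y))"
      by (simp add: mult_ac)
    also have "\<dots> = (s / N * EW v w) * kc As (P v) E a y"
      unfolding kc_def by (intro intp_cmult fs_mult fs_P fs_kern[OF E_kern] fs_intros)
    finally show "intp As (\<lambda>x. (1 / N * P v a x) * ((EW v w * s) * E x y)) = (s / N) * (EW v w * P v a y)"
      unfolding E_P by simp
  qed
  also have "\<dots> = (s / N) * intp [r] (\<lambda>v. EW v w * P v a y)"
    by (intro intp_cmult fs_mult fs_P fs_kern[OF EW_kern] fs_intros)
  also have "\<dots> = s * \<mu> a (pr n w y)" unfolding int_EW mu_pr[OF p] by simp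
  finally show ?thesis .
qed

lemma nu_pre:
  assumes H: "fs2 K" "\<And>w y. w \<in> pts [r] \<Longrightarrow> y \<in> pts As \<Longrightarrow> K (pr n v x) (pr n w y) = (EW v w * s) * E x y"
    and p: "v \<in> pts [r]" "x \<in> pts As"
  shows "kc Bs K \<nu> (pr n v x) b = s * \<nu> (pr n v x) b"
proof -
  have "kc Bs K \<nu> (pr n v x) b = intp [r] (\<lambda>w. intp As (\<lambda>y. ((EW v w * s) * E x y) * P w y b))"
    unfolding kc_Bs[OF H(1) fs2_kern[OF nu_kern]] by (intro intp_cong) (simp only: nu_pr H(2))
  also have "\<dots> = intp [r] (\<lambda>w. s * (EW v w * P w x b))"
  proof (rule intp_cong)
    fix w
    have "intp As (\<lambda>y. ((EW v w * s) * E x y) * P w y b) = intp As (\<lambda>y. (s * EW v w) * (E x y * P w y b))"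
      by (simp add: mult_ac)
    also have "\<dots> = (s * EW v w) * kc As E (P w) x b"
      unfolding kc_def by (intro intp_cmult fs_mult fs_P fs_kern[OF E_kern] fs_intros)
    finally show "intp As (\<lambda>y. ((EW v w * s) * E x y) * P w y b) = s * (EW v w * P w x b)"
      unfolding E_P by simp
  qed
  also have "\<dots> = s * intp [r] (\<lambda>w. EW v w * P w x b)"
    by (intro intp_cmult fs_mult fs_P fs_kern[OF EW_kern] fs_intros)
  also have "\<dots> = s * \<nu> (pr n v x) b" unfolding int_EW nu_pr[OF p] by simp
  finally show ?thesis .
qed

lemma mu_pre:
  assumes K: "fs2 K" and p: "w \<in> pts [r]" "y \<in> pts As"
  shows "kc As K \<mu> a (pr n w y) = 1 / N * kc As K (P w) a y"
  unfolding kc_def mu_pr[OF p] using intp_cmult[OF fs_mult[OF fs2D[OF K eqm_const eqm_id] fs_P[OF eqm_const eqm_id eqm_const]], of As "1 / N" a w y]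
  by (simp add: mult_ac)

lemma nu_post:
  assumes p: "v \<in> pts [r]" "x \<in> pts As"
  shows "kc As \<nu> K (pr n v x) b = kc As (P v) K x b"
  unfolding kc_def nu_pr[OF p] ..

lemma S_B_supp: "\<not> (z \<in> pts Bs \<and> z' \<in> pts Bs) \<Longrightarrow> center_object.B t Bs dS I J z z' = 0"
  using center_object.B_supp[OF S_zob] by blast

text \<open>\<open>\<mu>\<close> decomposes a vector into its components of the various degrees and
  records each degree by a tuple in the factor of the generator; \<open>\<nu>\<close> forgets the
  tuple after projecting. The composite averages \<open>P v\<close> over all tuples, which is why
  only one of the two maps carries the factor \<open>1 / N\<close>. Both commute with the braidings
  because on either side the degree is \<open>W.ta v\<close>.\<close>

lemma retract:
  assumes hd: "center_object t As h d" "kr As As h = \<theta>" "\<And>i j. center_object.B t As d [i] [j] = kc As \<theta> (pp i j)"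
  shows "center_kernel As h d Bs f dS \<mu>" "center_kernel Bs f dS As h d \<nu>" "kc Bs \<mu> \<nu> = kr As As h"
proof -
  note fs2_theta = fs2_kern[OF theta_kern] and fs2_SB = center_object.fs2_B[OF S_zob] and fs2_f = fs2_kern[OF f_kern]
  have fs2_d: "fs2 (kc As \<theta> (pp i j))" for i j by (intro fs_kc fs2_theta fs2_B fs_intros)
  have thpp: "kc As (kc As \<theta> (pp i j)) (P w) = (\<lambda>a b. of_bool (W.ta w i = j) * P w a b)" for i j w
    unfolding kcA[OF fs2_theta fs2_B fs2_P] pp_P by (simp add: P_theta kc_zero)
  have ppth: "kc As (P v) (kc As \<theta> (pp i j)) = (\<lambda>a b. of_bool (W.ta v i = j) * P v a b)" for i j v
    unfolding kcA[OF fs2_P fs2_theta fs2_B, symmetric] P_theta pp_P_commute[symmetric] pp_P by auto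
  have SB: "center_object.B t Bs dS [i] [j] (pr n v x) (pr n w y) = (EW v w * of_bool (W.ta w i = j)) * E x y"
    if "v \<in> pts [r]" "w \<in> pts [r]" "x \<in> pts As" "y \<in> pts As" for v w x y i j
    unfolding S_B[OF that] using rel_eq[of v w] by (simp add: EW_eq)
  have f1: "kr Bs Bs f (pr n v x) (pr n w y) = (EW v w * 1) * E x y"
    if "v \<in> pts [r]" "w \<in> pts [r]" "x \<in> pts As" "y \<in> pts As" for v w x y
    using kr_f[OF that] by simp
  show "center_kernel As h d Bs f dS \<mu>"
    unfolding center_kernel_def hd(2,3)
  proof (intro conjI allI)
    show "kc As \<theta> \<mu> = \<mu>"
    proof (rule supp_eqI)
      fix a z assume "z \<in> pts Bs"
      then obtain w y where p: "w \<in> pts [r]" "y \<in> pts As" "z = pr n w y" by (rule pts_BsE)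
      show "kc As \<theta> \<mu> a z = \<mu> a z" unfolding p(3) mu_pre[OF fs2_theta p(1,2)] mu_pr[OF p(1,2)] P_theta ..
    qed (rule kern_0[OF kc_kern[OF theta_kern mu_kern]] kern_0[OF mu_kern]; assumption)+
    show "kc Bs \<mu> (kr Bs Bs f) = \<mu>"
    proof (rule supp_eqI)
      fix a z assume "z \<in> pts Bs"
      then obtain w y where p: "w \<in> pts [r]" "y \<in> pts As" "z = pr n w y" by (rule pts_BsE)
      show "kc Bs \<mu> (kr Bs Bs f) a z = \<mu> a z"
        unfolding p(3) using mu_post[OF fs2_f f1 p(1,2), of a] p by simp
    qed (rule kern_0[OF kc_kern[OF mu_kern f_kern]] kern_0[OF mu_kern]; assumption)+
    fix i j
    show "kc As (kc As \<theta> (pp i j)) \<mu> = kc Bs \<mu> (center_object.B t Bs dS [i] [j])"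
    proof (rule supp_eqI)
      fix a z assume "z \<in> pts Bs"
      then obtain w y where p: "w \<in> pts [r]" "y \<in> pts As" "z = pr n w y" by (rule pts_BsE)
      have "kc Bs \<mu> (center_object.B t Bs dS [i] [j]) a z = of_bool (W.ta w i = j) * \<mu> a z"
        unfolding p(3) by (rule mu_post[OF fs2_SB SB p(1,2)]) (use p in auto)
      then show "kc As (kc As \<theta> (pp i j)) \<mu> a z = kc Bs \<mu> (center_object.B t Bs dS [i] [j]) a z"
        unfolding p(3) mu_pre[OF fs2_d p(1,2)] thpp mu_pr[OF p(1,2)] by simp
    next
      fix a z assume n: "\<not> (a \<in> pts As \<and> z \<in> pts Bs)"
      have th: "kc As \<theta> (pp i j) a b = 0" if "\<not> (a \<in> pts As \<and> b \<in> pts As)" for a b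
        using that hd(3)[of i j] center_object.B_supp[OF hd(1), of "[i]" "[j]" a b] by metis
      show "kc As (kc As \<theta> (pp i j)) \<mu> a z = 0"
        by (rule kc_supp[OF th kern_0[OF mu_kern] n])
      show "kc Bs \<mu> (center_object.B t Bs dS [i] [j]) a z = 0"
        by (rule kc_supp[OF kern_0[OF mu_kern] S_B_supp n])
    qed
  qed (rule mu_kern)
  show "center_kernel Bs f dS As h d \<nu>"
    unfolding center_kernel_def hd(2,3)
  proof (intro conjI allI)
    show "kc As \<nu> \<theta> = \<nu>"
    proof (rule supp_eqI)
      fix b z assume "z \<in> pts Bs"
      then obtain v x where p: "v \<in> pts [r]" "x \<in> pts As" "z = pr n v x" by (rule pts_BsE)
      show "kc As \<nu> \<theta> z b = \<nu> z b" unfolding p(3) nu_post[OF p(1,2)] nu_pr[OF p(1,2)] P_theta ..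
    qed (rule kern_0[OF kc_kern[OF nu_kern theta_kern]] kern_0[OF nu_kern]; assumption)+
    show "kc Bs (kr Bs Bs f) \<nu> = \<nu>"
    proof (rule supp_eqI)
      fix b z assume "z \<in> pts Bs"
      then obtain v x where p: "v \<in> pts [r]" "x \<in> pts As" "z = pr n v x" by (rule pts_BsE)
      show "kc Bs (kr Bs Bs f) \<nu> z b = \<nu> z b"
        unfolding p(3) using nu_pre[OF fs2_f f1 p(1,2), of b] p by simp
    qed (rule kern_0[OF kc_kern[OF f_kern nu_kern]] kern_0[OF nu_kern]; assumption)+
    fix i j
    show "kc Bs (center_object.B t Bs dS [i] [j]) \<nu> = kc As \<nu> (kc As \<theta> (pp i j))"
    proof (rule supp_eqI)
      fix b z assume "z \<in> pts Bs"
      then obtain v x where p: "v \<in> pts [r]" "x \<in> pts As" "z = pr n v x" by (rule pts_BsE)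
      have "kc Bs (center_object.B t Bs dS [i] [j]) \<nu> z b = of_bool (W.ta v i = j) * \<nu> z b"
        unfolding p(3) by (rule nu_pre[OF fs2_SB S_B p(1,2)]) (use p in auto)
      then show "kc Bs (center_object.B t Bs dS [i] [j]) \<nu> z b = kc As \<nu> (kc As \<theta> (pp i j)) z b"
        unfolding p(3) nu_post[OF p(1,2)] ppth nu_pr[OF p(1,2)] by simp
    next
      fix z b assume n: "\<not> (z \<in> pts Bs \<and> b \<in> pts As)"
      have th: "kc As \<theta> (pp i j) a b = 0" if "\<not> (a \<in> pts As \<and> b \<in> pts As)" for a b
        using that hd(3)[of i j] center_object.B_supp[OF hd(1), of "[i]" "[j]" a b] by metis
      show "kc As \<nu> (kc As \<theta> (pp i j)) z b = 0"
        by (rule kc_supp[OF kern_0[OF nu_kern] th n])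
      show "kc Bs (center_object.B t Bs dS [i] [j]) \<nu> z b = 0"
        by (rule kc_supp[OF S_B_supp kern_0[OF nu_kern] n])
    qed
  qed (rule nu_kern)
  show "kc Bs \<mu> \<nu> = kr As As h"
  proof (intro ext)
    fix a b
    have "kc Bs \<mu> \<nu> a b = intp [r] (\<lambda>v. intp As (\<lambda>y. 1 / N * (P v a y * P v y b)))"
      unfolding kc_Bs[OF fs2_kern[OF mu_kern] fs2_kern[OF nu_kern]]
      by (intro intp_cong) (simp only: mu_pr nu_pr mult.assoc)
    also have "\<dots> = intp [r] (\<lambda>v. 1 / N * kc As (P v) (P v) a b)"
      unfolding kc_def by (intro intp_cong intp_cmult fs_mult fs_P fs_intros)
    also have "\<dots> = 1 / N * intp [r] (\<lambda>v. P v a b)"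
      unfolding P_idem by (intro intp_cmult fs_P fs_intros)
    finally show "kc Bs \<mu> \<nu> a b = kr As As h a b" by (simp add: hd(2) \<theta>_def)
  qed
qed

end

section \<open>Generation of the center\<close>

context grade
begin

text \<open>The object is the direct sum of the images of \<open>\<theta>\<close> and of the
  complementary idempotent. The former is in the closure by \<open>retract\<close>. The latter is
  left to \<open>rest\<close>: its projections to degrees of type \<open>\<sigma>\<close> vanish,
  and every projection that vanished before still does.\<close>

lemma split_off:
  assumes gen: "W_old t r \<sigma> 1 (\<lambda>_. 1\<^sub>m 1) \<in> cl G" and tr: "((As, e), tr As e) \<in> cl G"
    and rest: "\<And>h d. center_object t As h d \<Longrightarrow> center_object.moves_less t As d (Suc r) \<Longrightarrow>
      (\<And>ps. Q ps = (\<lambda>a b. 0) \<Longrightarrow> center_object.Q t As d ps = (\<lambda>a b. 0)) \<Longrightarrow>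
      (\<And>xs. length xs = r \<Longrightarrow> distinct xs \<Longrightarrow> center_object.Q t As d (perm_pairs r \<sigma> xs) = (\<lambda>a b. 0)) \<Longrightarrow> ((As, h), d) \<in> cl G"
  shows "((As, e), c) \<in> cl G"
proof -
  have Yz: "center_object t As e c" by (rule center_object_axioms)
  have "tens_obj ZC (W_old t r \<sigma> 1 (\<lambda>_. 1\<^sub>m 1)) ((As, e), tr As e) \<in> cl G"
    by (rule karoubian_tensor_closure.tensor[OF gen tr])
  moreover have "W_old t r \<sigma> 1 (\<lambda>_. 1\<^sub>m 1) = (([r], eW), tau.hbr t [r] eW W.ta)"
    using W.W_old_eq by simp
  ultimately have S: "((Bs, f), dS) \<in> cl G" by (simp only: ZC_tens)
  obtain h d where hd: "center_object t As h d" "kr As As h = \<theta>" "\<And>i j. center_object.B t As d [i] [j] = kc As \<theta> (pp i j)"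
    "center_kernel As h d As e c \<theta>" "center_kernel As e c As h d \<theta>"
    using split_idem[OF Yz theta_zh theta_idem] by metis
  have im: "((As, h), d) \<in> cl G"
    by (rule closure_retract[OF hd(1) S_zob S retract[OF hd(1-3)]])
  define \<eta> where "\<eta> = (\<lambda>a b. E a b - \<theta> a b)"
  note compl = zh_complement[OF Yz theta_zh theta_idem, folded \<eta>_def]
  obtain h' d' where hd': "center_object t As h' d'" "kr As As h' = \<eta>" "\<And>i j. center_object.B t As d' [i] [j] = kc As \<eta> (pp i j)"
    "center_kernel As h' d' As e c \<eta>" "center_kernel As e c As h' d' \<eta>"
    using split_idem[OF Yz compl(1,2)] by metis
  interpret C: center_object t As h' d' by (rule hd'(1))
  have \<eta>: "\<eta> \<in> kern As As" "kc As \<eta> E = \<eta>" and comm: "kc As (pp i j) \<eta> = kc As \<eta> (pp i j)" for i j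
    using compl(1) unfolding center_kernel_def by auto
  note f\<eta> = fs2_kern[OF \<eta>(1)]
  \<comment> \<open>Since \<open>\<eta>\<close> is an idempotent that commutes with every
    \<open>pp i j\<close>, its copies in a product of compressed projections can be collected into
    one.\<close>
  have CQ: "C.Q ps = kc As \<eta> (Q ps)" for ps
  proof (induction ps)
    case Nil
    show ?case unfolding Q_Nil C.Q_Nil hd'(2) \<eta>(2) ..
  next
    case (Cons p ps)
    let ?p = "pp (fst p) (snd p)"
    have "C.Q (p # ps) = kc As (kc As \<eta> ?p) (kc As \<eta> (Q ps))" unfolding C.Q_Cons Cons hd'(3) ..
    also have "\<dots> = kc As \<eta> (kc As (kc As ?p \<eta>) (Q ps))"
      using kcA[OF f\<eta> fs2_B fs_kc[OF f\<eta> fs2_Q eqm_fst[OF eqm_id] eqm_snd[OF eqm_id]]] kcA[OF fs2_B f\<eta> fs2_Q] by simp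
    also have "kc As (kc As ?p \<eta>) (Q ps) = kc As \<eta> (Q (p # ps))"
      unfolding comm Q_Cons by (rule kcA[OF f\<eta> fs2_B fs2_Q])
    also have "kc As \<eta> (kc As \<eta> (Q (p # ps))) = kc As \<eta> (Q (p # ps))"
      unfolding kcA[OF f\<eta> f\<eta> fs2_Q, symmetric] compl(2) ..
    finally show ?case .
  qed
  have keep: "C.Q ps = (\<lambda>a b. 0)" if "Q ps = (\<lambda>a b. 0)" for ps
    unfolding CQ that kc_zero ..
  have co: "((As, h'), d') \<in> cl G"
  proof (rule rest[OF hd'(1)])
    show "C.moves_less (Suc r)" using moves keep unfolding moves_less_def C.moves_less_def by blast
    show "C.Q ps = (\<lambda>a b. 0)" if "Q ps = (\<lambda>a b. 0)" for ps by (rule keep[OF that])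
    show "C.Q (perm_pairs r \<sigma> xs) = (\<lambda>a b. 0)" if "length xs = r" "distinct xs" for xs
    proof -
      have P: "Q (perm_pairs r \<sigma> xs) = P (Pt 0 xs)" using that by (simp add: P_def)
      have "kc As \<eta> (P (Pt 0 xs)) = (\<lambda>a b. 0)"
        unfolding \<eta>_def kc_diff_left[OF fs2_kern[OF E_kern] fs2_kern[OF theta_kern] fs2_P] E_P P_theta by simp
      then show ?thesis unfolding CQ P .
    qed
  qed
  have "is_direct_sum ZC ((As, h), d) ((As, h'), d') ((As, e), c)"
  proof (rule sum_from_split[OF Yz hd(1) hd'(1) hd(4,5) hd'(4,5)])
    show "kc As \<theta> \<theta> x y + kc As \<eta> \<eta> x y = E x y" for x y
      unfolding theta_idem compl(2) by (simp add: \<eta>_def)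
  qed (simp_all only: theta_idem compl hd(2) hd'(2))
  then show ?thesis
    by (rule karoubian_tensor_closure.direct_sum[OF im co, rotated]) (simp only: ZC_objects Yz)
qed

end

context center_object
begin

text \<open>Suppose that \<open>r\<close> points are moved. If the image \<open>j\<close> of a point
  is not among them, \<open>j\<close> must be fixed, as otherwise \<open>r + 1\<close> points would
  be moved; but then two points have the image \<open>j\<close>, a conflict. Otherwise the moved
  points are permuted without fixed points, and this case is excluded by
  \<open>killed\<close>.\<close>

lemma moves_less_step:
  assumes moves: "moves_less (Suc r)"
    and killed: "\<And>\<sigma> xs. \<sigma> permutes {1..r} \<Longrightarrow> \<forall>i\<in>{1..r}. \<sigma> i \<noteq> i \<Longrightarrow> length xs = r \<Longrightarrow> distinct xs \<Longrightarrow>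
      Q (perm_pairs r \<sigma> xs) = (\<lambda>a b. 0)"
  shows "moves_less r"
  unfolding moves_less_def
proof (intro allI impI)
  fix ps :: "(nat \<times> nat) list"
  assume "length ps = r \<and> distinct (map fst ps) \<and> (\<forall>(i, j)\<in>set ps. i \<noteq> j)"
  then have ps: "length ps = r" "distinct (map fst ps)" "\<And>i j. (i, j) \<in> set ps \<Longrightarrow> i \<noteq> j" by auto
  show "Q ps = (\<lambda>a b. 0)"
  proof (cases "snd ` set ps \<subseteq> fst ` set ps \<and> inj_on snd (set ps)")
    case False
    then consider i j where "(i, j) \<in> set ps" "j \<notin> fst ` set ps"
      | i j i' where "(i, j) \<in> set ps" "(i', j) \<in> set ps" "i \<noteq> i'" by (fastforce simp: inj_on_def)
    then show ?thesis
    proof cases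
      case (1 i j)
      have "Q ((j, l) # ps) = (\<lambda>a b. 0)" if "l \<noteq> j" for l
        by (rule moves_lessD[OF moves]) (use ps 1 that in \<open>auto simp: image_iff\<close>)
      then have "Q ps = Q ((j, j) # ps)" by (intro Q_pull[symmetric]) auto
      also have "\<dots> = (\<lambda>a b. 0)" using 1 ps(3) by (intro Q_conflict[of i j _ j j]) auto
      finally show ?thesis .
    next
      case (2 i j i')
      then show ?thesis by (intro Q_conflict[of i j _ i' j]) auto
    qed
  next
    case True
    let ?a = "map fst ps" and ?b = "map snd ps"
    have d: "distinct ?b" using True ps(2) by (simp add: distinct_map)
    have "card (snd ` set ps) = card (fst ` set ps)"
      using True ps(2) by (simp add: card_image distinct_map)
    then have ab: "set ?b = set ?a" using True card_subset_eq[of "fst ` set ps" "snd ` set ps"] by simp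
    have "length ?a = r" using ps(1) by simp
    then obtain g where g: "g permutes {1..r}" "?b = relabel r g ?a" by (rule relabel_ex[OF ps(2) _ d ab])
    \<comment> \<open>The second components arise from the first by moving the entry at
      \<open>i\<close> to position \<open>g i\<close>. Hence the pair at position \<open>i\<close>
      sends the first component there to the one at position \<open>inv_into UNIV g i\<close>, so
      the derangement is the inverse of \<open>g\<close>.\<close>
    let ?\<sigma> = "inv_into UNIV g"
    have \<sigma>: "?\<sigma> permutes {1..r}" by (rule permutes_inv[OF g(1)])
    have b: "?b ! (i - 1) = ?a ! (?\<sigma> i - 1)" if "i \<in> {1..r}" for i
      using relabel_nth[OF g(1) permutes_in[OF \<sigma> that], of ?a] unfolding g(2)[symmetric] permutes_inverses(1)[OF g(1)] .
    have nth: "?a ! (i - 1) = fst (ps ! (i - 1))" "?b ! (i - 1) = snd (ps ! (i - 1))" "ps ! (i - 1) \<in> set ps" if "i \<in> {1..r}" for i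
      using that ps(1) by auto
    have ne: "?\<sigma> i \<noteq> i" if "i \<in> {1..r}" for i
    proof
      assume "?\<sigma> i = i"
      then have "snd (ps ! (i - 1)) = fst (ps ! (i - 1))" using b[OF that] nth(1,2)[OF that] by simp
      then show False using ps(3) nth(3)[OF that] by (metis prod.collapse)
    qed
    have t: "tperm r ?\<sigma> ?a (fst p) = snd p" if m: "p \<in> set ps" for p
    proof -
      obtain i where i: "i \<in> {1..r}" "ps ! (i - 1) = p" using nth_ex[OF m] ps(1) by auto
      have "tperm r ?\<sigma> ?a (?a ! (i - 1)) = ?a ! (?\<sigma> i - 1)" by (rule tperm_nth[OF ps(2) _ i(1)]) (simp add: ps(1))
      then show ?thesis using b[OF i(1)] nth[OF i(1)] i(2) by simp
    qed
    have "set (perm_pairs r ?\<sigma> ?a) = (\<lambda>p. (fst p, snd p)) ` set ps"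
      unfolding perm_pairs_simps set_map image_image by (rule image_cong[OF refl]) (simp only: t)
    then have "Q ps = Q (perm_pairs r ?\<sigma> ?a)" by (intro Q_set_cong) simp
    also have "\<dots> = (\<lambda>a b. 0)" using killed[OF \<sigma> _ _ ps(2)] ne ps(1) by simp
    finally show ?thesis .
  qed
qed

text \<open>For \<open>r = 0\<close> the condition applies to the empty list, whose projection is
  the identity.\<close>

lemma moves_less_0_zero:
  assumes "moves_less 0"
  shows "is_zero_object ZC ((As, e), c)"
proof -
  have "E = (\<lambda>a b. 0)" using moves_lessD[OF assms, of "[]"] by (simp add: Q_Nil)
  then have "e = 0\<^sub>m (length As) (length As)"
    by (intro kr_eqI[OF e_hom(1) zero_ahom]) (simp add: kr_zero)
  then show ?thesis by (simp add: is_zero_object_def)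
qed

end

section \<open>Induction on the number of moved points and on the derangements\<close>

context deligne
begin

abbreviation "gens \<equiv> {W_old t n \<sigma> k \<rho> | n \<mu> \<sigma> k \<rho>.
       is_number_partition n \<mu> \<and> \<sigma> permutes {1..n} \<and> cycle_type n \<sigma> = \<mu> \<and>
       matrix_representation (perm_centralizer n \<sigma>) k \<rho>}"

lemma gens_I: "\<sigma> permutes {1..n} \<Longrightarrow> matrix_representation (perm_centralizer n \<sigma>) k \<rho> \<Longrightarrow> W_old t n \<sigma> k \<rho> \<in> gens"
  using cycle_type_partition by blast

lemma gens_zob:
  assumes "x \<in> gens"
  obtains As e c where "x = ((As, e), c)" "center_object t As e c"
proof -
  obtain n \<sigma> k \<rho> where x: "x = W_old t n \<sigma> k \<rho>" "\<sigma> permutes {1..n}" "matrix_representation (perm_centralizer n \<sigma>) k \<rho>"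
    using assms by blast
  then interpret W: wold t n \<sigma> k \<rho> by unfold_locales
  show ?thesis by (rule that[OF _ tau.center_object[OF W.tau]]) (simp add: x W.W_old_eq)
qed

lemma gens_objects: "gens \<subseteq> objects ZC"
proof
  fix x assume "x \<in> gens"
  then obtain As e c where "x = ((As, e), c)" "center_object t As e c" by (rule gens_zob)
  then show "x \<in> objects ZC" by (simp only: ZC_objects)
qed

lemma trivial_rep: "matrix_representation Z 1 (\<lambda>_. 1\<^sub>m 1)"
  by (simp add: matrix_representation_def)

text \<open>For at most one point the centralizer is trivial and every tuple is distinct, so the
  averaging idempotent is the identity and all degrees are trivial. This supplies the unit object
  and X with trivial braidings.\<close>

lemma trivial_gen:
  assumes "n \<le> 1"
  shows "(Xp n, tr [n] (ident CA [n])) \<in> cl gens"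
proof -
  have id: "id permutes {1..n}" by (rule permutes_id)
  interpret W: wold t n id 1 "\<lambda>_. 1\<^sub>m 1" by unfold_locales (rule id, rule trivial_rep)
  have As: "replicate 1 n = [n]" by simp
  have perms: "g = id" if "g permutes {1..n}" for g
    using that assms by (cases n) (auto simp: permutes_sing)
  then have Z: "perm_centralizer n id = {id}" using W.id_Z W.Z_perm by blast
  have rel: "relabel n id xs = xs" if "length xs = n" for xs
    using relabel_unique[OF id that, of xs] by simp
  have "W.e = ident CA [n]"
  proof (rule kr_eqI[OF W.e_hom[unfolded As] id_ahom])
    fix a b assume p: "a \<in> pts [n]" "b \<in> pts [n]"
    then obtain xs ys where ab: "a = Pt 0 xs" "length xs = n" "b = Pt 0 ys" "length ys = n" by (auto simp: pts_def)
    have "distinct xs" using ab(2) assms by (cases xs) auto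
    then show "kr [n] [n] W.e a b = kr [n] [n] (ident CA [n]) a b"
      using W.E_eq[of 0 xs 0 ys] ab rel unfolding As kr_id Z by (auto simp: idk_def simp del: kr.simps)
  qed
  moreover have "W.ta = (\<lambda>_. id)"
  proof
    show "W.ta a = id" for a by (cases a) (simp add: W.ta_def tperm_id)
  qed
  ultimately have "W_old t n id 1 (\<lambda>_. 1\<^sub>m 1) = (Xp n, tr [n] (ident CA [n]))"
    unfolding W.W_old_eq by (simp add: Xp_def tr_def)
  then show ?thesis
    using karoubian_tensor_closure.gen[OF gens_I[OF id trivial_rep]] by metis
qed

lemma tr_in_cl: "(As, e) \<in> objects RS \<Longrightarrow> ((As, e), tr As e) \<in> cl gens"
  by (rule tr_closure[OF trivial_gen trivial_gen]) simp_all

lemma in_cl: "center_object t As e c \<Longrightarrow> center_object.moves_less t As c r \<Longrightarrow> ((As, e), c) \<in> cl gens"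
proof (induction r arbitrary: e c)
  case 0
  then show ?case
    by (intro karoubian_tensor_closure.zero) (simp_all only: ZC_objects center_object.moves_less_0_zero)
next
  case (Suc r)
  define D where "D = {\<sigma>. \<sigma> permutes {1..r} \<and> (\<forall>i\<in>{1..r}. \<sigma> i \<noteq> i)}"
  have finD: "finite D" unfolding D_def by (rule finite_subset[OF _ finite_permutations[of "{1..r}"]]) auto
  \<comment> \<open>\<open>D'\<close> consists of the derangements still to be split off; the
    projections for the others already vanish. When \<open>D'\<close> is empty,
    \<open>moves_less_step\<close> lowers the bound. Conjugate derangements describe the same
    degrees, so some of these steps split off zero.\<close>
  have "((As, e), c) \<in> cl gens"
    if "D' \<subseteq> D" "center_object t As e c" "center_object.moves_less t As c (Suc r)"
      "\<And>\<sigma> xs. \<sigma> \<in> D - D' \<Longrightarrow> length xs = r \<Longrightarrow> distinct xs \<Longrightarrow> center_object.Q t As c (perm_pairs r \<sigma> xs) = (\<lambda>a b. 0)" for D' e c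
    using finite_subset[OF that(1) finD] that
  proof (induction D' arbitrary: e c rule: finite_induct)
    case empty
    then interpret Y: center_object t As e c by simp
    have "Y.moves_less r" by (rule Y.moves_less_step[OF empty(3)]) (use empty(4) in \<open>simp add: D_def\<close>)
    then show ?case by (rule Suc.IH[OF empty(2)])
  next
    case (insert \<sigma> D')
    have \<sigma>: "\<sigma> permutes {1..r}" "\<And>i. i \<in> {1..r} \<Longrightarrow> \<sigma> i \<noteq> i" using insert.prems(1) by (auto simp: D_def)
    interpret center_object t As e c by (rule insert.prems(2))
    interpret Y: grade t As e c r \<sigma> by unfold_locales (use \<sigma> insert.prems(3) in blast)+
    show ?case
    proof (rule Y.split_off)
      show "W_old t r \<sigma> 1 (\<lambda>_. 1\<^sub>m 1) \<in> cl gens"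
        by (rule karoubian_tensor_closure.gen[OF gens_I[OF \<sigma>(1) trivial_rep]])
      show "((As, e), tr As e) \<in> cl gens" by (rule tr_in_cl[OF Y])
      fix h d assume hd: "center_object t As h d" "center_object.moves_less t As d (Suc r)"
        and keep: "\<And>ps. Q ps = (\<lambda>a b. 0) \<Longrightarrow> center_object.Q t As d ps = (\<lambda>a b. 0)"
        and kill: "\<And>xs. length xs = r \<Longrightarrow> distinct xs \<Longrightarrow> center_object.Q t As d (perm_pairs r \<sigma> xs) = (\<lambda>a b. 0)"
      show "((As, h), d) \<in> cl gens"
      proof (rule insert.IH[OF _ hd])
        show "D' \<subseteq> D" using insert.prems(1) by blast
        fix \<tau> and xs :: "nat list" assume \<tau>: "\<tau> \<in> D - D'" and xs: "length xs = r" "distinct xs"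
        show "center_object.Q t As d (perm_pairs r \<tau> xs) = (\<lambda>a b. 0)"
        proof (cases "\<tau> = \<sigma>")
          case True
          then show ?thesis using kill[OF xs] by simp
        next
          case False
          then show ?thesis using insert.prems(4)[OF _ xs, of \<tau>] \<tau> by (intro keep) blast
        qed
      qed
    qed
  qed
  from this[OF subset_refl Suc.prems] show ?case by blast
qed

lemma closure_eq: "cl gens = objects ZC"
proof (intro Set.set_eqI iffI)
  fix x assume "x \<in> cl gens"
  then show "x \<in> objects ZC"
  proof induction
    case (gen A)
    then show ?case using gens_objects by blast
  next
    case (tensor A B)
    obtain As e c Bs f d where AB: "A = ((As, e), c)" "B = ((Bs, f), d)" by (metis surj_pair)
    then show ?case using tensor(3,4) ZC_tens_zob[of As e c Bs f d] by (simp only: AB ZC_objects ZC_tens)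
  qed
next
  fix x assume x: "x \<in> objects ZC"
  obtain As e c where x': "x = ((As, e), c)" by (metis surj_pair)
  then have z: "center_object t As e c" using x by (simp only: ZC_objects)
  then obtain r where "center_object.moves_less t As c r" using center_object.ex_moves_less by blast
  then show "x \<in> cl gens" unfolding x' by (rule in_cl[OF z])
qed

end
theorem proposition3p18:
  fixes t :: complex
  shows "generates_as_karoubian_tensor_category (drinfeld_center (Rep_S t))
    {W_old t n \<sigma> k \<rho> | n \<mu> \<sigma> k \<rho>.
       is_number_partition n \<mu> \<and> \<sigma> permutes {1..n} \<and> cycle_type n \<sigma> = \<mu> \<and>
       matrix_representation (perm_centralizer n \<sigma>) k \<rho>}"
  unfolding generates_as_karoubian_tensor_category_def
  using deligne.gens_objects[of t] deligne.closure_eq[of t] by blast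

end
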